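(* Let $\{u_k\}$ be the sequence defined by Algorithm A, with the corresponding $\{\alpha_k\}$ and $\beta_k=\beta(\alpha_k)$, and let $\mathcal{U}$ be the set of strong limit points of $\{u_k\}$ in $W_0^{1,p}(\Omega)$. Then the following assertions hold: (I) The sequence $\{R[u_k]\}$ monotonically decreases towards a higher eigenvalue $R^*$: $$R^*:=\inf_{k\geqslant1}R[u_k]=\lim_{k\to\infty}R[u_k].$$ (II) $\mathcal{U}\neq\varnothing$, and $\mathcal{U}$ is a subset of the (sign-changing) eigenfunctions corresponding to the eigenvalue $R^*$. (III) Any subsequence $\{u_{k_n}\}$ contains a sub-subsequence having a strong limit in $W_0^{1,p}(\Omega)$. If $\{u_{k_n}\}$ converges strongly to some $u\in\mathcal{U}$, then, for any $i\in\mathbb{N}$, the shifted subsequence $\{u_{k_n+i}\}$ also converges strongly to $u$. (IV) $\lim_{k\to\infty}\rho(u_k,\mathcal{U})=0$, where $\rho$ stands for the distance function in $W_0^{1,p}(\Omega)$. (V) There exists a limit $\lim_{k\to\infty}\alpha_k=\alpha^*=\lim_{k\to\infty}\beta_k$, coinciding with the only fixed point of the mapping $\beta(\cdot)$. (VI) $\mathcal{U}$ either consists of a single eigenfunction or has no isolated elements. In particular, if $R^*$ is a simple eigenvalue, then the whole sequence $\{u_k\}$ converges to the corresponding eigenfunction.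
   Context: Throughout, $1<p<\infty$, $p'=p/(p-1)$, and $\Omega\subset\mathbb{R}^D$, $D\geqslant1$, is a domain of finite measure. $\|\cdot\|_p$ is the $L^p(\Omega)$-norm, and $W_0^{1,p}(\Omega)$ carries the norm $\|\nabla u\|_p=(\int_\Omega|\nabla u|^p\,dx)^{1/p}$. Write $u^+=\max\{0,u\}$, $u^-=\max\{0,-u\}$, so $u=u^+-u^-$; $u$ is sign-changing if $u^+\neq0$ and $u^-\neq 0$. For nonzero $u\in L^p(\Omega)$, $\tilde u=u/\|u\|_p$, and $\tilde u^\pm=(\tilde u)^\pm=u^\pm/\|u\|_p$. The Rayleigh quotient of $u\in W_0^{1,p}(\Omega)\setminus\{0\}$ is $R[u]=\int_\Omega|\nabla u|^p\,dx/\int_\Omega|u|^p\,dx$, and $R^\pm[u]=R[u^\pm]$ whenever $u^\pm\ne0$. For $g\in L^{p'}(\Omega)$, "$-\Delta_p u=g$ in $\Omega$, $u|_{\partial\Omega}=0$" means that $u\in W_0^{1,p}(\Omega)$ and $\int_\Omega|\nabla u|^{p-2}\langle\nabla u,\nabla\psi\rangle\,dx=\int_\Omega g\psi\,dx$ for all $\psi\in W_0^{1,p}(\Omega)$; such a $u$ exists and is unique. A pair $(\lambda,u)\in\mathbb{R}\times(W_0^{1,p}(\Omega)\setminus\{0\})$ with $-\Delta_p u=\lambda|u|^{p-2}u$ in this weak sense is an eigenpair ($\lambda$ an eigenvalue, $u$ an eigenfunction). The smallest eigenvalue is $\lambda_1(\Omega,p)=\inf_{u\neq0}R[u]>0$;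 any other eigenvalue is called a higher eigenvalue. An eigenvalue is simple if all its eigenfunctions are scalar multiples of a single one. Algorithm A. Fix a continuous, (strictly) decreasing function $\beta:[0;1]\to[0;1]$ with $\beta(0)=1$, $\beta(1)=0$. Choose $u_0\in L^\infty(\Omega)$ with $\min\{\|u_0^+\|_p,\|u_0^-\|_p\}>0$ and $|\{x\in\Omega: u_0(x)=0\}|=0$. For $k=0,1,2,\dots$: (i) for $\alpha\in[0;1]$ let $\varphi_k(\alpha)\in W_0^{1,p}(\Omega)$ be the solution of $-\Delta_p\varphi_k(\alpha)=\alpha(\tilde u_k^+)^{p-1}-\beta(\alpha)(\tilde u_k^-)^{p-1}$ in $\Omega$, $\varphi_k(\alpha)|_{\partial\Omega}=0$; (ii) find any root $\alpha_k\in(0;1)$ of $R^+[\varphi_k(\alpha)]=R^-[\varphi_k(\alpha)]$ (being a root includes that both $\varphi_k^\pm(\alpha_k)\ne0$) and put $\beta_k:=\beta(\alpha_k)$; (iii) set $u_{k+1}:=\varphi_k(\alpha_k)$. Since $u_0$ need not lie in $W_0^{1,p}(\Omega)$, statements about $u_k$ in $W_0^{1,p}(\Omega)$ and about $R[u_k]$ refer to $k\geqslant1$. A strong limit point of $\{u_k\}$ is the limit, in the norm of $W_0^{1,p}(\Omega)$, of some subsequence of $\{u_k\}$. *)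

theory Defs
  imports "HOL-Analysis.Analysis"
begin

text \<open>
  Elements of Lebesgue and Sobolev spaces on \<open>\<Omega>\<close> are represented by functions on the whole space
  of which only the values on \<open>\<Omega>\<close> matter. Equality of such elements is equality almost everywhere
  on \<open>\<Omega>\<close>; no quotient is taken.
\<close>

definition ae_eq :: "'a::euclidean_space set \<Rightarrow> ('a \<Rightarrow> real) \<Rightarrow> ('a \<Rightarrow> real) \<Rightarrow> bool" where
  "ae_eq \<Omega> u v \<longleftrightarrow> (AE x in lebesgue_on \<Omega>. u x = v x)"

definition Lp_space :: "real \<Rightarrow> 'a::euclidean_space set \<Rightarrow> ('a \<Rightarrow> 'b::euclidean_space) set" where
  "Lp_space p \<Omega> = {f \<in> borel_measurable (lebesgue_on \<Omega>).
     integrable (lebesgue_on \<Omega>) (\<lambda>x. norm (f x) powr p)}"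

definition Lp_norm :: "real \<Rightarrow> 'a::euclidean_space set \<Rightarrow> ('a \<Rightarrow> 'b::euclidean_space) \<Rightarrow> real" where
  "Lp_norm p \<Omega> f = (LINT x|lebesgue_on \<Omega>. norm (f x) powr p) powr (1 / p)"

definition Linfty_space :: "'a::euclidean_space set \<Rightarrow> ('a \<Rightarrow> real) set" where
  "Linfty_space \<Omega> = {f \<in> borel_measurable (lebesgue_on \<Omega>).
     \<exists>C. AE x in lebesgue_on \<Omega>. \<bar>f x\<bar> \<le> C}"

subsection \<open>Test functions and Sobolev spaces\<close>

primrec C_k :: "nat \<Rightarrow> ('a::euclidean_space \<Rightarrow> real) \<Rightarrow> bool" where
  "C_k 0 f \<longleftrightarrow> continuous_on UNIV f"
| "C_k (Suc k) f \<longleftrightarrow> (\<forall>x. f differentiable (at x)) \<and>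
     (\<forall>b\<in>Basis. C_k k (\<lambda>x. frechet_derivative f (at x) b))"

definition test_functions :: "'a::euclidean_space set \<Rightarrow> ('a \<Rightarrow> real) set" where
  "test_functions \<Omega> =
     {f. (\<forall>k. C_k k f) \<and> compact (closure {x. f x \<noteq> 0}) \<and> closure {x. f x \<noteq> 0} \<subseteq> \<Omega>}"

definition classical_grad :: "('a::euclidean_space \<Rightarrow> real) \<Rightarrow> 'a \<Rightarrow> 'a" where
  "classical_grad f x = (\<Sum>b\<in>Basis. frechet_derivative f (at x) b *\<^sub>R b)"

definition locally_integrable_on ::
    "('a::euclidean_space \<Rightarrow> 'b::euclidean_space) \<Rightarrow> 'a set \<Rightarrow> bool" where
  "locally_integrable_on f \<Omega> \<longleftrightarrow> (\<forall>K. compact K \<and> K \<subseteq> \<Omega> \<longrightarrow> set_integrable lebesgue K f)"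

definition has_weak_grad ::
    "'a::euclidean_space set \<Rightarrow> ('a \<Rightarrow> real) \<Rightarrow> ('a \<Rightarrow> 'a) \<Rightarrow> bool" where
  "has_weak_grad \<Omega> u G \<longleftrightarrow> locally_integrable_on u \<Omega> \<and> locally_integrable_on G \<Omega> \<and>
     (\<forall>\<psi>\<in>test_functions \<Omega>.
        (LINT x|lebesgue_on \<Omega>. u x *\<^sub>R classical_grad \<psi> x) = - (LINT x|lebesgue_on \<Omega>. \<psi> x *\<^sub>R G x))"

text \<open>The weak gradient is unique only up to null sets; \<open>weak_grad\<close> picks a representative.\<close>

definition weak_grad :: "'a::euclidean_space set \<Rightarrow> ('a \<Rightarrow> real) \<Rightarrow> 'a \<Rightarrow> 'a" where
  "weak_grad \<Omega> u = (SOME G. has_weak_grad \<Omega> u G)"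

definition W1p :: "real \<Rightarrow> 'a::euclidean_space set \<Rightarrow> ('a \<Rightarrow> real) set" where
  "W1p p \<Omega> = {u \<in> Lp_space p \<Omega>. (\<exists>G. has_weak_grad \<Omega> u G) \<and> weak_grad \<Omega> u \<in> Lp_space p \<Omega>}"

definition W01p :: "real \<Rightarrow> 'a::euclidean_space set \<Rightarrow> ('a \<Rightarrow> real) set" where
  "W01p p \<Omega> = {u \<in> W1p p \<Omega>. \<exists>\<psi>. (\<forall>n. \<psi> n \<in> test_functions \<Omega>) \<and>
     (\<lambda>n. Lp_norm p \<Omega> (\<lambda>x. \<psi> n x - u x)) \<longlonglongrightarrow> 0 \<and>
     (\<lambda>n. Lp_norm p \<Omega> (\<lambda>x. classical_grad (\<psi> n) x - weak_grad \<Omega> u x)) \<longlonglongrightarrow> 0}"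

definition W0_norm :: "real \<Rightarrow> 'a::euclidean_space set \<Rightarrow> ('a \<Rightarrow> real) \<Rightarrow> real" where
  "W0_norm p \<Omega> u = Lp_norm p \<Omega> (weak_grad \<Omega> u)"

definition W0_dist :: "real \<Rightarrow> 'a::euclidean_space set \<Rightarrow> ('a \<Rightarrow> real) \<Rightarrow> ('a \<Rightarrow> real) \<Rightarrow> real" where
  "W0_dist p \<Omega> u v = W0_norm p \<Omega> (\<lambda>x. u x - v x)"

text \<open>
  Membership in \<open>W01p\<close> is only required eventually, because the first term \<open>u 0\<close> of the algorithm
  below need not be a Sobolev function.
\<close>

definition W0_converges ::
    "real \<Rightarrow> 'a::euclidean_space set \<Rightarrow> (nat \<Rightarrow> 'a \<Rightarrow> real) \<Rightarrow> ('a \<Rightarrow> real) \<Rightarrow> bool" where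
  "W0_converges p \<Omega> w v \<longleftrightarrow> v \<in> W01p p \<Omega> \<and> (\<forall>\<^sub>F n in sequentially. w n \<in> W01p p \<Omega>) \<and>
     (\<lambda>n. W0_dist p \<Omega> (w n) v) \<longlonglongrightarrow> 0"

definition W0_infdist ::
    "real \<Rightarrow> 'a::euclidean_space set \<Rightarrow> ('a \<Rightarrow> real) \<Rightarrow> ('a \<Rightarrow> real) set \<Rightarrow> real" where
  "W0_infdist p \<Omega> w S = (INF v\<in>S. W0_dist p \<Omega> w v)"

definition strong_limit_points ::
    "real \<Rightarrow> 'a::euclidean_space set \<Rightarrow> (nat \<Rightarrow> 'a \<Rightarrow> real) \<Rightarrow> ('a \<Rightarrow> real) set" where
  "strong_limit_points p \<Omega> u = {v. \<exists>r :: nat \<Rightarrow> nat. strict_mono r \<and> W0_converges p \<Omega> (u \<circ> r) v}"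

definition isolated_element ::
    "real \<Rightarrow> 'a::euclidean_space set \<Rightarrow> ('a \<Rightarrow> real) \<Rightarrow> ('a \<Rightarrow> real) set \<Rightarrow> bool" where
  "isolated_element p \<Omega> v S \<longleftrightarrow>
     v \<in> S \<and> (\<exists>\<epsilon>>0. \<forall>w\<in>S. W0_dist p \<Omega> w v < \<epsilon> \<longrightarrow> ae_eq \<Omega> w v)"

subsection \<open>The p-Laplacian and its eigenpairs\<close>

definition pos_part :: "('a \<Rightarrow> real) \<Rightarrow> 'a \<Rightarrow> real" where
  "pos_part u = (\<lambda>x. max 0 (u x))"

definition neg_part :: "('a \<Rightarrow> real) \<Rightarrow> 'a \<Rightarrow> real" where
  "neg_part u = (\<lambda>x. max 0 (- u x))"

definition is_zero :: "'a::euclidean_space set \<Rightarrow> ('a \<Rightarrow> real) \<Rightarrow> bool" where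
  "is_zero \<Omega> u \<longleftrightarrow> ae_eq \<Omega> u (\<lambda>_. 0)"

definition sign_changing :: "'a::euclidean_space set \<Rightarrow> ('a \<Rightarrow> real) \<Rightarrow> bool" where
  "sign_changing \<Omega> u \<longleftrightarrow> \<not> is_zero \<Omega> (pos_part u) \<and> \<not> is_zero \<Omega> (neg_part u)"

definition normalized :: "real \<Rightarrow> 'a::euclidean_space set \<Rightarrow> ('a \<Rightarrow> real) \<Rightarrow> 'a \<Rightarrow> real" where
  "normalized p \<Omega> u = (\<lambda>x. u x / Lp_norm p \<Omega> u)"

definition rayleigh :: "real \<Rightarrow> 'a::euclidean_space set \<Rightarrow> ('a \<Rightarrow> real) \<Rightarrow> real" where
  "rayleigh p \<Omega> u = (LINT x|lebesgue_on \<Omega>. norm (weak_grad \<Omega> u x) powr p) /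
                    (LINT x|lebesgue_on \<Omega>. \<bar>u x\<bar> powr p)"

text \<open>
  Since \<open>0 powr a = 0\<close>, the integrand on the left is \<open>0\<close> where the gradient vanishes, also if \<open>p < 2\<close>.
\<close>

definition plaplace_solution ::
    "real \<Rightarrow> 'a::euclidean_space set \<Rightarrow> ('a \<Rightarrow> real) \<Rightarrow> ('a \<Rightarrow> real) \<Rightarrow> bool" where
  "plaplace_solution p \<Omega> g u \<longleftrightarrow> g \<in> Lp_space (p / (p - 1)) \<Omega> \<and> u \<in> W01p p \<Omega> \<and>
     (\<forall>\<psi>\<in>W01p p \<Omega>.
        (LINT x|lebesgue_on \<Omega>.
           norm (weak_grad \<Omega> u x) powr (p - 2) * (weak_grad \<Omega> u x \<bullet> weak_grad \<Omega> \<psi> x)) =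
        (LINT x|lebesgue_on \<Omega>. g x * \<psi> x))"

definition eigenpair :: "real \<Rightarrow> 'a::euclidean_space set \<Rightarrow> real \<Rightarrow> ('a \<Rightarrow> real) \<Rightarrow> bool" where
  "eigenpair p \<Omega> \<mu> u \<longleftrightarrow> u \<in> W01p p \<Omega> \<and> \<not> is_zero \<Omega> u \<and>
     plaplace_solution p \<Omega> (\<lambda>x. \<mu> * \<bar>u x\<bar> powr (p - 2) * u x) u"

definition eigenvalue :: "real \<Rightarrow> 'a::euclidean_space set \<Rightarrow> real \<Rightarrow> bool" where
  "eigenvalue p \<Omega> \<mu> \<longleftrightarrow> (\<exists>u. eigenpair p \<Omega> \<mu> u)"

definition first_eigenvalue :: "real \<Rightarrow> 'a::euclidean_space set \<Rightarrow> real" where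
  "first_eigenvalue p \<Omega> = (INF u\<in>{u \<in> W01p p \<Omega>. \<not> is_zero \<Omega> u}. rayleigh p \<Omega> u)"

definition higher_eigenvalue :: "real \<Rightarrow> 'a::euclidean_space set \<Rightarrow> real \<Rightarrow> bool" where
  "higher_eigenvalue p \<Omega> \<mu> \<longleftrightarrow> eigenvalue p \<Omega> \<mu> \<and> \<mu> \<noteq> first_eigenvalue p \<Omega>"

definition simple_eigenvalue :: "real \<Rightarrow> 'a::euclidean_space set \<Rightarrow> real \<Rightarrow> bool" where
  "simple_eigenvalue p \<Omega> \<mu> \<longleftrightarrow>
     (\<exists>e. eigenpair p \<Omega> \<mu> e \<and> (\<forall>v. eigenpair p \<Omega> \<mu> v \<longrightarrow> (\<exists>c. ae_eq \<Omega> v (\<lambda>x. c * e x))))"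

subsection \<open>The algorithm\<close>

text \<open>
  \<open>\<phi> k a\<close> is the solution of the auxiliary problem of step \<open>k\<close> with parameter \<open>a\<close>; it is
  unique almost everywhere, so carrying the whole family \<open>\<phi>\<close> only fixes representatives.
\<close>

definition algorithm_A ::
    "real \<Rightarrow> 'a::euclidean_space set \<Rightarrow> (real \<Rightarrow> real) \<Rightarrow> (nat \<Rightarrow> real \<Rightarrow> 'a \<Rightarrow> real) \<Rightarrow>
     (nat \<Rightarrow> real) \<Rightarrow> (nat \<Rightarrow> 'a \<Rightarrow> real) \<Rightarrow> bool" where
  "algorithm_A p \<Omega> \<beta> \<phi> \<alpha> u \<longleftrightarrow>
     continuous_on {0..1} \<beta> \<and> strict_antimono_on {0..1} \<beta> \<and> \<beta> ` {0..1} \<subseteq> {0..1} \<and>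
     \<beta> 0 = 1 \<and> \<beta> 1 = 0 \<and>
     u 0 \<in> Linfty_space \<Omega> \<and>
     min (Lp_norm p \<Omega> (pos_part (u 0))) (Lp_norm p \<Omega> (neg_part (u 0))) > 0 \<and>
     {x \<in> \<Omega>. u 0 x = 0} \<in> null_sets lebesgue \<and>
     (\<forall>k.
        (\<forall>a\<in>{0..1}. plaplace_solution p \<Omega>
           (\<lambda>x. a * pos_part (normalized p \<Omega> (u k)) x powr (p - 1)
              - \<beta> a * neg_part (normalized p \<Omega> (u k)) x powr (p - 1)) (\<phi> k a)) \<and>
        \<alpha> k \<in> {0<..<1} \<and>
        sign_changing \<Omega> (\<phi> k (\<alpha> k)) \<and>
        rayleigh p \<Omega> (pos_part (\<phi> k (\<alpha> k))) = rayleigh p \<Omega> (neg_part (\<phi> k (\<alpha> k))) \<and>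
        u (Suc k) = \<phi> k (\<alpha> k))"

definition R_star :: "real \<Rightarrow> 'a::euclidean_space set \<Rightarrow> (nat \<Rightarrow> 'a \<Rightarrow> real) \<Rightarrow> real" where
  "R_star p \<Omega> u = (INF k\<in>{1..}. rayleigh p \<Omega> (u k))"

end

theory Submission
  imports Defs "HOL-Complex_Analysis.Great_Picard"
begin

text \<open>
  Let \<open>w\<close> be \<open>\<alpha>^(1/(p-1)) u\<^sup>+ - \<beta>^(1/(p-1)) u\<^sup>-\<close> for an iterate \<open>u\<close>, scaled to norm 1. The condition
  \<open>R\<^sup>+ = R\<^sup>-\<close> makes every combination of \<open>u\<^sup>+\<close> and \<open>u\<^sup>-\<close> have the Rayleigh quotient of \<open>u\<close>, so one step of the
  algorithm is a step of the inverse power method: the next iterate, suitably scaled, is the solution \<open>V\<close> of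
  \<open>-\<Delta>\<^sub>p V = \<bar>w\<bar>^(p-2) w\<close>. Testing with \<open>V\<close> and with \<open>w\<close> and applying Hoelder's inequality twice gives \<open>R[V] \<le> R[w]\<close>.
  Along a subsequence \<open>w\<close> converges in \<open>L\<^sup>p\<close> by Rellich's theorem, hence \<open>V\<close> converges in \<open>W\<^sub>0\<close> by
  monotonicity of the p-Laplacian; in the limit both Hoelder inequalities are equalities, so the limit is an
  eigenfunction. It changes sign: otherwise it would be nonzero almost everywhere by the strong maximum principle, while
  the normalized negative parts of \<open>V\<close> converge to a nonzero function that is supported where the limit vanishes.
  The next iterate converges to a combination \<open>s e\<^sup>+ - t e\<^sup>-\<close> of the parts of a sign-changing eigenfunction \<open>e\<close> which
  is again an eigenfunction, and the strong maximum principle forces \<open>s = t\<close>. Hence \<open>\<alpha>\<close> tends to the fixed point of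
  \<open>\<beta>\<close>, the norms of the iterates converge, and successive iterates approach each other.
  A sequence with vanishing increments and relatively compact range cannot have an isolated
  limit point unless it converges to it.
\<close>

subsection \<open>Lebesgue spaces\<close>

text \<open>The positive and the negative part of a function have disjoint supports. For nonnegative
  weights, the p-th powers of norm and gradient norm of \<open>comb s t u\<close> are therefore
  linear in s^p and t^p, and its p-Laplacian is linear in s^(p-1) and t^(p-1). The first linearity
  passes a common Rayleigh quotient of the parts to all combinations. By the second, the weak
  equations for e and for a combination of its parts are two linear relations between the defects of
  the parts; with unequal weights they are independent, so that the positive part of e alone would
  be an eigenfunction although it vanishes on a set of positive measure.

  The obstacle is that neither regularity of eigenfunctions nor any smoothness or boundedness of
  \<Omega> is at hand. The strong maximum principle is therefore derived from integral estimates,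
  and the theorems of Poincare and Rellich rest on one estimate of a double integral of |f y - f
  x|^p, which serves on the whole space and on balls.

  The maximum principle also shows that the limit of the quotients is a higher eigenvalue: otherwise
  the positive part of a limit point would be a minimizer.\<close>

definition Lp_fun :: "real \<Rightarrow> 'm measure \<Rightarrow> ('m \<Rightarrow> 'v::euclidean_space) set" where
  "Lp_fun p M = {f \<in> borel_measurable M. integrable M (\<lambda>x. norm (f x) powr p)}"

definition pint :: "real \<Rightarrow> 'm measure \<Rightarrow> ('m \<Rightarrow> 'v::euclidean_space) \<Rightarrow> real" where
  "pint p M f = (LINT x|M. norm (f x) powr p)"

definition Lp_nrm :: "real \<Rightarrow> 'm measure \<Rightarrow> ('m \<Rightarrow> 'v::euclidean_space) \<Rightarrow> real" where
  "Lp_nrm p M f = pint p M f powr (1 / p)"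

lemma Lp_fun_measurable[measurable_dest]: "f \<in> Lp_fun p M \<Longrightarrow> f \<in> borel_measurable M"
  by (simp add: Lp_fun_def)

lemma Lp_fun_integrable: "f \<in> Lp_fun p M \<Longrightarrow> integrable M (\<lambda>x. norm (f x) powr p)"
  by (simp add: Lp_fun_def)

lemma pint_nonneg[simp]: "0 \<le> pint p M f"
  by (simp add: pint_def)

lemma Lp_nrm_nonneg[simp]: "0 \<le> Lp_nrm p M f"
  by (simp add: Lp_nrm_def)

lemma Lp_nrm_powr: "p > 0 \<Longrightarrow> Lp_nrm p M f powr p = pint p M f"
  by (simp add: Lp_nrm_def powr_powr)

lemma Lp_fun_dom:
  assumes "f \<in> borel_measurable M" "g \<in> Lp_fun p M" "p > 0" "AE x in M. norm (f x) \<le> norm (g x)"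
  shows "f \<in> Lp_fun p M"
proof -
  have "integrable M (\<lambda>x. norm (f x) powr p)"
    apply (rule Bochner_Integration.integrable_bound[OF Lp_fun_integrable[OF assms(2)]])
    using assms by (auto intro!: powr_mono2)
  then show ?thesis using assms by (simp add: Lp_fun_def)
qed

lemma pint_mono:
  assumes "f \<in> borel_measurable M" "g \<in> Lp_fun p M" "p > 0" "AE x in M. norm (f x) \<le> norm (g x)"
  shows "pint p M f \<le> pint p M g"
  unfolding pint_def
  apply (rule integral_mono_AE)
  using Lp_fun_integrable[OF Lp_fun_dom[OF assms]] Lp_fun_integrable[OF assms(2)] assms(3,4)
  by (auto intro!: powr_mono2)

lemma norm_add_powr_le:
  fixes a b :: "'v::real_normed_vector"
  assumes "p > 0"
  shows "norm (a + b) powr p \<le> 2 powr p * (norm a powr p + norm b powr p)"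
proof -
  have "norm (a + b) \<le> 2 * max (norm a) (norm b)"
    using norm_triangle_ineq[of a b] by linarith
  then have "norm (a + b) powr p \<le> (2 * max (norm a) (norm b)) powr p"
    using assms by (intro powr_mono2) auto
  also have "\<dots> = 2 powr p * max (norm a) (norm b) powr p"
    by (rule powr_mult) 
  also have "max (norm a) (norm b) powr p \<le> norm a powr p + norm b powr p"
    by (auto simp: max_def)
  finally show ?thesis by simp
qed

lemma Lp_fun_add:
  assumes "f \<in> Lp_fun p M" "g \<in> Lp_fun p M" "p > 0"
  shows "(\<lambda>x. f x + g x) \<in> Lp_fun p M"
proof -
  have [measurable]: "f \<in> borel_measurable M" "g \<in> borel_measurable M"
    using assms by (auto simp: Lp_fun_def)
  have "integrable M (\<lambda>x. 2 powr p * (norm (f x) powr p + norm (g x) powr p))"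
    using assms by (auto simp: Lp_fun_def)
  then have "integrable M (\<lambda>x. norm (f x + g x) powr p)"
    by (rule Bochner_Integration.integrable_bound) (use norm_add_powr_le[OF assms(3)] in auto)
  then show ?thesis by (simp add: Lp_fun_def)
qed

lemma Lp_fun_scaleR: "f \<in> Lp_fun p M \<Longrightarrow> (\<lambda>x. c *\<^sub>R f x) \<in> Lp_fun p M"
  by (auto simp: Lp_fun_def powr_mult)

lemma Lp_fun_cmult:
  fixes f :: "'m \<Rightarrow> real"
  shows "f \<in> Lp_fun p M \<Longrightarrow> (\<lambda>x. c * f x) \<in> Lp_fun p M"
  using Lp_fun_scaleR[of f p M c] by simp

lemma Lp_fun_uminus: "f \<in> Lp_fun p M \<Longrightarrow> (\<lambda>x. - f x) \<in> Lp_fun p M"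
  by (auto simp: Lp_fun_def)

lemma Lp_fun_diff:
  assumes "f \<in> Lp_fun p M" "g \<in> Lp_fun p M" "p > 0"
  shows "(\<lambda>x. f x - g x) \<in> Lp_fun p M"
  using Lp_fun_add[OF assms(1) Lp_fun_uminus[OF assms(2)] assms(3)] by simp

lemma Lp_fun_zero[simp]: "(\<lambda>x. 0) \<in> Lp_fun p M"
  by (simp add: Lp_fun_def)

lemma pint_scaleR: "pint p M (\<lambda>x. c *\<^sub>R f x) = \<bar>c\<bar> powr p * pint p M f"
  by (simp add: pint_def powr_mult)

lemma Lp_nrm_scaleR: "p > 0 \<Longrightarrow> Lp_nrm p M (\<lambda>x. c *\<^sub>R f x) = \<bar>c\<bar> * Lp_nrm p M f"
  by (simp add: Lp_nrm_def pint_scaleR powr_mult powr_powr)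

lemma Lp_nrm_cmult: "p > 0 \<Longrightarrow> Lp_nrm p M (\<lambda>x. c * f x) = \<bar>c\<bar> * Lp_nrm p M (f::_ \<Rightarrow> real)"
  using Lp_nrm_scaleR[of p M c f] by simp

lemma pint_zero_iff:
  assumes "f \<in> Lp_fun p M" "p > 0"
  shows "pint p M f = 0 \<longleftrightarrow> (AE x in M. f x = 0)"
  unfolding pint_def
  by (subst integral_nonneg_eq_0_iff_AE) (use assms in \<open>auto simp: Lp_fun_def\<close>)

lemma Lp_nrm_zero_iff:
  assumes "f \<in> Lp_fun p M" "p > 0"
  shows "Lp_nrm p M f = 0 \<longleftrightarrow> (AE x in M. f x = 0)"
  using pint_zero_iff[OF assms] by (simp add: Lp_nrm_def)

lemma pint_cong_AE:
  assumes "AE x in M. norm (f x) = norm (g x)" "f \<in> borel_measurable M" "g \<in> borel_measurable M"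
  shows "pint p M f = pint p M g"
  unfolding pint_def by (rule integral_cong_AE) (use assms in auto)

lemma Lp_nrm_cong_AE:
  assumes "AE x in M. norm (f x) = norm (g x)" "f \<in> borel_measurable M" "g \<in> borel_measurable M"
  shows "Lp_nrm p M f = Lp_nrm p M g"
  unfolding Lp_nrm_def by (simp add: pint_cong_AE[OF assms])

lemma conjugate_exponent:
  fixes p :: real assumes "p > 1"
  shows "p / (p - 1) > 1" "1 / p + 1 / (p / (p - 1)) = 1" "p / (p - 1) > 0" "(p - 1) * (p / (p - 1)) = p"
    "(p / (p - 1)) / (p / (p - 1) - 1) = p"
proof -
  have "p / (p - 1) - 1 = 1 / (p - 1)" using assms by (simp add: field_simps)
  then show "(p / (p - 1)) / (p / (p - 1) - 1) = p" using assms by simp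
qed (use assms in \<open>auto simp: field_simps\<close>)

text \<open>Only the pointwise bound of \<open>h\<close> by the product of the norms enters, so one
  statement covers scalar products, scalar multiples of vectors and products of norms. Young's
  inequality is integrated for the factors scaled to norm 1; a factor of norm 0 is split
  off.\<close>

lemma Holder:
  fixes h :: "'m \<Rightarrow> 'w::euclidean_space" and f :: "'m \<Rightarrow> 'v::euclidean_space" and g :: "'m \<Rightarrow> 'u::euclidean_space"
  assumes p: "p > 1" and f: "f \<in> Lp_fun p M" and g: "g \<in> Lp_fun (p / (p - 1)) M"
    and h: "h \<in> borel_measurable M" "AE x in M. norm (h x) \<le> norm (f x) * norm (g x)"
  shows "integrable M h" "(LINT x|M. norm (h x)) \<le> Lp_nrm p M f * Lp_nrm (p / (p - 1)) M g"
proof -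
  let ?q = "p / (p - 1)"
  have q: "?q > 1" "1 / p + 1 / ?q = 1" using conjugate_exponent[OF p] by auto
  note [measurable] = h(1) Lp_fun_measurable[OF f] Lp_fun_measurable[OF g]
  have Y: "norm (h x) / (A * B) \<le> norm (f x) powr p / (p * A powr p) + norm (g x) powr ?q / (?q * B powr ?q)"
    if "norm (h x) \<le> norm (f x) * norm (g x)" "A > 0" "B > 0" for A B x
  proof -
    have "norm (h x) / (A * B) \<le> (norm (f x) * norm (g x)) / (A * B)"
      using that by (intro divide_right_mono) auto
    also have "\<dots> = (norm (f x) / A) * (norm (g x) / B)" by simp
    also have "\<dots> \<le> (norm (f x) / A) powr p / p + (norm (g x) / B) powr ?q / ?q"
      using that p q by (intro Youngs_inequality) auto
    finally show ?thesis using that by (simp add: powr_divide mult.commute)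
  qed
  have int: "integrable M (\<lambda>x. norm (f x) powr p / (p * A powr p) + norm (g x) powr ?q / (?q * B powr ?q))" for A B
    by (intro Bochner_Integration.integrable_add integrable_divide Lp_fun_integrable f g)
  show inth: "integrable M h"
  proof (rule Bochner_Integration.integrable_bound[OF int[of 1 1]])
    show "AE x in M. norm (h x) \<le> norm (norm (f x) powr p / (p * 1 powr p) + norm (g x) powr ?q / (?q * 1 powr ?q))"
      using h(2)
    proof eventually_elim
      case (elim x)
      with Y[of x 1 1] show ?case by simp
    qed
  qed simp
  define A where "A = Lp_nrm p M f"
  define B where "B = Lp_nrm ?q M g"
  show "(LINT x|M. norm (h x)) \<le> Lp_nrm p M f * Lp_nrm ?q M g"
  proof (cases "A = 0 \<or> B = 0")
    case True
    then have "(AE x in M. f x = 0) \<or> (AE x in M. g x = 0)"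
      using Lp_nrm_zero_iff[OF f] Lp_nrm_zero_iff[OF g] p q by (auto simp: A_def B_def)
    then have "AE x in M. norm (h x) = 0"
    proof
      assume "AE x in M. f x = 0"
      with h(2) show ?thesis by eventually_elim auto
    next
      assume "AE x in M. g x = 0"
      with h(2) show ?thesis by eventually_elim auto
    qed
    then have "(LINT x|M. norm (h x)) = 0" by (rule integral_eq_zero_AE)
    then show ?thesis by simp
  next
    case False
    then have AB: "A > 0" "B > 0" using Lp_nrm_nonneg[of p M f] Lp_nrm_nonneg[of ?q M g] by (auto simp: A_def B_def simp del: Lp_nrm_nonneg)
    have Ap: "A powr p = pint p M f" "B powr ?q = pint ?q M g"
      using p q by (auto simp: A_def B_def Lp_nrm_powr)
    have "(LINT x|M. norm (h x) / (A * B)) \<le> (LINT x|M. norm (f x) powr p / (p * A powr p) + norm (g x) powr ?q / (?q * B powr ?q))"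
    proof (rule integral_mono_AE)
      show "AE x in M. norm (h x) / (A * B) \<le> norm (f x) powr p / (p * A powr p) + norm (g x) powr ?q / (?q * B powr ?q)"
        using h(2) by eventually_elim (use Y AB in blast)
    qed (use inth int in auto)
    also have "\<dots> = pint p M f / (p * A powr p) + pint ?q M g / (?q * B powr ?q)"
      unfolding pint_def using Lp_fun_integrable[OF f] Lp_fun_integrable[OF g]
      by (subst Bochner_Integration.integral_add) auto
    also have "\<dots> = 1 / p + 1 / ?q"
      using AB p q unfolding Ap[symmetric] by simp
    finally have "(LINT x|M. norm (h x)) / (A * B) \<le> 1" using q by simp
    then show ?thesis using AB unfolding A_def[symmetric] B_def[symmetric] by (simp add: pos_divide_le_eq)
  qed
qed

subsection \<open>The duality map of a Lebesgue space\<close>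

text \<open>The gradient of \<open>norm a powr p / p\<close>. On vectors it is the flux of the
  p-Laplacian, on reals the power on the right-hand side of the eigenvalue equation, so one set of
  lemmas serves both sides.\<close>

definition flux :: "real \<Rightarrow> 'v::real_normed_vector \<Rightarrow> 'v" where
  "flux p a = norm a powr (p - 2) *\<^sub>R a"

lemma norm_flux: "norm (flux p a) = norm a powr (p - 1)"
  by (cases "a = 0") (auto simp: flux_def powr_mult_base[symmetric] powr_diff power2_eq_square)

lemma flux_zero[simp]: "flux p 0 = 0" by (simp add: flux_def)

lemma flux_inner: 
  fixes a :: "'v::real_inner"
  shows "flux p a \<bullet> a = norm a powr p"
  by (cases "a = 0") (auto simp: flux_def dot_square_norm powr_diff power2_eq_square powr_numeral)

lemma flux_scaleR: "flux p (c *\<^sub>R a) = (\<bar>c\<bar> powr (p - 2) * c) *\<^sub>R flux p a" for a :: "'v::real_normed_vector"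
  by (simp add: flux_def powr_mult)

lemma flux_scaleR_pos: "c \<ge> 0 \<Longrightarrow> flux p (c *\<^sub>R a) = c powr (p - 1) *\<^sub>R flux p a"
proof (cases "c = 0")
  case False
  assume "c \<ge> 0"
  with False have "c powr (p - 2) * c = c powr (p - 1)"
    by (simp add: powr_diff power2_eq_square powr_numeral)
  with \<open>c \<ge> 0\<close> show ?thesis by (simp add: flux_scaleR)
qed simp

lemma continuous_flux:
  assumes "p > 1"
  shows "continuous_on UNIV (flux p :: 'v::real_normed_vector \<Rightarrow> 'v)"
proof -
  have "isCont (flux p) a" for a :: 'v
  proof (cases "a = 0")
    case True
    have "((\<lambda>x::'v. norm x powr (p - 1)) \<longlongrightarrow> norm (0::'v) powr (p - 1)) (at 0)"
      using assms by (intro tendsto_powr' tendsto_intros) auto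
    then have "((\<lambda>x::'v. norm (flux p x)) \<longlongrightarrow> 0) (at 0)"
      using assms by (simp add: norm_flux)
    then have "(flux p \<longlongrightarrow> 0) (at (0::'v))" by (rule tendsto_norm_zero_cancel)
    then show ?thesis unfolding True by (simp add: isCont_def)
  next
    case False
    then show ?thesis unfolding flux_def by (intro continuous_intros) auto
  qed
  then show ?thesis by (simp add: continuous_on_eq_continuous_at)
qed

lemma flux_measurable[measurable]:
  assumes "p > 1" "f \<in> borel_measurable M"
  shows "(\<lambda>x. flux p (f x :: 'v::euclidean_space)) \<in> borel_measurable M"
  using borel_measurable_continuous_on[OF continuous_flux[OF assms(1)] assms(2)] .

lemma flux_Lp:
  assumes "p > 1" "f \<in> Lp_fun p M"
  shows "(\<lambda>x. flux p (f x)) \<in> Lp_fun (p / (p - 1)) M"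
    "pint (p / (p - 1)) M (\<lambda>x. flux p (f x)) = pint p M f"
    "Lp_nrm (p / (p - 1)) M (\<lambda>x. flux p (f x)) = Lp_nrm p M f powr (p - 1)"
proof -
  have eq: "norm (flux p (f x)) powr (p / (p - 1)) = norm (f x) powr p" for x
    using conjugate_exponent[OF assms(1)] by (simp only: norm_flux powr_powr)
  show "(\<lambda>x. flux p (f x)) \<in> Lp_fun (p / (p - 1)) M"
    using assms flux_measurable[OF assms(1), of f M] by (simp add: Lp_fun_def eq)
  show e: "pint (p / (p - 1)) M (\<lambda>x. flux p (f x)) = pint p M f"
    by (simp add: pint_def eq)
  show "Lp_nrm (p / (p - 1)) M (\<lambda>x. flux p (f x)) = Lp_nrm p M f powr (p - 1)"
    by (simp add: Lp_nrm_def e powr_powr)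
qed

text \<open>Hoelder's inequality against \<open>flux p (f + g)\<close>, whose dual norm is the power
  p - 1 of the norm of f + g. That power cancels unless the norm is 0.\<close>

lemma Minkowski:
  assumes p: "p > 1" and f: "f \<in> Lp_fun p M" and g: "g \<in> Lp_fun p M"
  shows "Lp_nrm p M (\<lambda>x. f x + g x) \<le> Lp_nrm p M f + Lp_nrm p M g"
proof -
  let ?h = "\<lambda>x. f x + g x" and ?q = "p / (p - 1)"
  note [measurable] = Lp_fun_measurable[OF f] Lp_fun_measurable[OF g]
  have h: "?h \<in> Lp_fun p M" using Lp_fun_add f g p by fastforce
  define N where "N = Lp_nrm p M ?h"
  have F: "integrable M (\<lambda>x. norm (f x) * norm (flux p (?h x)))"
     "(LINT x|M. norm (f x) * norm (flux p (?h x))) \<le> Lp_nrm p M f * N powr (p - 1)"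
    using Holder[OF p f flux_Lp(1)[OF p h], of "\<lambda>x. norm (f x) * norm (flux p (?h x))"] p
    by (auto simp: flux_Lp(3)[OF p h] N_def)
  have G: "integrable M (\<lambda>x. norm (g x) * norm (flux p (?h x)))"
     "(LINT x|M. norm (g x) * norm (flux p (?h x))) \<le> Lp_nrm p M g * N powr (p - 1)"
    using Holder[OF p g flux_Lp(1)[OF p h], of "\<lambda>x. norm (g x) * norm (flux p (?h x))"] p
    by (auto simp: flux_Lp(3)[OF p h] N_def)
  have "norm (?h x) powr p \<le> norm (f x) * norm (flux p (?h x)) + norm (g x) * norm (flux p (?h x))" for x
  proof -
    have "norm (?h x) powr p = norm (?h x) * norm (flux p (?h x))"
      by (cases "?h x = 0") (auto simp: norm_flux powr_diff)
    also have "\<dots> \<le> (norm (f x) + norm (g x)) * norm (flux p (?h x))"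
      by (intro mult_right_mono norm_triangle_ineq) auto
    finally show ?thesis by (simp add: algebra_simps)
  qed
  then have "pint p M ?h \<le> (LINT x|M. norm (f x) * norm (flux p (?h x)) + norm (g x) * norm (flux p (?h x)))"
    unfolding pint_def using F(1) G(1) Lp_fun_integrable[OF h] by (intro integral_mono) auto
  also have "\<dots> \<le> (Lp_nrm p M f + Lp_nrm p M g) * N powr (p - 1)"
    using F G by (simp add: algebra_simps)
  finally have *: "N powr p \<le> (Lp_nrm p M f + Lp_nrm p M g) * N powr (p - 1)"
    using p by (simp add: N_def Lp_nrm_powr)
  show ?thesis
  proof (cases "N = 0")
    case True then show ?thesis by (simp add: N_def)
  next
    case False
    then have N: "N > 0" using Lp_nrm_nonneg[of p M ?h] by (simp add: N_def del: Lp_nrm_nonneg)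
    then have "N powr p = N * N powr (p - 1)" by (simp add: powr_mult_base)
    with * N show ?thesis by (simp add: N_def)
  qed
qed

lemma Lp_nrm_uminus[simp]: "Lp_nrm p M (\<lambda>x. - f x) = Lp_nrm p M f"
  by (simp add: Lp_nrm_def pint_def)

lemma Lp_nrm_minus_commute: "Lp_nrm p M (\<lambda>x. f x - g x) = Lp_nrm p M (\<lambda>x. g x - f x)"
  by (simp add: Lp_nrm_def pint_def norm_minus_commute)

lemma Minkowski_diff:
  assumes p: "p > 1" and f: "f \<in> Lp_fun p M" and g: "g \<in> Lp_fun p M"
  shows "Lp_nrm p M (\<lambda>x. f x - g x) \<le> Lp_nrm p M f + Lp_nrm p M g"
    "\<bar>Lp_nrm p M f - Lp_nrm p M g\<bar> \<le> Lp_nrm p M (\<lambda>x. f x - g x)"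
proof -
  show "Lp_nrm p M (\<lambda>x. f x - g x) \<le> Lp_nrm p M f + Lp_nrm p M g"
    using Minkowski[OF p f Lp_fun_uminus[OF g]] by simp
  have d: "(\<lambda>x. f x - g x) \<in> Lp_fun p M" "(\<lambda>x. g x - f x) \<in> Lp_fun p M"
    using Lp_fun_diff f g p by fastforce+
  show "\<bar>Lp_nrm p M f - Lp_nrm p M g\<bar> \<le> Lp_nrm p M (\<lambda>x. f x - g x)"
    using Minkowski[OF p d(1) g] Minkowski[OF p d(2) f] by (simp add: Lp_nrm_minus_commute[of p M f g])
qed

lemma Minkowski_triangle:
  assumes p: "p > 1" and "f \<in> Lp_fun p M" "g \<in> Lp_fun p M" "h \<in> Lp_fun p M"
  shows "Lp_nrm p M (\<lambda>x. f x - h x) \<le> Lp_nrm p M (\<lambda>x. f x - g x) + Lp_nrm p M (\<lambda>x. g x - h x)"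
proof -
  have "(\<lambda>x. f x - g x) \<in> Lp_fun p M" "(\<lambda>x. g x - h x) \<in> Lp_fun p M"
    using Lp_fun_diff assms by fastforce+
  from Minkowski[OF p this] show ?thesis by simp
qed

section \<open>Convergence, almost everywhere convergent subsequences and completeness\<close>

definition Lp_conv :: "real \<Rightarrow> 'm measure \<Rightarrow> (nat \<Rightarrow> 'm \<Rightarrow> 'v::euclidean_space) \<Rightarrow> ('m \<Rightarrow> 'v) \<Rightarrow> bool" where
  "Lp_conv p M F f \<longleftrightarrow> (\<forall>n. F n \<in> Lp_fun p M) \<and> f \<in> Lp_fun p M \<and> (\<lambda>n. Lp_nrm p M (\<lambda>x. F n x - f x)) \<longlonglongrightarrow> 0"

lemma Lp_nrm_tendsto_0_iff:
  assumes "p > 0"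
  shows "(\<lambda>n. Lp_nrm p M (F n)) \<longlonglongrightarrow> 0 \<longleftrightarrow> (\<lambda>n. pint p M (F n)) \<longlonglongrightarrow> 0"
proof
  assume "(\<lambda>n. Lp_nrm p M (F n)) \<longlonglongrightarrow> 0"
  then have "(\<lambda>n. Lp_nrm p M (F n) powr p) \<longlonglongrightarrow> 0 powr p"
    using assms by (intro tendsto_powr') auto
  then show "(\<lambda>n. pint p M (F n)) \<longlonglongrightarrow> 0" using assms by (simp add: Lp_nrm_powr)
next
  assume "(\<lambda>n. pint p M (F n)) \<longlonglongrightarrow> 0"
  then have "(\<lambda>n. pint p M (F n) powr (1 / p)) \<longlonglongrightarrow> 0 powr (1 / p)"
    using assms by (intro tendsto_powr') auto
  then show "(\<lambda>n. Lp_nrm p M (F n)) \<longlonglongrightarrow> 0" by (simp add: Lp_nrm_def)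
qed

lemma Lp_convD:
  assumes "Lp_conv p M F f"
  shows "F n \<in> Lp_fun p M" "f \<in> Lp_fun p M" "(\<lambda>n. Lp_nrm p M (\<lambda>x. F n x - f x)) \<longlonglongrightarrow> 0"
  using assms by (auto simp: Lp_conv_def)

lemma Lp_conv_pint: "Lp_conv p M F f \<Longrightarrow> p > 0 \<Longrightarrow> (\<lambda>n. pint p M (\<lambda>x. F n x - f x)) \<longlonglongrightarrow> 0"
  using Lp_nrm_tendsto_0_iff[of p M "\<lambda>n x. F n x - f x"] by (simp add: Lp_conv_def)

lemma Lp_conv_const: "f \<in> Lp_fun p M \<Longrightarrow> Lp_conv p M (\<lambda>n. f) f"
  by (simp add: Lp_conv_def Lp_nrm_def pint_def)

lemma Lp_conv_subseq: "Lp_conv p M F f \<Longrightarrow> strict_mono r \<Longrightarrow> Lp_conv p M (\<lambda>n. F (r n)) f"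
  unfolding Lp_conv_def using LIMSEQ_subseq_LIMSEQ[of "\<lambda>n. Lp_nrm p M (\<lambda>x. F n x - f x)" 0 r]
  by (auto simp: o_def)

lemma Lp_conv_sandwich:
  assumes "\<And>n. F n \<in> Lp_fun p M" "f \<in> Lp_fun p M"
    "\<forall>\<^sub>F n in sequentially. Lp_nrm p M (\<lambda>x. F n x - f x) \<le> e n" "e \<longlonglongrightarrow> 0"
  shows "Lp_conv p M F f"
proof -
  have "(\<lambda>n. Lp_nrm p M (\<lambda>x. F n x - f x)) \<longlonglongrightarrow> 0"
    by (rule tendsto_sandwich[OF _ assms(3) tendsto_const assms(4)]) auto
  then show ?thesis using assms by (simp add: Lp_conv_def)
qed

lemma Lp_conv_add:
  assumes p: "p > 1" and F: "Lp_conv p M F f" and G: "Lp_conv p M G g"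
  shows "Lp_conv p M (\<lambda>n x. F n x + G n x) (\<lambda>x. f x + g x)"
proof (rule Lp_conv_sandwich)
  show "(\<lambda>n. Lp_nrm p M (\<lambda>x. F n x - f x) + Lp_nrm p M (\<lambda>x. G n x - g x)) \<longlonglongrightarrow> 0"
    using tendsto_add[OF Lp_convD(3)[OF F] Lp_convD(3)[OF G]] by simp
  have "Lp_nrm p M (\<lambda>x. F n x + G n x - (f x + g x)) \<le> Lp_nrm p M (\<lambda>x. F n x - f x) + Lp_nrm p M (\<lambda>x. G n x - g x)" for n
  proof -
    have "(\<lambda>x. F n x - f x) \<in> Lp_fun p M" "(\<lambda>x. G n x - g x) \<in> Lp_fun p M"
      using p Lp_convD[OF F] Lp_convD[OF G] by (auto intro!: Lp_fun_diff)
    from Minkowski[OF p this] show ?thesis by (simp add: algebra_simps)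
  qed
  then show "\<forall>\<^sub>F n in sequentially. Lp_nrm p M (\<lambda>x. F n x + G n x - (f x + g x)) \<le> Lp_nrm p M (\<lambda>x. F n x - f x) + Lp_nrm p M (\<lambda>x. G n x - g x)"
    by simp
qed (use p Lp_convD[OF F] Lp_convD[OF G] in \<open>auto intro!: Lp_fun_add\<close>)

lemma Lp_conv_nrm:
  assumes p: "p > 1" and F: "Lp_conv p M F f"
  shows "(\<lambda>n. Lp_nrm p M (F n)) \<longlonglongrightarrow> Lp_nrm p M f"
proof (rule LIM_zero_cancel, rule tendsto_rabs_zero_cancel)
  show "(\<lambda>n. \<bar>Lp_nrm p M (F n) - Lp_nrm p M f\<bar>) \<longlonglongrightarrow> 0"
    by (rule tendsto_sandwich[OF _ _ tendsto_const Lp_convD(3)[OF F]])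
       (use Minkowski_diff(2)[OF p Lp_convD(1)[OF F] Lp_convD(2)[OF F]] in auto)
qed

lemma Lp_conv_pint':
  assumes p: "p > 1" and F: "Lp_conv p M F f"
  shows "(\<lambda>n. pint p M (F n)) \<longlonglongrightarrow> pint p M f"
proof -
  have "(\<lambda>n. Lp_nrm p M (F n) powr p) \<longlonglongrightarrow> Lp_nrm p M f powr p"
    using Lp_conv_nrm[OF assms] p by (intro tendsto_powr') auto
  then show ?thesis using p by (simp add: Lp_nrm_powr)
qed

lemma Lp_conv_scaleR:
  assumes p: "p > 1" and F: "Lp_conv p M F f" and c: "c \<longlonglongrightarrow> c0"
  shows "Lp_conv p M (\<lambda>n x. c n *\<^sub>R F n x) (\<lambda>x. c0 *\<^sub>R f x)"
proof (rule Lp_conv_sandwich)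
  have p0: "p > 0" using p by simp
  have *: "(\<lambda>n. \<bar>c n\<bar> * Lp_nrm p M (\<lambda>x. F n x - f x) + \<bar>c n - c0\<bar> * Lp_nrm p M f) \<longlonglongrightarrow> \<bar>c0\<bar> * 0 + \<bar>c0 - c0\<bar> * Lp_nrm p M f"
    by (intro tendsto_intros c Lp_convD(3)[OF F])
  then show "(\<lambda>n. \<bar>c n\<bar> * Lp_nrm p M (\<lambda>x. F n x - f x) + \<bar>c n - c0\<bar> * Lp_nrm p M f) \<longlonglongrightarrow> 0" by simp
  have "Lp_nrm p M (\<lambda>x. c n *\<^sub>R F n x - c0 *\<^sub>R f x) \<le> \<bar>c n\<bar> * Lp_nrm p M (\<lambda>x. F n x - f x) + \<bar>c n - c0\<bar> * Lp_nrm p M f" for n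
  proof -
    have "(\<lambda>x. c n *\<^sub>R (F n x - f x)) \<in> Lp_fun p M" "(\<lambda>x. (c n - c0) *\<^sub>R f x) \<in> Lp_fun p M"
      using p Lp_convD[OF F] by (auto intro!: Lp_fun_diff Lp_fun_scaleR)
    from Minkowski[OF p this] show ?thesis unfolding Lp_nrm_scaleR[OF p0] by (simp add: algebra_simps)
  qed
  then show "\<forall>\<^sub>F n in sequentially. Lp_nrm p M (\<lambda>x. c n *\<^sub>R F n x - c0 *\<^sub>R f x) \<le> \<bar>c n\<bar> * Lp_nrm p M (\<lambda>x. F n x - f x) + \<bar>c n - c0\<bar> * Lp_nrm p M f"
    by simp
qed (use p Lp_convD[OF F] in \<open>auto intro!: Lp_fun_scaleR\<close>)

lemma Lp_conv_cmult:
  fixes F :: "nat \<Rightarrow> 'm \<Rightarrow> real"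
  assumes "p > 1" "Lp_conv p M F f" "c \<longlonglongrightarrow> c0"
  shows "Lp_conv p M (\<lambda>n x. c n * F n x) (\<lambda>x. c0 * f x)"
  using Lp_conv_scaleR[OF assms] by simp

lemma Lp_conv_diff:
  assumes p: "p > 1" and F: "Lp_conv p M F f" and G: "Lp_conv p M G g"
  shows "Lp_conv p M (\<lambda>n x. F n x - G n x) (\<lambda>x. f x - g x)"
  using Lp_conv_add[OF p F Lp_conv_scaleR[OF p G, of "\<lambda>_. -1" "-1"]] by simp

lemma Lp_conv_AE_subseq:
  assumes p: "p > 1" and F: "Lp_conv p M F f"
  obtains r where "strict_mono r" "AE x in M. (\<lambda>n. F (r n) x) \<longlonglongrightarrow> f x"
proof -
  have p0: "p > 0" using p by simp
  have d: "(\<lambda>x. F n x - f x) \<in> Lp_fun p M" for n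
    using p Lp_convD[OF F] by (auto intro!: Lp_fun_diff)
  have "(\<lambda>n. LINT x|M. norm (norm (F n x - f x) powr p)) \<longlonglongrightarrow> 0"
    using Lp_conv_pint[OF F p0] by (simp add: pint_def)
  from tendsto_L1_AE_subseq[OF Lp_fun_integrable[OF d] this]
  obtain r where r: "strict_mono r" "AE x in M. (\<lambda>n. norm (F (r n) x - f x) powr p) \<longlonglongrightarrow> 0" by blast
  have "AE x in M. (\<lambda>n. F (r n) x) \<longlonglongrightarrow> f x"
    using r(2)
  proof eventually_elim
    case (elim x)
    then have "(\<lambda>n. (norm (F (r n) x - f x) powr p) powr (1/p)) \<longlonglongrightarrow> 0 powr (1/p)"
      using p by (intro tendsto_powr') auto
    then have "(\<lambda>n. norm (F (r n) x - f x)) \<longlonglongrightarrow> 0" using p by (simp add: powr_powr)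
    then show ?case by (rule LIM_zero_cancel[OF tendsto_norm_zero_cancel])
  qed
  with r(1) that show ?thesis by blast
qed

lemma Lp_conv_unique:
  assumes p: "p > 1" and F: "Lp_conv p M F f" and G: "Lp_conv p M F g"
  shows "AE x in M. f x = g x"
proof -
  obtain r where r: "strict_mono r" "AE x in M. (\<lambda>n. F (r n) x) \<longlonglongrightarrow> f x" using Lp_conv_AE_subseq[OF p F] .
  obtain s where s: "strict_mono s" "AE x in M. (\<lambda>n. F (r (s n)) x) \<longlonglongrightarrow> g x"
    using Lp_conv_AE_subseq[OF p Lp_conv_subseq[OF G r(1)]] .
  show ?thesis using r(2) s(2)
  proof eventually_elim
    case (elim x)
    have "(\<lambda>n. F (r (s n)) x) \<longlonglongrightarrow> f x" using LIMSEQ_subseq_LIMSEQ[OF elim(1) s(1)] by (simp add: o_def)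
    with elim(2) show ?case using LIMSEQ_unique by blast
  qed
qed

lemma Lp_conv_dominated:
  assumes p: "p > 0" and m: "\<And>n. F n \<in> borel_measurable M" and fm: "f \<in> borel_measurable M"
    and g: "g \<in> Lp_fun p M"
    and le: "\<And>n. AE x in M. norm (F n x) \<le> norm (g x)" and lim: "AE x in M. (\<lambda>n. F n x) \<longlonglongrightarrow> f x"
  shows "Lp_conv p M F f"
proof -
  have Fp: "F n \<in> Lp_fun p M" for n using Lp_fun_dom[OF m g p le] .
  have "AE x in M. \<forall>n. norm (F n x) \<le> norm (g x)" using le by (simp add: AE_all_countable)
  then have fle: "AE x in M. norm (f x) \<le> norm (g x)"
    using lim by eventually_elim (auto intro: tendsto_upperbound[OF tendsto_norm])
  have f: "f \<in> Lp_fun p M" using Lp_fun_dom[OF fm g p fle] .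
  have "(\<lambda>n. pint p M (\<lambda>x. F n x - f x)) \<longlonglongrightarrow> (LINT x|M. 0)"
    unfolding pint_def
  proof (rule integral_dominated_convergence)
    show "integrable M (\<lambda>x. 2 powr p * (norm (g x) powr p + norm (g x) powr p))"
      using Lp_fun_integrable[OF g] by auto
    show "AE x in M. (\<lambda>n. norm (F n x - f x) powr p) \<longlonglongrightarrow> 0" using lim
    proof eventually_elim
      case (elim x)
      then have "(\<lambda>n. norm (F n x - f x) powr p) \<longlonglongrightarrow> norm (f x - f x) powr p"
        using p by (intro tendsto_powr' tendsto_intros) auto
      then show ?case by simp
    qed
    show "AE x in M. norm (norm (F n x - f x) powr p) \<le> 2 powr p * (norm (g x) powr p + norm (g x) powr p)" for n
      using le[of n] fle
    proof eventually_elim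
      case (elim x)
      have "norm (F n x - f x) powr p \<le> 2 powr p * (norm (F n x) powr p + norm (f x) powr p)"
        using norm_add_powr_le[OF p, of "F n x" "- f x"] by simp
      also have "\<dots> \<le> 2 powr p * (norm (g x) powr p + norm (g x) powr p)"
        using elim p by (intro mult_left_mono add_mono powr_mono2) auto
      finally show ?case by simp
    qed
    show "(\<lambda>x. norm (F n x - f x) powr p) \<in> borel_measurable M" for n using m[of n] fm by measurable
  qed simp
  then show ?thesis using Fp f p by (simp add: Lp_conv_def Lp_nrm_tendsto_0_iff)
qed

lemma fast_Cauchy_subsequence:
  assumes "\<And>e::real. e > 0 \<Longrightarrow> \<exists>N. \<forall>m\<ge>N. \<forall>n\<ge>N. d m n < e" "\<And>n::nat. e n > 0"
  obtains r :: "nat \<Rightarrow> nat" where "strict_mono r" "\<And>n m. m \<ge> r n \<Longrightarrow> d m (r n) < e n"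
proof -
  obtain N where N: "\<And>k m n. m \<ge> N k \<Longrightarrow> n \<ge> N k \<Longrightarrow> d m n < e k"
  proof -
    have "\<forall>k. \<exists>N. \<forall>m\<ge>N. \<forall>n\<ge>N. d m n < e k" using assms by blast
    from choice[OF this] show ?thesis using that by blast
  qed
  \<comment> \<open>The sum bounds every single \<open>N k\<close> with k \<le> n, and the summand
    \<open>n\<close> makes the sequence strictly increasing even where \<open>N\<close> is
    0.\<close>
  define r where "r n = n + (\<Sum>i\<le>n. N i)" for n
  have "r n < r (Suc n)" for n by (simp add: r_def)
  then have "strict_mono r" by (simp add: strict_mono_Suc_iff)
  moreover have "N n \<le> r n" for n
    unfolding r_def using member_le_sum[of n "{..n}" N] by simp
  then have "m \<ge> r n \<Longrightarrow> d m (r n) < e n" for n m using N by (meson le_trans)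
  ultimately show ?thesis using that by blast
qed

lemma Lp_complete:
  fixes F :: "nat \<Rightarrow> 'm \<Rightarrow> 'v::euclidean_space"
  assumes p: "p > 1" and F: "\<And>n. F n \<in> Lp_fun p M"
    and C: "\<And>e. e > 0 \<Longrightarrow> \<exists>N. \<forall>m\<ge>N. \<forall>n\<ge>N. pint p M (\<lambda>x. F m x - F n x) < e"
  obtains f where "Lp_conv p M F f"
proof -
  have p0: "p > 0" using p by simp
  \<comment> \<open>If the p-th powers of the increments have integral below 4^(-pn), then weighted
    by 2^(pn) they still have integral at most 2^(-pn). So almost everywhere the increments are
    eventually below 2^(-n), hence summable.\<close>
  define e where "e n = (4 powr (-p)) ^ n" for n :: nat
  obtain r where r: "strict_mono r" "\<And>n m. m \<ge> r n \<Longrightarrow> pint p M (\<lambda>x. F m x - F (r n) x) < e n"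
    using fast_Cauchy_subsequence[of "\<lambda>m n. pint p M (\<lambda>x. F m x - F n x)" e, OF C] by (auto simp: e_def)
  note [measurable] = Lp_fun_measurable[OF F]
  have dF: "(\<lambda>x. F m x - F n x) \<in> Lp_fun p M" for m n by (rule Lp_fun_diff[OF F F p0])
  define h where "h n x = (2 powr p) ^ n * norm (F (r (Suc n)) x - F (r n) x) powr p" for n x
  have hI: "integrable M (h n)" for n
    unfolding h_def using Lp_fun_integrable[OF dF] by auto
  have hle: "(\<integral>\<^sup>+x. ennreal (h n x) \<partial>M) \<le> ennreal ((2 powr (-p)) ^ n)" for n
  proof -
    have "(\<integral>\<^sup>+x. ennreal (h n x) \<partial>M) = ennreal (LINT x|M. h n x)"
      by (rule nn_integral_eq_integral[OF hI]) (simp add: h_def)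
    also have "(LINT x|M. h n x) = (2 powr p) ^ n * pint p M (\<lambda>x. F (r (Suc n)) x - F (r n) x)"
      by (simp add: h_def pint_def)
    also have "\<dots> \<le> (2 powr p) ^ n * e n"
      using r(2)[of n "r (Suc n)"] r(1) by (intro mult_left_mono) (auto simp: strict_mono_less_eq less_imp_le)
    also have "\<dots> = (2 powr p * 4 powr (-p)) ^ n" by (simp add: e_def power_mult_distrib)
    also have "2 powr p * 4 powr (-p) = 2 powr (-p)"
    proof -
      have "(4::real) powr (-p) = 2 powr (-p) * 2 powr (-p)" by (simp add: powr_mult[symmetric])
      moreover have "2 powr p * 2 powr (-p) = (1::real)" by (simp add: powr_minus)
      ultimately show ?thesis by (simp add: mult.assoc[symmetric])
    qed
    finally show ?thesis by (simp add: ennreal_leI)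
  qed
  have "(\<integral>\<^sup>+x. (\<Sum>n. ennreal (h n x)) \<partial>M) = (\<Sum>n. \<integral>\<^sup>+x. ennreal (h n x) \<partial>M)"
    by (rule nn_integral_suminf) (auto simp: h_def)
  also have "\<dots> \<le> (\<Sum>n. ennreal ((2 powr (-p)) ^ n))"
    by (intro suminf_le hle) auto
  also have "\<dots> < \<infinity>"
  proof -
    have "(2::real) powr (-p) < 1" using p powr_less_mono[of "-p" 0 2] by simp
    then have "summable (\<lambda>n. (2 powr (-p)) ^ n :: real)" by (intro summable_geometric) auto
    then show ?thesis by (subst suminf_ennreal2) (auto simp: less_top)
  qed
  finally have "AE x in M. (\<Sum>n. ennreal (h n x)) \<noteq> \<infinity>"
    by (intro nn_integral_PInf_AE) (auto simp: h_def)
  then have conv: "AE x in M. convergent (\<lambda>n. F (r n) x)"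
  proof eventually_elim
    case (elim x)
    have "summable (\<lambda>n. h n x)"
      using elim by (intro summable_suminf_not_top) (auto simp: h_def)
    then have "(\<lambda>n. h n x) \<longlonglongrightarrow> 0" by (rule summable_LIMSEQ_zero)
    then have "\<forall>\<^sub>F n in sequentially. h n x < 1" by (rule order_tendstoD) simp
    then have "\<forall>\<^sub>F n in sequentially. norm (F (r (Suc n)) x - F (r n) x) \<le> (1/2) ^ n"
    proof eventually_elim
      case (elim n)
      have *: "(2 powr p) ^ n = ((2::real)^n) powr p" by (simp add: powr_powr powr_realpow[symmetric] mult.commute)
      have "(2 ^ n * norm (F (r (Suc n)) x - F (r n) x)) powr p < 1 powr p"
        using elim unfolding h_def * by (simp add: powr_mult)
      then have "2 ^ n * norm (F (r (Suc n)) x - F (r n) x) < 1"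
        using p0 ge_one_powr_ge_zero[of "2 ^ n * norm (F (r (Suc n)) x - F (r n) x)" p] by (smt (verit, best) powr_one_eq_one)
      then show ?case by (simp add: field_simps)
    qed
    then have "\<exists>N. \<forall>n\<ge>N. norm (F (r (Suc n)) x - F (r n) x) \<le> (1/2) ^ n" by (simp add: eventually_sequentially)
    then have "summable (\<lambda>n. F (r (Suc n)) x - F (r n) x)"
      by (rule summable_comparison_test) (auto intro: summable_geometric)
    then have "convergent (\<lambda>n. \<Sum>i<n. F (r (Suc i)) x - F (r i) x)" by (simp add: summable_iff_convergent)
    then obtain l where "(\<lambda>n. \<Sum>i<n. F (r (Suc i)) x - F (r i) x) \<longlonglongrightarrow> l" by (auto simp: convergent_def)
    then have "(\<lambda>n. (F (r n) x - F (r 0) x) + F (r 0) x) \<longlonglongrightarrow> l + F (r 0) x"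
      by (intro tendsto_add tendsto_const) (simp add: sum_lessThan_telescope[of "\<lambda>i. F (r i) x"])
    then show ?case by (auto simp: convergent_def)
  qed
  define f where "f x = lim (\<lambda>n. F (r n) x)" for x
  have [measurable]: "f \<in> borel_measurable M"
    unfolding f_def by (intro borel_measurable_lim_metric) auto
  have fl: "AE x in M. (\<lambda>n. F (r n) x) \<longlonglongrightarrow> f x"
    using conv by eventually_elim (simp add: f_def convergent_LIMSEQ_iff)
  \<comment> \<open>Fatou's lemma, in terms of nonnegative integrals because \<open>F m - f\<close>
    is not yet known to lie in L^p.\<close>
  have est: "(\<integral>\<^sup>+x. ennreal (norm (F m x - f x) powr p) \<partial>M) \<le> ennreal e'"
    if N: "\<And>n m. n \<ge> N \<Longrightarrow> m \<ge> N \<Longrightarrow> pint p M (\<lambda>x. F m x - F n x) < e'" and m: "m \<ge> N" for N m e'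
  proof -
    have "(\<integral>\<^sup>+x. ennreal (norm (F m x - f x) powr p) \<partial>M) = (\<integral>\<^sup>+x. liminf (\<lambda>n. ennreal (norm (F m x - F (r n) x) powr p)) \<partial>M)"
    proof (rule nn_integral_cong_AE)
      show "AE x in M. ennreal (norm (F m x - f x) powr p) = liminf (\<lambda>n. ennreal (norm (F m x - F (r n) x) powr p))"
        using fl
      proof eventually_elim
        case (elim x)
        have "(\<lambda>n. ennreal (norm (F m x - F (r n) x) powr p)) \<longlonglongrightarrow> ennreal (norm (F m x - f x) powr p)"
          using p0 elim by (intro tendsto_ennrealI tendsto_powr' tendsto_intros) auto
        then show ?case by (intro lim_imp_Liminf[symmetric]) auto
      qed
    qed
    also have "\<dots> \<le> liminf (\<lambda>n. \<integral>\<^sup>+x. ennreal (norm (F m x - F (r n) x) powr p) \<partial>M)"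
      by (rule nn_integral_liminf) auto
    also have "\<dots> \<le> limsup (\<lambda>n. \<integral>\<^sup>+x. ennreal (norm (F m x - F (r n) x) powr p) \<partial>M)"
      by (rule Liminf_le_Limsup) simp
    also have "\<dots> \<le> ennreal e'"
    proof (rule Limsup_bounded)
      have "(\<integral>\<^sup>+x. ennreal (norm (F m x - F (r n) x) powr p) \<partial>M) \<le> ennreal e'" if "n \<ge> N" for n
      proof -
        have "r n \<ge> N" using that seq_suble[OF r(1)] le_trans by blast
        have "(\<integral>\<^sup>+x. ennreal (norm (F m x - F (r n) x) powr p) \<partial>M) = ennreal (pint p M (\<lambda>x. F m x - F (r n) x))"
          unfolding pint_def using Lp_fun_integrable[OF dF] by (intro nn_integral_eq_integral) auto
        also have "\<dots> \<le> ennreal e'" using N[OF \<open>r n \<ge> N\<close> m] by (intro ennreal_leI) simp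
        finally show ?thesis .
      qed
      then show "\<forall>\<^sub>F n in sequentially. (\<integral>\<^sup>+x. ennreal (norm (F m x - F (r n) x) powr p) \<partial>M) \<le> ennreal e'"
        by (auto simp: eventually_sequentially)
    qed
    finally show ?thesis .
  qed
  have int: "(\<lambda>x. F m x - f x) \<in> Lp_fun p M \<and> pint p M (\<lambda>x. F m x - f x) \<le> e'"
    if "\<And>n m. n \<ge> N \<Longrightarrow> m \<ge> N \<Longrightarrow> pint p M (\<lambda>x. F m x - F n x) < e'" "m \<ge> N" for N m e'
  proof -
    have e0: "0 \<le> e'" using that(1)[of N N] pint_nonneg[of p M "\<lambda>x. F N x - F N x"] by linarith
    have "(\<integral>\<^sup>+x. ennreal (norm (F m x - f x) powr p) \<partial>M) < \<infinity>"
      using est[OF that] by (simp add: order.strict_trans1)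
    then have i: "integrable M (\<lambda>x. norm (F m x - f x) powr p)"
      by (subst integrable_iff_bounded) auto
    have "ennreal (pint p M (\<lambda>x. F m x - f x)) \<le> ennreal e'"
      using est[OF that] nn_integral_eq_integral[OF i] by (simp add: pint_def)
    then show ?thesis using i e0 by (simp add: Lp_fun_def ennreal_le_iff)
  qed
  obtain N1 where "\<forall>m\<ge>N1. \<forall>n\<ge>N1. pint p M (\<lambda>x. F m x - F n x) < 1" using C[of 1] by auto
  then have FN: "(\<lambda>x. F N1 x - f x) \<in> Lp_fun p M" using int[of N1 1 N1] by auto
  have fL: "f \<in> Lp_fun p M" using Lp_fun_diff[OF F FN p0, of N1] by simp
  have "(\<lambda>n. pint p M (\<lambda>x. F n x - f x)) \<longlonglongrightarrow> 0"
  proof (rule LIMSEQ_I)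
    fix e' :: real assume e': "0 < e'"
    then have "0 < e'/2" by simp
    then obtain N where N: "\<forall>m\<ge>N. \<forall>n\<ge>N. pint p M (\<lambda>x. F m x - F n x) < e'/2" using C by blast
    then have "\<forall>m\<ge>N. pint p M (\<lambda>x. F m x - f x) \<le> e'/2" using int[of N "e'/2"] by blast
    then show "\<exists>no. \<forall>n\<ge>no. norm (pint p M (\<lambda>x. F n x - f x) - 0) < e'" using e' by (intro exI[of _ N]) fastforce
  qed
  then have "Lp_conv p M F f" using fL F p0 by (simp add: Lp_conv_def Lp_nrm_tendsto_0_iff)
  then show ?thesis by (rule that)
qed

subsection \<open>Homogeneous functions and strong monotonicity\<close>

lemma homogeneous_zero: 
  fixes N :: "'v::real_vector \<Rightarrow> real"
  assumes "p > 0" "\<And>t x. t > 0 \<Longrightarrow> N (t *\<^sub>R x) = t powr p * N x"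
  shows "N 0 = 0"
  using assms(2)[of 2 0] powr_less_mono[of 0 p 2] assms(1) by auto

text \<open>
  By homogeneity it suffices to look at the unit sphere, where compactness yields the constant. Applied to pairs of
  vectors, with \<open>M\<close> the monotonicity defect of \<open>flux p\<close> and \<open>N\<close> the \<open>p\<close>-th power of their distance, this
  replaces the usual quantitative inequalities and their case distinction between \<open>p < 2\<close> and \<open>p \<ge> 2\<close>.
\<close>

lemma homogeneous_domination:
  fixes N M :: "'v::euclidean_space \<Rightarrow> real"
  assumes p: "p > 0" and cN: "continuous_on UNIV N" and cM: "continuous_on UNIV M"
    and hN: "\<And>t x. t > 0 \<Longrightarrow> N (t *\<^sub>R x) = t powr p * N x"
    and hM: "\<And>t x. t > 0 \<Longrightarrow> M (t *\<^sub>R x) = t powr p * M x"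
    and M0: "\<And>x. M x \<ge> 0" and z: "\<And>x. M x = 0 \<Longrightarrow> N x \<le> 0" and e: "e > 0"
  obtains C where "C \<ge> 0" "\<And>x. N x \<le> e * norm x powr p + C * M x"
proof -
  have cN': "continuous_on S N" and cM': "continuous_on S M" for S
    using cN cM continuous_on_subset by blast+
  \<comment> \<open>On the sphere outside \<open>K\<close> the bound e suffices. On \<open>K\<close>
    the function \<open>M\<close> has no zero by \<open>z\<close>, hence a positive minimum, and the
    maximum of \<open>N\<close> divided by it is an admissible constant.\<close>
  define K where "K = {x \<in> sphere 0 1. N x \<ge> e}"
  have "K = sphere 0 1 \<inter> N -` {e..}" by (auto simp: K_def)
  moreover have "closed (sphere 0 1 \<inter> N -` {e..})"
    by (intro continuous_closed_preimage cN') auto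
  ultimately have K: "compact K" by (auto simp: K_def intro!: compact_Int_closed compact_eq_bounded_closed[THEN iffD2] bounded_subset[OF bounded_sphere])
  have "\<exists>C\<ge>0. \<forall>x\<in>sphere 0 1. N x \<le> e + C * M x"
  proof (cases "K = {}")
    case True
    then show ?thesis by (intro exI[of _ 0]) (force simp: K_def)
  next
    case False
    obtain y where y: "y \<in> K" "\<forall>x\<in>K. M y \<le> M x" using continuous_attains_inf[OF K False cM'] by blast
    obtain w where w: "w \<in> K" "\<forall>x\<in>K. N x \<le> N w" using continuous_attains_sup[OF K False cN'] by blast
    have "M y > 0" using z[of y] M0[of y] y(1) e by (auto simp: K_def order.order_iff_strict)
    have w0: "N w > 0" using w(1) e by (auto simp: K_def)
    show ?thesis
    proof (intro exI[of _ "N w / M y"] conjI ballI)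
      show "0 \<le> N w / M y" using \<open>M y > 0\<close> w0 by simp
      fix x :: 'v assume x: "x \<in> sphere 0 1"
      show "N x \<le> e + N w / M y * M x"
      proof (cases "x \<in> K")
        case True
        have "N x \<le> N w" using w True by blast
        also have "N w = N w / M y * M y" using \<open>M y > 0\<close> by simp
        also have "\<dots> \<le> N w / M y * M x" using True y w0 \<open>M y > 0\<close> by (intro mult_left_mono) auto
        finally show ?thesis using e by simp
      next
        case False
        then have "N x < e" using x by (auto simp: K_def)
        also have "e \<le> e + N w / M y * M x" using w0 \<open>M y > 0\<close> M0[of x] by simp
        finally show ?thesis by simp
      qed
    qed
  qed
  then obtain C where C: "C \<ge> 0" "\<And>x. x \<in> sphere 0 1 \<Longrightarrow> N x \<le> e + C * M x" by blast
  have "N x \<le> e * norm x powr p + C * M x" for x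
  proof (cases "x = 0")
    case True
    then show ?thesis using homogeneous_zero[OF p hN] homogeneous_zero[OF p hM] by simp
  next
    case False
    define u where "u = (1 / norm x) *\<^sub>R x"
    have u: "u \<in> sphere 0 1" "x = norm x *\<^sub>R u" using False by (auto simp: u_def)
    have "N x = norm x powr p * N u" "M x = norm x powr p * M u"
      using hN[of "norm x" u] hM[of "norm x" u] u False by auto
    then show ?thesis using mult_left_mono[OF C(2)[OF u(1)], of "norm x powr p"] by (simp add: algebra_simps)
  qed
  with C(1) that show ?thesis by blast
qed

lemma homogeneous_bound:
  fixes N :: "'v::euclidean_space \<Rightarrow> real"
  assumes p: "p > 0" and cN: "continuous_on UNIV N"
    and hN: "\<And>t x. t > 0 \<Longrightarrow> N (t *\<^sub>R x) = t powr p * N x"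
  obtains C where "C \<ge> 0" "\<And>x. \<bar>N x\<bar> \<le> C * norm x powr p"
proof -
  obtain C where C: "C \<ge> 0" "\<And>x. \<bar>N x\<bar> \<le> 1 * norm x powr p + C * (norm x powr p)"
  proof (rule homogeneous_domination[of p "\<lambda>x. \<bar>N x\<bar>" "\<lambda>x. norm x powr p" 1])
    show "continuous_on UNIV (\<lambda>x::'v. norm x powr p)"
      using p by (intro continuous_on_powr' continuous_intros) auto
    show "norm x powr p = 0 \<Longrightarrow> \<bar>N x\<bar> \<le> 0" for x using homogeneous_zero[OF p hN] by simp
  qed (use p hN cN in \<open>auto simp: abs_mult powr_mult intro!: continuous_intros\<close>)
  show ?thesis by (rule that[of "1 + C"]) (use C in \<open>auto simp: algebra_simps\<close>)
qed

lemma homogeneous_integrable: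
  fixes N :: "'v::euclidean_space \<Rightarrow> real"
  assumes p: "p > 0" and cN: "continuous_on UNIV N"
    and hN: "\<And>t x. t > 0 \<Longrightarrow> N (t *\<^sub>R x) = t powr p * N x" and X: "X \<in> Lp_fun p M"
  shows "integrable M (\<lambda>x. N (X x))"
proof -
  obtain C where C: "C \<ge> 0" "\<And>x. \<bar>N x\<bar> \<le> C * norm x powr p" using homogeneous_bound[OF p cN hN] by blast
  have "integrable M (\<lambda>x. C * norm (X x) powr p)" using Lp_fun_integrable[OF X] by auto
  then show ?thesis
    by (rule Bochner_Integration.integrable_bound)
       (use C borel_measurable_continuous_on[OF cN Lp_fun_measurable[OF X]] in auto)
qed

text \<open>\<open>N\<close> is split into a small multiple of the p-th power and a large multiple
  of \<open>D\<close>; the first is controlled by the bound \<open>B\<close>, the second by the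
  smallness of the integral of \<open>D\<close>. The threshold \<open>d\<close> is fixed before the
  measure and the function, as Cauchy arguments require.\<close>

lemma homogeneous_integral_small:
  fixes N D :: "'v::euclidean_space \<Rightarrow> real"
  assumes p: "p > 0" and cN: "continuous_on UNIV N" and cM: "continuous_on UNIV D"
    and hN: "\<And>t x. t > 0 \<Longrightarrow> N (t *\<^sub>R x) = t powr p * N x"
    and hM: "\<And>t x. t > 0 \<Longrightarrow> D (t *\<^sub>R x) = t powr p * D x"
    and M0: "\<And>x. D x \<ge> 0" and z: "\<And>x. D x = 0 \<Longrightarrow> N x \<le> 0" and e: "e > 0" and B: "B > 0"
  obtains d where "d > 0"
    "\<And>M (X :: 'm \<Rightarrow> 'v). X \<in> Lp_fun p M \<Longrightarrow> pint p M X \<le> B \<Longrightarrow> (LINT x|M. D (X x)) < d \<Longrightarrow> (LINT x|M. N (X x)) < e"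
proof -
  have "e / (2 * B) > 0" using e B by simp
  from homogeneous_domination[OF p cN cM hN hM M0 z this] obtain C where
    C: "C \<ge> 0" "\<And>x. N x \<le> e / (2 * B) * norm x powr p + C * D x" by blast
  show ?thesis
  proof (rule that[of "e / (2 * (C + 1))"])
    show "0 < e / (2 * (C + 1))" using C e by simp
    fix M and X :: "'m \<Rightarrow> 'v" 
    assume X: "X \<in> Lp_fun p M" "pint p M X \<le> B" "(LINT x|M. D (X x)) < e / (2 * (C + 1))"
    have i: "integrable M (\<lambda>x. N (X x))" "integrable M (\<lambda>x. D (X x))"
      using homogeneous_integrable[OF p cN hN X(1)] homogeneous_integrable[OF p cM hM X(1)] by auto
    have "(LINT x|M. N (X x)) \<le> (LINT x|M. e / (2 * B) * norm (X x) powr p + C * D (X x))"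
      using i C Lp_fun_integrable[OF X(1)] by (intro integral_mono) auto
    also have "\<dots> = e / (2 * B) * pint p M X + C * (LINT x|M. D (X x))"
      using i Lp_fun_integrable[OF X(1)] by (simp add: pint_def)
    also have "\<dots> \<le> e / (2 * B) * B + C * (e / (2 * (C + 1)))"
      using X e B C by (intro add_mono mult_left_mono) auto
    also have "\<dots> < e"
    proof -
      have "C * (e / (2 * (C + 1))) < e / 2" using C e by (simp add: field_simps)
      moreover have "e / (2 * B) * B = e / 2" using B by simp
      ultimately show ?thesis by linarith
    qed
    finally show "(LINT x|M. N (X x)) < e" .
  qed
qed

text \<open>Lets a comparison of two functions be treated as a homogeneous function of one function
  with values in pairs.\<close>

lemma Lp_fun_Pair:
  assumes p: "p > 0" and f: "f \<in> Lp_fun p M" and g: "g \<in> Lp_fun p M"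
  shows "(\<lambda>x. (f x, g x)) \<in> Lp_fun p M" "pint p M (\<lambda>x. (f x, g x)) \<le> 2 powr p * (pint p M f + pint p M g)"
proof -
  note [measurable] = Lp_fun_measurable[OF f] Lp_fun_measurable[OF g]
  have [measurable]: "(\<lambda>x. (f x, g x)) \<in> borel_measurable M" by (rule borel_measurable_Pair) auto
  have le: "norm (f x, g x) powr p \<le> 2 powr p * (norm (f x) powr p + norm (g x) powr p)" for x
    using norm_add_powr_le[OF p, of "(f x, 0)" "(0, g x)"] by simp
  have I: "integrable M (\<lambda>x. 2 powr p * (norm (f x) powr p + norm (g x) powr p))"
    using Lp_fun_integrable[OF f] Lp_fun_integrable[OF g] by auto
  then have I': "integrable M (\<lambda>x. norm (f x, g x) powr p)"
    by (rule Bochner_Integration.integrable_bound) (use le in auto)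
  then show "(\<lambda>x. (f x, g x)) \<in> Lp_fun p M" by (simp add: Lp_fun_def)
  have "pint p M (\<lambda>x. (f x, g x)) \<le> (LINT x|M. 2 powr p * (norm (f x) powr p + norm (g x) powr p))"
    unfolding pint_def by (rule integral_mono[OF I' I]) (rule le)
  also have "\<dots> = 2 powr p * (pint p M f + pint p M g)"
    using Lp_fun_integrable[OF f] Lp_fun_integrable[OF g] by (simp add: pint_def)
  finally show "pint p M (\<lambda>x. (f x, g x)) \<le> 2 powr p * (pint p M f + pint p M g)" .
qed

lemma Lp_conv_bounded:
  assumes "p > 1" "Lp_conv p M F f"
  obtains B where "B > 0" "\<And>n. pint p M (F n) \<le> B" "pint p M f \<le> B"
proof -
  have "Bseq (\<lambda>n. pint p M (F n))" using Lp_conv_pint'[OF assms] convergent_imp_Bseq convergentI by blast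
  then obtain K where K: "K > 0" "\<And>n. norm (pint p M (F n)) \<le> K" by (auto simp: Bseq_def)
  show ?thesis by (rule that[of "K + pint p M f"]) (use K in \<open>auto simp: add_pos_nonneg add_increasing2 add_increasing\<close>)
qed

text \<open>The pair of \<open>F n x\<close> and \<open>f x\<close> is the argument of
  \<open>homogeneous_integral_small\<close>. The power of the flux difference is p-homogeneous
  because p - 1 times the conjugate exponent is p, and it vanishes wherever the two entries
  agree.\<close>

lemma Lp_conv_flux:
  fixes F :: "nat \<Rightarrow> 'm \<Rightarrow> 'v::euclidean_space"
  assumes p: "p > 1" and F: "Lp_conv p M F f"
  shows "Lp_conv (p / (p - 1)) M (\<lambda>n x. flux p (F n x)) (\<lambda>x. flux p (f x))"
proof -
  let ?q = "p / (p - 1)"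
  have p0: "p > 0" and q0: "?q > 0" using p by auto
  obtain B where B: "B > 0" "\<And>n. pint p M (F n) \<le> B" "pint p M f \<le> B" using Lp_conv_bounded[OF p F] by blast
  define N :: "'v \<times> 'v \<Rightarrow> real" where "N z = norm (flux p (fst z) - flux p (snd z)) powr ?q" for z
  define D :: "'v \<times> 'v \<Rightarrow> real" where "D z = norm (fst z - snd z) powr p" for z
  have cf: "continuous_on UNIV (\<lambda>z::'v\<times>'v. flux p (fst z))" "continuous_on UNIV (\<lambda>z::'v\<times>'v. flux p (snd z))"
    by (rule continuous_on_compose2[OF continuous_flux[OF p]]; auto intro!: continuous_intros)+
  have cN: "continuous_on UNIV N" unfolding N_def
    using q0 by (intro continuous_on_powr' continuous_on_norm continuous_on_diff cf continuous_on_const) auto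
  have cD: "continuous_on UNIV D" unfolding D_def
    using p0 by (intro continuous_on_powr' continuous_intros) auto
  have hN: "N (t *\<^sub>R z) = t powr p * N z" if "t > 0" for t z
  proof -
    have "flux p (fst (t *\<^sub>R z)) - flux p (snd (t *\<^sub>R z)) = t powr (p - 1) *\<^sub>R (flux p (fst z) - flux p (snd z))"
      using that by (simp add: flux_scaleR_pos scaleR_diff_right)
    then show ?thesis using conjugate_exponent(4)[OF p] by (simp add: N_def powr_mult powr_powr)
  qed
  have hD: "D (t *\<^sub>R z) = t powr p * D z" if "t > 0" for t z
    using that by (simp add: D_def powr_mult scaleR_diff_right[symmetric])
  have D0: "D z \<ge> 0" "D z = 0 \<Longrightarrow> N z \<le> 0" for z by (auto simp: D_def N_def)
  have "(\<lambda>n. pint ?q M (\<lambda>x. flux p (F n x) - flux p (f x))) \<longlonglongrightarrow> 0"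
  proof (rule LIMSEQ_I)
    fix e :: real assume "e > 0"
    have B2: "2 powr p * (B + B) > 0" using B by simp
    obtain d where d: "d > 0" "\<And>M (X :: 'm \<Rightarrow> 'v \<times> 'v). X \<in> Lp_fun p M \<Longrightarrow> pint p M X \<le> 2 powr p * (B + B) \<Longrightarrow> (LINT x|M. D (X x)) < d \<Longrightarrow> (LINT x|M. N (X x)) < e"
      using homogeneous_integral_small[OF p0 cN cD hN hD D0 \<open>e > 0\<close> B2] by blast
    have "\<forall>\<^sub>F n in sequentially. pint p M (\<lambda>x. F n x - f x) < d"
      using Lp_conv_pint[OF F p0] d(1) by (rule order_tendstoD)
    then have "\<forall>\<^sub>F n in sequentially. pint ?q M (\<lambda>x. flux p (F n x) - flux p (f x)) < e"
    proof eventually_elim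
      case (elim n)
      have "(LINT x|M. N (F n x, f x)) < e"
      proof (rule d(2))
        show "(\<lambda>x. (F n x, f x)) \<in> Lp_fun p M" using Lp_fun_Pair(1)[OF p0 Lp_convD(1,2)[OF F]] .
        have "pint p M (\<lambda>x. (F n x, f x)) \<le> 2 powr p * (pint p M (F n) + pint p M f)"
          using Lp_fun_Pair(2)[OF p0 Lp_convD(1,2)[OF F]] .
        also have "\<dots> \<le> 2 powr p * (B + B)" using B by (intro mult_left_mono add_mono) auto
        finally show "pint p M (\<lambda>x. (F n x, f x)) \<le> 2 powr p * (B + B)" .
        show "(LINT x|M. D (F n x, f x)) < d" using elim by (simp add: D_def pint_def)
      qed
      then show ?case by (simp add: N_def pint_def)
    qed
    then show "\<exists>no. \<forall>n\<ge>no. norm (pint ?q M (\<lambda>x. flux p (F n x) - flux p (f x)) - 0) < e"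
      by (simp add: eventually_sequentially)
  qed
  then show ?thesis
    using flux_Lp(1)[OF p Lp_convD(1)[OF F]] flux_Lp(1)[OF p Lp_convD(2)[OF F]] q0
    by (simp add: Lp_conv_def Lp_nrm_tendsto_0_iff)
qed

text \<open>By Cauchy-Schwarz the left-hand side is at least (s^(p-1) - t^(p-1)) (s - t) with the
  norms s and t. If it is 0 the norms agree, and unless they vanish equality holds in Cauchy-Schwarz
  as well.\<close>

lemma flux_mono:
  fixes a b :: "'v::real_inner"
  assumes p: "p > 1"
  shows "(flux p a - flux p b) \<bullet> (a - b) \<ge> 0" "(flux p a - flux p b) \<bullet> (a - b) = 0 \<Longrightarrow> a = b"
proof -
  define s where "s = norm a" define t where "t = norm b"
  have st: "s \<ge> 0" "t \<ge> 0" by (auto simp: s_def t_def)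
  have ip: "a \<bullet> b \<le> s * t" using norm_cauchy_schwarz by (auto simp: s_def t_def)
  have e1: "s powr p = s powr (p - 1) * s" "t powr p = t powr (p - 1) * t"
    using st by (cases "s = 0"; simp add: powr_diff; fail) (use st in \<open>cases "t = 0"; simp add: powr_diff\<close>)
  have e2: "s powr (p - 1) = s powr (p - 2) * s" "t powr (p - 1) = t powr (p - 2) * t"
    using st by (cases "s = 0"; simp add: powr_diff power2_eq_square; fail)
      (use st in \<open>cases "t = 0"; simp add: powr_diff power2_eq_square\<close>)
  have eq: "(flux p a - flux p b) \<bullet> (a - b) = s powr p + t powr p - (s powr (p - 2) + t powr (p - 2)) * (a \<bullet> b)"
    by (simp add: inner_diff_left inner_diff_right flux_inner)
       (simp add: flux_def s_def t_def inner_commute algebra_simps)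
  have eq2: "s powr p + t powr p - (s powr (p - 2) + t powr (p - 2)) * (s * t) = (s powr (p - 1) - t powr (p - 1)) * (s - t)"
    unfolding e1 by (simp add: algebra_simps e2)
  have nn: "(s powr (p - 1) - t powr (p - 1)) * (s - t) \<ge> 0"
  proof (cases "s \<le> t")
    case True
    then have "s powr (p - 1) \<le> t powr (p - 1)" using p st by (intro powr_mono2) auto
    with True show ?thesis by (intro mult_nonpos_nonpos) auto
  next
    case False
    then have "t powr (p - 1) \<le> s powr (p - 1)" using p st by (intro powr_mono2) auto
    with False show ?thesis by (intro mult_nonneg_nonneg) auto
  qed
  have k: "(s powr (p - 2) + t powr (p - 2)) * (a \<bullet> b) \<le> (s powr (p - 2) + t powr (p - 2)) * (s * t)"
    using ip by (intro mult_left_mono) auto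
  show "(flux p a - flux p b) \<bullet> (a - b) \<ge> 0" using eq eq2 nn k by linarith
  assume z: "(flux p a - flux p b) \<bullet> (a - b) = 0"
  then have "(s powr (p - 1) - t powr (p - 1)) * (s - t) = 0" using eq eq2 nn k by linarith
  then have stq: "s = t"
    using p st powr_less_mono2[of "p - 1" s t] powr_less_mono2[of "p - 1" t s] by (auto simp: not_less_iff_gr_or_eq) (metis less_irrefl linorder_neqE)
  show "a = b"
  proof (cases "s = 0")
    case True then show ?thesis using stq by (simp add: s_def t_def)
  next
    case False
    then have "(s powr (p - 2) + t powr (p - 2)) > 0" using st by (simp add: add_pos_nonneg)
    moreover have "(s powr (p - 2) + t powr (p - 2)) * (a \<bullet> b) = (s powr (p - 2) + t powr (p - 2)) * (s * t)"
      using z eq eq2 nn k by linarith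
    ultimately have "a \<bullet> b = s * t" by simp
    then have "(norm (a - b))\<^sup>2 = 0"
      using stq by (simp add: power2_norm_eq_inner inner_diff_left inner_diff_right inner_commute s_def t_def)
        (simp add: dot_square_norm power2_eq_square)
    then show ?thesis by simp
  qed
qed

text \<open>Strict monotonicity made uniform on bounded sets of L^p: the threshold depends on p, e
  and B only. This is what turns weak equations into strong convergence of gradients in
  \<open>sol_conv\<close>.\<close>

lemma flux_mono_small:
  assumes p: "p > 1" and e: "e > 0" and B: "B > 0"
  obtains d where "d > 0"
    "\<And>M (f :: 'm \<Rightarrow> 'v::euclidean_space) g. f \<in> Lp_fun p M \<Longrightarrow> g \<in> Lp_fun p M \<Longrightarrow> pint p M f \<le> B \<Longrightarrow> pint p M g \<le> B \<Longrightarrow>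
       (LINT x|M. (flux p (f x) - flux p (g x)) \<bullet> (f x - g x)) < d \<Longrightarrow> pint p M (\<lambda>x. f x - g x) < e"
proof -
  have p0: "p > 0" using p by simp
  define N :: "'v \<times> 'v \<Rightarrow> real" where "N z = norm (fst z - snd z) powr p" for z
  define D :: "'v \<times> 'v \<Rightarrow> real" where "D z = (flux p (fst z) - flux p (snd z)) \<bullet> (fst z - snd z)" for z
  have cf: "continuous_on UNIV (\<lambda>z::'v\<times>'v. flux p (fst z))" "continuous_on UNIV (\<lambda>z::'v\<times>'v. flux p (snd z))"
    by (rule continuous_on_compose2[OF continuous_flux[OF p]]; auto intro!: continuous_intros)+
  have cD: "continuous_on UNIV D" unfolding D_def
    by (intro continuous_on_inner continuous_on_diff cf continuous_intros)
  have cN: "continuous_on UNIV N" unfolding N_def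
    using p0 by (intro continuous_on_powr' continuous_intros) auto
  have hD: "D (t *\<^sub>R z) = t powr p * D z" if "t > 0" for t z
  proof -
    have "flux p (fst (t *\<^sub>R z)) - flux p (snd (t *\<^sub>R z)) = t powr (p - 1) *\<^sub>R (flux p (fst z) - flux p (snd z))"
      using that by (simp add: flux_scaleR_pos scaleR_diff_right)
    then have "D (t *\<^sub>R z) = (t powr (p - 1) * t) * D z"
      by (simp add: D_def scaleR_diff_right[symmetric])
    also have "t powr (p - 1) * t = t powr p" using that by (simp add: powr_diff)
    finally show ?thesis .
  qed
  have hN: "N (t *\<^sub>R z) = t powr p * N z" if "t > 0" for t z
    using that by (simp add: N_def powr_mult scaleR_diff_right[symmetric])
  have D0: "D z \<ge> 0" "D z = 0 \<Longrightarrow> N z \<le> 0" for z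
    using flux_mono[OF p, of "fst z" "snd z"] by (auto simp: D_def N_def)
  have B2: "2 powr p * (B + B) > 0" using B by simp
  obtain d where d: "d > 0" "\<And>M (X :: 'm \<Rightarrow> 'v \<times> 'v). X \<in> Lp_fun p M \<Longrightarrow> pint p M X \<le> 2 powr p * (B + B) \<Longrightarrow> (LINT x|M. D (X x)) < d \<Longrightarrow> (LINT x|M. N (X x)) < e"
    using homogeneous_integral_small[OF p0 cN cD hN hD D0 e B2] by blast
  show ?thesis
  proof (rule that[OF d(1)])
    fix M and f g :: "'m \<Rightarrow> 'v"
    assume a: "f \<in> Lp_fun p M" "g \<in> Lp_fun p M" "pint p M f \<le> B" "pint p M g \<le> B"
      "(LINT x|M. (flux p (f x) - flux p (g x)) \<bullet> (f x - g x)) < d"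
    have "(LINT x|M. N (f x, g x)) < e"
    proof (rule d(2))
      show "(\<lambda>x. (f x, g x)) \<in> Lp_fun p M" using Lp_fun_Pair(1)[OF p0 a(1,2)] .
      have "pint p M (\<lambda>x. (f x, g x)) \<le> 2 powr p * (pint p M f + pint p M g)"
        using Lp_fun_Pair(2)[OF p0 a(1,2)] .
      also have "\<dots> \<le> 2 powr p * (B + B)" using a by (intro mult_left_mono add_mono) auto
      finally show "pint p M (\<lambda>x. (f x, g x)) \<le> 2 powr p * (B + B)" .
      show "(LINT x|M. D (f x, g x)) < d" using a(5) by (simp add: D_def)
    qed
    then show "pint p M (\<lambda>x. f x - g x) < e" by (simp add: N_def pint_def)
  qed
qed

section \<open>Duality pairings and the equality case of Hoelder's inequality\<close>

lemma Holder_inner: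
  fixes f g :: "'m \<Rightarrow> 'v::euclidean_space"
  assumes p: "p > 1" and f: "f \<in> Lp_fun p M" and g: "g \<in> Lp_fun (p / (p - 1)) M"
  shows "integrable M (\<lambda>x. g x \<bullet> f x)" "\<bar>LINT x|M. g x \<bullet> f x\<bar> \<le> Lp_nrm p M f * Lp_nrm (p / (p - 1)) M g"
proof -
  note [measurable] = Lp_fun_measurable[OF f] Lp_fun_measurable[OF g]
  have le: "AE x in M. norm (g x \<bullet> f x) \<le> norm (f x) * norm (g x)"
  proof (rule AE_I2)
    show "norm (g x \<bullet> f x) \<le> norm (f x) * norm (g x)" for x
      using Cauchy_Schwarz_ineq2[of "g x" "f x"] by (simp add: mult.commute)
  qed
  show "integrable M (\<lambda>x. g x \<bullet> f x)" using Holder(1)[OF p f g _ le] by simp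
  have "\<bar>LINT x|M. g x \<bullet> f x\<bar> \<le> (LINT x|M. norm (g x \<bullet> f x))"
    using integral_abs_bound[of M "\<lambda>x. g x \<bullet> f x"] by simp
  also have "\<dots> \<le> Lp_nrm p M f * Lp_nrm (p / (p - 1)) M g" using Holder(2)[OF p f g _ le] by simp
  finally show "\<bar>LINT x|M. g x \<bullet> f x\<bar> \<le> Lp_nrm p M f * Lp_nrm (p / (p - 1)) M g" .
qed

lemma Lp_pairing_tendsto:
  fixes F :: "nat \<Rightarrow> 'm \<Rightarrow> 'v::euclidean_space"
  assumes p: "p > 1" and F: "Lp_conv p M F f" and G: "Lp_conv (p / (p - 1)) M G g"
  shows "(\<lambda>n. LINT x|M. G n x \<bullet> F n x) \<longlonglongrightarrow> (LINT x|M. g x \<bullet> f x)"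
proof (rule LIM_zero_cancel, rule tendsto_rabs_zero_cancel)
  let ?q = "p / (p - 1)"
  have p0: "p > 0" and q1: "?q > 1" using p conjugate_exponent by auto
  have dF: "(\<lambda>x. F n x - f x) \<in> Lp_fun p M" for n by (rule Lp_fun_diff[OF Lp_convD(1,2)[OF F] p0])
  have dG: "(\<lambda>x. G n x - g x) \<in> Lp_fun ?q M" for n by (rule Lp_fun_diff[OF Lp_convD(1,2)[OF G]]) (use q1 in simp)
  have le: "\<bar>(LINT x|M. G n x \<bullet> F n x) - (LINT x|M. g x \<bullet> f x)\<bar> \<le>
     Lp_nrm p M (F n) * Lp_nrm ?q M (\<lambda>x. G n x - g x) + Lp_nrm p M (\<lambda>x. F n x - f x) * Lp_nrm ?q M g" for n
  proof -
    have "(LINT x|M. G n x \<bullet> F n x) - (LINT x|M. g x \<bullet> f x) = (LINT x|M. G n x \<bullet> F n x - g x \<bullet> f x)"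
      by (rule Bochner_Integration.integral_diff[symmetric]) (rule Holder_inner[OF p] Lp_convD[OF F] Lp_convD[OF G])+
    also have "\<dots> = (LINT x|M. (G n x - g x) \<bullet> F n x + g x \<bullet> (F n x - f x))"
      by (simp add: inner_diff_left inner_diff_right)
    also have "\<dots> = (LINT x|M. (G n x - g x) \<bullet> F n x) + (LINT x|M. g x \<bullet> (F n x - f x))"
      by (rule Bochner_Integration.integral_add) (rule Holder_inner[OF p] Lp_convD[OF F] Lp_convD[OF G] dF dG)+
    finally show ?thesis
      using Holder_inner(2)[OF p Lp_convD(1)[OF F] dG, of n n] Holder_inner(2)[OF p dF Lp_convD(2)[OF G], of n] by linarith
  qed
  show "(\<lambda>n. \<bar>(LINT x|M. G n x \<bullet> F n x) - (LINT x|M. g x \<bullet> f x)\<bar>) \<longlonglongrightarrow> 0"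
  proof (rule tendsto_sandwich[OF _ always_eventually tendsto_const])
    show "\<forall>n. \<bar>(LINT x|M. G n x \<bullet> F n x) - (LINT x|M. g x \<bullet> f x)\<bar> \<le>
     Lp_nrm p M (F n) * Lp_nrm ?q M (\<lambda>x. G n x - g x) + Lp_nrm p M (\<lambda>x. F n x - f x) * Lp_nrm ?q M g" using le by blast
    have "(\<lambda>n. Lp_nrm p M (F n) * Lp_nrm ?q M (\<lambda>x. G n x - g x) + Lp_nrm p M (\<lambda>x. F n x - f x) * Lp_nrm ?q M g)
      \<longlonglongrightarrow> Lp_nrm p M f * 0 + 0 * Lp_nrm ?q M g"
      by (intro tendsto_intros Lp_conv_nrm[OF p F] Lp_convD(3)[OF F] Lp_convD(3)[OF G])
    then show "(\<lambda>n. Lp_nrm p M (F n) * Lp_nrm ?q M (\<lambda>x. G n x - g x) + Lp_nrm p M (\<lambda>x. F n x - f x) * Lp_nrm ?q M g) \<longlonglongrightarrow> 0" by simp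
  qed simp
qed

text \<open>For A = s^p, B = t^p and their weighted mean m, the bounds ln x \<le> x - 1 at A / m and
  B / m have a weighted sum whose right-hand side is 0; this is the inequality of weighted means.
  Equality forces A = B = m, since ln x = x - 1 only at 1.\<close>

lemma Young_inequality:
  fixes s t :: real
  assumes p: "p > 1" and st: "s \<ge> 0" "t \<ge> 0"
  shows "s powr (p - 1) * t \<le> (1 - 1/p) * s powr p + 1/p * t powr p"
    "s powr (p - 1) * t = (1 - 1/p) * s powr p + 1/p * t powr p \<Longrightarrow> s = t"
proof -
  have "s powr (p - 1) * t \<le> (1 - 1/p) * s powr p + 1/p * t powr p \<and>
    (s powr (p - 1) * t = (1 - 1/p) * s powr p + 1/p * t powr p \<longrightarrow> s = t)"
  proof (cases "s = 0 \<or> t = 0")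
    case True
    then show ?thesis using p st by auto
  next
    case False
    then have st: "s > 0" "t > 0" using st by auto
    define A where "A = s powr p" define B where "B = t powr p"
    define m where "m = (1 - 1/p) * A + 1/p * B"
    have AB: "A > 0" "B > 0" using st by (auto simp: A_def B_def)
    have m: "m > 0" unfolding m_def using AB p by (intro add_pos_pos mult_pos_pos) auto
    have pp: "0 < 1 - 1/p" "0 < 1/p" using p by auto
    have l: "ln (s powr (p - 1) * t) = (1 - 1/p) * ln A + 1/p * ln B"
      using st p by (simp add: A_def B_def ln_mult ln_powr field_simps)
    have i: "ln (A / m) \<le> A / m - 1" "ln (B / m) \<le> B / m - 1" using AB m by (auto intro!: ln_le_minus_one)
    have z: "(1 - 1/p) * (A / m - 1) + 1/p * (B / m - 1) = 0"
    proof -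
      have "(1 - 1/p) * (A / m - 1) + 1/p * (B / m - 1) = ((1 - 1/p) * A + 1/p * B) / m - 1"
        by (simp add: algebra_simps add_divide_distrib diff_divide_distrib)
      then show ?thesis using m unfolding m_def[symmetric] by simp
    qed
    have e: "(1 - 1/p) * ln (A / m) + 1/p * ln (B / m) = ln (s powr (p - 1) * t) - ln m"
      unfolding l using AB m by (simp add: ln_div algebra_simps)
    have "(1 - 1/p) * ln (A / m) \<le> (1 - 1/p) * (A / m - 1)"
      by (rule mult_left_mono[OF i(1)]) (use pp in simp)
    moreover have "1/p * ln (B / m) \<le> 1/p * (B / m - 1)"
      by (rule mult_left_mono[OF i(2)]) (use pp in simp)
    ultimately have i2: "(1 - 1/p) * ln (A / m) \<le> (1 - 1/p) * (A / m - 1)" "1/p * ln (B / m) \<le> 1/p * (B / m - 1)" by auto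
    have "ln (s powr (p - 1) * t) \<le> ln m" using i2 z e by linarith
    then have 1: "s powr (p - 1) * t \<le> m" using m st by (subst (asm) ln_le_cancel_iff) auto
    have 2: "s = t" if "s powr (p - 1) * t = m"
    proof -
      have "(1 - 1/p) * ln (A / m) = (1 - 1/p) * (A / m - 1)" "1/p * ln (B / m) = 1/p * (B / m - 1)"
      proof -
        have "ln (s powr (p - 1) * t) = ln m" using that by simp
        then show "(1 - 1/p) * ln (A / m) = (1 - 1/p) * (A / m - 1)" "1/p * ln (B / m) = 1/p * (B / m - 1)"
          using i2 z e by linarith+
      qed
      then have "ln (A / m) = A / m - 1" "ln (B / m) = B / m - 1" using pp p by auto
      moreover have "A / m > 0" "B / m > 0" using AB m by auto
      ultimately have "A / m = 1" "B / m = 1" using ln_eq_minus_one by metis+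
      then have "A = B" using m by simp
      then show ?thesis using st p powr_inj[of s p t] unfolding A_def B_def by (smt (verit) powr_less_mono2)
    qed
    show ?thesis using 1 2 unfolding m_def A_def B_def by blast
  qed
  then show "s powr (p - 1) * t \<le> (1 - 1/p) * s powr p + 1/p * t powr p"
    "s powr (p - 1) * t = (1 - 1/p) * s powr p + 1/p * t powr p \<Longrightarrow> s = t" by auto
qed

text \<open>The gap \<open>?T\<close> in the pointwise Young inequality is nonnegative and has
  nonpositive integral, so it is 0 almost everywhere. Equality in Young's inequality gives equal
  absolute values, and the positive product gives equal signs.\<close>

lemma Holder_equality:
  fixes w v :: "'m \<Rightarrow> real"
  assumes p: "p > 1" and w: "w \<in> Lp_fun p M" and v: "v \<in> Lp_fun p M"
    and 1: "pint p M w = 1" "pint p M v = 1" and ge: "(LINT x|M. flux p (w x) * v x) \<ge> 1"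
  shows "AE x in M. w x = v x"
proof -
  let ?T = "\<lambda>x. (1 - 1/p) * norm (w x) powr p + 1/p * norm (v x) powr p - flux p (w x) * v x"
  have i: "integrable M (\<lambda>x. flux p (w x) * v x)"
    using Holder_inner(1)[OF p v flux_Lp(1)[OF p w]] by simp
  have le: "flux p a * b \<le> \<bar>a\<bar> powr (p - 1) * \<bar>b\<bar>" for a b
    using abs_ge_self[of "flux p a * b"] norm_flux[of p a] by (simp add: abs_mult)
  have T0: "?T x \<ge> 0" for x
    using le[of "w x" "v x"] Young_inequality(1)[OF p, of "\<bar>w x\<bar>" "\<bar>v x\<bar>"] by auto
  have iT: "integrable M ?T" using i Lp_fun_integrable[OF w] Lp_fun_integrable[OF v] by auto
  have "integral\<^sup>L M ?T = (1 - 1/p) * pint p M w + 1/p * pint p M v - (LINT x|M. flux p (w x) * v x)"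
    using i Lp_fun_integrable[OF w] Lp_fun_integrable[OF v] by (simp add: pint_def)
  then have "integral\<^sup>L M ?T \<le> 0" using ge by (simp add: 1)
  then have "integral\<^sup>L M ?T = 0" using T0 by (simp add: order.antisym)
  then have "AE x in M. ?T x = 0" using integral_nonneg_eq_0_iff_AE[OF iT] T0 by simp
  then show ?thesis
  proof eventually_elim
    case (elim x)
    have e: "\<bar>w x\<bar> = \<bar>v x\<bar>" "flux p (w x) * v x = \<bar>w x\<bar> powr (p - 1) * \<bar>v x\<bar>"
      using elim le[of "w x" "v x"] Young_inequality[OF p, of "\<bar>w x\<bar>" "\<bar>v x\<bar>"] by auto
    show ?case
    proof (cases "w x = 0")
      case False
      have "flux p (w x) * v x > 0" using e False by simp
      then have "w x * v x > 0" using False by (auto simp: flux_def zero_less_mult_iff mult_less_0_iff)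
      then show ?thesis using e(1) by (auto simp: zero_less_mult_iff abs_if split: if_splits)
    qed (use e in auto)
  qed
qed

subsection \<open>Test functions\<close>

lemma C_k_SucI:
  fixes f :: "'a::euclidean_space \<Rightarrow> real"
  assumes "\<And>x. (f has_derivative D x) (at x)" "\<And>b. b \<in> Basis \<Longrightarrow> C_k k (\<lambda>x. D x b)"
  shows "C_k (Suc k) f"
proof -
  have "frechet_derivative f (at x) = D x" for x
    using frechet_derivative_at[OF assms(1)] by simp
  then show ?thesis using assms by (auto simp: differentiable_def)
qed

lemma C_k_has_derivative:
  "C_k (Suc k) f \<Longrightarrow> (f has_derivative frechet_derivative f (at x)) (at x)"
  using frechet_derivative_works by auto

lemma C_k_SucD: "C_k (Suc k) f \<Longrightarrow> b \<in> Basis \<Longrightarrow> C_k k (\<lambda>x. frechet_derivative f (at x) b)"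
  by simp

lemma C_k_mono: "C_k (Suc k) f \<Longrightarrow> C_k k f"
proof (induction k arbitrary: f)
  case 0
  then show ?case by (auto simp: continuous_on_eq_continuous_at differentiable_imp_continuous_within)
next
  case (Suc k)
  then show ?case by (metis C_k.simps(2))
qed

lemma C_k_continuous: "C_k k f \<Longrightarrow> continuous_on UNIV f"
  by (induction k) (use C_k_mono in \<open>auto simp del: C_k.simps(2)\<close>)

lemma C_k_const: "C_k k (\<lambda>x. c)"
proof (induction k arbitrary: c)
  case (Suc k)
  show ?case by (rule C_k_SucI[where D = "\<lambda>x h. 0"]) (use Suc in auto)
qed simp

lemma C_k_inner: "C_k k (\<lambda>x. x \<bullet> b)"
proof (cases k)
  case (Suc j)
  show ?thesis unfolding Suc
    by (rule C_k_SucI[where D = "\<lambda>x h. h \<bullet> b"]) (auto intro!: C_k_const derivative_eq_intros)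
qed (auto intro!: continuous_intros)

lemma C_k_add: "C_k k f \<Longrightarrow> C_k k g \<Longrightarrow> C_k k (\<lambda>x. f x + g x)"
proof (induction k arbitrary: f g)
  case 0
  then show ?case by (auto intro: continuous_intros)
next
  case (Suc k)
  show ?case
    by (rule C_k_SucI[OF has_derivative_add[OF Suc.prems(1)[THEN C_k_has_derivative] Suc.prems(2)[THEN C_k_has_derivative]]])
       (intro Suc.IH C_k_SucD Suc.prems)
qed

lemma C_k_mult: "C_k k f \<Longrightarrow> C_k k g \<Longrightarrow> C_k k (\<lambda>x. f x * g x)"
proof (induction k arbitrary: f g)
  case 0
  then show ?case by (auto intro: continuous_intros)
next
  case (Suc k)
  show ?case
    by (rule C_k_SucI[OF has_derivative_mult[OF Suc.prems(1)[THEN C_k_has_derivative] Suc.prems(2)[THEN C_k_has_derivative]]])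
       (intro Suc.IH C_k_add C_k_SucD Suc.prems C_k_mono[OF Suc.prems(1)] C_k_mono[OF Suc.prems(2)])
qed

lemma C_k_powr:
  assumes "C_k k f" "\<And>x. f x > 0"
  shows "C_k k (\<lambda>x. f x powr q)"
  using assms(1)
proof (induction k arbitrary: q)
  case 0
  then show ?case using assms(2) by (auto intro!: continuous_on_powr continuous_intros simp: less_imp_neq[symmetric])
next
  case (Suc k)
  show ?case
  proof (rule C_k_SucI)
    show "((\<lambda>x. f x powr q) has_derivative (\<lambda>h. (q * f x powr (q - 1)) * frechet_derivative f (at x) h)) (at x)" for x
    proof -
      have "((\<lambda>t. t powr q) has_real_derivative q * f x powr (q - 1)) (at (f x))"
        using assms(2) by (rule has_real_derivative_powr)
      from has_derivative_compose[OF C_k_has_derivative[OF Suc.prems, of x] this[unfolded has_field_derivative_def]]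
      show ?thesis by (simp add: mult.commute)
    qed
    show "C_k k (\<lambda>x. (q * f x powr (q - 1)) * frechet_derivative f (at x) b)" if "b \<in> Basis" for b
      by (intro C_k_mult C_k_const Suc.IH C_k_mono[OF Suc.prems] C_k_SucD[OF Suc.prems that])
  qed
qed

text \<open>The factor \<open>inverse t ^ n\<close> makes the family closed under differentiation,
  so that smoothness of all its members follows by one induction.\<close>

definition expinv :: "nat \<Rightarrow> real \<Rightarrow> real" where
  "expinv n t = (if t \<le> 0 then 0 else exp (- inverse t) * inverse t ^ n)"

lemma expinv_lim: "((\<lambda>t. expinv n t) \<longlongrightarrow> 0) (at_right 0)"
proof -
  have 1: "((\<lambda>x::real. exp (-x) * x ^ n) \<longlongrightarrow> 0) at_top"
    using tendsto_power_div_exp_0[of n] by (simp add: exp_minus divide_inverse mult.commute)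
  have 2: "((\<lambda>t::real. exp (- inverse t) * inverse t ^ n) \<longlongrightarrow> 0) (at_right 0)"
    using filterlim_compose[OF 1 filterlim_inverse_at_top_right] .
  have 3: "\<forall>\<^sub>F t in at_right 0. exp (- inverse t) * inverse t ^ n = expinv n t"
    by (auto simp: expinv_def eventually_at_filter)
  show ?thesis by (rule Lim_transform_eventually[OF 2 3])
qed

lemma expinv_deriv: "(expinv n has_real_derivative (- real n * expinv (Suc n) t + expinv (n + 2) t)) (at t)"
proof -
  consider "t < 0" | "t = 0" | "t > 0" by linarith
  then show ?thesis
  proof cases
    case 1
    have "((\<lambda>_. 0) has_real_derivative 0) (at t)" by simp
    then have "(expinv n has_real_derivative 0) (at t)"
      by (rule has_field_derivative_transform_within_open[of _ _ _ "{..<0}"]) (use 1 in \<open>auto simp: expinv_def\<close>)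
    then show ?thesis using 1 by (simp add: expinv_def)
  next
    case 3
    have t: "t \<noteq> 0" using 3 by simp
    have 1: "((\<lambda>t. exp (- inverse t)) has_real_derivative exp (- inverse t) * (inverse t * inverse t)) (at t)"
      using DERIV_chain'[OF DERIV_minus[OF DERIV_inverse[OF t]] DERIV_exp] by (simp add: power2_eq_square mult.commute)
    have 2: "((\<lambda>t. inverse t ^ n) has_real_derivative - real n * inverse t ^ Suc n) (at t)"
    proof (cases n)
      case (Suc m)
      show ?thesis
        by (rule DERIV_cong[OF DERIV_power[OF DERIV_inverse[OF t], of n]]) (simp add: Suc algebra_simps)
    qed simp
    have "((\<lambda>t. exp (- inverse t) * inverse t ^ n) has_real_derivative (- real n * expinv (Suc n) t + expinv (n + 2) t)) (at t)"
      by (rule DERIV_cong[OF DERIV_mult[OF 1 2]]) (use 3 in \<open>simp add: expinv_def algebra_simps\<close>)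
    then show ?thesis
      by (rule has_field_derivative_transform_within_open[of _ _ _ "{0<..}"]) (use 3 in \<open>auto simp: expinv_def\<close>)
  next
    case 2
    \<comment> \<open>The right difference quotient at 0 is the next member of the family, which
      tends to 0.\<close>
    have 1: "\<forall>\<^sub>F h in at_right 0. expinv (Suc n) h = expinv n h / h"
      by (auto simp: eventually_at_filter expinv_def divide_inverse)
    have "((\<lambda>h. expinv n h / h) \<longlongrightarrow> 0) (at_right 0)"
      by (rule Lim_transform_eventually[OF expinv_lim 1])
    moreover have 2: "\<forall>\<^sub>F h in at_left 0. 0 = expinv n h / h"
      by (auto simp: eventually_at_filter expinv_def)
    have "((\<lambda>h. expinv n h / h) \<longlongrightarrow> 0) (at_left 0)"
      by (rule Lim_transform_eventually[OF tendsto_const 2])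
    ultimately have "((\<lambda>h. expinv n h / h) \<longlongrightarrow> 0) (at 0)" by (simp add: filterlim_split_at)
    then have "(expinv n has_real_derivative 0) (at 0)"
      by (simp add: DERIV_def expinv_def)
    then show ?thesis using \<open>t = 0\<close> by (simp add: expinv_def)
  qed
qed

lemma C_k_expinv:
  assumes "C_k k f"
  shows "C_k k (\<lambda>x. expinv n (f x))"
  using assms
proof (induction k arbitrary: n)
  case 0
  have "continuous_on UNIV (expinv n)"
    using DERIV_isCont[OF expinv_deriv] by (simp add: continuous_on_eq_continuous_at)
  from continuous_on_compose2[OF this] 0 show ?case by simp
next
  case (Suc k)
  show ?case
  proof (rule C_k_SucI)
    show "((\<lambda>x. expinv n (f x)) has_derivative (\<lambda>h. (- real n * expinv (Suc n) (f x) + expinv (n + 2) (f x)) * frechet_derivative f (at x) h)) (at x)" for x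
      using has_derivative_compose[OF C_k_has_derivative[OF Suc.prems, of x] expinv_deriv[unfolded has_field_derivative_def]]
      by (simp add: mult.commute)
    show "C_k k (\<lambda>x. (- real n * expinv (Suc n) (f x) + expinv (n + 2) (f x)) * frechet_derivative f (at x) b)" if "b \<in> Basis" for b
      by (intro C_k_mult C_k_add C_k_const Suc.IH C_k_mono[OF Suc.prems] C_k_SucD[OF Suc.prems that])
  qed
qed

lemma C_k_cmult: "C_k k f \<Longrightarrow> C_k k (\<lambda>x. c * f x)"
  by (intro C_k_mult C_k_const)

lemma C_k_power: "C_k k f \<Longrightarrow> C_k k (\<lambda>x. f x ^ n)"
  by (induction n) (auto intro: C_k_const C_k_mult)

text \<open>The squared distance, unlike the distance, is smooth at the centre.\<close>

definition bump :: "'a::euclidean_space \<Rightarrow> real \<Rightarrow> 'a \<Rightarrow> real" where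
  "bump c r x = expinv 0 (r\<^sup>2 - (x - c) \<bullet> (x - c))"

lemma C_k_bump: "C_k k (bump c r)"
proof -
  have "C_k k (\<lambda>x. r\<^sup>2 - (x - c) \<bullet> (x - c))" for k
  proof (cases k)
    case (Suc j)
    show ?thesis unfolding Suc
    proof (rule C_k_SucI)
      show "((\<lambda>x. r\<^sup>2 - (x - c) \<bullet> (x - c)) has_derivative (\<lambda>h. (-2) * (x \<bullet> h + (- c \<bullet> h)))) (at x)" for x
        by (auto intro!: derivative_eq_intros simp: inner_commute algebra_simps)
      show "C_k j (\<lambda>x. (-2) * (x \<bullet> b + (- c \<bullet> b)))" for b
        by (intro C_k_mult C_k_const C_k_add C_k_inner)
    qed
  qed (auto intro!: continuous_intros)
  then show ?thesis unfolding bump_def by (rule C_k_expinv)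
qed

lemma expinv_bounds: "0 \<le> expinv 0 t" "expinv 0 t \<le> 1" "expinv 0 t > 0 \<longleftrightarrow> t > 0" "expinv 0 t \<noteq> 0 \<longleftrightarrow> t > 0"
  by (auto simp: expinv_def)

lemma bump_pos_iff: "r > 0 \<Longrightarrow> bump c r x \<noteq> 0 \<longleftrightarrow> x \<in> ball c r" "r > 0 \<Longrightarrow> bump c r x > 0 \<longleftrightarrow> x \<in> ball c r"
  using power2_less_imp_less[of "norm (x - c)" r] power_strict_mono[of "norm (x - c)" r 2]
  by (auto simp: bump_def expinv_bounds dist_norm norm_minus_commute power2_norm_eq_inner[symmetric])

lemma bump_bounds: "0 \<le> bump c r x" "bump c r x \<le> 1"
  by (auto simp: bump_def expinv_bounds)

text \<open>Any compact set outside which \<open>f\<close> vanishes may stand for the support, so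
  that sums, products and compositions need no closures.\<close>

lemma test_functionI:
  assumes "\<And>k. C_k k f" "compact K" "K \<subseteq> \<Omega>" "\<And>x. x \<notin> K \<Longrightarrow> f x = 0"
  shows "f \<in> test_functions \<Omega>"
proof -
  have "closure {x. f x \<noteq> 0} \<subseteq> K"
    using assms by (intro closure_minimal compact_imp_closed) auto
  moreover have "compact (closure {x. f x \<noteq> 0})"
    using calculation assms(2) by (metis closed_closure compact_Int_closed inf.absorb_iff2)
  ultimately show ?thesis using assms by (auto simp: test_functions_def)
qed

lemma test_functionE:
  assumes "f \<in> test_functions \<Omega>"
  obtains K where "\<And>k. C_k k f" "compact K" "K \<subseteq> \<Omega>" "\<And>x. x \<notin> K \<Longrightarrow> f x = 0"
proof (rule that[of "closure {x. f x \<noteq> 0}"])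
  show "x \<notin> closure {x. f x \<noteq> 0} \<Longrightarrow> f x = 0" for x using closure_subset[of "{x. f x \<noteq> 0}"] by auto
qed (use assms in \<open>auto simp: test_functions_def\<close>)

lemma test_smooth: "f \<in> test_functions \<Omega> \<Longrightarrow> C_k k f"
  by (simp add: test_functions_def)

lemma test_sub:
  assumes "f \<in> test_functions \<Omega>" "\<And>k. C_k k g" "\<And>x. f x = 0 \<Longrightarrow> g x = 0"
  shows "g \<in> test_functions \<Omega>"
proof -
  obtain K where "\<And>k. C_k k f" "compact K" "K \<subseteq> \<Omega>" "\<And>x. x \<notin> K \<Longrightarrow> f x = 0" using test_functionE[OF assms(1)] by blast
  then show ?thesis using assms by (intro test_functionI[of g K]) auto
qed

lemma test_add:
  assumes "f \<in> test_functions \<Omega>" "g \<in> test_functions \<Omega>"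
  shows "(\<lambda>x. f x + g x) \<in> test_functions \<Omega>"
proof -
  obtain K where K: "\<And>k. C_k k f" "compact K" "K \<subseteq> \<Omega>" "\<And>x. x \<notin> K \<Longrightarrow> f x = 0" using test_functionE[OF assms(1)] by blast
  obtain L where L: "\<And>k. C_k k g" "compact L" "L \<subseteq> \<Omega>" "\<And>x. x \<notin> L \<Longrightarrow> g x = 0" using test_functionE[OF assms(2)] by blast
  show ?thesis by (rule test_functionI[of _ "K \<union> L"]) (use K L in \<open>auto intro: C_k_add\<close>)
qed

lemma test_mult:
  assumes "f \<in> test_functions \<Omega>" "\<And>k. C_k k g"
  shows "(\<lambda>x. f x * g x) \<in> test_functions \<Omega>"
  by (rule test_sub[OF assms(1) C_k_mult[OF test_smooth[OF assms(1)] assms(2)]]) simp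

lemma test_cmult: "f \<in> test_functions \<Omega> \<Longrightarrow> (\<lambda>x. c * f x) \<in> test_functions \<Omega>"
  using test_mult[of f \<Omega> "\<lambda>_. c", OF _ C_k_const] by (simp add: mult.commute)

lemma test_bump:
  assumes "r > 0" "cball c r \<subseteq> \<Omega>"
  shows "bump c r \<in> test_functions \<Omega>"
proof (rule test_functionI[OF C_k_bump compact_cball assms(2)])
  fix x assume "x \<notin> cball c r"
  then have "x \<notin> ball c r" by auto
  then show "bump c r x = 0" using bump_pos_iff(1)[OF assms(1), of c x] by blast
qed

section \<open>Gradients of smooth functions\<close>

lemma smooth_grad:
  assumes "\<And>k. C_k k f"
  shows "(f has_derivative (\<lambda>h. classical_grad f x \<bullet> h)) (at x)"
proof -
  have d: "(f has_derivative frechet_derivative f (at x)) (at x)"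
    using assms[of "Suc 0"] by (rule C_k_has_derivative)
  then interpret bounded_linear "frechet_derivative f (at x)" by (rule has_derivative_bounded_linear)
  have "frechet_derivative f (at x) h = classical_grad f x \<bullet> h" for h
  proof -
    have "frechet_derivative f (at x) h = frechet_derivative f (at x) (\<Sum>b\<in>Basis. (h \<bullet> b) *\<^sub>R b)"
      by (simp add: euclidean_representation)
    also have "\<dots> = (\<Sum>b\<in>Basis. (h \<bullet> b) * frechet_derivative f (at x) b)"
      by (simp add: sum scaleR)
    finally show ?thesis
      by (simp add: classical_grad_def inner_sum_left inner_sum_right inner_commute mult.commute)
  qed
  then have "frechet_derivative f (at x) = (\<lambda>h. classical_grad f x \<bullet> h)" by auto
  with d show ?thesis by simp
qed

lemma classical_grad_eqI:
  assumes "(f has_derivative (\<lambda>h. G \<bullet> h)) (at x)"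
  shows "classical_grad f x = G"
proof -
  have "frechet_derivative f (at x) = (\<lambda>h. G \<bullet> h)"
    using frechet_derivative_at[OF assms] by simp
  then show ?thesis by (simp add: classical_grad_def euclidean_representation)
qed

lemma grad_comp:
  assumes "\<And>k. C_k k f" "(F has_real_derivative F') (at (f x))"
  shows "classical_grad (\<lambda>x. F (f x)) x = F' *\<^sub>R classical_grad f x"
  by (rule classical_grad_eqI)
     (use has_derivative_compose[OF smooth_grad[OF assms(1)] assms(2)[unfolded has_field_derivative_def]] in simp)

lemma grad_add:
  assumes "\<And>k. C_k k f" "\<And>k. C_k k g"
  shows "classical_grad (\<lambda>x. f x + g x) x = classical_grad f x + classical_grad g x"
  by (rule classical_grad_eqI)
     (use has_derivative_add[OF smooth_grad[OF assms(1)] smooth_grad[OF assms(2)]] in \<open>simp add: inner_add_left\<close>)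

lemma grad_mult:
  assumes "\<And>k. C_k k f" "\<And>k. C_k k g"
  shows "classical_grad (\<lambda>x. f x * g x) x = f x *\<^sub>R classical_grad g x + g x *\<^sub>R classical_grad f x"
  by (rule classical_grad_eqI)
     (use has_derivative_mult[OF smooth_grad[OF assms(1)] smooth_grad[OF assms(2)]] in \<open>simp add: inner_add_left mult.commute\<close>)

lemma grad_const: "classical_grad (\<lambda>x. c) x = 0"
  by (rule classical_grad_eqI) simp

lemma grad_cmult:
  assumes "\<And>k. C_k k f"
  shows "classical_grad (\<lambda>x. c * f x) x = c *\<^sub>R classical_grad f x"
  using grad_mult[OF C_k_const assms] by (simp add: grad_const)

lemma grad_continuous:
  assumes "\<And>k. C_k k f"
  shows "continuous_on UNIV (classical_grad f)"
  unfolding classical_grad_def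
  using C_k_SucD[OF assms[of "Suc 0"]]
  by (intro continuous_on_sum continuous_on_scaleR continuous_on_const) simp

lemma grad_zero_outside:
  assumes "\<And>k. C_k k f" "closed K" "\<And>x. x \<notin> K \<Longrightarrow> f x = 0" "x \<notin> K"
  shows "classical_grad f x = 0"
proof (rule classical_grad_eqI)
  have "((\<lambda>_. 0) has_derivative (\<lambda>h. 0 \<bullet> h)) (at x)" by simp
  then show "(f has_derivative (\<lambda>h. 0 \<bullet> h)) (at x)"
    by (rule has_derivative_transform_within_open[of _ _ _ _ "- K"]) (use assms in auto)
qed

section \<open>Integrals of test functions and integration by parts\<close>

lemma continuous_compact_support_bounded:
  fixes g :: "'a::euclidean_space \<Rightarrow> 'v::euclidean_space"
  assumes "continuous_on UNIV g" "compact K" "\<And>x. x \<notin> K \<Longrightarrow> g x = 0"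
  obtains B where "B > 0" "\<And>x. norm (g x) \<le> B"
proof -
  have "compact (g ` K)" by (rule compact_continuous_image[OF continuous_on_subset[OF assms(1)] assms(2)]) simp
  then obtain B where "B > 0" "\<forall>y\<in>g ` K. norm y \<le> B" using compact_imp_bounded bounded_pos by metis
  then have "norm (g x) \<le> B" for x using assms(3)[of x] by (cases "x \<in> K") auto
  with \<open>B > 0\<close> that show ?thesis by blast
qed

lemma continuous_compact_support_Lp_lborel:
  fixes g :: "'a::euclidean_space \<Rightarrow> 'v::euclidean_space"
  assumes "continuous_on UNIV g" "compact K" "\<And>x. x \<notin> K \<Longrightarrow> g x = 0" "p > 0"
  shows "g \<in> Lp_fun p lborel" "integrable lborel g"
proof -
  have [measurable]: "g \<in> borel_measurable borel" using assms(1) by (rule borel_measurable_continuous_onI)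
  obtain B where B: "B > 0" "\<And>x. norm (g x) \<le> B" using continuous_compact_support_bounded[OF assms(1-3)] by blast
  have K[measurable]: "K \<in> sets borel" using assms(2) by (simp add: borel_compact)
  have iK: "integrable lborel (\<lambda>x. c * indicat_real K x)" for c
    using emeasure_compact_finite[OF assms(2)] by (intro integrable_mult_right integrable_real_indicator) (auto simp: less_top)
  have "integrable lborel (\<lambda>x. norm (g x) powr p)"
    by (rule Bochner_Integration.integrable_bound[OF iK[of "B powr p"]])
       (use assms B in \<open>auto simp: indicator_def intro!: powr_mono2\<close>)
  then show "g \<in> Lp_fun p lborel" by (simp add: Lp_fun_def)
  show "integrable lborel g"
    by (rule Bochner_Integration.integrable_bound[OF iK[of B]])
       (use assms B in \<open>auto simp: indicator_def\<close>)
qed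

lemma borel_lebesgue_on: "g \<in> borel_measurable borel \<Longrightarrow> g \<in> borel_measurable (lebesgue_on \<Omega>)"
  by (intro measurable_restrict_space1 measurable_completion) simp

lemma integrable_lebesgue_on:
  fixes g :: "'a::euclidean_space \<Rightarrow> 'v::euclidean_space"
  assumes "integrable lborel g" "\<Omega> \<in> sets lebesgue"
  shows "integrable (lebesgue_on \<Omega>) g"
proof -
  have "integrable lebesgue g" using assms(1) by (simp add: integrable_completion)
  then have "integrable lebesgue (\<lambda>x. indicator \<Omega> x *\<^sub>R g x)" by (rule integrable_mult_indicator[OF assms(2)])
  then show ?thesis using assms(2) by (simp add: integrable_restrict_space)
qed

lemma Lp_lborel_on:
  assumes "g \<in> Lp_fun p lborel" "\<Omega> \<in> sets lebesgue"
  shows "g \<in> Lp_fun p (lebesgue_on \<Omega>)"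
proof -
  have "integrable (lebesgue_on \<Omega>) (\<lambda>x. norm (g x) powr p)"
    by (rule integrable_lebesgue_on[OF Lp_fun_integrable[OF assms(1)] assms(2)])
  moreover have "g \<in> borel_measurable borel" using Lp_fun_measurable[OF assms(1)] by simp
  ultimately show ?thesis unfolding Lp_fun_def using borel_lebesgue_on by blast
qed

lemma continuous_compact_support_Lp:
  fixes g :: "'a::euclidean_space \<Rightarrow> 'v::euclidean_space"
  assumes "continuous_on UNIV g" "compact K" "\<And>x. x \<notin> K \<Longrightarrow> g x = 0" "p > 0" "\<Omega> \<in> sets lebesgue"
  shows "g \<in> Lp_fun p (lebesgue_on \<Omega>)"
  using Lp_lborel_on[OF continuous_compact_support_Lp_lborel(1)[OF assms(1-4)] assms(5)] .

lemma integral_lebesgue_on_lborel: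
  fixes g :: "'a::euclidean_space \<Rightarrow> 'v::euclidean_space"
  assumes "g \<in> borel_measurable borel" "\<And>x. x \<notin> \<Omega> \<Longrightarrow> g x = 0" "\<Omega> \<in> sets lebesgue"
  shows "integral\<^sup>L (lebesgue_on \<Omega>) g = integral\<^sup>L lborel g"
proof -
  have "integral\<^sup>L (lebesgue_on \<Omega>) g = integral\<^sup>L lebesgue (\<lambda>x. indicator \<Omega> x *\<^sub>R g x)"
    using assms(3) by (subst integral_restrict_space) auto
  also have "(\<lambda>x. indicator \<Omega> x *\<^sub>R g x) = g" using assms(2) by (auto simp: indicator_def fun_eq_iff)
  also have "integral\<^sup>L lebesgue g = integral\<^sup>L lborel g" using assms(1) by (intro integral_completion) auto
  finally show ?thesis .
qed

lemma test_grad_zero: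
  assumes "\<And>k. C_k k f" "compact K" "\<And>x. x \<notin> K \<Longrightarrow> f x = 0" "x \<notin> K"
  shows "classical_grad f x = 0"
  using grad_zero_outside[OF assms(1) compact_imp_closed[OF assms(2)] assms(3,4)] .

lemma test_Lp:
  assumes "f \<in> test_functions \<Omega>" "p > 0" "S \<in> sets lebesgue"
  shows "f \<in> Lp_fun p (lebesgue_on S)" "classical_grad f \<in> Lp_fun p (lebesgue_on S)"
    "f \<in> Lp_fun p lborel" "classical_grad f \<in> Lp_fun p lborel"
proof -
  obtain K where K: "\<And>k. C_k k f" "compact K" "K \<subseteq> \<Omega>" "\<And>x. x \<notin> K \<Longrightarrow> f x = 0" using test_functionE[OF assms(1)] by blast
  have G: "classical_grad f x = 0" if "x \<notin> K" for x using test_grad_zero[OF K(1,2,4) that] .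
  note c = C_k_continuous[OF K(1)] grad_continuous[OF K(1)]
  show "f \<in> Lp_fun p (lebesgue_on S)" by (rule continuous_compact_support_Lp[OF c(1) K(2,4) assms(2,3)])
  show "classical_grad f \<in> Lp_fun p (lebesgue_on S)" by (rule continuous_compact_support_Lp[OF c(2) K(2) G assms(2,3)])
  show "f \<in> Lp_fun p lborel" by (rule continuous_compact_support_Lp_lborel(1)[OF c(1) K(2,4) assms(2)])
  show "classical_grad f \<in> Lp_fun p lborel" by (rule continuous_compact_support_Lp_lborel(1)[OF c(2) K(2) G assms(2)])
qed

lemma test_bounded:
  assumes "f \<in> test_functions \<Omega>"
  obtains B where "B > 0" "\<And>x. \<bar>f x\<bar> \<le> B" "\<And>x. norm (classical_grad f x) \<le> B"
proof -
  obtain K where K: "\<And>k. C_k k f" "compact K" "K \<subseteq> \<Omega>" "\<And>x. x \<notin> K \<Longrightarrow> f x = 0" using test_functionE[OF assms(1)] by blast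
  have G: "classical_grad f x = 0" if "x \<notin> K" for x using test_grad_zero[OF K(1,2,4) that] .
  note c = C_k_continuous[OF K(1)] grad_continuous[OF K(1)]
  obtain B1 where B1: "B1 > 0" "\<And>x. norm (f x) \<le> B1" using continuous_compact_support_bounded[OF c(1) K(2,4)] by blast
  obtain B2 where B2: "B2 > 0" "\<And>x. norm (classical_grad f x) \<le> B2" using continuous_compact_support_bounded[OF c(2) K(2) G] by blast
  show ?thesis
  proof (rule that[of "B1 + B2"])
    show "\<bar>f x\<bar> \<le> B1 + B2" "norm (classical_grad f x) \<le> B1 + B2" for x using B1(1) B2(1) B1(2)[of x] B2(2)[of x] by auto
  qed (use B1 B2 in simp)
qed

lemma test_mvt:
  assumes "\<And>k. C_k k f"
  shows "f (x + h) - f x = integral\<^sup>L lborel (\<lambda>t. indicator {0..1} t *\<^sub>R (classical_grad f (x + t *\<^sub>R h) \<bullet> h))"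
proof -
  have d: "((\<lambda>t. f (x + t *\<^sub>R h)) has_vector_derivative (classical_grad f (x + t *\<^sub>R h) \<bullet> h)) (at t within {0..1})" for t
  proof -
    have "((\<lambda>t. x + t *\<^sub>R h) has_derivative (\<lambda>s. s *\<^sub>R h)) (at t within {0..1})"
      by (auto intro!: derivative_eq_intros)
    from has_derivative_compose[OF this smooth_grad[OF assms, of "x + t *\<^sub>R h"]]
    show ?thesis by (simp add: has_vector_derivative_def)
  qed
  have c: "continuous_on {0..1} (\<lambda>t. classical_grad f (x + t *\<^sub>R h) \<bullet> h)"
    by (intro continuous_on_inner continuous_on_const continuous_on_compose2[OF grad_continuous[OF assms]] continuous_intros) auto
  have "(LBINT t. indicator {0..1} t *\<^sub>R (classical_grad f (x + t *\<^sub>R h) \<bullet> h)) = f (x + 1 *\<^sub>R h) - f (x + 0 *\<^sub>R h)"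
    by (rule integral_FTC_atLeastAtMost[of 0 1]) (use d c in auto)
  then show ?thesis by simp
qed

text \<open>Translation invariance gives the difference quotients in a fixed direction the integral
  0, and dominated convergence carries this over to the derivative.\<close>

lemma test_integral_grad_zero:
  assumes "f \<in> test_functions \<Omega>"
  shows "(LINT x|lborel. classical_grad f x) = 0"
proof -
  obtain K where K: "\<And>k. C_k k f" "compact K" "K \<subseteq> \<Omega>" "\<And>x. x \<notin> K \<Longrightarrow> f x = 0" using test_functionE[OF assms(1)] by blast
  have G: "classical_grad f x = 0" if "x \<notin> K" for x using test_grad_zero[OF K(1,2,4) that] .
  note c = C_k_continuous[OF K(1)] grad_continuous[OF K(1)]
  note [measurable] = borel_measurable_continuous_onI[OF c(1)] borel_measurable_continuous_onI[OF c(2)]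
  have if': "integrable lborel f" by (rule continuous_compact_support_Lp_lborel(2)[OF c(1) K(2,4), of 1]) auto
  have ig: "integrable lborel (classical_grad f)" by (rule continuous_compact_support_Lp_lborel(2)[OF c(2) K(2) G, of 1]) auto
  obtain B where B: "B > 0" "\<And>x. \<bar>f x\<bar> \<le> B" "\<And>x. norm (classical_grad f x) \<le> B" using test_bounded[OF assms] by blast
  have comp: "(LINT x|lborel. classical_grad f x \<bullet> b) = 0" if b: "b \<in> Basis" for b
  proof -
    define h where "h n = 1 / real (Suc n)" for n
    have h: "h n > 0" "h n \<le> 1" for n by (auto simp: h_def)
    have h0: "h \<longlonglongrightarrow> 0" unfolding h_def by (rule LIMSEQ_Suc[OF lim_const_over_n])
    define g where "g n x = (f (x + h n *\<^sub>R b) - f x) / h n" for n x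
    have shift: "integrable lborel (\<lambda>x. f (x + h n *\<^sub>R b))" "(LINT x|lborel. f (x + h n *\<^sub>R b)) = (LINT x|lborel. f x)" for n
    proof -
      have [measurable]: "(\<lambda>x. x + h n *\<^sub>R b) \<in> borel_measurable borel" by simp
      have D: "distr lborel borel (\<lambda>x. x + h n *\<^sub>R b) = (lborel :: 'a measure)"
        
      proof -
        have "(+) (h n *\<^sub>R b) = (\<lambda>x. x + h n *\<^sub>R b)" by (auto simp: fun_eq_iff)
        then show ?thesis using lborel_distr_plus[of "h n *\<^sub>R b"] by simp
      qed
      show "integrable lborel (\<lambda>x. f (x + h n *\<^sub>R b))"
        using if' integrable_distr_eq[of "\<lambda>x. x + h n *\<^sub>R b" lborel borel f] by (simp add: D)
      show "(LINT x|lborel. f (x + h n *\<^sub>R b)) = (LINT x|lborel. f x)"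
        using integral_distr[of "\<lambda>x. x + h n *\<^sub>R b" lborel borel f] by (simp add: D)
    qed
    have g0: "(LINT x|lborel. g n x) = 0" for n
      using shift if' by (simp add: g_def)
    define L where "L = {x + y | x y. x \<in> K \<and> y \<in> cball 0 (1::real)}"
    \<comment> \<open>Since \<open>h n\<close> is at most 1, this compact set contains the supports
      of all difference quotients and carries their common majorant.\<close>
    have L: "compact {x + y | x y. x \<in> K \<and> y \<in> cball (0::'a) 1}" using compact_sums[OF K(2) compact_cball] .
    have "(\<lambda>n. LINT x|lborel. g n x) \<longlonglongrightarrow> (LINT x|lborel. classical_grad f x \<bullet> b)"
    proof (rule integral_dominated_convergence)
      show "integrable lborel (\<lambda>x. B * indicat_real {x + y | x y. x \<in> K \<and> y \<in> cball (0::'a) 1} x)"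
        using emeasure_compact_finite[OF L] borel_compact[OF L]
        by (intro integrable_mult_right integrable_real_indicator) (auto simp: less_top)
      show "AE x in lborel. norm (g n x) \<le> B * indicat_real {x + y | x y. x \<in> K \<and> y \<in> cball (0::'a) 1} x" for n
      proof (rule AE_I2)
        fix x
        show "norm (g n x) \<le> B * indicat_real {x + y | x y. x \<in> K \<and> y \<in> cball (0::'a) 1} x"
        proof (cases "x \<in> {x + y | x y. x \<in> K \<and> y \<in> cball (0::'a) 1}")
          case False
          have "x \<notin> K" using False 
            using centre_in_cball[of "0::'a" 1] add_0_right[of x] by (metis (mono_tags, lifting) mem_Collect_eq zero_le_one)
          moreover have "x + h n *\<^sub>R b \<notin> K"
          proof
            assume a: "x + h n *\<^sub>R b \<in> K"
            have "x = (x + h n *\<^sub>R b) + (- h n *\<^sub>R b)" "- h n *\<^sub>R b \<in> cball 0 1"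
              using b h[of n] by (auto simp: norm_Basis)
            with a False show False by blast
          qed
          ultimately show ?thesis using K(4) B(1) by (simp add: g_def)
        next
          case True
          have "norm (f (x + h n *\<^sub>R b) - f x) \<le> B * norm ((x + h n *\<^sub>R b) - x)"
          proof (rule differentiable_bound[of UNIV f "\<lambda>x h. classical_grad f x \<bullet> h"])
            show "onorm (\<lambda>h. classical_grad f y \<bullet> h) \<le> B" for y
            proof (rule onorm_bound)
              show "norm (classical_grad f y \<bullet> h) \<le> B * norm h" for h
                using order_trans[OF Cauchy_Schwarz_ineq2 mult_right_mono[OF B(3) norm_ge_zero]] by simp
            qed (use B in simp)
          qed (use smooth_grad[OF K(1)] in auto)
          then show ?thesis using True h[of n] b by (simp add: g_def field_simps)
        qed
      qed
      show "AE x in lborel. (\<lambda>n. g n x) \<longlonglongrightarrow> classical_grad f x \<bullet> b"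
      proof (rule AE_I2)
        fix x
        have "((\<lambda>t. f (x + t *\<^sub>R b)) has_real_derivative (classical_grad f x \<bullet> b)) (at 0)"
        proof -
          have 1: "((\<lambda>t. x + t *\<^sub>R b) has_derivative (\<lambda>s. s *\<^sub>R b)) (at 0)"
            by (auto intro!: derivative_eq_intros)
          have 2: "(f has_derivative (\<lambda>h. classical_grad f x \<bullet> h)) (at (x + 0 *\<^sub>R b))" using smooth_grad[OF K(1)] by simp
          from has_derivative_compose[OF 1 2]
          show ?thesis by (simp add: has_field_derivative_def mult_commute_abs)
        qed
        then have "((\<lambda>t. (f (x + t *\<^sub>R b) - f x) / t) \<longlongrightarrow> classical_grad f x \<bullet> b) (at 0)"
          by (simp add: DERIV_def)
        moreover have "filterlim h (at 0) sequentially"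
          using h0 h by (auto simp: filterlim_at less_imp_neq[symmetric])
        ultimately show "(\<lambda>n. g n x) \<longlonglongrightarrow> classical_grad f x \<bullet> b"
          unfolding g_def by (rule filterlim_compose)
      qed
    qed (auto simp: g_def)
    then have "(\<lambda>n. 0) \<longlonglongrightarrow> (LINT x|lborel. classical_grad f x \<bullet> b)" by (simp add: g0)
    then show ?thesis using LIMSEQ_unique[OF tendsto_const] by metis
  qed
  have "(LINT x|lborel. classical_grad f x) \<bullet> b = 0" if "b \<in> Basis" for b
  proof -
    have "(LINT x|lborel. classical_grad f x \<bullet> b) = (LINT x|lborel. classical_grad f x) \<bullet> b"
      by (rule integral_inner_left) (rule ig)
    with comp[OF that] show ?thesis by linarith
  qed
  then show ?thesis by (simp only: euclidean_eqI[of _ 0] inner_zero_left)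
qed

lemma test_integration_by_parts_lborel:
  assumes "f \<in> test_functions \<Omega>" "g \<in> test_functions \<Omega>"
  shows "(LINT x|lborel. f x *\<^sub>R classical_grad g x) = - (LINT x|lborel. g x *\<^sub>R classical_grad f x)"
    "integrable lborel (\<lambda>x. f x *\<^sub>R classical_grad g x)"
proof -
  have I: "integrable lborel (\<lambda>x. f x *\<^sub>R classical_grad g x)" if fg: "f \<in> test_functions \<Omega>" "g \<in> test_functions \<Omega>" for f g
  proof -
    obtain K where K: "\<And>k. C_k k f" "compact K" "K \<subseteq> \<Omega>" "\<And>x. x \<notin> K \<Longrightarrow> f x = 0" using test_functionE[OF fg(1)] by blast
    show ?thesis
      by (rule continuous_compact_support_Lp_lborel(2)[OF _ K(2), of _ 1])
        (use K in \<open>auto intro!: continuous_on_scaleR C_k_continuous[OF K(1)] grad_continuous test_smooth[OF fg(2)]\<close>)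
  qed
  note sm = test_smooth[OF assms(1)] test_smooth[OF assms(2)]
  have "(LINT x|lborel. classical_grad (\<lambda>x. f x * g x) x) = 0"
    by (rule test_integral_grad_zero[OF test_mult[OF assms(1) sm(2)]])
  then have "(LINT x|lborel. f x *\<^sub>R classical_grad g x) + (LINT x|lborel. g x *\<^sub>R classical_grad f x) = 0"
    using I[OF assms] I[OF assms(2,1)] by (simp add: grad_mult[OF sm])
  then show "(LINT x|lborel. f x *\<^sub>R classical_grad g x) = - (LINT x|lborel. g x *\<^sub>R classical_grad f x)"
    by (simp add: eq_neg_iff_add_eq_0)
  show "integrable lborel (\<lambda>x. f x *\<^sub>R classical_grad g x)" by (rule I[OF assms])
qed

subsection \<open>The fundamental lemma of the calculus of variations\<close>

lemma sigma_finite_lebesgue: "sigma_finite_measure (lebesgue :: 'a::euclidean_space measure)"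
proof
  have "\<Union>(range (\<lambda>n::nat. cball (0::'a) (real n))) = UNIV"
    using real_arch_simple by auto
  moreover have "emeasure lebesgue (cball (0::'a) (real n)) \<noteq> \<infinity>" for n
    using emeasure_compact_finite[OF compact_cball[of "0::'a" "real n"]] by auto
  ultimately show "\<exists>A::'a set set. countable A \<and> A \<subseteq> sets lebesgue \<and> \<Union>A = space lebesgue \<and> (\<forall>a\<in>A. emeasure lebesgue a \<noteq> \<infinity>)"
    by (intro exI[of _ "range (\<lambda>n::nat. cball (0::'a) (real n))"]) auto
qed

text \<open>
  The sets where some smooth nonnegative function is positive form an intersection-stable generator of the Borel
  sets; so Dynkin's lemma applies and no mollification is needed.
\<close>

lemma fundamental_ball:
  fixes G :: "'a::euclidean_space \<Rightarrow> 'v::euclidean_space"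
  assumes r: "r > 0" and i: "set_integrable lebesgue (cball c r) G"
    and z: "\<And>f. f \<in> test_functions UNIV \<Longrightarrow> (\<And>x. x \<notin> cball c r \<Longrightarrow> f x = 0) \<Longrightarrow> (LINT x|lebesgue. f x *\<^sub>R G x) = 0"
  shows "AE x in lebesgue. x \<in> ball c r \<longrightarrow> G x = 0"
proof -
  define g where "g x = indicator (ball c r) x *\<^sub>R G x" for x
  have gi: "integrable lebesgue g"
  proof -
    have "integrable lebesgue (\<lambda>x. indicator (ball c r) x *\<^sub>R (indicator (cball c r) x *\<^sub>R G x))"
      using i unfolding set_integrable_def
      by (intro integrable_mult_indicator[of _ _ "\<lambda>x. indicator (cball c r) x *\<^sub>R G x"]) auto
    also have "(\<lambda>x. indicator (ball c r) x *\<^sub>R (indicator (cball c r) x *\<^sub>R G x)) = g"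
      by (auto simp: g_def indicator_def fun_eq_iff)
    finally show ?thesis .
  qed
  have [measurable]: "g \<in> borel_measurable lebesgue" using gi by auto
  define E :: "'a set set" where "E = {{x. f x > 0} | f. (\<forall>k. C_k k f) \<and> (\<forall>x. f x \<ge> 0)}"
  have EI: "Int_stable E"
  proof (rule Int_stableI)
    fix A B assume "A \<in> E" "B \<in> E"
    then obtain f h where f: "\<forall>k. C_k k f" "\<forall>x. f x \<ge> 0" "A = {x. f x > 0}" and h: "\<forall>k. C_k k h" "\<forall>x. h x \<ge> 0" "B = {x. h x > 0}"
      by (auto simp: E_def)
    have "f x * h x > 0 \<longleftrightarrow> f x > 0 \<and> h x > 0" "f x * h x \<ge> 0" for x
      using f(2)[rule_format, of x] h(2)[rule_format, of x] by (auto simp: zero_less_mult_iff)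
    moreover have "\<forall>k. C_k k (\<lambda>x. f x * h x)" using f(1) h(1) by (blast intro: C_k_mult)
    ultimately show "A \<inter> B \<in> E"
      unfolding E_def using f(3) h(3) by (intro CollectI exI[of _ "\<lambda>x. f x * h x"]) auto
  qed
  have Eb: "E \<subseteq> sets borel"
  proof
    fix A assume "A \<in> E"
    then obtain f where f: "\<forall>k. C_k k f" "A = {x. f x > 0}" by (auto simp: E_def)
    have [measurable]: "f \<in> borel_measurable borel" using f C_k_continuous borel_measurable_continuous_onI by blast
    show "A \<in> sets borel" unfolding f(2) by measurable
  qed
  have bE: "sets borel \<subseteq> sigma_sets UNIV E"
  proof -
    \<comment> \<open>Every open half-space is the positivity set of a smooth nonnegative function,
      so \<open>E\<close> generates the Borel sets.\<close>
    have "{x. x \<bullet> i < a} \<in> E" for a i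
    proof -
      have "C_k k (\<lambda>x. expinv 0 (a + - 1 * (x \<bullet> i)))" for k
        by (intro C_k_expinv C_k_add C_k_const C_k_cmult C_k_inner)
      then show ?thesis unfolding E_def
        by (intro CollectI exI[of _ "\<lambda>x. expinv 0 (a + - 1 * (x \<bullet> i))"]) (auto simp: expinv_bounds)
    qed
    then have "(\<lambda>(a, i). {x::'a. x \<bullet> i < a}) ` (UNIV \<times> Basis) \<subseteq> E" by auto
    then have "sigma_sets UNIV ((\<lambda>(a, i). {x::'a. x \<bullet> i < a}) ` (UNIV \<times> Basis)) \<subseteq> sigma_sets UNIV E"
      by (rule sigma_sets_mono')
    then show ?thesis by (subst borel_eq_halfspace_less) simp
  qed
  have base: "set_lebesgue_integral lebesgue A g = 0" if "A \<in> E" for A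
  proof -
    obtain f where f: "\<And>k. C_k k f" "\<And>x. f x \<ge> 0" "A = {x. f x > 0}" using \<open>A \<in> E\<close> by (auto simp: E_def)
    define h where "h x = f x * bump c r x" for x
    have hs: "C_k k h" for k unfolding h_def by (intro C_k_mult f C_k_bump)
    have h0: "h x \<ge> 0" for x unfolding h_def by (intro mult_nonneg_nonneg f bump_bounds)
    have hp: "h x > 0 \<longleftrightarrow> x \<in> A \<inter> ball c r" for x
      using f(2)[of x] bump_pos_iff[OF r, of c x] bump_bounds(1)[of c r x]
      by (auto simp: h_def f(3) zero_less_mult_iff)
    \<comment> \<open>The quotients h / (h + 1/(n+1)) are smooth, lie between 0 and 1 and tend to
      the indicator of the set where h is positive; the bump inside \<open>h\<close> confines them
      to the ball. The power -1 lets \<open>C_k_powr\<close> apply.\<close>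
    define e where "e n x = h x * (h x + inverse (real (Suc n))) powr (-1)" for n x
    have e_eq: "e n x = h x / (h x + inverse (real (Suc n)))" for n x
      using h0[of x] by (simp add: e_def powr_minus_divide add_nonneg_pos)
    have pos: "h x + inverse (real (Suc n)) > 0" for n x using h0[of x] by (simp add: add_nonneg_pos)
    have eb: "0 \<le> e n x" "e n x \<le> 1" for n x
      using h0[of x] pos[of x n] by (auto simp: e_eq)
    have hz: "h x = 0" if "x \<notin> ball c r" for x using hp[of x] h0[of x] that by auto
    have et: "e n \<in> test_functions UNIV" for n
    proof (rule test_functionI[OF _ compact_cball])
      show "C_k k (e n)" for k unfolding e_def
        by (intro C_k_mult C_k_powr C_k_add C_k_const hs pos)
      show "x \<notin> cball c r \<Longrightarrow> e n x = 0" for x using hz[of x] by (auto simp: e_eq)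
    qed auto
    have e0: "(LINT x|lebesgue. e n x *\<^sub>R G x) = 0" for n
      by (rule z[OF et]) (use hz in \<open>auto simp: e_eq\<close>)
    have elim: "(\<lambda>n. e n x) \<longlonglongrightarrow> indicator (A \<inter> ball c r) x" for x
    proof (cases "h x > 0")
      case True
      have "(\<lambda>n. h x / (h x + inverse (real (Suc n)))) \<longlonglongrightarrow> h x / (h x + 0)"
        using True by (intro tendsto_intros LIMSEQ_inverse_real_of_nat) auto
      then show ?thesis using True hp[of x] by (simp add: e_eq)
    next
      case False
      then have "h x = 0" using h0[of x] by simp
      moreover have "x \<notin> A \<inter> ball c r" using False hp[of x] by blast
      ultimately show ?thesis by (simp add: e_eq)
    qed
    have "(\<lambda>n. LINT x|lebesgue. e n x *\<^sub>R g x) \<longlonglongrightarrow> (LINT x|lebesgue. indicator A x *\<^sub>R g x)"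
    proof (rule integral_dominated_convergence)
      show "integrable lebesgue (\<lambda>x. norm (g x))" using gi by simp
      have A[measurable]: "A \<in> sets lebesgue" using Eb \<open>A \<in> E\<close> by auto
      show "(\<lambda>x. indicator A x *\<^sub>R g x) \<in> borel_measurable lebesgue" by measurable
      have "e n \<in> borel_measurable borel" for n using et test_smooth C_k_continuous borel_measurable_continuous_onI by blast
      then have [measurable]: "e n \<in> borel_measurable lebesgue" for n by (intro measurable_completion) simp
      show "(\<lambda>x. e n x *\<^sub>R g x) \<in> borel_measurable lebesgue" for n by measurable
      show "AE x in lebesgue. (\<lambda>n. e n x *\<^sub>R g x) \<longlonglongrightarrow> indicator A x *\<^sub>R g x"
      proof (rule AE_I2)
        fix x
        have "(\<lambda>n. e n x *\<^sub>R g x) \<longlonglongrightarrow> indicator (A \<inter> ball c r) x *\<^sub>R g x"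
          by (intro tendsto_intros elim)
        also have "indicator (A \<inter> ball c r) x *\<^sub>R g x = indicator A x *\<^sub>R g x" by (auto simp: g_def indicator_def)
        finally show "(\<lambda>n. e n x *\<^sub>R g x) \<longlonglongrightarrow> indicator A x *\<^sub>R g x" .
      qed
      show "AE x in lebesgue. norm (e n x *\<^sub>R g x) \<le> norm (g x)" for n
        using eb by (intro AE_I2) (auto simp: mult_left_le_one_le)
    qed
    moreover have "(\<lambda>x. e n x *\<^sub>R g x) = (\<lambda>x. e n x *\<^sub>R G x)" for n
      using hz by (auto simp: g_def e_eq indicator_def fun_eq_iff)
    ultimately have "(\<lambda>n. 0) \<longlonglongrightarrow> (LINT x|lebesgue. indicator A x *\<^sub>R g x)" using e0 by simp
    then show ?thesis unfolding set_lebesgue_integral_def using LIMSEQ_unique[OF tendsto_const] by metis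
  qed
  have UE: "UNIV \<in> E" unfolding E_def
    by (intro CollectI exI[of _ "\<lambda>_. 1"]) (auto intro: C_k_const)
  have bor: "A \<in> sets borel \<and> set_lebesgue_integral lebesgue A g = 0" if "A \<in> sigma_sets UNIV E" for A
    using EI subset_UNIV[of E, folded Pow_UNIV] that
  proof (induction rule: sigma_sets_induct_disjoint)
    case (basic A)
    then show ?case using base Eb by auto
  next
    case empty
    then show ?case by (simp add: set_lebesgue_integral_def)
  next
    case (compl A)
    have "set_lebesgue_integral lebesgue (A \<union> (UNIV - A)) g = set_lebesgue_integral lebesgue A g + set_lebesgue_integral lebesgue (UNIV - A) g"
      using compl gi by (intro set_integral_Un) (auto simp: set_integrable_def intro!: integrable_mult_indicator)
    moreover have "A \<union> (UNIV - A) = UNIV" by auto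
    ultimately show ?case using compl base[OF UE] by auto
  next
    case (union A)
    have d: "A i \<inter> A j = {}" if "i \<noteq> j" for i j using union(1) that by (auto simp: disjoint_family_on_def)
    have m: "A i \<in> sets lebesgue" for i using union(3)[of i] by auto
    have "set_lebesgue_integral lebesgue (\<Union>i. A i) g = (\<Sum>i. set_lebesgue_integral lebesgue (A i) g)"
      by (rule lebesgue_integral_countable_add[OF m d])
         (use m gi in \<open>auto simp: set_integrable_def intro!: integrable_mult_indicator\<close>)
    then show ?case using union(3) by auto
  qed
  \<comment> \<open>The density argument asks for all Lebesgue sets, while Dynkin's lemma has
    reached the Borel sets; the two differ by null sets.\<close>
  have "AE x in lebesgue. g x = 0"
  proof (rule sigma_finite_measure.density_zero[OF sigma_finite_lebesgue gi])
    fix A :: "'a set" assume "A \<in> sets lebesgue"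
    then obtain S N N' where S: "A = S \<union> N" "N \<subseteq> N'" "N' \<in> null_sets lborel" "S \<in> sets lborel"
      by (rule sets_completionE)
    have "AE x in lborel. x \<notin> N'" using S(3) by (rule AE_not_in)
    then have N: "AE x in lebesgue. x \<notin> N'" by (rule AE_completion)
    have "set_lebesgue_integral lebesgue A g = set_lebesgue_integral lebesgue S g"
      unfolding set_lebesgue_integral_def
    proof (rule integral_cong_AE)
      have [measurable]: "S \<in> sets lebesgue" "A \<in> sets lebesgue" using S \<open>A \<in> sets lebesgue\<close> by auto
      show "(\<lambda>x. indicator A x *\<^sub>R g x) \<in> borel_measurable lebesgue" "(\<lambda>x. indicator S x *\<^sub>R g x) \<in> borel_measurable lebesgue" by measurable
      show "AE x in lebesgue. indicat_real A x *\<^sub>R g x = indicat_real S x *\<^sub>R g x"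
        using N by eventually_elim (use S in \<open>auto simp: indicator_def\<close>)
    qed
    also have "\<dots> = 0" using bor[of S] bE S(4) by auto
    finally show "set_lebesgue_integral lebesgue A g = 0" .
  qed
  then show ?thesis by eventually_elim (auto simp: g_def indicator_def split: if_splits)
qed

text \<open>By Lindelof's theorem countably many balls whose closures lie in \<Omega> cover it, so
  the exceptional sets unite to a null set.\<close>

lemma fundamental_lemma:
  fixes G :: "'a::euclidean_space \<Rightarrow> 'v::euclidean_space"
  assumes \<Omega>: "open \<Omega>" and i: "locally_integrable_on G \<Omega>"
    and z: "\<And>f. f \<in> test_functions \<Omega> \<Longrightarrow> (LINT x|lebesgue_on \<Omega>. f x *\<^sub>R G x) = 0"
  shows "AE x in lebesgue_on \<Omega>. G x = 0"
proof -
  have ball: "AE x in lebesgue. x \<in> ball c r \<longrightarrow> G x = 0" if r: "r > 0" "cball c r \<subseteq> \<Omega>" for c r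
  proof (rule fundamental_ball[OF r(1)])
    show "set_integrable lebesgue (cball c r) G" using i r by (auto simp: locally_integrable_on_def)
    fix f :: "'a \<Rightarrow> real" assume f: "f \<in> test_functions UNIV" "\<And>x. x \<notin> cball c r \<Longrightarrow> f x = 0"
    have "f \<in> test_functions \<Omega>" by (rule test_functionI[OF test_smooth[OF f(1)] compact_cball r(2) f(2)])
    then have "0 = (LINT x|lebesgue_on \<Omega>. f x *\<^sub>R G x)" using z by simp
    also have "\<dots> = (LINT x|lebesgue. indicator \<Omega> x *\<^sub>R (f x *\<^sub>R G x))"
      using \<Omega> by (subst integral_restrict_space) auto
    also have "(\<lambda>x. indicator \<Omega> x *\<^sub>R (f x *\<^sub>R G x)) = (\<lambda>x. f x *\<^sub>R G x)"
    proof -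
      have "f x = 0" if "x \<notin> \<Omega>" for x using f(2)[of x] r(2) that by blast
      then show ?thesis by (auto simp: indicator_def fun_eq_iff)
    qed
    finally show "(LINT x|lebesgue. f x *\<^sub>R G x) = 0" by simp
  qed
  define F where "F = {ball c r | c r. r > 0 \<and> cball c r \<subseteq> \<Omega>}"
  have UF: "\<Union>F = \<Omega>"
  proof
    show "\<Union>F \<subseteq> \<Omega>" using ball_subset_cball by (force simp: F_def)
    show "\<Omega> \<subseteq> \<Union>F"
    proof
      fix x assume "x \<in> \<Omega>"
      then obtain r where "r > 0" "cball x r \<subseteq> \<Omega>" using \<Omega> open_contains_cball by blast
      then show "x \<in> \<Union>F" by (auto simp: F_def intro!: exI[of _ "ball x r"])
    qed
  qed
  have opF: "open S" if "S \<in> F" for S using that by (auto simp: F_def)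
  obtain F' where F': "F' \<subseteq> F" "countable F'" "\<Union>F' = \<Union>F"
    using Lindelof[OF opF] by blast
  have "AE x in lebesgue. \<forall>B\<in>F'. x \<in> B \<longrightarrow> G x = 0"
    using F'(2) by (subst AE_ball_countable) (use F'(1) ball in \<open>auto simp: F_def\<close>)
  then have "AE x in lebesgue. x \<in> \<Omega> \<longrightarrow> G x = 0"
    by eventually_elim (use F' UF in blast)
  then show ?thesis using \<Omega> by (simp add: AE_restrict_space_iff)
qed

subsection \<open>The Sobolev space\<close>

lemma Lp_nrm_mono:
  assumes "f \<in> borel_measurable M" "g \<in> Lp_fun p M" "p > 0" "AE x in M. norm (f x) \<le> norm (g x)"
  shows "Lp_nrm p M f \<le> Lp_nrm p M g"
  unfolding Lp_nrm_def using pint_mono[OF assms] assms(3) by (intro powr_mono2) auto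

lemma Lp_fun_bdd_mult:
  assumes "f \<in> Lp_fun p M" "p > 0" "b \<in> borel_measurable M" "AE x in M. \<bar>b x\<bar> \<le> B"
  shows "(\<lambda>x. b x *\<^sub>R f x) \<in> Lp_fun p M" "B \<ge> 0 \<Longrightarrow> Lp_nrm p M (\<lambda>x. b x *\<^sub>R f x) \<le> B * Lp_nrm p M f"
proof -
  note [measurable] = Lp_fun_measurable[OF assms(1)] assms(3)
  have m: "(\<lambda>x. b x *\<^sub>R f x) \<in> borel_measurable M" by measurable
  have L: "(\<lambda>x. B *\<^sub>R f x) \<in> Lp_fun p M" using assms(1) by (rule Lp_fun_scaleR)
  have le: "AE x in M. norm (b x *\<^sub>R f x) \<le> norm (B *\<^sub>R f x)"
    using assms(4) by eventually_elim (auto intro!: mult_right_mono)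
  show "(\<lambda>x. b x *\<^sub>R f x) \<in> Lp_fun p M" by (rule Lp_fun_dom[OF m L assms(2) le])
  show "B \<ge> 0 \<Longrightarrow> Lp_nrm p M (\<lambda>x. b x *\<^sub>R f x) \<le> B * Lp_nrm p M f"
    using Lp_nrm_mono[OF m L assms(2) le] assms(2) by (simp add: Lp_nrm_scaleR)
qed

lemma Lp_conv_bdd_mult:
  assumes p: "p > 1" and F: "Lp_conv p M F f" and b: "b \<in> borel_measurable M" "\<And>x. \<bar>b x\<bar> \<le> B"
  shows "Lp_conv p M (\<lambda>n x. b x *\<^sub>R F n x) (\<lambda>x. b x *\<^sub>R f x)"
proof (rule Lp_conv_sandwich)
  have p0: "p > 0" using p by simp
  have B: "B \<ge> 0" using b(2)[of undefined] by linarith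
  have bA: "AE x in M. \<bar>b x\<bar> \<le> B" using b(2) by simp
  show "(\<lambda>n. B * Lp_nrm p M (\<lambda>x. F n x - f x)) \<longlonglongrightarrow> 0"
    using tendsto_mult[OF tendsto_const Lp_convD(3)[OF F], of B] by simp
  show "(\<lambda>x. b x *\<^sub>R F n x) \<in> Lp_fun p M" for n by (rule Lp_fun_bdd_mult(1)[OF Lp_convD(1)[OF F] p0 b(1) bA])
  show "(\<lambda>x. b x *\<^sub>R f x) \<in> Lp_fun p M" by (rule Lp_fun_bdd_mult(1)[OF Lp_convD(2)[OF F] p0 b(1) bA])
  have "(\<lambda>x. F n x - f x) \<in> Lp_fun p M" for n by (rule Lp_fun_diff[OF Lp_convD(1,2)[OF F] p0])
  from Lp_fun_bdd_mult(2)[OF this p0 b(1) bA B]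
  show "\<forall>\<^sub>F n in sequentially. Lp_nrm p M (\<lambda>x. b x *\<^sub>R F n x - b x *\<^sub>R f x) \<le> B * Lp_nrm p M (\<lambda>x. F n x - f x)"
    by (simp add: scaleR_diff_right)
qed

lemma Lp_fun_cong_AE:
  assumes "f \<in> Lp_fun p M" "AE x in M. f x = g x" "g \<in> borel_measurable M" "p > 0"
  shows "g \<in> Lp_fun p M"
proof (rule Lp_fun_dom[OF assms(3,1,4)])
  show "AE x in M. norm (g x) \<le> norm (f x)" using assms(2) by eventually_elim simp
qed

lemma Lp_conv_cong_AE:
  assumes F: "Lp_conv p M F f" and "AE x in M. f x = g x" "g \<in> borel_measurable M" "p > 0"
  shows "Lp_conv p M F g"
proof -
  have g: "g \<in> Lp_fun p M" using Lp_fun_cong_AE[OF Lp_convD(2)[OF F] assms(2-4)] .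
  have "Lp_nrm p M (\<lambda>x. F n x - g x) = Lp_nrm p M (\<lambda>x. F n x - f x)" for n
  proof (rule Lp_nrm_cong_AE)
    show "AE x in M. norm (F n x - g x) = norm (F n x - f x)" using assms(2) by eventually_elim simp
  qed (use Lp_fun_measurable[OF Lp_convD(1)[OF F]] Lp_fun_measurable[OF Lp_convD(2)[OF F]] assms(3) in auto)
  then show ?thesis using F g by (simp add: Lp_conv_def)
qed

text \<open>Completeness of Lebesgue measure. It lets functions be replaced by almost everywhere
  equal ones without a separate measurability argument.\<close>

lemma borel_measurable_AE_lebesgue_on:
  fixes f g :: "'a::euclidean_space \<Rightarrow> 'v::euclidean_space"
  assumes "f \<in> borel_measurable (lebesgue_on S)" "AE x in lebesgue_on S. f x = g x" "S \<in> sets lebesgue"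
  shows "g \<in> borel_measurable (lebesgue_on S)"
proof -
  have "(\<lambda>x. indicator S x *\<^sub>R f x) \<in> borel_measurable lebesgue"
    using assms(1,3) by (subst (asm) borel_measurable_restrict_space_iff) auto
  moreover have "AE x in lebesgue. indicator S x *\<^sub>R f x = indicator S x *\<^sub>R g x"
  proof -
    have "AE x in lebesgue. x \<in> S \<longrightarrow> f x = g x" using assms(2,3) by (simp add: AE_restrict_space_iff)
    then show ?thesis by eventually_elim (auto simp: indicator_def)
  qed
  ultimately have "(\<lambda>x. indicator S x *\<^sub>R g x) \<in> borel_measurable lebesgue"
    by (rule borel_measurable_AE)
  then show ?thesis using assms(3) by (subst borel_measurable_restrict_space_iff) auto
qed

locale sobolev =
  fixes p :: real and \<Omega> :: "'a::euclidean_space set"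
  assumes p1: "1 < p" and op: "open \<Omega>" and fin: "emeasure lebesgue \<Omega> < \<infinity>"
begin

abbreviation M where "M \<equiv> lebesgue_on \<Omega>"
abbreviation q where "q \<equiv> p / (p - 1)"

lemma p0: "p > 0" using p1 by simp
lemma q1: "q > 1" using conjugate_exponent[OF p1] by simp
lemma q0: "q > 0" using q1 by simp
lemma Omega_sets: "\<Omega> \<in> sets lebesgue" using op by auto

lemma finM: "finite_measure M"
  by (rule finite_measureI) (use fin Omega_sets in \<open>simp add: emeasure_restrict_space\<close>)

lemma const_int: "integrable M (\<lambda>x. c :: real)"
proof -
  interpret finite_measure M by (rule finM)
  show ?thesis by simp
qed

text \<open>A nonnegative number is at most 1 plus its p-th power, and constants are integrable
  because \<Omega> has finite measure.\<close>

lemma Lp_int: 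
  fixes f :: "'a \<Rightarrow> 'v::euclidean_space"
  assumes "f \<in> Lp_fun p M" shows "integrable M f"
proof (rule Bochner_Integration.integrable_bound)
  show "integrable M (\<lambda>x. 1 + norm (f x) powr p)" 
    by (intro Bochner_Integration.integrable_add const_int Lp_fun_integrable assms)
  show "AE x in M. norm (f x) \<le> norm (1 + norm (f x) powr p)"
  proof (rule AE_I2)
    fix x
    show "norm (f x) \<le> norm (1 + norm (f x) powr p)"
    proof (cases "norm (f x) \<le> 1")
      case False
      then have "norm (f x) powr 1 \<le> norm (f x) powr p" using p1 by (intro powr_mono) auto
      then show ?thesis by simp
    qed (simp add: add_increasing2)
  qed
qed (rule Lp_fun_measurable[OF assms])

lemma Lp_loc_int:
  fixes f :: "'a \<Rightarrow> 'v::euclidean_space"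
  assumes "f \<in> Lp_fun p M" shows "locally_integrable_on f \<Omega>"
  unfolding locally_integrable_on_def set_integrable_def
proof (intro allI impI)
  fix K assume K: "compact K \<and> K \<subseteq> \<Omega>"
  have "integrable lebesgue (\<lambda>x. indicator \<Omega> x *\<^sub>R f x)"
    using Lp_int[OF assms] Omega_sets by (subst (asm) integrable_restrict_space) auto
  then have "integrable lebesgue (\<lambda>x. indicator K x *\<^sub>R (indicator \<Omega> x *\<^sub>R f x))"
    using K by (intro integrable_mult_indicator[of _ _ "\<lambda>x. indicator \<Omega> x *\<^sub>R f x"]) (auto dest: borel_compact)
  also have "(\<lambda>x. indicator K x *\<^sub>R (indicator \<Omega> x *\<^sub>R f x)) = (\<lambda>x. indicator K x *\<^sub>R f x)"
    using K by (auto simp: indicator_def fun_eq_iff)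
  finally show "integrable lebesgue (\<lambda>x. indicator K x *\<^sub>R f x)" .
qed

lemma Lp_space_eq: "Lp_space r \<Omega> = Lp_fun r M"
  by (simp add: Lp_space_def Lp_fun_def)

lemma Lp_norm_eq: "Lp_norm r \<Omega> f = Lp_nrm r M f"
  by (simp add: Lp_norm_def Lp_nrm_def pint_def)

lemma test_Lp': 
  assumes "f \<in> test_functions U" "r > 0"
  shows "f \<in> Lp_fun r M" "classical_grad f \<in> Lp_fun r M"
  using test_Lp[OF assms Omega_sets] by auto

lemma test_integration_by_parts:
  assumes "f \<in> test_functions \<Omega>" "g \<in> test_functions \<Omega>"
  shows "(LINT x|M. f x *\<^sub>R classical_grad g x) = - (LINT x|M. g x *\<^sub>R classical_grad f x)"
proof -
  have eq: "(LINT x|M. f x *\<^sub>R classical_grad g x) = (LINT x|lborel. f x *\<^sub>R classical_grad g x)"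
    if fg: "f \<in> test_functions \<Omega>" "g \<in> test_functions \<Omega>" for f g
  proof (rule integral_lebesgue_on_lborel[OF _ _ Omega_sets])
    obtain K where K: "\<And>k. C_k k f" "compact K" "K \<subseteq> \<Omega>" "\<And>x. x \<notin> K \<Longrightarrow> f x = 0" using test_functionE[OF fg(1)] by blast
    show "f x *\<^sub>R classical_grad g x = 0" if "x \<notin> \<Omega>" for x using K(3) K(4)[of x] that by auto
    show "(\<lambda>x. f x *\<^sub>R classical_grad g x) \<in> borel_measurable borel"
      using C_k_continuous[OF K(1)] grad_continuous[OF test_smooth[OF fg(2)]]
      by (intro borel_measurable_continuous_onI continuous_on_scaleR)
  qed
  show ?thesis unfolding eq[OF assms] eq[OF assms(2,1)] by (rule test_integration_by_parts_lborel(1)[OF assms])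
qed

text \<open>
  \<open>is_W0 u G\<close> says that \<open>u\<close> lies in \<open>W01p\<close> with weak gradient \<open>G\<close>. The set \<open>S\<close> restricts the values of the
  approximating test functions; \<open>S = {0..}\<close> lets one compose with functions that are smooth only near \<open>{0..}\<close>.
\<close>

definition is_W0S :: "real set \<Rightarrow> ('a \<Rightarrow> real) \<Rightarrow> ('a \<Rightarrow> 'a) \<Rightarrow> bool" where
  "is_W0S S u G \<longleftrightarrow> (\<exists>\<psi>. (\<forall>n. \<psi> n \<in> test_functions \<Omega>) \<and> (\<forall>n x. \<psi> n x \<in> S) \<and>
     Lp_conv p M \<psi> u \<and> Lp_conv p M (\<lambda>n. classical_grad (\<psi> n)) G)"

abbreviation is_W0 where "is_W0 \<equiv> is_W0S UNIV"

lemma is_W0SE: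
  assumes "is_W0S S u G"
  obtains \<psi> where "\<And>n. \<psi> n \<in> test_functions \<Omega>" "\<And>n x. \<psi> n x \<in> S" "Lp_conv p M \<psi> u" "Lp_conv p M (\<lambda>n. classical_grad (\<psi> n)) G"
  using assms unfolding is_W0S_def by blast

lemma is_W0E:
  assumes "is_W0S S u G"
  obtains \<psi> where "\<And>n. \<psi> n \<in> test_functions \<Omega>" "Lp_conv p M \<psi> u" "Lp_conv p M (\<lambda>n. classical_grad (\<psi> n)) G"
proof -
  from assms obtain \<psi> where \<psi>: "(\<forall>n. \<psi> n \<in> test_functions \<Omega>) \<and> (\<forall>n x. \<psi> n x \<in> S) \<and>
     Lp_conv p M \<psi> u \<and> Lp_conv p M (\<lambda>n. classical_grad (\<psi> n)) G" unfolding is_W0S_def ..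
  show ?thesis by (rule that[of \<psi>]) (use \<psi> in auto)
qed

lemma is_W0SI:
  assumes "\<And>n. \<psi> n \<in> test_functions \<Omega>" "\<And>n x. \<psi> n x \<in> S" "Lp_conv p M \<psi> u" "Lp_conv p M (\<lambda>n. classical_grad (\<psi> n)) G"
  shows "is_W0S S u G"
  using assms unfolding is_W0S_def by blast

lemma is_W0S_imp_is_W0: "is_W0S S u G \<Longrightarrow> is_W0 u G"
  unfolding is_W0S_def by blast

lemma is_W0_Lp: 
  assumes "is_W0S S u G"
  shows "u \<in> Lp_fun p M" "G \<in> Lp_fun p M"
  using assms Lp_convD(2) by (auto simp: is_W0S_def)

lemma is_W0_test: "f \<in> test_functions \<Omega> \<Longrightarrow> is_W0 f (classical_grad f)"
  by (rule is_W0SI[of "\<lambda>_. f"]) (auto intro!: Lp_conv_const test_Lp' p0)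

lemma is_W0_add:
  assumes "is_W0 u G" "is_W0 v H"
  shows "is_W0 (\<lambda>x. u x + v x) (\<lambda>x. G x + H x)"
proof -
  obtain \<psi> where \<psi>: "\<And>n. \<psi> n \<in> test_functions \<Omega>" "Lp_conv p M \<psi> u" "Lp_conv p M (\<lambda>n. classical_grad (\<psi> n)) G" using is_W0E[OF assms(1)] by blast
  obtain \<eta> where \<eta>: "\<And>n. \<eta> n \<in> test_functions \<Omega>" "Lp_conv p M \<eta> v" "Lp_conv p M (\<lambda>n. classical_grad (\<eta> n)) H" using is_W0E[OF assms(2)] by blast
  have "classical_grad (\<lambda>x. \<psi> n x + \<eta> n x) = (\<lambda>x. classical_grad (\<psi> n) x + classical_grad (\<eta> n) x)" for n
    by (rule ext, rule grad_add[OF test_smooth[OF \<psi>(1)] test_smooth[OF \<eta>(1)]])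
  note eq = this
  show ?thesis
  proof (rule is_W0SI[of "\<lambda>n x. \<psi> n x + \<eta> n x"])
    show "Lp_conv p M (\<lambda>n. classical_grad (\<lambda>x. \<psi> n x + \<eta> n x)) (\<lambda>x. G x + H x)"
      unfolding eq by (rule Lp_conv_add[OF p1 \<psi>(3) \<eta>(3)])
    show "Lp_conv p M (\<lambda>n x. \<psi> n x + \<eta> n x) (\<lambda>x. u x + v x)"
      by (rule Lp_conv_add[OF p1 \<psi>(2) \<eta>(2)])
  qed (simp_all add: test_add \<psi>(1) \<eta>(1))
qed

lemma is_W0_cmult:
  assumes "is_W0 u G"
  shows "is_W0 (\<lambda>x. c * u x) (\<lambda>x. c *\<^sub>R G x)"
proof -
  obtain \<psi> where \<psi>: "\<And>n. \<psi> n \<in> test_functions \<Omega>" "Lp_conv p M \<psi> u" "Lp_conv p M (\<lambda>n. classical_grad (\<psi> n)) G" using is_W0E[OF assms(1)] by blast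
  have "classical_grad (\<lambda>x. c * \<psi> n x) = (\<lambda>x. c *\<^sub>R classical_grad (\<psi> n) x)" for n
    by (rule ext, rule grad_cmult[OF test_smooth[OF \<psi>(1)]])
  note eq = this
  show ?thesis
  proof (rule is_W0SI[of "\<lambda>n x. c * \<psi> n x"])
    show "Lp_conv p M (\<lambda>n. classical_grad (\<lambda>x. c * \<psi> n x)) (\<lambda>x. c *\<^sub>R G x)"
      unfolding eq by (rule Lp_conv_scaleR[OF p1 \<psi>(3) tendsto_const])
    show "Lp_conv p M (\<lambda>n x. c * \<psi> n x) (\<lambda>x. c * u x)"
      by (rule Lp_conv_cmult[OF p1 \<psi>(2) tendsto_const])
  qed (simp_all add: test_cmult \<psi>(1))
qed

lemma is_W0_diff:
  assumes "is_W0 u G" "is_W0 v H"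
  shows "is_W0 (\<lambda>x. u x - v x) (\<lambda>x. G x - H x)"
  using is_W0_add[OF assms(1) is_W0_cmult[OF assms(2), of "-1"]] by simp

text \<open>Integration by parts holds for the approximating test functions and passes to the limit
  by Hoelder's inequality. This is done componentwise, because the pairing in
  \<open>Lp_pairing_tendsto\<close> is scalar.\<close>

lemma is_W0_weak:
  assumes "is_W0 u G"
  shows "has_weak_grad \<Omega> u G"
  unfolding has_weak_grad_def
proof (intro conjI ballI)
  show "locally_integrable_on u \<Omega>" "locally_integrable_on G \<Omega>" using is_W0_Lp[OF assms] Lp_loc_int by auto
  fix \<phi> assume \<phi>: "\<phi> \<in> test_functions \<Omega>"
  obtain \<psi> where \<psi>: "\<And>n. \<psi> n \<in> test_functions \<Omega>" "Lp_conv p M \<psi> u" "Lp_conv p M (\<lambda>n. classical_grad (\<psi> n)) G"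
    using is_W0E[OF assms(1)] by blast
  note L = is_W0_Lp[OF assms]
  note \<phi>L = test_Lp'[OF \<phi> q0]
  have I1: "integrable M (\<lambda>x. v x *\<^sub>R classical_grad \<phi> x)" if "v \<in> Lp_fun p M" for v
    by (rule Holder(1)[OF p1 that \<phi>L(2)]) (use Lp_fun_measurable[OF that] Lp_fun_measurable[OF \<phi>L(2)] in auto)
  have I2: "integrable M (\<lambda>x. \<phi> x *\<^sub>R H x)" if "H \<in> Lp_fun p M" for H :: "'a \<Rightarrow> 'a"
    by (rule Holder(1)[OF p1 that \<phi>L(1)]) (use Lp_fun_measurable[OF that] Lp_fun_measurable[OF \<phi>L(1)] in \<open>auto simp: mult.commute\<close>)
  have "(LINT x|M. u x *\<^sub>R classical_grad \<phi> x) \<bullet> b = (- (LINT x|M. \<phi> x *\<^sub>R G x)) \<bullet> b" if b: "b \<in> Basis" for b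
  proof -
    have g1: "(\<lambda>x. classical_grad \<phi> x \<bullet> b) \<in> Lp_fun q M"
      by (rule Lp_fun_dom[OF _ \<phi>L(2) q0]) (use Lp_fun_measurable[OF \<phi>L(2)] b in \<open>auto intro!: AE_I2 Basis_le_norm\<close>)
    have g2: "(\<lambda>x. \<phi> x *\<^sub>R b) \<in> Lp_fun q M"
      by (rule Lp_fun_dom[OF _ \<phi>L(1) q0]) (use Lp_fun_measurable[OF \<phi>L(1)] b in auto)
    have c1: "(\<lambda>n. LINT x|M. (classical_grad \<phi> x \<bullet> b) \<bullet> \<psi> n x) \<longlonglongrightarrow> (LINT x|M. (classical_grad \<phi> x \<bullet> b) \<bullet> u x)"
      by (rule Lp_pairing_tendsto[OF p1 \<psi>(2) Lp_conv_const[OF g1]])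
    have c2: "(\<lambda>n. LINT x|M. (\<phi> x *\<^sub>R b) \<bullet> classical_grad (\<psi> n) x) \<longlonglongrightarrow> (LINT x|M. (\<phi> x *\<^sub>R b) \<bullet> G x)"
      by (rule Lp_pairing_tendsto[OF p1 \<psi>(3) Lp_conv_const[OF g2]])
    have e1: "(LINT x|M. (classical_grad \<phi> x \<bullet> b) \<bullet> v x) = (LINT x|M. v x *\<^sub>R classical_grad \<phi> x) \<bullet> b" if "v \<in> Lp_fun p M" for v
    proof -
      have "(LINT x|M. (v x *\<^sub>R classical_grad \<phi> x) \<bullet> b) = (LINT x|M. v x *\<^sub>R classical_grad \<phi> x) \<bullet> b"
        by (rule integral_inner_left) (rule I1[OF that])
      then show ?thesis by (simp add: mult.commute)
    qed
    have e2: "(LINT x|M. (\<phi> x *\<^sub>R b) \<bullet> H x) = (LINT x|M. \<phi> x *\<^sub>R H x) \<bullet> b" if "H \<in> Lp_fun p M" for H :: "'a \<Rightarrow> 'a"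
    proof -
      have "(LINT x|M. (\<phi> x *\<^sub>R H x) \<bullet> b) = (LINT x|M. \<phi> x *\<^sub>R H x) \<bullet> b"
        by (rule integral_inner_left) (rule I2[OF that])
      then show ?thesis by (simp add: inner_commute)
    qed
    have "(LINT x|M. (classical_grad \<phi> x \<bullet> b) \<bullet> \<psi> n x) = - (LINT x|M. (\<phi> x *\<^sub>R b) \<bullet> classical_grad (\<psi> n) x)" for n
      unfolding e1[OF Lp_convD(1)[OF \<psi>(2)]] e2[OF Lp_convD(1)[OF \<psi>(3)]] test_integration_by_parts[OF \<psi>(1) \<phi>] by simp
    then have "(LINT x|M. (classical_grad \<phi> x \<bullet> b) \<bullet> u x) = - (LINT x|M. (\<phi> x *\<^sub>R b) \<bullet> G x)"
      using LIMSEQ_unique[OF c1] tendsto_minus[OF c2] by simp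
    then show ?thesis unfolding e1[OF L(1)] e2[OF L(2)] by simp
  qed
  then show "(LINT x|M. u x *\<^sub>R classical_grad \<phi> x) = - (LINT x|M. \<phi> x *\<^sub>R G x)"
    by (rule euclidean_eqI)
qed

text \<open>The difference of the two gradients is annihilated by all test functions. This makes the
  choice in \<open>weak_grad\<close> harmless, so that proofs can carry any representative of the
  gradient.\<close>

lemma weak_unique:
  assumes "has_weak_grad \<Omega> u G" "has_weak_grad \<Omega> v H" "AE x in M. u x = v x" "u \<in> borel_measurable M" "v \<in> borel_measurable M"
  shows "AE x in M. G x = H x"
proof -
  have GH: "locally_integrable_on G \<Omega>" "locally_integrable_on H \<Omega>" using assms by (auto simp: has_weak_grad_def)
  have I: "integrable M (\<lambda>x. f x *\<^sub>R G x)" if f: "f \<in> test_functions \<Omega>" and G: "locally_integrable_on G \<Omega>" for f and G :: "'a \<Rightarrow> 'a"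
  proof -
    obtain K where K: "\<And>k. C_k k f" "compact K" "K \<subseteq> \<Omega>" "\<And>x. x \<notin> K \<Longrightarrow> f x = 0" using test_functionE[OF f] by blast
    have k: "integrable lebesgue (\<lambda>x. indicator K x *\<^sub>R G x)"
      using G K by (auto simp: locally_integrable_on_def set_integrable_def)
    obtain B where B: "B > 0" "\<And>x. \<bar>f x\<bar> \<le> B" "\<And>x. norm (classical_grad f x) \<le> B" using test_bounded[OF f] by blast
    have [measurable]: "f \<in> borel_measurable lebesgue"
      using C_k_continuous[OF K(1)] by (intro measurable_completion) (simp add: borel_measurable_continuous_onI)
    have "integrable lebesgue (\<lambda>x. f x *\<^sub>R (indicator K x *\<^sub>R G x))"
    proof (rule Bochner_Integration.integrable_bound)
      show "integrable lebesgue (\<lambda>x. B * norm (indicator K x *\<^sub>R G x))" by (intro integrable_mult_right integrable_norm k)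
      show "AE x in lebesgue. norm (f x *\<^sub>R (indicator K x *\<^sub>R G x)) \<le> norm (B * norm (indicator K x *\<^sub>R G x))"
      proof (rule AE_I2)
        have "norm (f x *\<^sub>R v) \<le> norm (B * norm v)" for v :: 'a and x
          using mult_right_mono[OF B(2)[of x] norm_ge_zero[of v]] B(1) by (simp add: abs_mult)
        then show "norm (f x *\<^sub>R (indicator K x *\<^sub>R G x)) \<le> norm (B * norm (indicator K x *\<^sub>R G x))" for x .
      qed
    qed (use k in measurable)
    also have "(\<lambda>x. f x *\<^sub>R (indicator K x *\<^sub>R G x)) = (\<lambda>x. indicator \<Omega> x *\<^sub>R (f x *\<^sub>R G x))"
    proof
      show "f x *\<^sub>R (indicator K x *\<^sub>R G x) = indicator \<Omega> x *\<^sub>R (f x *\<^sub>R G x)" for x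
        using K(3) K(4)[of x] by (cases "x \<in> K") (auto simp: indicator_def)
    qed
    finally show ?thesis using Omega_sets by (simp add: integrable_restrict_space)
  qed
  have "AE x in M. G x - H x = 0"
  proof (rule fundamental_lemma[OF op])
    show "locally_integrable_on (\<lambda>x. G x - H x) \<Omega>"
      using GH by (auto simp: locally_integrable_on_def set_integrable_def scaleR_diff_right)
    fix f assume f: "f \<in> test_functions \<Omega>"
    have "(LINT x|M. f x *\<^sub>R (G x - H x)) = (LINT x|M. f x *\<^sub>R G x) - (LINT x|M. f x *\<^sub>R H x)"
      using I[OF f GH(1)] I[OF f GH(2)] by (simp add: scaleR_diff_right)
    also have "\<dots> = - (LINT x|M. u x *\<^sub>R classical_grad f x) + (LINT x|M. v x *\<^sub>R classical_grad f x)"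
      using assms f by (auto simp: has_weak_grad_def)
    also have "(LINT x|M. u x *\<^sub>R classical_grad f x) = (LINT x|M. v x *\<^sub>R classical_grad f x)"
    proof (rule integral_cong_AE)
      show "AE x in M. u x *\<^sub>R classical_grad f x = v x *\<^sub>R classical_grad f x"
        using assms(3) by eventually_elim simp
    qed (use assms(4,5) Lp_fun_measurable[OF test_Lp'(2)[OF f p0]] in auto)
    finally show "(LINT x|M. f x *\<^sub>R (G x - H x)) = 0" by simp
  qed
  then show ?thesis by eventually_elim simp
qed

lemma is_W0_unique:
  assumes "is_W0 u G" "is_W0 v H" "AE x in M. u x = v x"
  shows "AE x in M. G x = H x"
  using weak_unique[OF is_W0_weak[OF assms(1)] is_W0_weak[OF assms(2)] assms(3)]
    Lp_fun_measurable[OF is_W0_Lp(1)[OF assms(1)]] Lp_fun_measurable[OF is_W0_Lp(1)[OF assms(2)]] by simp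

lemma is_W0_cong:
  assumes W: "is_W0S S u G" and "AE x in M. u x = u' x" "AE x in M. G x = G' x"
  shows "is_W0S S u' G'"
proof -
  obtain \<psi> where \<psi>: "\<And>n. \<psi> n \<in> test_functions \<Omega>" "\<And>n x. \<psi> n x \<in> S" "Lp_conv p M \<psi> u" "Lp_conv p M (\<lambda>n. classical_grad (\<psi> n)) G" using is_W0SE[OF W] by blast
  have "u' \<in> borel_measurable M" "G' \<in> borel_measurable M"
    using borel_measurable_AE_lebesgue_on[OF Lp_fun_measurable[OF is_W0_Lp(1)[OF W]] assms(2) Omega_sets] borel_measurable_AE_lebesgue_on[OF Lp_fun_measurable[OF is_W0_Lp(2)[OF W]] assms(3) Omega_sets] by auto
  then show ?thesis
    using is_W0SI[OF \<psi>(1,2) Lp_conv_cong_AE[OF \<psi>(3) assms(2) _ p0] Lp_conv_cong_AE[OF \<psi>(4) assms(3) _ p0]] by blast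
qed

text \<open>Together with \<open>W01p_is_W0\<close> it translates between the given space and pairs
  of a function and a gradient. The limit of the test gradients is a weak gradient, hence almost
  everywhere the chosen one.\<close>

lemma is_W0_W01p:
  assumes W: "is_W0 u G"
  shows "u \<in> W01p p \<Omega>" "AE x in M. weak_grad \<Omega> u x = G x"
proof -
  have w: "has_weak_grad \<Omega> u (weak_grad \<Omega> u)"
    unfolding weak_grad_def by (rule someI[of "has_weak_grad \<Omega> u", OF is_W0_weak[OF W]])
  have ae: "AE x in M. G x = weak_grad \<Omega> u x"
    using weak_unique[OF is_W0_weak[OF W] w] Lp_fun_measurable[OF is_W0_Lp(1)[OF W]] by simp
  then show "AE x in M. weak_grad \<Omega> u x = G x" by eventually_elim simp
  have W': "is_W0 u (weak_grad \<Omega> u)" by (rule is_W0_cong[OF W _ ae]) simp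
  obtain \<psi> where "\<And>n. \<psi> n \<in> test_functions \<Omega>" "Lp_conv p M \<psi> u" "Lp_conv p M (\<lambda>n. classical_grad (\<psi> n)) (weak_grad \<Omega> u)"
    using is_W0E[OF W'] by blast
  then show "u \<in> W01p p \<Omega>"
    unfolding W01p_def W1p_def Lp_space_eq Lp_norm_eq using is_W0_Lp[OF W'] w
    by (auto simp: Lp_conv_def intro!: exI[of _ \<psi>])
qed

lemma W01p_is_W0:
  assumes "u \<in> W01p p \<Omega>"
  shows "is_W0 u (weak_grad \<Omega> u)"
proof -
  have L: "u \<in> Lp_fun p M" "weak_grad \<Omega> u \<in> Lp_fun p M"
    using assms by (auto simp: W01p_def W1p_def Lp_space_eq)
  obtain \<psi> where "\<And>n. \<psi> n \<in> test_functions \<Omega>" "(\<lambda>n. Lp_nrm p M (\<lambda>x. \<psi> n x - u x)) \<longlonglongrightarrow> 0"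
     "(\<lambda>n. Lp_nrm p M (\<lambda>x. classical_grad (\<psi> n) x - weak_grad \<Omega> u x)) \<longlonglongrightarrow> 0"
    using assms by (auto simp: W01p_def Lp_norm_eq)
  then show ?thesis
    by (intro is_W0SI[of \<psi>]) (auto simp: Lp_conv_def L intro!: test_Lp' p0)
qed

text \<open>For every n a test function is chosen within 1/(n+1) of \<open>v n\<close>, in the
  function and in the gradient. Taking it from the approximations of \<open>v n\<close> preserves
  the range condition \<open>S\<close>.\<close>

lemma is_W0_closed:
  assumes W: "\<And>n. is_W0S S (v n) (H n)" and v: "Lp_conv p M v u" and H: "Lp_conv p M H G"
  shows "is_W0S S u G"
proof -
  have "\<exists>\<psi>. \<psi> \<in> test_functions \<Omega> \<and> (\<forall>x. \<psi> x \<in> S) \<and> Lp_nrm p M (\<lambda>x. \<psi> x - v n x) < inverse (real (Suc n)) \<and>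
    Lp_nrm p M (\<lambda>x. classical_grad \<psi> x - H n x) < inverse (real (Suc n))" for n
  proof -
    obtain \<psi> where \<psi>: "\<And>n. \<psi> n \<in> test_functions \<Omega>" "\<And>n x. \<psi> n x \<in> S" "Lp_conv p M \<psi> (v n)" "Lp_conv p M (\<lambda>n. classical_grad (\<psi> n)) (H n)"
      using is_W0SE[OF W] by blast
    have "0 < inverse (real (Suc n))" by simp
    from order_tendstoD(2)[OF Lp_convD(3)[OF \<psi>(3)] this] order_tendstoD(2)[OF Lp_convD(3)[OF \<psi>(4)] this]
    have "\<forall>\<^sub>F k in sequentially. Lp_nrm p M (\<lambda>x. \<psi> k x - v n x) < inverse (real (Suc n)) \<and> Lp_nrm p M (\<lambda>x. classical_grad (\<psi> k) x - H n x) < inverse (real (Suc n))"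
      by (rule eventually_conj)
    then obtain k where "Lp_nrm p M (\<lambda>x. \<psi> k x - v n x) < inverse (real (Suc n)) \<and> Lp_nrm p M (\<lambda>x. classical_grad (\<psi> k) x - H n x) < inverse (real (Suc n))"
      by (auto simp: eventually_sequentially)
    then show ?thesis using \<psi> by blast
  qed
  then obtain \<psi> where \<psi>: "\<And>n. \<psi> n \<in> test_functions \<Omega>" "\<And>n x. \<psi> n x \<in> S" "\<And>n. Lp_nrm p M (\<lambda>x. \<psi> n x - v n x) < inverse (real (Suc n))"
    "\<And>n. Lp_nrm p M (\<lambda>x. classical_grad (\<psi> n) x - H n x) < inverse (real (Suc n))" by metis
  show ?thesis
  proof (rule is_W0SI[OF \<psi>(1,2)])
    show "Lp_conv p M \<psi> u"
    proof (rule Lp_conv_sandwich)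
      show "(\<lambda>n. inverse (real (Suc n)) + Lp_nrm p M (\<lambda>x. v n x - u x)) \<longlonglongrightarrow> 0"
        using tendsto_add[OF LIMSEQ_inverse_real_of_nat Lp_convD(3)[OF v]] by simp
      show "\<forall>\<^sub>F n in sequentially. Lp_nrm p M (\<lambda>x. \<psi> n x - u x) \<le> inverse (real (Suc n)) + Lp_nrm p M (\<lambda>x. v n x - u x)"
      proof (intro always_eventually allI)
        fix n
        show "Lp_nrm p M (\<lambda>x. \<psi> n x - u x) \<le> inverse (real (Suc n)) + Lp_nrm p M (\<lambda>x. v n x - u x)"
          using Minkowski_triangle[OF p1 test_Lp'(1)[OF \<psi>(1) p0] Lp_convD(1,2)[OF v], of n n] \<psi>(3)[of n] by linarith
      qed
    qed (use test_Lp'(1)[OF \<psi>(1) p0] Lp_convD(2)[OF v] in auto)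
    show "Lp_conv p M (\<lambda>n. classical_grad (\<psi> n)) G"
    proof (rule Lp_conv_sandwich)
      show "(\<lambda>n. inverse (real (Suc n)) + Lp_nrm p M (\<lambda>x. H n x - G x)) \<longlonglongrightarrow> 0"
        using tendsto_add[OF LIMSEQ_inverse_real_of_nat Lp_convD(3)[OF H]] by simp
      show "\<forall>\<^sub>F n in sequentially. Lp_nrm p M (\<lambda>x. classical_grad (\<psi> n) x - G x) \<le> inverse (real (Suc n)) + Lp_nrm p M (\<lambda>x. H n x - G x)"
      proof (intro always_eventually allI)
        fix n
        show "Lp_nrm p M (\<lambda>x. classical_grad (\<psi> n) x - G x) \<le> inverse (real (Suc n)) + Lp_nrm p M (\<lambda>x. H n x - G x)"
          using Minkowski_triangle[OF p1 test_Lp'(2)[OF \<psi>(1) p0] Lp_convD(1,2)[OF H], of n n] \<psi>(4)[of n] by linarith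
      qed
    qed (use test_Lp'(2)[OF \<psi>(1) p0] Lp_convD(2)[OF H] in auto)
  qed
qed

end

subsection \<open>Chain rule and truncation\<close>

lemma lipschitz_from_deriv:
  fixes F :: "real \<Rightarrow> real"
  assumes "\<And>t. (F has_real_derivative F' t) (at t)" "\<And>t. \<bar>F' t\<bar> \<le> L"
  shows "\<bar>F a - F b\<bar> \<le> L * \<bar>a - b\<bar>"
  using field_differentiable_bound[of UNIV F F' L a b] assms by simp

lemma Lp_conv_scaleR_bdd:
  fixes F :: "nat \<Rightarrow> 'm \<Rightarrow> real" and b :: "'m \<Rightarrow> 'v::euclidean_space"
  assumes p: "p > 1" and F: "Lp_conv p M F f" and b: "b \<in> borel_measurable M" "\<And>x. norm (b x) \<le> B"
  shows "Lp_conv p M (\<lambda>n x. F n x *\<^sub>R b x) (\<lambda>x. f x *\<^sub>R b x)"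
proof (rule Lp_conv_sandwich)
  have p0: "p > 0" using p by simp
  have B: "B \<ge> 0" using b(2)[of undefined] norm_ge_zero order_trans by blast
  have *: "(\<lambda>x. g x *\<^sub>R b x) \<in> Lp_fun p M \<and> Lp_nrm p M (\<lambda>x. g x *\<^sub>R b x) \<le> B * Lp_nrm p M g" if g: "g \<in> Lp_fun p M" for g
  proof -
    note [measurable] = Lp_fun_measurable[OF g] b(1)
    have m: "(\<lambda>x. g x *\<^sub>R b x) \<in> borel_measurable M" by measurable
    have L: "(\<lambda>x. B * g x) \<in> Lp_fun p M" by (rule Lp_fun_cmult[OF g])
    have le: "AE x in M. norm (g x *\<^sub>R b x) \<le> norm (B * g x)"
    proof (rule AE_I2)
      show "norm (g x *\<^sub>R b x) \<le> norm (B * g x)" for x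
        using mult_left_mono[OF b(2)[of x] abs_ge_zero[of "g x"]] B by (simp add: abs_mult mult.commute)
    qed
    show ?thesis
      using Lp_fun_dom[OF m L p0 le] Lp_nrm_mono[OF m L p0 le] Lp_nrm_cmult[OF p0, of M B g] B by simp
  qed
  show "(\<lambda>n. B * Lp_nrm p M (\<lambda>x. F n x - f x)) \<longlonglongrightarrow> 0"
    using tendsto_mult[OF tendsto_const Lp_convD(3)[OF F], of B] by simp
  show "(\<lambda>x. F n x *\<^sub>R b x) \<in> Lp_fun p M" for n using *[OF Lp_convD(1)[OF F]] by simp
  show "(\<lambda>x. f x *\<^sub>R b x) \<in> Lp_fun p M" using *[OF Lp_convD(2)[OF F]] by simp
  have "(\<lambda>x. F n x - f x) \<in> Lp_fun p M" for n by (rule Lp_fun_diff[OF Lp_convD(1,2)[OF F] p0])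
  from *[OF this]
  show "\<forall>\<^sub>F n in sequentially. Lp_nrm p M (\<lambda>x. F n x *\<^sub>R b x - f x *\<^sub>R b x) \<le> B * Lp_nrm p M (\<lambda>x. F n x - f x)"
    by (simp add: scaleR_diff_left)
qed

context sobolev begin

lemma is_W0_test_mult:
  assumes W: "is_W0 v H" and \<zeta>: "\<zeta> \<in> test_functions \<Omega>"
  shows "is_W0 (\<lambda>x. \<zeta> x * v x) (\<lambda>x. \<zeta> x *\<^sub>R H x + v x *\<^sub>R classical_grad \<zeta> x)"
proof -
  obtain \<psi> where \<psi>: "\<And>n. \<psi> n \<in> test_functions \<Omega>" "Lp_conv p M \<psi> v" "Lp_conv p M (\<lambda>n. classical_grad (\<psi> n)) H" using is_W0E[OF W] by blast
  obtain B where B: "B > 0" "\<And>x. \<bar>\<zeta> x\<bar> \<le> B" "\<And>x. norm (classical_grad \<zeta> x) \<le> B" using test_bounded[OF \<zeta>] by blast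
  have m: "\<zeta> \<in> borel_measurable M" "classical_grad \<zeta> \<in> borel_measurable M"
    using test_Lp'[OF \<zeta> p0] by (auto dest: Lp_fun_measurable)
  show ?thesis
  proof (rule is_W0SI[of "\<lambda>n x. \<zeta> x * \<psi> n x"])
    show "(\<lambda>x. \<zeta> x * \<psi> n x) \<in> test_functions \<Omega>" for n by (rule test_mult[OF \<zeta> test_smooth[OF \<psi>(1)]])
    show "Lp_conv p M (\<lambda>n x. \<zeta> x * \<psi> n x) (\<lambda>x. \<zeta> x * v x)"
      using Lp_conv_bdd_mult[OF p1 \<psi>(2) m(1) B(2)] by simp
    have g: "classical_grad (\<lambda>x. \<zeta> x * \<psi> n x) = (\<lambda>x. \<zeta> x *\<^sub>R classical_grad (\<psi> n) x + \<psi> n x *\<^sub>R classical_grad \<zeta> x)" for n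
      by (rule ext, rule grad_mult[OF test_smooth[OF \<zeta>] test_smooth[OF \<psi>(1)]])
    show "Lp_conv p M (\<lambda>n. classical_grad (\<lambda>x. \<zeta> x * \<psi> n x)) (\<lambda>x. \<zeta> x *\<^sub>R H x + v x *\<^sub>R classical_grad \<zeta> x)"
      unfolding g by (rule Lp_conv_add[OF p1 Lp_conv_bdd_mult[OF p1 \<psi>(3) m(1) B(2)] Lp_conv_scaleR_bdd[OF p1 \<psi>(2) m(2) B(3)]])
  qed simp
qed

text \<open>Smoothness and the gradient formula are required along the approximating functions, so
  that \<open>F\<close> may be smooth on their values only. Along an almost everywhere convergent
  subsequence the gradients split into a bounded factor times a null sequence and a dominated
  sequence.\<close>

lemma is_W0S_chain_rule:
  fixes F F' :: "real \<Rightarrow> real"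
  assumes \<psi>: "\<And>n. \<psi> n \<in> test_functions \<Omega>" "Lp_conv p M \<psi> u" "Lp_conv p M (\<lambda>n. classical_grad (\<psi> n)) G"
    and CF: "\<And>n k. C_k k (\<lambda>x. F (\<psi> n x))"
    and gr: "\<And>n x. classical_grad (\<lambda>x. F (\<psi> n x)) x = F' (\<psi> n x) *\<^sub>R classical_grad (\<psi> n) x"
    and lip: "\<And>a b. \<bar>F a - F b\<bar> \<le> L * \<bar>a - b\<bar>" and cont: "continuous_on UNIV F'"
    and bd: "\<And>t. \<bar>F' t\<bar> \<le> L" and F0: "F 0 = 0" and rng: "\<And>n x. F (\<psi> n x) \<in> S"
  shows "is_W0S S (\<lambda>x. F (u x)) (\<lambda>x. F' (u x) *\<^sub>R G x)"
proof -
  obtain r where r: "strict_mono r" "AE x in M. (\<lambda>n. \<psi> (r n) x) \<longlonglongrightarrow> u x" using Lp_conv_AE_subseq[OF p1 \<psi>(2)] by blast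
  have L: "L \<ge> 0" using bd[of 0] by linarith
  note c1 = Lp_conv_subseq[OF \<psi>(2) r(1)] and c2 = Lp_conv_subseq[OF \<psi>(3) r(1)]
  note mu = Lp_fun_measurable[OF Lp_convD(2)[OF \<psi>(2)]] and mG = Lp_fun_measurable[OF Lp_convD(2)[OF \<psi>(3)]]
  have cF: "continuous_on UNIV F"
  proof (rule continuous_onI)
    fix x e :: real assume e: "e > 0"
    show "\<exists>d>0. \<forall>x'\<in>UNIV. dist x' x < d \<longrightarrow> dist (F x') (F x) \<le> e"
    proof (intro exI[of _ "e / (L + 1)"] conjI ballI impI)
      show "0 < e / (L + 1)" using e L by simp
      fix y assume "dist y x < e / (L + 1)"
      then have "(L + 1) * \<bar>y - x\<bar> \<le> e" using L by (simp add: dist_real_def field_simps)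
      moreover have "L * \<bar>y - x\<bar> \<le> (L + 1) * \<bar>y - x\<bar>" by (simp add: algebra_simps)
      ultimately show "dist (F y) (F x) \<le> e" using lip[of y x] by (simp add: dist_real_def)
    qed
  qed
  have mF: "(\<lambda>x. F (f x)) \<in> borel_measurable M" "(\<lambda>x. F' (f x)) \<in> borel_measurable M" if "f \<in> borel_measurable M" for f
    using borel_measurable_continuous_on[OF cF that] borel_measurable_continuous_on[OF cont that] .
  have tF: "(\<lambda>x. F (\<psi> n x)) \<in> test_functions \<Omega>" for n
    by (rule test_sub[OF \<psi>(1)[of n] CF]) (use F0 in simp)
  show ?thesis
  proof (rule is_W0SI[of "\<lambda>n x. F (\<psi> (r n) x)"])
    show "(\<lambda>x. F (\<psi> (r n) x)) \<in> test_functions \<Omega>" for n by (rule tF)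
    show "F (\<psi> (r n) x) \<in> S" for n x by (rule rng)
    have LF: "(\<lambda>x. F (f x)) \<in> Lp_fun p M" if f: "f \<in> Lp_fun p M" for f
    proof (rule Lp_fun_dom[OF mF(1)[OF Lp_fun_measurable[OF f]] Lp_fun_cmult[OF f, of L] p0])
      show "AE x in M. norm (F (f x)) \<le> norm (L * f x)"
        using lip[of _ 0] F0 L by (intro AE_I2) (simp add: abs_mult)
    qed
    show "Lp_conv p M (\<lambda>n x. F (\<psi> (r n) x)) (\<lambda>x. F (u x))"
    proof (rule Lp_conv_sandwich)
      show "(\<lambda>n. L * Lp_nrm p M (\<lambda>x. \<psi> (r n) x - u x)) \<longlonglongrightarrow> 0"
        using tendsto_mult[OF tendsto_const Lp_convD(3)[OF c1], of L] by simp
      have "Lp_nrm p M (\<lambda>x. F (\<psi> (r n) x) - F (u x)) \<le> L * Lp_nrm p M (\<lambda>x. \<psi> (r n) x - u x)" for n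
      proof -
        have d: "(\<lambda>x. L * (\<psi> (r n) x - u x)) \<in> Lp_fun p M"
          by (intro Lp_fun_cmult Lp_fun_diff Lp_convD(1)[OF c1] Lp_convD(2)[OF c1] p0)
        have "Lp_nrm p M (\<lambda>x. F (\<psi> (r n) x) - F (u x)) \<le> Lp_nrm p M (\<lambda>x. L * (\<psi> (r n) x - u x))"
        proof (rule Lp_nrm_mono[OF _ d p0])
          show "(\<lambda>x. F (\<psi> (r n) x) - F (u x)) \<in> borel_measurable M"
            using mF(1)[OF mu] mF(1)[OF Lp_fun_measurable[OF Lp_convD(1)[OF c1]]] by (rule borel_measurable_diff[rotated])
          show "AE x in M. norm (F (\<psi> (r n) x) - F (u x)) \<le> norm (L * (\<psi> (r n) x - u x))"
            using lip L by (intro AE_I2) (simp add: abs_mult)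
        qed
        then show ?thesis using L by (simp add: Lp_nrm_cmult[OF p0])
      qed
      then show "\<forall>\<^sub>F n in sequentially. Lp_nrm p M (\<lambda>x. F (\<psi> (r n) x) - F (u x)) \<le> L * Lp_nrm p M (\<lambda>x. \<psi> (r n) x - u x)" by simp
    qed (intro LF Lp_convD(1)[OF c1] Lp_convD(2)[OF c1])+
    have A: "Lp_conv p M (\<lambda>n x. F' (\<psi> (r n) x) *\<^sub>R (classical_grad (\<psi> (r n)) x - G x)) (\<lambda>x. 0)"
    proof (rule Lp_conv_sandwich)
      show "(\<lambda>n. L * Lp_nrm p M (\<lambda>x. classical_grad (\<psi> (r n)) x - G x)) \<longlonglongrightarrow> 0"
        using tendsto_mult[OF tendsto_const Lp_convD(3)[OF c2], of L] by simp
      have d: "(\<lambda>x. classical_grad (\<psi> (r n)) x - G x) \<in> Lp_fun p M" for n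
        by (rule Lp_fun_diff[OF Lp_convD(1,2)[OF c2] p0])
      have bA: "AE x in M. \<bar>F' (\<psi> (r n) x)\<bar> \<le> L" for n using bd by simp
      note b = Lp_fun_bdd_mult[OF d p0 mF(2)[OF Lp_fun_measurable[OF Lp_convD(1)[OF c1]]] bA]
      show "(\<lambda>x. F' (\<psi> (r n) x) *\<^sub>R (classical_grad (\<psi> (r n)) x - G x)) \<in> Lp_fun p M" for n by (rule b(1))
      show "\<forall>\<^sub>F n in sequentially. Lp_nrm p M (\<lambda>x. F' (\<psi> (r n) x) *\<^sub>R (classical_grad (\<psi> (r n)) x - G x) - 0) \<le> L * Lp_nrm p M (\<lambda>x. classical_grad (\<psi> (r n)) x - G x)"
        using b(2)[OF L] by simp
    qed simp
    have B: "Lp_conv p M (\<lambda>n x. F' (\<psi> (r n) x) *\<^sub>R G x) (\<lambda>x. F' (u x) *\<^sub>R G x)"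
    proof (rule Lp_conv_dominated[OF p0])
      show "(\<lambda>x. L *\<^sub>R G x) \<in> Lp_fun p M" by (rule Lp_fun_scaleR[OF Lp_convD(2)[OF c2]])
      show "(\<lambda>x. F' (\<psi> (r n) x) *\<^sub>R G x) \<in> borel_measurable M" for n
        by (rule borel_measurable_scaleR[OF mF(2)[OF Lp_fun_measurable[OF Lp_convD(1)[OF c1]]] mG])
      show "(\<lambda>x. F' (u x) *\<^sub>R G x) \<in> borel_measurable M"
        by (rule borel_measurable_scaleR[OF mF(2)[OF mu] mG])
      show "AE x in M. norm (F' (\<psi> (r n) x) *\<^sub>R G x) \<le> norm (L *\<^sub>R G x)" for n
        using bd L by (intro AE_I2) (auto intro!: mult_right_mono)
      show "AE x in M. (\<lambda>n. F' (\<psi> (r n) x) *\<^sub>R G x) \<longlonglongrightarrow> F' (u x) *\<^sub>R G x"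
        using r(2)
      proof eventually_elim
        case (elim x)
        have "isCont F' (u x)" using cont by (simp add: continuous_on_eq_continuous_at)
        from isCont_tendsto_compose[OF this elim] show ?case by (intro tendsto_intros)
      qed
    qed
    have "classical_grad (\<lambda>x. F (\<psi> (r n) x)) = (\<lambda>x. F' (\<psi> (r n) x) *\<^sub>R (classical_grad (\<psi> (r n)) x - G x) + F' (\<psi> (r n) x) *\<^sub>R G x)" for n
      by (rule ext) (simp add: gr scaleR_diff_right)
    note eq = this
    show "Lp_conv p M (\<lambda>n. classical_grad (\<lambda>x. F (\<psi> (r n) x))) (\<lambda>x. F' (u x) *\<^sub>R G x)"
      unfolding eq using Lp_conv_add[OF p1 A B] by simp
  qed
qed

text \<open>
  The approximations \<open>sqrt ((t - \<kappa>\<epsilon>)\<^sup>2 + \<epsilon>\<^sup>2)\<close> of \<open>\<bar>t\<bar>\<close> have, in the limit, a slope at \<open>0\<close> that depends on \<open>\<kappa>\<close>.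
  Uniqueness of the weak gradient then forces \<open>G\<close> to vanish almost everywhere on \<open>{u = 0}\<close>.
\<close>

lemma is_W0S_abs_branch:
  assumes W: "is_W0 u G" and \<kappa>: "\<kappa> \<ge> 0" and S: "S = UNIV \<or> (\<kappa> = 0 \<and> S = {0..})"
  shows "is_W0S S (\<lambda>x. \<bar>u x\<bar>) (\<lambda>x. (if u x = 0 then - \<kappa> / sqrt (\<kappa>\<^sup>2 + 1) else sgn (u x)) *\<^sub>R G x)"
proof -
  obtain \<psi> where \<psi>: "\<And>n. \<psi> n \<in> test_functions \<Omega>" "Lp_conv p M \<psi> u" "Lp_conv p M (\<lambda>n. classical_grad (\<psi> n)) G" using is_W0E[OF W] by blast
  note mu[measurable] = Lp_fun_measurable[OF is_W0_Lp(1)[OF W]] and mG[measurable] = Lp_fun_measurable[OF is_W0_Lp(2)[OF W]]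
  define g where "g e t = (t - \<kappa> * e)\<^sup>2 + e\<^sup>2" for e t :: real
  \<comment> \<open>Square roots are written as powers so that \<open>C_k_powr\<close> applies; the
    constant is subtracted because a composed test function must stay 0 where the original one is
    0.\<close>
  define F where "F e t = g e t powr (1/2) - g e 0 powr (1/2)" for e t
  define F' where "F' e t = (t - \<kappa> * e) * g e t powr (-1/2)" for e t
  have gp: "g e t > 0" if "e > 0" for e t using that by (simp add: g_def add_nonneg_pos)
  have Fs: "F e t = sqrt (g e t) - sqrt (g e 0)" if "e > 0" for e t
    using gp[OF that] by (simp add: F_def powr_half_sqrt less_imp_le)
  have F's: "F' e t = (t - \<kappa> * e) / sqrt (g e t)" if "e > 0" for e t
    using gp[OF that, of t] powr_minus_divide[of "g e t" "1/2"] by (simp add: F'_def powr_half_sqrt less_imp_le)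
  have der: "(F e has_real_derivative F' e t) (at t)" if "e > 0" for e t
  proof -
    have "((\<lambda>t. (t - \<kappa> * e)\<^sup>2 + e\<^sup>2) has_real_derivative 2 * (t - \<kappa> * e)) (at t)"
      by (auto intro!: derivative_eq_intros)
    then have gd: "(g e has_real_derivative 2 * (t - \<kappa> * e)) (at t)" by (simp add: g_def[abs_def])
    have "((\<lambda>t. g e t powr (1/2)) has_real_derivative (1/2) * g e t powr (1/2 - 1) * (2 * (t - \<kappa> * e))) (at t)"
      by (rule DERIV_chain2[OF has_real_derivative_powr[OF gp[OF that]] gd])
    from DERIV_diff[OF this DERIV_const[of "g e 0 powr (1/2)"]]
    show ?thesis unfolding F_def[abs_def] F'_def by (rule DERIV_cong) simp
  qed
  have bd: "\<bar>F' e t\<bar> \<le> 1" if "e > 0" for e t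
  proof -
    have "\<bar>t - \<kappa> * e\<bar> \<le> sqrt (g e t)" unfolding g_def by (rule real_le_rsqrt) simp
    then show ?thesis using gp[OF that, of t] by (simp add: F's[OF that])
  qed
  have F0: "F e 0 = 0" for e by (simp add: F_def)
  have lip: "\<bar>F e a - F e b\<bar> \<le> 1 * \<bar>a - b\<bar>" if "e > 0" for e a b
    by (rule lipschitz_from_deriv[OF der[OF that] bd[OF that]])
  have cont: "continuous_on UNIV (F' e)" if "e > 0" for e
    unfolding F'_def g_def using gp[OF that, unfolded g_def] by (intro continuous_intros) (auto simp: less_imp_neq[symmetric] dest: less_imp_neq)
  define h where "h n = inverse (real (Suc n))" for n
  have h: "h n > 0" for n by (simp add: h_def)
  have h0: "h \<longlonglongrightarrow> 0" unfolding h_def by (rule LIMSEQ_inverse_real_of_nat)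
  have W1: "is_W0S S (\<lambda>x. F e (u x)) (\<lambda>x. F' e (u x) *\<^sub>R G x)" if e: "e > 0" for e
  proof (rule is_W0S_chain_rule[OF \<psi> _ _ lip[OF e] cont[OF e] bd[OF e] F0])
    show "C_k k (\<lambda>x. F e (\<psi> n x))" for n k
    proof -
      have "C_k k (\<lambda>x. (\<psi> n x + - (\<kappa> * e))^2 + e^2)" 
        by (intro C_k_add C_k_power C_k_const test_smooth[OF \<psi>(1)])
      then have "C_k k (\<lambda>x. g e (\<psi> n x))" by (simp add: g_def)
      from C_k_add[OF C_k_powr[OF this gp[OF e]] C_k_const[of _ "- (g e 0 powr (1/2))"]]
      show ?thesis by (simp add: F_def)
    qed
    show "classical_grad (\<lambda>x. F e (\<psi> n x)) x = F' e (\<psi> n x) *\<^sub>R classical_grad (\<psi> n) x" for n x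
      by (rule grad_comp[OF test_smooth[OF \<psi>(1)] der[OF e]])
    show "F e (\<psi> n x) \<in> S" for n x
    proof (cases "S = UNIV")
      case False
      then have "\<kappa> = 0" "S = {0..}" using S by auto
      then show ?thesis using e by (simp add: Fs[OF e]) (simp add: g_def)
    qed simp
  qed
  have lim: "(\<lambda>n. F (h n) t) \<longlonglongrightarrow> \<bar>t\<bar>" for t
  proof -
    have "(\<lambda>n. sqrt ((t - \<kappa> * h n)\<^sup>2 + (h n)\<^sup>2) - sqrt ((0 - \<kappa> * h n)\<^sup>2 + (h n)\<^sup>2)) \<longlonglongrightarrow> sqrt ((t - \<kappa> * 0)\<^sup>2 + 0\<^sup>2) - sqrt ((0 - \<kappa> * 0)\<^sup>2 + 0\<^sup>2)"
      by (intro tendsto_intros h0)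
    then show ?thesis by (simp add: Fs[OF h] g_def)
  qed
  have lim': "(\<lambda>n. F' (h n) t) \<longlonglongrightarrow> (if t = 0 then - \<kappa> / sqrt (\<kappa>\<^sup>2 + 1) else sgn t)" for t
  proof (cases "t = 0")
    case True
    \<comment> \<open>Shift and width shrink at the same rate, so the slope at 0 does not depend on
      \<open>h n\<close> and survives the limit.\<close>
    have "F' (h n) 0 = - \<kappa> / sqrt (\<kappa>\<^sup>2 + 1)" for n
    proof -
      have "g (h n) 0 = (h n)\<^sup>2 * (\<kappa>\<^sup>2 + 1)" by (simp add: g_def power_mult_distrib algebra_simps)
      then have "sqrt (g (h n) 0) = h n * sqrt (\<kappa>\<^sup>2 + 1)" using h[of n] by (simp add: real_sqrt_mult)
      then show ?thesis using h[of n] by (simp add: F's[OF h])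
    qed
    then show ?thesis using True by simp
  next
    case False
    have "(\<lambda>n. (t - \<kappa> * h n) / sqrt ((t - \<kappa> * h n)\<^sup>2 + (h n)\<^sup>2)) \<longlonglongrightarrow> (t - \<kappa> * 0) / sqrt ((t - \<kappa> * 0)\<^sup>2 + 0\<^sup>2)"
      by (intro tendsto_intros h0) (use False in simp)
    then show ?thesis using False by (simp add: F's[OF h] g_def sgn_real_def abs_if split: if_splits)
  qed
  show ?thesis
  proof (rule is_W0_closed[OF W1[OF h]])
    have Wn: "is_W0S S (\<lambda>x. F (h n) (u x)) (\<lambda>x. F' (h n) (u x) *\<^sub>R G x)" for n by (rule W1[OF h])
    show "Lp_conv p M (\<lambda>n x. F (h n) (u x)) (\<lambda>x. \<bar>u x\<bar>)"
    proof (rule Lp_conv_dominated[OF p0 Lp_fun_measurable[OF is_W0_Lp(1)[OF Wn]] _ is_W0_Lp(1)[OF W]])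
      show "AE x in M. norm (F (h n) (u x)) \<le> norm (u x)" for n
        using lip[OF h[of n], of _ 0] by (simp add: F0)
    qed (use lim in auto)
    show "Lp_conv p M (\<lambda>n x. F' (h n) (u x) *\<^sub>R G x) (\<lambda>x. (if u x = 0 then - \<kappa> / sqrt (\<kappa>\<^sup>2 + 1) else sgn (u x)) *\<^sub>R G x)"
    proof (rule Lp_conv_dominated[OF p0 Lp_fun_measurable[OF is_W0_Lp(2)[OF Wn]] _ is_W0_Lp(2)[OF W]])
      show "AE x in M. norm (F' (h n) (u x) *\<^sub>R G x) \<le> norm (G x)" for n
        using bd[OF h[of n]] by (simp add: mult_left_le_one_le)
      show "AE x in M. (\<lambda>n. F' (h n) (u x) *\<^sub>R G x) \<longlonglongrightarrow> (if u x = 0 then - \<kappa> / sqrt (\<kappa>\<^sup>2 + 1) else sgn (u x)) *\<^sub>R G x"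
        by (intro AE_I2 tendsto_scaleR lim' tendsto_const)
    qed measurable
  qed
qed

lemma grad_zero_set:
  assumes W: "is_W0 u G"
  shows "AE x in M. u x = 0 \<longrightarrow> G x = 0"
proof -
  have "AE x in M. (if u x = 0 then - 0 / sqrt (0\<^sup>2 + 1) else sgn (u x)) *\<^sub>R G x = (if u x = 0 then - 1 / sqrt (1\<^sup>2 + 1) else sgn (u x)) *\<^sub>R G x"
    by (rule is_W0_unique[OF is_W0S_abs_branch[OF W, of 0 UNIV] is_W0S_abs_branch[OF W, of 1 UNIV]]) auto
  then show ?thesis by eventually_elim (auto split: if_splits)
qed

lemma is_W0_abs:
  assumes W: "is_W0 u G"
  shows "is_W0S {0..} (\<lambda>x. \<bar>u x\<bar>) (\<lambda>x. sgn (u x) *\<^sub>R G x)"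
  by (rule is_W0_cong[OF is_W0S_abs_branch[OF W, of 0 "{0..}"]]) auto

text \<open>Here |u| = u almost everywhere, and the construction for |u| yields nonnegative
  approximations. \<open>chain_nonneg\<close> composes these with functions that are smooth only
  near \<open>{0..}\<close>.\<close>

lemma is_W0_nonneg:
  assumes W: "is_W0 u G" and "AE x in M. u x \<ge> 0"
  shows "is_W0S {0..} u G"
proof (rule is_W0_cong[OF is_W0_abs[OF W]])
  show "AE x in M. \<bar>u x\<bar> = u x" using assms(2) by eventually_elim simp
  show "AE x in M. sgn (u x) *\<^sub>R G x = G x" using assms(2) grad_zero_set[OF W]
    by eventually_elim (auto simp: sgn_real_def)
qed

lemma is_W0_pos_part:
  assumes W: "is_W0 u G"
  shows "is_W0 (pos_part u) (\<lambda>x. indicat_real {x. u x > 0} x *\<^sub>R G x)"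
proof (rule is_W0_cong[OF is_W0_cmult[OF is_W0_add[OF W is_W0S_imp_is_W0[OF is_W0_abs[OF W]]], of "1/2"]])
  show "AE x in M. 1/2 * (u x + \<bar>u x\<bar>) = pos_part u x" by (auto simp: pos_part_def max_def)
  show "AE x in M. (1/2) *\<^sub>R (G x + sgn (u x) *\<^sub>R G x) = indicat_real {x. u x > 0} x *\<^sub>R G x"
    using grad_zero_set[OF W]
  proof eventually_elim
    case (elim x)
    consider "u x > 0" | "u x = 0" | "u x < 0" by linarith
    then show ?case using elim by cases (auto simp: scaleR_2[symmetric])
  qed
qed

lemma is_W0_neg_part:
  assumes W: "is_W0 u G"
  shows "is_W0 (neg_part u) (\<lambda>x. - (indicat_real {x. u x < 0} x *\<^sub>R G x))"
proof -
  have "is_W0 (\<lambda>x. -1 * u x) (\<lambda>x. -1 *\<^sub>R G x)" by (rule is_W0_cmult[OF W])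
  from is_W0_pos_part[OF this] show ?thesis
    by (rule is_W0_cong) (auto simp: pos_part_def neg_part_def indicator_def)
qed

end

subsection \<open>The Poincare inequality\<close>

text \<open>Jensen's inequality on a set of finite measure, from Hoelder's inequality with the
  indicator as second factor.\<close>

lemma Holder_set:
  fixes c :: "'m \<Rightarrow> 'v::euclidean_space"
  assumes p: "p > 1" and A: "A \<in> sets N" "emeasure N A < \<infinity>" and c: "(\<lambda>x. indicat_real A x *\<^sub>R c x) \<in> Lp_fun p N"
  shows "norm (LINT x|N. indicat_real A x *\<^sub>R c x) powr p \<le> measure N A powr (p - 1) * pint p N (\<lambda>x. indicat_real A x *\<^sub>R c x)"
proof -
  let ?c = "\<lambda>x. indicat_real A x *\<^sub>R c x" and ?q = "p / (p - 1)"
  have q0: "?q > 0" using p by simp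
  have e: "norm (indicat_real A x) powr ?q = indicat_real A x" "indicat_real A x powr ?q = indicat_real A x" for x
    by (auto simp: indicator_def)
  have g: "indicat_real A \<in> Lp_fun ?q N" using A by (simp add: Lp_fun_def e integrable_real_indicator)
  have m: "Lp_nrm ?q N (indicat_real A) = measure N A powr ((p - 1) / p)"
    using A by (simp add: Lp_nrm_def pint_def e)
  have "norm (LINT x|N. ?c x) \<le> (LINT x|N. norm (?c x))" by (rule integral_norm_bound)
  also have "\<dots> \<le> Lp_nrm p N ?c * Lp_nrm ?q N (indicat_real A)"
    by (rule Holder(2)[OF p c g Lp_fun_measurable[OF c]]) (auto simp: indicator_def)
  finally have "norm (LINT x|N. ?c x) powr p \<le> (Lp_nrm p N ?c * Lp_nrm ?q N (indicat_real A)) powr p"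
    using p by (intro powr_mono2) auto
  also have "\<dots> = pint p N ?c * measure N A powr (p - 1)"
    using p by (simp add: powr_mult Lp_nrm_powr m powr_powr)
  finally show ?thesis by (simp add: mult.commute)
qed

lemma nn_integral_shift:
  fixes F :: "'a::euclidean_space \<Rightarrow> ennreal"
  assumes "F \<in> borel_measurable borel"
  shows "(\<integral>\<^sup>+h. F (x + h) \<partial>lborel) = (\<integral>\<^sup>+y. F y \<partial>lborel)"
proof -
  have "(\<integral>\<^sup>+y. F y \<partial>lborel) = (\<integral>\<^sup>+y. F y \<partial>(distr lborel borel ((+) x)))" by (simp add: lborel_distr_plus)
  also have "\<dots> = (\<integral>\<^sup>+h. F (x + h) \<partial>lborel)" using assms by (subst nn_integral_distr) auto
  finally show ?thesis by simp
qed

text \<open>The fundamental theorem of calculus along the segment from x to x + h, followed by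
  \<open>Holder_set\<close> on the unit interval; the length of the segment gives the factor
  d^p.\<close>

lemma smooth_increment_powr:
  assumes p: "p > 1" and sm: "\<And>k. C_k k f" and h: "norm h \<le> d"
  shows "ennreal (\<bar>f (x + h) - f x\<bar> powr p) \<le> (\<integral>\<^sup>+t. ennreal (d powr p) * ennreal (norm (classical_grad f (x + t *\<^sub>R h)) powr p) * indicator {0..1} t \<partial>lborel)"
proof -
  define c where "c t = classical_grad f (x + t *\<^sub>R h) \<bullet> h" for t :: real
  have cc: "continuous_on UNIV c" unfolding c_def
    by (intro continuous_on_inner continuous_on_const continuous_on_compose2[OF grad_continuous[OF sm]] continuous_intros) auto
  have [measurable]: "c \<in> borel_measurable borel" using cc by (rule borel_measurable_continuous_onI)
  have "compact (c ` {0..1})" by (rule compact_continuous_image[OF continuous_on_subset[OF cc]]) auto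
  then obtain B where B: "\<forall>y\<in>c ` {0..1}. norm y \<le> B" using compact_imp_bounded bounded_iff by metis
  have B0: "norm (indicat_real {0..1} t *\<^sub>R c t) \<le> norm (B * indicat_real {0..1} t)" for t
    using B by (auto simp: indicator_def intro: order_trans[OF _ abs_ge_self])
  have i: "(\<lambda>t. B * indicat_real {0..1::real} t) \<in> Lp_fun p lborel"
  proof -
    have "norm (indicat_real {0..1::real} t) powr p = indicat_real {0..1} t" for t by (simp add: indicator_def)
    then have 1: "(\<lambda>t. indicat_real {0..1::real} t) \<in> Lp_fun p lborel" by (simp add: Lp_fun_def)
    show ?thesis by (rule Lp_fun_cmult[OF 1])
  qed
  have cL: "(\<lambda>t. indicat_real {0..1} t *\<^sub>R c t) \<in> Lp_fun p lborel"
    by (rule Lp_fun_dom[OF _ i]) (use p B0 in auto)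
  have "\<bar>f (x + h) - f x\<bar> powr p = norm (LINT t|lborel. indicat_real {0..1} t *\<^sub>R c t) powr p"
    using test_mvt[OF sm, of x h] by (simp add: c_def)
  also have "\<dots> \<le> measure lborel {0..1::real} powr (p - 1) * pint p lborel (\<lambda>t. indicat_real {0..1} t *\<^sub>R c t)"
    by (rule Holder_set[OF p _ _ cL]) auto
  also have "\<dots> = pint p lborel (\<lambda>t. indicat_real {0..1} t *\<^sub>R c t)" by simp
  finally have "ennreal (\<bar>f (x + h) - f x\<bar> powr p) \<le> ennreal (pint p lborel (\<lambda>t. indicat_real {0..1} t *\<^sub>R c t))"
    by (rule ennreal_leI)
  also have "\<dots> = (\<integral>\<^sup>+t. ennreal (norm (indicat_real {0..1} t *\<^sub>R c t) powr p) \<partial>lborel)"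
    unfolding pint_def by (rule nn_integral_eq_integral[symmetric, OF Lp_fun_integrable[OF cL]]) simp
  also have "\<dots> \<le> (\<integral>\<^sup>+t. ennreal (d powr p) * ennreal (norm (classical_grad f (x + t *\<^sub>R h)) powr p) * indicator {0..1} t \<partial>lborel)"
  proof (rule nn_integral_mono)
    fix t
    have "\<bar>c t\<bar> \<le> norm (classical_grad f (x + t *\<^sub>R h)) * d"
      unfolding c_def using Cauchy_Schwarz_ineq2[of "classical_grad f (x + t *\<^sub>R h)" h] h
      by (meson mult_left_mono norm_ge_zero order_trans)
    then have "\<bar>c t\<bar> powr p \<le> (norm (classical_grad f (x + t *\<^sub>R h)) * d) powr p"
      using p by (intro powr_mono2) auto
    then have "ennreal (\<bar>c t\<bar> powr p) \<le> ennreal (d powr p) * ennreal (norm (classical_grad f (x + t *\<^sub>R h)) powr p)"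
      by (simp add: ennreal_mult[symmetric] powr_mult mult.commute ennreal_leI)
    then show "ennreal (norm (indicat_real {0..1} t *\<^sub>R c t) powr p) \<le> ennreal (d powr p) * ennreal (norm (classical_grad f (x + t *\<^sub>R h)) powr p) * indicator {0..1} t"
      by (auto simp: indicator_def)
  qed
  finally show ?thesis .
qed

text \<open>
  Write \<open>f y - f x\<close> as an integral of the gradient along the segment, which stays in the convex set \<open>Q\<close>; for fixed
  \<open>h = y - x\<close> and fixed position \<open>t\<close> on the segment, the translation \<open>x \<mapsto> x + t h\<close> preserves Lebesgue measure.
\<close>

lemma double_integral_le:
  fixes f :: "'a::euclidean_space \<Rightarrow> real"
  assumes p: "p > 1" and sm: "\<And>k. C_k k f" and Q: "convex Q" "Q \<in> sets borel"
  shows "(\<integral>\<^sup>+x. \<integral>\<^sup>+y. ennreal (\<bar>f y - f x\<bar> powr p) * indicator Q x * indicator Q y * indicator {y. dist x y < d} y \<partial>lborel \<partial>lborel)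
     \<le> ennreal (d powr p) * emeasure lborel (ball (0::'a) d) * (\<integral>\<^sup>+x. ennreal (norm (classical_grad f x) powr p) * indicator Q x \<partial>lborel)"
proof -
  note [measurable] = Q(2)
  have [measurable]: "f \<in> borel_measurable borel" "classical_grad f \<in> borel_measurable borel"
    using C_k_continuous[OF sm] grad_continuous[OF sm] borel_measurable_continuous_onI by auto
  define k where "k z = ennreal (norm (classical_grad f z) powr p) * indicator Q z" for z
  have [measurable]: "k \<in> borel_measurable borel" unfolding k_def by measurable
  define i1 :: "real \<Rightarrow> ennreal" where "i1 = indicator {0..1}"
  define i2 :: "'a \<Rightarrow> ennreal" where "i2 = indicator (ball 0 d)"
  have [measurable]: "i1 \<in> borel_measurable borel" "i2 \<in> borel_measurable borel"
    unfolding i1_def i2_def by (auto intro!: borel_measurable_indicator)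
  define T where "T x h t = ennreal (d powr p) * k (x + t *\<^sub>R h) * i1 t * i2 h" for x h and t :: real
  have T2: "(\<lambda>(x, t). T x h t) \<in> borel_measurable (lborel \<Otimes>\<^sub>M lborel)" for h unfolding T_def by measurable
  have "(\<lambda>z. T (fst (fst z)) (snd (fst z)) (snd z)) \<in> borel_measurable ((lborel \<Otimes>\<^sub>M lborel) \<Otimes>\<^sub>M lborel)"
    unfolding T_def by measurable
  then have T3: "(\<lambda>(z, t). T (fst z) (snd z) t) \<in> borel_measurable ((lborel \<Otimes>\<^sub>M lborel) \<Otimes>\<^sub>M lborel)"
    by (simp add: split_beta')
  have T4: "(\<lambda>(x, h). \<integral>\<^sup>+t. T x h t \<partial>lborel) \<in> borel_measurable (lborel \<Otimes>\<^sub>M lborel)"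
    using lborel.borel_measurable_nn_integral[OF T3] by (simp add: split_beta')
  have le: "ennreal (\<bar>f (x + h) - f x\<bar> powr p) * indicator Q x * indicator Q (x + h) * indicator {y. dist x y < d} (x + h)
     \<le> (\<integral>\<^sup>+t. T x h t \<partial>lborel)" for x h
  proof (cases "x \<in> Q \<and> x + h \<in> Q \<and> norm h < d")
    case True
    have "x + t *\<^sub>R h \<in> Q" if "t \<in> {0..1}" for t
    proof -
      have "(1 - t) *\<^sub>R x + t *\<^sub>R (x + h) \<in> Q" using True that Q(1) by (intro convexD) auto
      then show ?thesis by (simp add: algebra_simps)
    qed
    then have "T x h t = ennreal (d powr p) * ennreal (norm (classical_grad f (x + t *\<^sub>R h)) powr p) * indicator {0..1} t" for t
      using True by (auto simp: T_def k_def i1_def i2_def indicator_def)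
    then show ?thesis using smooth_increment_powr[OF p sm, of h d x] True by (simp add: dist_norm)
  qed (auto simp: dist_norm indicator_def)
  have "(\<integral>\<^sup>+x. \<integral>\<^sup>+y. ennreal (\<bar>f y - f x\<bar> powr p) * indicator Q x * indicator Q y * indicator {y. dist x y < d} y \<partial>lborel \<partial>lborel)
     = (\<integral>\<^sup>+x. \<integral>\<^sup>+h. ennreal (\<bar>f (x + h) - f x\<bar> powr p) * indicator Q x * indicator Q (x + h) * indicator {y. dist x y < d} (x + h) \<partial>lborel \<partial>lborel)"
    by (intro nn_integral_cong nn_integral_shift[symmetric]) measurable
  also have "\<dots> \<le> (\<integral>\<^sup>+x. \<integral>\<^sup>+h. \<integral>\<^sup>+t. T x h t \<partial>lborel \<partial>lborel \<partial>lborel)"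
    by (intro nn_integral_mono le)
  \<comment> \<open>Two exchanges of integrals bring x innermost; for fixed h and t the integrand
    depends on x only through the translate x + t h.\<close>
  also have "\<dots> = (\<integral>\<^sup>+h. \<integral>\<^sup>+x. \<integral>\<^sup>+t. T x h t \<partial>lborel \<partial>lborel \<partial>lborel)"
    by (rule pair_sigma_finite.Fubini'[OF _ T4, symmetric]) unfold_locales
  also have "\<dots> = (\<integral>\<^sup>+h. \<integral>\<^sup>+t. \<integral>\<^sup>+x. T x h t \<partial>lborel \<partial>lborel \<partial>lborel)"
    by (intro nn_integral_cong pair_sigma_finite.Fubini'[OF _ T2, symmetric]) unfold_locales
  also have "\<dots> = (\<integral>\<^sup>+h. \<integral>\<^sup>+t. ennreal (d powr p) * (\<integral>\<^sup>+x. k x \<partial>lborel) * indicator {0..1} t * indicator (ball (0::'a) d) h \<partial>(lborel::real measure) \<partial>lborel)"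
  proof (intro nn_integral_cong)
    fix h :: 'a and t :: real
    have "(\<integral>\<^sup>+x. T x h t \<partial>lborel) = (\<integral>\<^sup>+x. k (x + t *\<^sub>R h) * (ennreal (d powr p) * i1 t * i2 h) \<partial>lborel)"
      by (intro nn_integral_cong) (simp add: T_def ac_simps)
    also have "\<dots> = (\<integral>\<^sup>+x. k (x + t *\<^sub>R h) \<partial>lborel) * (ennreal (d powr p) * i1 t * i2 h)"
      by (rule nn_integral_multc) measurable
    also have "(\<integral>\<^sup>+x. k (x + t *\<^sub>R h) \<partial>lborel) = (\<integral>\<^sup>+x. k x \<partial>lborel)"
      using nn_integral_shift[of k "t *\<^sub>R h"] by (simp add: add.commute)
    finally show "(\<integral>\<^sup>+x. T x h t \<partial>lborel) = ennreal (d powr p) * (\<integral>\<^sup>+x. k x \<partial>lborel) * indicator {0..1} t * indicator (ball 0 d) h"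
      by (simp add: ac_simps i1_def i2_def)
  qed
  also have "\<dots> = (\<integral>\<^sup>+h. ennreal (d powr p) * (\<integral>\<^sup>+x. k x \<partial>lborel) * indicator (ball (0::'a) d) h \<partial>lborel)"
  proof (intro nn_integral_cong)
    fix h :: 'a
    have "(\<integral>\<^sup>+t. ennreal (d powr p) * (\<integral>\<^sup>+x. k x \<partial>lborel) * indicator {0..1} t * indicator (ball (0::'a) d) h \<partial>(lborel::real measure))
      = (\<integral>\<^sup>+t. (ennreal (d powr p) * (\<integral>\<^sup>+x. k x \<partial>lborel) * indicator (ball (0::'a) d) h) * indicator {0..1} t \<partial>(lborel::real measure))"
      by (intro nn_integral_cong) (simp add: ac_simps)
    also have "\<dots> = (ennreal (d powr p) * (\<integral>\<^sup>+x. k x \<partial>lborel) * indicator (ball (0::'a) d) h) * emeasure lborel {0..1::real}"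
      by (rule nn_integral_cmult_indicator) simp
    finally show "(\<integral>\<^sup>+t. ennreal (d powr p) * (\<integral>\<^sup>+x. k x \<partial>lborel) * indicator {0..1} t * indicator (ball (0::'a) d) h \<partial>(lborel::real measure))
      = ennreal (d powr p) * (\<integral>\<^sup>+x. k x \<partial>lborel) * indicator (ball (0::'a) d) h" by simp
  qed
  also have "\<dots> = ennreal (d powr p) * (\<integral>\<^sup>+x. k x \<partial>lborel) * emeasure lborel (ball (0::'a) d)"
    by (rule nn_integral_cmult_indicator) simp
  finally show ?thesis by (simp add: k_def ac_simps)
qed

lemma ennreal_norm_add_powr_le:
  assumes "p > 0"
  shows "ennreal (\<bar>a + b\<bar> powr p) \<le> ennreal (2 powr p) * (ennreal (\<bar>a\<bar> powr p) + ennreal (\<bar>b\<bar> powr p))"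
proof -
  have "ennreal (\<bar>a + b\<bar> powr p) \<le> ennreal (2 powr p * (\<bar>a\<bar> powr p + \<bar>b\<bar> powr p))"
    using norm_add_powr_le[OF assms, of a b] by (intro ennreal_leI) simp
  then show ?thesis by (simp add: ennreal_mult ennreal_plus)
qed

lemma emeasure_ball_unbounded:
  fixes c :: real
  obtains d where "d > 0" "ennreal c < emeasure lborel (ball (0::'a::euclidean_space) d)"
proof -
  have "(SUP n. emeasure lborel (ball (0::'a) (real n))) = emeasure lborel (\<Union>n. ball (0::'a) (real n))"
    by (rule SUP_emeasure_incseq) (auto simp: incseq_def)
  also have "(\<Union>n. ball (0::'a) (real n)) = UNIV"
    using reals_Archimedean2 by auto
  also have "emeasure lborel (UNIV :: 'a set) = \<infinity>" by simp
  finally have "ennreal c < (SUP n. emeasure lborel (ball (0::'a) (real n)))" by (metis ennreal_less_top infinity_ennreal_def)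
  then obtain n where n: "ennreal c < emeasure lborel (ball (0::'a) (real n))" unfolding less_SUP_iff by blast
  have "ball (0::'a) (real n) \<subseteq> ball 0 (real (Suc n))" by auto
  then have "emeasure lborel (ball (0::'a) (real n)) \<le> emeasure lborel (ball (0::'a) (real (Suc n)))" by (intro emeasure_mono) auto
  with n show ?thesis by (intro that[of "real (Suc n)"]) auto
qed

context sobolev begin

text \<open>Test functions vanish outside \<Omega>, so their integrals may be taken over the whole
  space, on which translations act.\<close>

lemma pint_M_test:
  assumes "f \<in> test_functions \<Omega>"
  shows "ennreal (pint p M f) = (\<integral>\<^sup>+x. ennreal (\<bar>f x\<bar> powr p) \<partial>lborel)"
    "ennreal (pint p M (classical_grad f)) = (\<integral>\<^sup>+x. ennreal (norm (classical_grad f x) powr p) \<partial>lborel)"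
proof -
  obtain K where K: "\<And>k. C_k k f" "compact K" "K \<subseteq> \<Omega>" "\<And>x. x \<notin> K \<Longrightarrow> f x = 0" using test_functionE[OF assms(1)] by blast
  have G: "classical_grad f x = 0" if "x \<notin> K" for x using test_grad_zero[OF K(1,2,4) that] .
  note L = test_Lp(3,4)[OF assms p0 Omega_sets]
  have [measurable]: "f \<in> borel_measurable borel" "classical_grad f \<in> borel_measurable borel"
    using C_k_continuous[OF K(1)] grad_continuous[OF K(1)] borel_measurable_continuous_onI by auto
  have "pint p M f = (LINT x|lborel. norm (f x) powr p)" unfolding pint_def
    by (rule integral_lebesgue_on_lborel[OF _ _ Omega_sets]) (use K in auto)
  then show "ennreal (pint p M f) = (\<integral>\<^sup>+x. ennreal (\<bar>f x\<bar> powr p) \<partial>lborel)"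
    using nn_integral_eq_integral[OF Lp_fun_integrable[OF L(1)]] by simp
  have "pint p M (classical_grad f) = (LINT x|lborel. norm (classical_grad f x) powr p)" unfolding pint_def
    by (rule integral_lebesgue_on_lborel[OF _ _ Omega_sets]) (use K G in auto)
  then show "ennreal (pint p M (classical_grad f)) = (\<integral>\<^sup>+x. ennreal (norm (classical_grad f x) powr p) \<partial>lborel)"
    using nn_integral_eq_integral[OF Lp_fun_integrable[OF L(2)]] by simp
qed

text \<open>
  \<open>\<Omega>\<close> may be unbounded: in a ball whose volume exceeds that of \<open>\<Omega>\<close> sufficiently, a function supported in \<open>\<Omega>\<close>
  vanishes on a large part, so that \<open>\<bar>f x\<bar> = \<bar>f y - f x\<bar>\<close> for many \<open>y\<close> near \<open>x\<close>.
\<close>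

lemma poincare_test:
  obtains C where "C > 0" "\<And>f. f \<in> test_functions \<Omega> \<Longrightarrow> pint p M f \<le> C * pint p M (classical_grad f)"
proof -
  define w where "w = measure lborel \<Omega>"
  have Ob[measurable]: "\<Omega> \<in> sets borel" using op by simp
  have wO: "emeasure lborel \<Omega> = ennreal w"
    using fin op unfolding w_def by (intro emeasure_eq_ennreal_measure) auto
  \<comment> \<open>The volume is so large that the term with factor 2^p w, which stems from the
    values f y with y in \<Omega>, is at most half of the left-hand side and can be absorbed; the
    summand 1 makes m positive.\<close>
  obtain d where d: "d > 0" "ennreal (2 * 2 powr p * w + 1) < emeasure lborel (ball (0::'a) d)"
    using emeasure_ball_unbounded by blast
  define m where "m = measure lborel (ball (0::'a) d)"
  have mB: "emeasure lborel (ball (0::'a) d) = ennreal m"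
    unfolding m_def using emeasure_lborel_ball_finite[of "0::'a" d] by (intro emeasure_eq_ennreal_measure) auto
  have m0: "m \<ge> 0" by (simp add: m_def)
  have mw: "2 * 2 powr p * w + 1 < m" using d(2) unfolding mB
    by (subst (asm) ennreal_less_iff) (auto simp: w_def)
  show ?thesis
  proof (rule that[of "2 * 2 powr p * d powr p"])
    fix f assume f: "f \<in> test_functions \<Omega>"
    note sm = test_smooth[OF f]
    have [measurable]: "f \<in> borel_measurable borel" using C_k_continuous[OF sm] borel_measurable_continuous_onI by auto
    have fz: "f x = 0" if "x \<notin> \<Omega>" for x using test_functionE[OF f] that by (metis subsetD)
    define I where "I = pint p M f" define J where "J = pint p M (classical_grad f)"
    have I: "(\<integral>\<^sup>+x. ennreal (\<bar>f x\<bar> powr p) \<partial>lborel) = ennreal I" using pint_M_test(1)[OF f] by (simp add: I_def)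
    have J: "(\<integral>\<^sup>+x. ennreal (norm (classical_grad f x) powr p) \<partial>lborel) = ennreal J" using pint_M_test(2)[OF f] by (simp add: J_def)
    have IJ: "I \<ge> 0" "J \<ge> 0" by (auto simp: I_def J_def)
    have mball: "emeasure lborel {y::'a. dist x y < d} = ennreal m" for x
    proof -
      have "emeasure lborel {y. dist x y < d} = (\<integral>\<^sup>+y. indicator (ball x d) y \<partial>lborel)"
        by (simp add: ball_def)
      also have "\<dots> = (\<integral>\<^sup>+h. indicator (ball x d) (x + h) \<partial>lborel)" by (rule nn_integral_shift[symmetric], rule borel_measurable_indicator) simp
      also have "\<dots> = (\<integral>\<^sup>+h. indicator (ball (0::'a) d) h \<partial>lborel)"
        by (intro nn_integral_cong) (simp add: indicator_def dist_norm)
      finally show ?thesis by (simp add: mB)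
    qed
    have "ennreal m * ennreal I = (\<integral>\<^sup>+x. ennreal (\<bar>f x\<bar> powr p) * ennreal m \<partial>lborel)"
      by (subst nn_integral_multc) (auto simp: I mult.commute)
    also have "\<dots> = (\<integral>\<^sup>+x. \<integral>\<^sup>+y. ennreal (\<bar>f x\<bar> powr p) * indicator \<Omega> x * indicator {y. dist x y < d} y \<partial>lborel \<partial>lborel)"
    proof (rule nn_integral_cong)
      fix x
      have "(\<integral>\<^sup>+y. ennreal (\<bar>f x\<bar> powr p) * indicator \<Omega> x * indicator {y. dist x y < d} y \<partial>lborel) = ennreal (\<bar>f x\<bar> powr p) * indicator \<Omega> x * emeasure lborel {y. dist x y < d}"
        by (rule nn_integral_cmult_indicator) simp
      then show "ennreal (\<bar>f x\<bar> powr p) * ennreal m = (\<integral>\<^sup>+y. ennreal (\<bar>f x\<bar> powr p) * indicator \<Omega> x * indicator {y. dist x y < d} y \<partial>lborel)"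
        using fz[of x] p0 by (cases "x \<in> \<Omega>") (auto simp: mball)
    qed
    also have "\<dots> \<le> (\<integral>\<^sup>+x. \<integral>\<^sup>+y. ennreal (2 powr p) * (ennreal (\<bar>f y - f x\<bar> powr p) * indicator UNIV x * indicator UNIV y * indicator {y. dist x y < d} y
       + ennreal (\<bar>f y\<bar> powr p) * indicator \<Omega> x) \<partial>lborel \<partial>lborel)"
    proof (intro nn_integral_mono)
      fix x y
      show "ennreal (\<bar>f x\<bar> powr p) * indicator \<Omega> x * indicator {y. dist x y < d} y \<le> ennreal (2 powr p) * (ennreal (\<bar>f y - f x\<bar> powr p) * indicator UNIV x * indicator UNIV y * indicator {y. dist x y < d} y
       + ennreal (\<bar>f y\<bar> powr p) * indicator \<Omega> x)"
        using ennreal_norm_add_powr_le[OF p0, of "f x - f y" "f y"] by (auto simp: indicator_def abs_minus_commute)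
    qed
    also have "\<dots> = ennreal (2 powr p) * ((\<integral>\<^sup>+x. \<integral>\<^sup>+y. ennreal (\<bar>f y - f x\<bar> powr p) * indicator UNIV x * indicator UNIV y * indicator {y. dist x y < d} y \<partial>lborel \<partial>lborel)
       + (\<integral>\<^sup>+x. \<integral>\<^sup>+y. ennreal (\<bar>f y\<bar> powr p) * indicator \<Omega> x \<partial>lborel \<partial>lborel))"
      by (subst nn_integral_cmult, measurable)+ (subst nn_integral_add, measurable)+
    also have "(\<integral>\<^sup>+x. \<integral>\<^sup>+y. ennreal (\<bar>f y\<bar> powr p) * indicator \<Omega> x \<partial>lborel \<partial>lborel) = ennreal I * ennreal w"
    proof -
      have "(\<integral>\<^sup>+y. ennreal (\<bar>f y\<bar> powr p) * indicator \<Omega> x \<partial>lborel) = ennreal I * indicator \<Omega> x" for x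
        by (subst nn_integral_multc) (auto simp: I)
      then show ?thesis using nn_integral_cmult_indicator[of \<Omega> lborel "ennreal I"] by (simp add: wO)
    qed
    also have "(\<integral>\<^sup>+x. \<integral>\<^sup>+y. ennreal (\<bar>f y - f x\<bar> powr p) * indicator UNIV x * indicator UNIV y * indicator {y. dist x y < d} y \<partial>lborel \<partial>lborel)
      \<le> ennreal (d powr p) * ennreal m * ennreal J"
      using double_integral_le[OF p1 sm convex_UNIV, of d] by (simp add: mB J)
    finally have "ennreal m * ennreal I \<le> ennreal (2 powr p) * (ennreal (d powr p) * ennreal m * ennreal J + ennreal I * ennreal w)"
      by (simp add: mult_left_mono add_mono)
    also have "\<dots> = ennreal (2 powr p * (d powr p * m * J + I * w))"
      using m0 IJ by (simp add: ennreal_mult ennreal_plus w_def)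
    finally have "m * I \<le> 2 powr p * (d powr p * m * J + I * w)"
      using m0 IJ by (subst (asm) ennreal_mult[symmetric]) (auto simp: ennreal_le_iff w_def)
    moreover have "I * (2 * 2 powr p * w + 1) \<le> I * m" using mw IJ by (intro mult_left_mono) auto
    ultimately have "m * I \<le> 2 * (2 powr p * d powr p * m * J)" using IJ by (simp add: algebra_simps)
    moreover have "m > 0" using mw by (smt (verit) w_def measure_nonneg mult_nonneg_nonneg powr_ge_zero)
    ultimately have "I \<le> 2 * 2 powr p * d powr p * J" by (simp add: field_simps)
    then show "pint p M f \<le> 2 * 2 powr p * d powr p * pint p M (classical_grad f)" by (simp add: I_def J_def)
  qed (use d in simp)
qed

lemma poincare:
  obtains C where "C > 0" "\<And>u G. is_W0 u G \<Longrightarrow> pint p M u \<le> C * pint p M G"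
proof -
  obtain C where C: "C > 0" "\<And>f. f \<in> test_functions \<Omega> \<Longrightarrow> pint p M f \<le> C * pint p M (classical_grad f)" using poincare_test by blast
  show ?thesis
  proof (rule that[OF C(1)])
    fix u G assume W: "is_W0 u G"
    obtain \<psi> where \<psi>: "\<And>n. \<psi> n \<in> test_functions \<Omega>" "Lp_conv p M \<psi> u" "Lp_conv p M (\<lambda>n. classical_grad (\<psi> n)) G" using is_W0E[OF W] by blast
    show "pint p M u \<le> C * pint p M G"
      by (rule LIMSEQ_le[OF Lp_conv_pint'[OF p1 \<psi>(2)] tendsto_mult[OF tendsto_const Lp_conv_pint'[OF p1 \<psi>(3)]]])
         (use C(2)[OF \<psi>(1)] in auto)
  qed
qed

end

subsection \<open>Rellich's compactness theorem\<close>

text \<open>Lower corner of the grid cube of mesh s that contains x. Cells depend on x through it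
  alone, so each mesh has only countably many.\<close>

definition cell_corner :: "real \<Rightarrow> 'a::euclidean_space \<Rightarrow> 'a" where
  "cell_corner s x = (\<Sum>b\<in>Basis. (s * real_of_int \<lfloor>x \<bullet> b / s\<rfloor>) *\<^sub>R b)"

definition cell :: "real \<Rightarrow> 'a::euclidean_space \<Rightarrow> 'a set" where
  "cell s x = cbox (cell_corner s x) (cell_corner s x + s *\<^sub>R One)"

text \<open>A step function determined by countably many cell integrals and close to f by
  \<open>cell_avg_error\<close>; this reduces compactness to sequences of numbers.\<close>

definition cell_avg :: "real \<Rightarrow> ('a::euclidean_space \<Rightarrow> real) \<Rightarrow> 'a \<Rightarrow> real" where
  "cell_avg s f x = (LINT y|lborel. indicat_real (cell s x) y * f y) / s ^ DIM('a)"

lemma mem_cell: "y \<in> cell s x \<longleftrightarrow> (\<forall>b\<in>Basis. s * real_of_int \<lfloor>x \<bullet> b / s\<rfloor> \<le> y \<bullet> b \<and> y \<bullet> b \<le> s * real_of_int \<lfloor>x \<bullet> b / s\<rfloor> + s)"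
  by (auto simp: cell_def cell_corner_def mem_box inner_sum_left inner_Basis inner_add_left if_distrib cong: if_cong)

lemma self_mem_cell: "s > 0 \<Longrightarrow> x \<in> cell s x"
proof -
  assume s: "s > 0"
  have "s * real_of_int \<lfloor>t / s\<rfloor> \<le> t" "t \<le> s * real_of_int \<lfloor>t / s\<rfloor> + s" for t
    using mult_left_mono[OF of_int_floor_le[of "t / s"], of s] mult_left_mono[OF real_of_int_floor_add_one_ge[of "t / s"], of s] s
    by (auto simp: algebra_simps)
  then show ?thesis by (simp add: mem_cell)
qed

lemma measure_cell: 
  assumes "s > 0" shows "measure lborel (cell s (x::'a::euclidean_space)) = s ^ DIM('a)" "emeasure lborel (cell s x) < \<infinity>"
proof -
  have "cell_corner s x \<bullet> b \<le> (cell_corner s x + s *\<^sub>R One) \<bullet> b" if "b \<in> Basis" for b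
    using assms that by (simp add: inner_add_left)
  then show "measure lborel (cell s x) = s ^ DIM('a)"
    unfolding cell_def by (subst measure_lborel_cbox) (auto simp: inner_add_left inner_diff_left)
  show "emeasure lborel (cell s x) < \<infinity>" unfolding cell_def by (rule emeasure_lborel_cbox_finite)
qed

lemma cell_dist:
  fixes x y :: "'a::euclidean_space"
  assumes s: "s > 0" and y: "y \<in> cell s x"
  shows "dist x y < 2 * real DIM('a) * s"
proof -
  have "dist x y \<le> (\<Sum>b\<in>Basis. \<bar>(x - y) \<bullet> b\<bar>)" unfolding dist_norm by (rule norm_le_l1)
  also have "\<dots> \<le> (\<Sum>b\<in>(Basis::'a set). s)"
  proof (rule sum_mono)
    fix b :: 'a assume b: "b \<in> Basis"
    show "\<bar>(x - y) \<bullet> b\<bar> \<le> s" using y self_mem_cell[OF s, of x] b unfolding mem_cell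
      by (auto simp: inner_diff_left abs_le_iff dest!: bspec[of _ _ b])
  qed
  \<comment> \<open>The factor 2 makes the inequality strict, as the strict distance condition of
    \<open>double_integral_le\<close> requires.\<close>
  also have "\<dots> < 2 * real DIM('a) * s" using s by simp
  finally show ?thesis .
qed

lemma cell_measurable[measurable]: "cell s x \<in> sets borel"
  by (simp add: cell_def)

lemma cell_avg_measurable[measurable]:
  fixes f :: "'a::euclidean_space \<Rightarrow> real"
  assumes [measurable]: "f \<in> borel_measurable borel"
  shows "cell_avg s f \<in> borel_measurable borel"
proof -
  have "(\<lambda>(x::'a, y::'a). indicat_real {z. \<forall>b\<in>Basis. s * real_of_int \<lfloor>fst z \<bullet> b / s\<rfloor> \<le> snd z \<bullet> b \<and> snd z \<bullet> b \<le> s * real_of_int \<lfloor>fst z \<bullet> b / s\<rfloor> + s} (x, y) * f y)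
     \<in> borel_measurable (lborel \<Otimes>\<^sub>M lborel)"
    by measurable
  then have "(\<lambda>(x::'a, y::'a). indicat_real (cell s x) y * f y) \<in> borel_measurable (lborel \<Otimes>\<^sub>M lborel)"
    by (rule measurable_cong[THEN iffD1, rotated]) (auto simp: indicator_def mem_cell)
  from lborel.borel_measurable_lebesgue_integral[OF this]
  show ?thesis unfolding cell_avg_def[abs_def] by simp
qed

lemma countable_cell_corners: "countable (range (cell_corner s :: 'a::euclidean_space \<Rightarrow> 'a))"
proof -
  have "range (cell_corner s :: 'a \<Rightarrow> 'a) \<subseteq> (\<lambda>k. \<Sum>b\<in>Basis. (s * real_of_int (k b)) *\<^sub>R b) ` (PiE (Basis::'a set) (\<lambda>_. UNIV :: int set))"
  proof
    fix z :: 'a assume "z \<in> range (cell_corner s)"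
    then obtain x where x: "z = cell_corner s x" by auto
    show "z \<in> (\<lambda>k. \<Sum>b\<in>Basis. (s * real_of_int (k b)) *\<^sub>R b) ` (PiE (Basis::'a set) (\<lambda>_. UNIV :: int set))"
    proof (rule image_eqI[of _ _ "restrict (\<lambda>b. \<lfloor>x \<bullet> b / s\<rfloor>) Basis"])
      show "z = (\<Sum>b\<in>Basis. (s * real_of_int (restrict (\<lambda>b. \<lfloor>x \<bullet> b / s\<rfloor>) Basis b)) *\<^sub>R b)"
        unfolding x cell_corner_def by (rule sum.cong) auto
    qed auto
  qed
  then show ?thesis by (rule countable_subset) (intro countable_image countable_PiE finite_Basis countableI_type)
qed

lemma ball_measure_le:
  assumes "d > 0"
  shows "emeasure lborel (ball (0::'a::euclidean_space) d) \<le> ennreal ((2 * d) ^ DIM('a))"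
proof -
  have "ball (0::'a) d \<subseteq> cbox (- d *\<^sub>R One) (d *\<^sub>R One)"
  proof
    fix x :: 'a assume "x \<in> ball 0 d"
    then have "\<bar>x \<bullet> b\<bar> \<le> d" if "b \<in> Basis" for b using Basis_le_norm[OF that, of x] by simp
    then show "x \<in> cbox (- d *\<^sub>R One) (d *\<^sub>R One)" by (auto simp: mem_box abs_le_iff) (smt (verit))+
  qed
  then have "emeasure lborel (ball (0::'a) d) \<le> emeasure lborel (cbox (- d *\<^sub>R One) (d *\<^sub>R (One::'a)))"
    by (intro emeasure_mono) auto
  also have "\<dots> = ennreal ((2 * d) ^ DIM('a))"
  proof -
    have "(\<Prod>b\<in>Basis. (d *\<^sub>R (One::'a) - (- d *\<^sub>R One)) \<bullet> b) = (\<Prod>b\<in>(Basis::'a set). 2 * d)"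
      by (rule prod.cong) (auto simp: inner_diff_left inner_add_left)
    then show ?thesis using assms by (subst emeasure_lborel_cbox) auto
  qed
  finally show ?thesis .
qed

text \<open>By Jensen's inequality the p-th power of the error at x is at most the mean of |f x - f
  y|^p over the cell, and \<open>double_integral_le\<close> applies with d = 2 D s, where D is the
  dimension. The ball of radius d lies in a cube of side 4 D s, whose volume is (4 D)^D times that
  of the cell; the cell volume cancels and the power of s remains.\<close>

lemma (in sobolev) cell_avg_error:
  assumes f: "f \<in> test_functions \<Omega>" and s: "s > 0"
  shows "pint p M (\<lambda>x. f x - cell_avg s f x) \<le> (2 * real DIM('a) * s) powr p * (4 * real DIM('a)) ^ DIM('a) * pint p M (classical_grad f)"
    "(\<lambda>x. f x - cell_avg s f x) \<in> Lp_fun p M"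
proof -
  let ?D = "real DIM('a)"
  define d where "d = 2 * ?D * s"
  have d: "d > 0" using s by (simp add: d_def)
  obtain K where K: "\<And>k. C_k k f" "compact K" "K \<subseteq> \<Omega>" "\<And>x. x \<notin> K \<Longrightarrow> f x = 0" using test_functionE[OF f] by blast
  note sm = K(1)
  have cf: "continuous_on UNIV f" using C_k_continuous[OF sm] .
  have [measurable]: "f \<in> borel_measurable borel" using cf borel_measurable_continuous_onI by auto
  obtain B where B: "B > 0" "\<And>x. \<bar>f x\<bar> \<le> B" "\<And>x. norm (classical_grad f x) \<le> B" using test_bounded[OF f] by blast
  define m where "m = s ^ DIM('a)"
  have m: "m > 0" using s by (simp add: m_def)
  have pw: "\<bar>f x - cell_avg s f x\<bar> powr p \<le> (1 / m) * (LINT y|lborel. indicat_real (cell s x) y * \<bar>f x - f y\<bar> powr p)"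
    and pwi: "integrable lborel (\<lambda>y. indicat_real (cell s x) y * \<bar>f x - f y\<bar> powr p)" for x
  proof -
    have ci: "integrable lborel (\<lambda>y. c * indicat_real (cell s x) y)" for c
      using measure_cell(2)[OF s, of x] by (intro integrable_mult_right integrable_real_indicator) auto
    have fi: "integrable lborel (\<lambda>y. indicat_real (cell s x) y * f y)"
      by (rule Bochner_Integration.integrable_bound[OF ci[of B]]) (use B in \<open>auto simp: indicator_def\<close>)
    have "(LINT y|lborel. indicat_real (cell s x) y *\<^sub>R (f x - f y)) = (LINT y|lborel. f x * indicat_real (cell s x) y - indicat_real (cell s x) y * f y)"
      by (simp add: algebra_simps)
    also have "\<dots> = (LINT y|lborel. f x * indicat_real (cell s x) y) - (LINT y|lborel. indicat_real (cell s x) y * f y)"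
      by (rule Bochner_Integration.integral_diff[OF ci fi])
    also have "\<dots> = m * (f x - cell_avg s f x)"
      using measure_cell[OF s, of x] m by (simp add: cell_avg_def m_def[symmetric] field_simps)
    finally have e: "(LINT y|lborel. indicat_real (cell s x) y *\<^sub>R (f x - f y)) = m * (f x - cell_avg s f x)" .
    have Bx: "\<bar>f x - f y\<bar> \<le> 2 * B" for y using B(2)[of x] B(2)[of y] by linarith
    have L: "(\<lambda>y. indicat_real (cell s x) y *\<^sub>R (f x - f y)) \<in> Lp_fun p lborel"
    proof -
      have eq: "norm (indicat_real (cell s x) y *\<^sub>R (f x - f y)) powr p = indicat_real (cell s x) y * \<bar>f x - f y\<bar> powr p" for y
        by (auto simp: indicator_def)
      have "integrable lborel (\<lambda>y. indicat_real (cell s x) y * \<bar>f x - f y\<bar> powr p)"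
        by (rule Bochner_Integration.integrable_bound[OF ci[of "(2 * B) powr p"]])
          (use Bx p0 in \<open>auto simp: indicator_def intro!: powr_mono2\<close>)
      then show ?thesis by (simp only: Lp_fun_def mem_Collect_eq eq) measurable
    qed
    have eq: "norm (indicat_real (cell s x) y *\<^sub>R (f x - f y)) powr p = indicat_real (cell s x) y * \<bar>f x - f y\<bar> powr p" for y
      by (auto simp: indicator_def)
    show "integrable lborel (\<lambda>y. indicat_real (cell s x) y * \<bar>f x - f y\<bar> powr p)"
      using Lp_fun_integrable[OF L] unfolding eq .
    have "m powr p * \<bar>f x - cell_avg s f x\<bar> powr p = norm (LINT y|lborel. indicat_real (cell s x) y *\<^sub>R (f x - f y)) powr p"
      unfolding e using m by (simp add: powr_mult abs_mult)
    also have "\<dots> \<le> m powr (p - 1) * pint p lborel (\<lambda>y. indicat_real (cell s x) y *\<^sub>R (f x - f y))"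
      using Holder_set[OF p1 _ measure_cell(2)[OF s] L] measure_cell(1)[OF s, of x] by (simp add: m_def)
    also have "pint p lborel (\<lambda>y. indicat_real (cell s x) y *\<^sub>R (f x - f y)) = (LINT y|lborel. indicat_real (cell s x) y * \<bar>f x - f y\<bar> powr p)"
      unfolding pint_def eq ..
    finally show "\<bar>f x - cell_avg s f x\<bar> powr p \<le> (1 / m) * (LINT y|lborel. indicat_real (cell s x) y * \<bar>f x - f y\<bar> powr p)"
      using m by (simp add: powr_diff field_simps)
  qed
  have "(\<integral>\<^sup>+x. ennreal (\<bar>f x - cell_avg s f x\<bar> powr p) \<partial>lborel) \<le>
     (\<integral>\<^sup>+x. ennreal (1/m) * (\<integral>\<^sup>+y. ennreal (\<bar>f y - f x\<bar> powr p) * indicator UNIV x * indicator UNIV y * indicator {y. dist x y < d} y \<partial>lborel) \<partial>lborel)"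
  proof (rule nn_integral_mono)
    fix x
    have "ennreal (\<bar>f x - cell_avg s f x\<bar> powr p) \<le> ennreal ((1 / m) * (LINT y|lborel. indicat_real (cell s x) y * \<bar>f x - f y\<bar> powr p))"
      using pw by (rule ennreal_leI)
    also have "\<dots> = ennreal (1/m) * (\<integral>\<^sup>+y. ennreal (indicat_real (cell s x) y * \<bar>f x - f y\<bar> powr p) \<partial>lborel)"
      using m by (subst nn_integral_eq_integral[OF pwi]) (auto simp: ennreal_mult'[symmetric] intro!: AE_I2)
    also have "\<dots> \<le> ennreal (1/m) * (\<integral>\<^sup>+y. ennreal (\<bar>f y - f x\<bar> powr p) * indicator UNIV x * indicator UNIV y * indicator {y. dist x y < d} y \<partial>lborel)"
      using cell_dist[OF s, of _ x] unfolding d_def[symmetric]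
      by (intro mult_left_mono nn_integral_mono) (auto simp: indicator_def abs_minus_commute)
    finally show "ennreal (\<bar>f x - cell_avg s f x\<bar> powr p) \<le> ennreal (1/m) * (\<integral>\<^sup>+y. ennreal (\<bar>f y - f x\<bar> powr p) * indicator UNIV x * indicator UNIV y * indicator {y. dist x y < d} y \<partial>lborel)" .
  qed
  also have "\<dots> = ennreal (1/m) * (\<integral>\<^sup>+x. (\<integral>\<^sup>+y. ennreal (\<bar>f y - f x\<bar> powr p) * indicator UNIV x * indicator UNIV y * indicator {y. dist x y < d} y \<partial>lborel) \<partial>lborel)"
    by (rule nn_integral_cmult) measurable
  also have "\<dots> \<le> ennreal (1/m) * (ennreal (d powr p) * emeasure lborel (ball (0::'a) d) * (\<integral>\<^sup>+x. ennreal (norm (classical_grad f x) powr p) * indicator UNIV x \<partial>lborel))"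
    by (intro mult_left_mono double_integral_le[OF p1 sm]) auto
  also have "(\<integral>\<^sup>+x. ennreal (norm (classical_grad f x) powr p) * indicator UNIV x \<partial>lborel) = ennreal (pint p M (classical_grad f))"
    using pint_M_test(2)[OF f] by simp
  also have "ennreal (1/m) * (ennreal (d powr p) * emeasure lborel (ball (0::'a) d) * ennreal (pint p M (classical_grad f)))
     \<le> ennreal (1/m) * (ennreal (d powr p) * ennreal ((2 * d) ^ DIM('a)) * ennreal (pint p M (classical_grad f)))"
    by (intro mult_left_mono mult_right_mono ball_measure_le d) auto
  also have "\<dots> = ennreal ((1/m) * (d powr p * (2 * d) ^ DIM('a) * pint p M (classical_grad f)))"
    using m d by (simp add: ennreal_mult''[symmetric] algebra_simps)
  also have "(1/m) * (d powr p * (2 * d) ^ DIM('a) * pint p M (classical_grad f)) = (2 * ?D * s) powr p * (4 * ?D) ^ DIM('a) * pint p M (classical_grad f)"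
  proof -
    have "(2 * d) ^ DIM('a) = (4 * ?D) ^ DIM('a) * m" 
    proof -
      have "2 * d = (4 * ?D) * s" by (simp add: d_def)
      then show ?thesis by (simp only: power_mult_distrib m_def)
    qed
    then show ?thesis using m by (simp add: d_def)
  qed
  finally have est: "(\<integral>\<^sup>+x. ennreal (\<bar>f x - cell_avg s f x\<bar> powr p) \<partial>lborel) \<le> ennreal ((2 * ?D * s) powr p * (4 * ?D) ^ DIM('a) * pint p M (classical_grad f))" .
  have I: "integrable lborel (\<lambda>x. \<bar>f x - cell_avg s f x\<bar> powr p)"
    using order.strict_trans1[OF est ennreal_less_top] by (subst integrable_iff_bounded) auto
  then have "(\<lambda>x. f x - cell_avg s f x) \<in> Lp_fun p lborel" by (simp add: Lp_fun_def)
  then show L: "(\<lambda>x. f x - cell_avg s f x) \<in> Lp_fun p M" by (rule Lp_lborel_on[OF _ Omega_sets])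
  have "pint p M (\<lambda>x. f x - cell_avg s f x) = (LINT x|lebesgue. indicat_real \<Omega> x *\<^sub>R \<bar>f x - cell_avg s f x\<bar> powr p)"
    unfolding pint_def using Omega_sets by (subst integral_restrict_space) auto
  also have "\<dots> \<le> (LINT x|lebesgue. \<bar>f x - cell_avg s f x\<bar> powr p)"
  proof (rule integral_mono)
    show I': "integrable lebesgue (\<lambda>x. \<bar>f x - cell_avg s f x\<bar> powr p)" using I by (simp add: integrable_completion)
    show "integrable lebesgue (\<lambda>x. indicat_real \<Omega> x *\<^sub>R \<bar>f x - cell_avg s f x\<bar> powr p)"
      by (rule integrable_mult_indicator[OF Omega_sets I'])
  qed (auto simp: indicator_def)
  also have "\<dots> = (LINT x|lborel. \<bar>f x - cell_avg s f x\<bar> powr p)" by (rule integral_completion) measurable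
  also have "\<dots> \<le> (2 * ?D * s) powr p * (4 * ?D) ^ DIM('a) * pint p M (classical_grad f)"
  proof -
    have "ennreal (LINT x|lborel. \<bar>f x - cell_avg s f x\<bar> powr p) \<le> ennreal ((2 * ?D * s) powr p * (4 * ?D) ^ DIM('a) * pint p M (classical_grad f))"
      using est nn_integral_eq_integral[OF I] by simp
    then show ?thesis by (subst (asm) ennreal_le_iff) auto
  qed
  finally show "pint p M (\<lambda>x. f x - cell_avg s f x) \<le> (2 * ?D * s) powr p * (4 * ?D) ^ DIM('a) * pint p M (classical_grad f)" .
qed

text \<open>
  A diagonal subsequence makes the averages over the countably many cells of all sizes \<open>1/(j+1)\<close> converge; for fixed \<open>j\<close>
  they are uniformly bounded and \<open>\<Omega>\<close> has finite measure, so dominated convergence applies.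
\<close>

lemma (in sobolev) rellich_test:
  fixes \<psi> :: "nat \<Rightarrow> 'a \<Rightarrow> real"
  assumes \<psi>: "\<And>n. \<psi> n \<in> test_functions \<Omega>" and B: "\<And>n. pint p M (\<psi> n) \<le> B" "\<And>n. pint p M (classical_grad (\<psi> n)) \<le> B"
  obtains r :: "nat \<Rightarrow> nat" and f where "strict_mono r" "Lp_conv p M (\<lambda>n. \<psi> (r n)) f"
proof -
  let ?D = "real DIM('a)"
  define s where "s j = inverse (real (Suc j))" for j
  have s: "s j > 0" "s j \<le> 1" for j by (auto simp: s_def field_simps)
  have s0: "s \<longlonglongrightarrow> 0" unfolding s_def by (rule LIMSEQ_inverse_real_of_nat)
  have B0: "B \<ge> 0" by (rule order_trans[OF pint_nonneg B(1)[of 0]])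
  note sm = test_smooth[OF \<psi>]
  have [measurable]: "\<psi> n \<in> borel_measurable borel" for n using C_k_continuous[OF sm] borel_measurable_continuous_onI by auto
  \<comment> \<open>The index is the pair of level and corner instead of a point: this leaves
    countably many cell integrals, as a diagonal argument requires.\<close>
  define I where "I n = (\<lambda>(j, z). LINT y|lborel. indicat_real (cbox z (z + s j *\<^sub>R One)) y * \<psi> n y)" for n
  define T :: "(nat \<times> 'a) set" where "T = (SIGMA j:UNIV. range (cell_corner (s j)))"
  have cT: "countable T" unfolding T_def by (intro countable_SIGMA countable_cell_corners) auto
  have Icell: "I n (j, cell_corner (s j) x) = (LINT y|lborel. indicat_real (cell (s j) x) y * \<psi> n y)" for n j x
    by (simp add: I_def cell_def)
  \<comment> \<open>A cell has measure at most 1, because \<open>s j\<close> is at most 1, so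
    Jensen's inequality bounds the p-th power of the cell integral by B. A nonnegative number whose
    p-th power is at most B is at most 1 + B.\<close>
  have bI: "norm (I n z) \<le> 1 + B" if zT: "z \<in> T" for n z
  proof -
    obtain j x where z: "z = (j, cell_corner (s j) x)" using zT by (auto simp: T_def)
    have L: "(\<lambda>y. indicat_real (cell (s j) x) y *\<^sub>R \<psi> n y) \<in> Lp_fun p lborel"
      by (rule Lp_fun_dom[OF _ test_Lp(3)[OF \<psi> p0 Omega_sets] p0]) (auto simp: indicator_def)
    have "norm (LINT y|lborel. indicat_real (cell (s j) x) y *\<^sub>R \<psi> n y) powr p \<le>
      measure lborel (cell (s j) x) powr (p - 1) * pint p lborel (\<lambda>y. indicat_real (cell (s j) x) y *\<^sub>R \<psi> n y)"
      by (rule Holder_set[OF p1 _ measure_cell(2)[OF s(1)] L]) simp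
    also have "\<dots> \<le> 1 * B"
    proof (rule mult_mono)
      have "measure lborel (cell (s j) x) \<le> 1" using s[of j] by (simp add: measure_cell(1)[OF s(1)] power_le_one)
      then have "measure lborel (cell (s j) x) powr (p - 1) \<le> 1 powr (p - 1)" using p1 by (intro powr_mono2) auto
      then show "measure lborel (cell (s j) x) powr (p - 1) \<le> 1" by simp
      have "pint p lborel (\<lambda>y. indicat_real (cell (s j) x) y *\<^sub>R \<psi> n y) \<le> pint p lborel (\<psi> n)"
        by (rule pint_mono[OF Lp_fun_measurable[OF L] test_Lp(3)[OF \<psi> p0 Omega_sets] p0]) (auto simp: indicator_def)
      also have "ennreal (pint p lborel (\<psi> n)) = ennreal (pint p M (\<psi> n))"
        using nn_integral_eq_integral[OF Lp_fun_integrable[OF test_Lp(3)[OF \<psi> p0 Omega_sets]]] pint_M_test(1)[OF \<psi>, of n] by (simp add: pint_def)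
      then have "pint p lborel (\<psi> n) = pint p M (\<psi> n)" by simp
      finally show "pint p lborel (\<lambda>y. indicat_real (cell (s j) x) y *\<^sub>R \<psi> n y) \<le> B" using B(1)[of n] by simp
    qed auto
    finally have *: "\<bar>I n z\<bar> powr p \<le> B" by (simp add: z Icell)
    show ?thesis
    proof (cases "\<bar>I n z\<bar> \<le> 1")
      case False
      then have "\<bar>I n z\<bar> powr 1 \<le> \<bar>I n z\<bar> powr p" using p1 by (intro powr_mono) auto
      with * show ?thesis by simp
    qed (use B0 in simp)
  qed
  obtain r where r: "strict_mono r" "\<And>z. z \<in> T \<Longrightarrow> \<exists>l. (\<lambda>n. I (r n) z) \<longlonglongrightarrow> l"
    using function_convergent_subsequence[of T I "1 + B", OF cT bI] by blast
  define P where "P j n = cell_avg (s j) (\<psi> (r n))" for j n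
  have Pc: "convergent (\<lambda>n. P j n x)" for j x
  proof -
    obtain l where "(\<lambda>n. I (r n) (j, cell_corner (s j) x)) \<longlonglongrightarrow> l" using r(2)[of "(j, cell_corner (s j) x)"] by (auto simp: T_def)
    then have "(\<lambda>n. I (r n) (j, cell_corner (s j) x) / s j ^ DIM('a)) \<longlonglongrightarrow> l / s j ^ DIM('a)"
      by (intro tendsto_intros) (use s[of j] in auto)
    then show ?thesis by (auto simp: P_def cell_avg_def Icell convergent_def)
  qed
  have Pb: "\<bar>P j n x\<bar> \<le> (1 + B) / s j ^ DIM('a)" for j n x
    using bI[of "(j, cell_corner (s j) x)" "r n"] s[of j] by (simp add: P_def cell_avg_def Icell T_def divide_right_mono)
  define g where "g j x = lim (\<lambda>n. P j n x)" for j x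
  have mP: "P j n \<in> borel_measurable M" for j n unfolding P_def by (rule borel_lebesgue_on) measurable
  have PL: "Lp_conv p M (P j) (g j)" for j
  proof (rule Lp_conv_dominated[OF p0 mP])
    show "g j \<in> borel_measurable M" unfolding g_def by (rule borel_measurable_lim_metric) (rule mP)
    show "(\<lambda>x. (1 + B) / s j ^ DIM('a)) \<in> Lp_fun p M" by (simp add: Lp_fun_def const_int)
    show "AE x in M. norm (P j n x) \<le> norm ((1 + B) / s j ^ DIM('a))" for n
      by (intro AE_I2) (simp only: real_norm_def order_trans[OF Pb abs_ge_self])
    show "AE x in M. (\<lambda>n. P j n x) \<longlonglongrightarrow> g j x" using Pc by (simp add: g_def convergent_LIMSEQ_iff)
  qed
  define C where "C = (4 * ?D) ^ DIM('a) * B"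
  have err: "Lp_nrm p M (\<lambda>x. \<psi> (r n) x - P j n x) \<le> (C powr (1/p) * (2 * ?D)) * s j" for j n
  proof -
    have "pint p M (\<lambda>x. \<psi> (r n) x - P j n x) \<le> (2 * ?D * s j) powr p * (4 * ?D) ^ DIM('a) * pint p M (classical_grad (\<psi> (r n)))"
      unfolding P_def by (rule cell_avg_error(1)[OF \<psi> s(1)])
    also have "\<dots> \<le> (2 * ?D * s j) powr p * C" unfolding C_def mult.assoc[symmetric]
      by (intro mult_left_mono B) auto
    finally have "Lp_nrm p M (\<lambda>x. \<psi> (r n) x - P j n x) \<le> ((2 * ?D * s j) powr p * C) powr (1/p)"
      unfolding Lp_nrm_def using p0 by (intro powr_mono2) auto
    also have "\<dots> = (C powr (1/p) * (2 * ?D)) * s j"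
      using p0 s[of j] by (simp add: powr_mult powr_powr)
    finally show ?thesis .
  qed
  have LP: "\<psi> n \<in> Lp_fun p M" for n by (rule test_Lp'(1)[OF \<psi> p0])
  have "\<exists>N. \<forall>m\<ge>N. \<forall>n\<ge>N. pint p M (\<lambda>x. \<psi> (r m) x - \<psi> (r n) x) < e" if e: "e > 0" for e
  proof -
    \<comment> \<open>The estimate runs in norms, where the triangle inequality holds, while the
      Cauchy criterion of \<open>Lp_complete\<close> is stated for p-th powers.\<close>
    define e' where "e' = e powr (1/p)"
    have e': "e' > 0" using e by (simp add: e'_def)
    have "(\<lambda>j. (C powr (1/p) * (2 * ?D)) * s j) \<longlonglongrightarrow> (C powr (1/p) * (2 * ?D)) * 0"
      by (intro tendsto_intros s0)
    then have "\<forall>\<^sub>F j in sequentially. (C powr (1/p) * (2 * ?D)) * s j < e' / 4" by (rule order_tendstoD) (use e' in simp)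
    then obtain j where j: "(C powr (1/p) * (2 * ?D)) * s j < e' / 4" by (auto simp: eventually_sequentially)
    have "\<forall>\<^sub>F n in sequentially. Lp_nrm p M (\<lambda>x. P j n x - g j x) < e' / 4"
      using Lp_convD(3)[OF PL] by (rule order_tendstoD) (use e' in simp)
    then obtain N where N: "\<And>n. n \<ge> N \<Longrightarrow> Lp_nrm p M (\<lambda>x. P j n x - g j x) < e' / 4" by (auto simp: eventually_sequentially)
    have "pint p M (\<lambda>x. \<psi> (r m) x - \<psi> (r n) x) < e" if mn: "m \<ge> N" "n \<ge> N" for m n
    proof -
      have t1: "Lp_nrm p M (\<lambda>x. \<psi> (r m) x - g j x) < e' / 2" if "m \<ge> N" for m
        using Minkowski_triangle[OF p1 LP[of "r m"] Lp_convD(1)[OF PL, of j m] Lp_convD(2)[OF PL, of j]] err[of m j] N[OF that] j by linarith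
      have "Lp_nrm p M (\<lambda>x. \<psi> (r m) x - \<psi> (r n) x) < e'"
        using Minkowski_triangle[OF p1 LP[of "r m"] Lp_convD(2)[OF PL, of j] LP[of "r n"]] t1[OF mn(1)] t1[OF mn(2)]
        by (simp add: Lp_nrm_minus_commute[of p M "g j"])
      then have "Lp_nrm p M (\<lambda>x. \<psi> (r m) x - \<psi> (r n) x) powr p < e' powr p" using p0 by (intro powr_less_mono2) auto
      then show ?thesis using p0 e by (simp add: Lp_nrm_powr e'_def powr_powr)
    qed
    then show ?thesis by blast
  qed
  then obtain f where "Lp_conv p M (\<lambda>n. \<psi> (r n)) f" using Lp_complete[OF p1, of "\<lambda>n. \<psi> (r n)" M] LP by blast
  with r(1) that show ?thesis by blast
qed

text \<open>Every \<open>v n\<close> is replaced by a test function at distance below 1/(n+1) in L^p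
  with energy below B + 1, which does not affect the limit. Poincare's inequality supplies the bound
  on the norms.\<close>

lemma (in sobolev) rellich:
  fixes v :: "nat \<Rightarrow> 'a \<Rightarrow> real"
  assumes W: "\<And>n. is_W0 (v n) (G n)" and B: "\<And>n. pint p M (G n) \<le> B"
  obtains r :: "nat \<Rightarrow> nat" and f where "strict_mono r" "Lp_conv p M (\<lambda>n. v (r n)) f"
proof -
  obtain C where C: "C > 0" "\<And>u G. is_W0 u G \<Longrightarrow> pint p M u \<le> C * pint p M G" using poincare by blast
  have B0: "B \<ge> 0" by (rule order_trans[OF pint_nonneg B[of 0]])
  have "\<exists>\<psi>. \<psi> \<in> test_functions \<Omega> \<and> Lp_nrm p M (\<lambda>x. \<psi> x - v n x) < inverse (real (Suc n)) \<and> pint p M (classical_grad \<psi>) < B + 1" for n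
  proof -
    obtain \<psi> where \<psi>: "\<And>n. \<psi> n \<in> test_functions \<Omega>" "Lp_conv p M \<psi> (v n)" "Lp_conv p M (\<lambda>n. classical_grad (\<psi> n)) (G n)" using is_W0E[OF W] by blast
    have 1: "\<forall>\<^sub>F k in sequentially. Lp_nrm p M (\<lambda>x. \<psi> k x - v n x) < inverse (real (Suc n))"
      using Lp_convD(3)[OF \<psi>(2)] by (rule order_tendstoD) simp
    have 2: "\<forall>\<^sub>F k in sequentially. pint p M (classical_grad (\<psi> k)) < B + 1"
      using Lp_conv_pint'[OF p1 \<psi>(3)] by (rule order_tendstoD) (use B[of n] in simp)
    obtain k where "Lp_nrm p M (\<lambda>x. \<psi> k x - v n x) < inverse (real (Suc n))" "pint p M (classical_grad (\<psi> k)) < B + 1"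
      using eventually_happens[OF eventually_conj[OF 1 2]] by auto
    with \<psi>(1) show ?thesis by blast
  qed
  then obtain \<psi> where \<psi>: "\<And>n. \<psi> n \<in> test_functions \<Omega>" "\<And>n. Lp_nrm p M (\<lambda>x. \<psi> n x - v n x) < inverse (real (Suc n))" "\<And>n. pint p M (classical_grad (\<psi> n)) < B + 1"
    by metis
  have b: "pint p M (\<psi> n) \<le> (C + 1) * (B + 1)" "pint p M (classical_grad (\<psi> n)) \<le> (C + 1) * (B + 1)" for n
  proof -
    have "pint p M (\<psi> n) \<le> C * pint p M (classical_grad (\<psi> n))" by (rule C(2)[OF is_W0_test[OF \<psi>(1)]])
    also have "\<dots> \<le> (C + 1) * (B + 1)" using \<psi>(3)[of n] C(1) by (intro mult_mono) auto
    finally show "pint p M (\<psi> n) \<le> (C + 1) * (B + 1)" .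
    have "1 * pint p M (classical_grad (\<psi> n)) \<le> (C + 1) * (B + 1)" using \<psi>(3)[of n] C(1) B0 by (intro mult_mono) auto
    then show "pint p M (classical_grad (\<psi> n)) \<le> (C + 1) * (B + 1)" by simp
  qed
  obtain r f where r: "strict_mono r" "Lp_conv p M (\<lambda>n. \<psi> (r n)) f" using rellich_test[of \<psi> "(C + 1) * (B + 1)", OF \<psi>(1) b] by blast
  have "Lp_conv p M (\<lambda>n. v (r n)) f"
  proof (rule Lp_conv_sandwich)
    have "(\<lambda>n. inverse (real (Suc (r n)))) \<longlonglongrightarrow> 0"
      using LIMSEQ_subseq_LIMSEQ[OF LIMSEQ_inverse_real_of_nat r(1)] unfolding o_def .
    from tendsto_add[OF this Lp_convD(3)[OF r(2)]]
    show "(\<lambda>n. inverse (real (Suc (r n))) + Lp_nrm p M (\<lambda>x. \<psi> (r n) x - f x)) \<longlonglongrightarrow> 0" by simp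
    show "v (r n) \<in> Lp_fun p M" for n by (rule is_W0_Lp(1)[OF W])
    show "f \<in> Lp_fun p M" by (rule Lp_convD(2)[OF r(2)])
    have "Lp_nrm p M (\<lambda>x. v (r n) x - f x) \<le> inverse (real (Suc (r n))) + Lp_nrm p M (\<lambda>x. \<psi> (r n) x - f x)" for n
      using Minkowski_triangle[OF p1 is_W0_Lp(1)[OF W, of "r n"] Lp_convD(1)[OF r(2), of n] Lp_convD(2)[OF r(2)]] \<psi>(2)[of "r n"]
      by (simp add: Lp_nrm_minus_commute[of p M "v (r n)"])
    then show "\<forall>\<^sub>F n in sequentially. Lp_nrm p M (\<lambda>x. v (r n) x - f x) \<le> inverse (real (Suc (r n))) + Lp_nrm p M (\<lambda>x. \<psi> (r n) x - f x)" by simp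
  qed
  with r(1) that show ?thesis by blast
qed

subsection \<open>The strong maximum principle\<close>

lemma C_k_ln:
  assumes "\<And>k. C_k k f" "\<And>x. f x > 0"
  shows "C_k k (\<lambda>x. ln (f x))"
proof (cases k)
  case 0
  have "continuous_on UNIV (\<lambda>x. ln (f x))"
    using assms(2) C_k_continuous[OF assms(1)] by (intro continuous_on_ln) (auto simp: less_imp_neq[symmetric])
  then show ?thesis using 0 by simp
next
  case (Suc j)
  show ?thesis unfolding Suc
  proof (rule C_k_SucI)
    show "((\<lambda>x. ln (f x)) has_derivative (\<lambda>h. f x powr (-1) * frechet_derivative f (at x) h)) (at x)" for x
    proof -
      have "(ln has_real_derivative f x powr (-1)) (at (f x))"
        using DERIV_ln_divide[OF assms(2)[of x]] assms(2)[of x] by (simp add: powr_minus_divide)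
      from has_derivative_compose[OF C_k_has_derivative[OF assms(1), of x] this[unfolded has_field_derivative_def]]
      show ?thesis by (simp add: mult.commute)
    qed
    show "C_k j (\<lambda>x. f x powr (-1) * frechet_derivative f (at x) b)" if "b \<in> Basis" for b
      by (intro C_k_mult C_k_powr assms C_k_SucD[OF assms(1) that])
  qed
qed

text \<open>Composition with \<open>max 0\<close> extends a function controlled only on
  \<open>{0..}\<close> to a Lipschitz function on the line, as the chain rule asks.\<close>

lemma has_derivative_mono_lipschitz:
  fixes F :: "real \<Rightarrow> real"
  assumes "\<And>t. t \<ge> 0 \<Longrightarrow> (F has_real_derivative F' t) (at t)" "\<And>t. t \<ge> 0 \<Longrightarrow> \<bar>F' t\<bar> \<le> L"
  shows "\<bar>F (max 0 a) - F (max 0 b)\<bar> \<le> L * \<bar>a - b\<bar>"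
proof -
  have L: "L \<ge> 0" using assms(2)[of 0] by linarith
  have "\<bar>F (max 0 a) - F (max 0 b)\<bar> \<le> L * \<bar>max 0 a - max 0 b\<bar>"
    using field_differentiable_bound[of "{0..}" F F' L "max 0 a" "max 0 b"] assms
    by (auto intro: has_field_derivative_at_within)
  also have "\<dots> \<le> L * \<bar>a - b\<bar>" using L by (intro mult_left_mono) (auto simp: max_def)
  finally show ?thesis .
qed

context sobolev begin

lemma pint_M_test_ind:
  assumes f: "f \<in> test_functions \<Omega>" and S: "S \<in> sets borel" "S \<subseteq> \<Omega>"
  shows "ennreal (pint p M (\<lambda>x. indicat_real S x *\<^sub>R f x)) = (\<integral>\<^sup>+x. ennreal (\<bar>f x\<bar> powr p) * indicator S x \<partial>lborel)"
    "ennreal (pint p M (\<lambda>x. indicat_real S x *\<^sub>R classical_grad f x)) = (\<integral>\<^sup>+x. ennreal (norm (classical_grad f x) powr p) * indicator S x \<partial>lborel)"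
proof -
  note [measurable] = S(1)
  have gen: "ennreal (pint p M (\<lambda>x. indicat_real S x *\<^sub>R g x)) = (\<integral>\<^sup>+x. ennreal (norm (g x) powr p) * indicator S x \<partial>lborel)"
    if g: "g \<in> Lp_fun p lborel" for g :: "'a \<Rightarrow> 'v::euclidean_space"
  proof -
    have [measurable]: "g \<in> borel_measurable borel" using Lp_fun_measurable[OF g] by simp
    have L: "(\<lambda>x. indicat_real S x *\<^sub>R g x) \<in> Lp_fun p lborel"
      by (rule Lp_fun_dom[OF _ g p0]) (auto simp: indicator_def)
    have "pint p M (\<lambda>x. indicat_real S x *\<^sub>R g x) = pint p lborel (\<lambda>x. indicat_real S x *\<^sub>R g x)"
      unfolding pint_def by (rule integral_lebesgue_on_lborel[OF _ _ Omega_sets]) (use S(2) in \<open>auto simp: indicator_def\<close>)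
    also have "ennreal \<dots> = (\<integral>\<^sup>+x. ennreal (norm (indicat_real S x *\<^sub>R g x) powr p) \<partial>lborel)"
      unfolding pint_def by (rule nn_integral_eq_integral[symmetric, OF Lp_fun_integrable[OF L]]) simp
    also have "\<dots> = (\<integral>\<^sup>+x. ennreal (norm (g x) powr p) * indicator S x \<partial>lborel)"
      by (intro nn_integral_cong) (auto simp: indicator_def)
    finally show ?thesis .
  qed
  show "ennreal (pint p M (\<lambda>x. indicat_real S x *\<^sub>R f x)) = (\<integral>\<^sup>+x. ennreal (\<bar>f x\<bar> powr p) * indicator S x \<partial>lborel)"
    using gen[OF test_Lp(3)[OF f p0 Omega_sets]] by simp
  show "ennreal (pint p M (\<lambda>x. indicat_real S x *\<^sub>R classical_grad f x)) = (\<integral>\<^sup>+x. ennreal (norm (classical_grad f x) powr p) * indicator S x \<partial>lborel)"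
    using gen[OF test_Lp(4)[OF f p0 Omega_sets]] by simp
qed

text \<open>The inequality |f x| \<le> |f y - f x| + |f y| is integrated over x in the ball and y in
  \<open>Z\<close>; points of the ball are less than 2 r apart. In the application \<open>Z\<close>
  consists of zeros, and the last term disappears.\<close>

lemma local_poincare_test:
  assumes f: "f \<in> test_functions \<Omega>" and r: "r > 0" "ball c r \<subseteq> \<Omega>" and Z: "Z \<in> sets borel" "Z \<subseteq> ball c r"
  shows "measure lborel Z * pint p M (\<lambda>x. indicat_real (ball c r) x *\<^sub>R f x) \<le>
    2 powr p * ((2 * r) powr p * measure lborel (ball (0::'a) (2 * r)) * pint p M (\<lambda>x. indicat_real (ball c r) x *\<^sub>R classical_grad f x)
     + measure lborel (ball c r) * pint p M (\<lambda>x. indicat_real Z x *\<^sub>R f x))"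
proof -
  define K where "K = ball c r"
  have K[measurable]: "K \<in> sets borel" by (simp add: K_def)
  note [measurable] = Z(1)
  note sm = test_smooth[OF f]
  have [measurable]: "f \<in> borel_measurable borel" using C_k_continuous[OF sm] borel_measurable_continuous_onI by auto
  define mZ where "mZ = measure lborel Z" define mK where "mK = measure lborel K"
  define mB where "mB = measure lborel (ball (0::'a) (2 * r))"
  have eK: "emeasure lborel K = ennreal mK" unfolding mK_def K_def using emeasure_lborel_ball_finite[of c r]
    by (intro emeasure_eq_ennreal_measure) auto
  have eB: "emeasure lborel (ball (0::'a) (2 * r)) = ennreal mB" unfolding mB_def using emeasure_lborel_ball_finite[of "0::'a" "2 * r"]
    by (intro emeasure_eq_ennreal_measure) auto
  have eZ: "emeasure lborel Z = ennreal mZ"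
  proof -
    have "emeasure lborel Z \<le> emeasure lborel K" using Z by (intro emeasure_mono) (auto simp: K_def)
    then have "emeasure lborel Z \<noteq> \<infinity>" by (auto simp: eK top_unique)
    then show ?thesis unfolding mZ_def by (intro emeasure_eq_ennreal_measure) auto
  qed
  define I where "I = pint p M (\<lambda>x. indicat_real K x *\<^sub>R f x)"
  define J where "J = pint p M (\<lambda>x. indicat_real K x *\<^sub>R classical_grad f x)"
  define L where "L = pint p M (\<lambda>x. indicat_real Z x *\<^sub>R f x)"
  have KO: "K \<subseteq> \<Omega>" "Z \<subseteq> \<Omega>" using r Z by (auto simp: K_def)
  have eI: "(\<integral>\<^sup>+x. ennreal (\<bar>f x\<bar> powr p) * indicator K x \<partial>lborel) = ennreal I"
    unfolding I_def by (rule pint_M_test_ind(1)[symmetric, OF f K KO(1)])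
  have eJ: "(\<integral>\<^sup>+x. ennreal (norm (classical_grad f x) powr p) * indicator K x \<partial>lborel) = ennreal J"
    unfolding J_def by (rule pint_M_test_ind(2)[symmetric, OF f K KO(1)])
  have eL: "(\<integral>\<^sup>+x. ennreal (\<bar>f x\<bar> powr p) * indicator Z x \<partial>lborel) = ennreal L"
    unfolding L_def by (rule pint_M_test_ind(1)[symmetric, OF f Z(1) KO(2)])
  have nn: "mZ \<ge> 0" "mK \<ge> 0" "mB \<ge> 0" "I \<ge> 0" "J \<ge> 0" "L \<ge> 0" by (auto simp: mZ_def mK_def mB_def I_def J_def L_def)
  have "ennreal mZ * ennreal I = (\<integral>\<^sup>+x. ennreal (\<bar>f x\<bar> powr p) * indicator K x * ennreal mZ \<partial>lborel)"
    by (subst nn_integral_multc, measurable) (subst eI, rule mult.commute)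
  also have "\<dots> = (\<integral>\<^sup>+x. \<integral>\<^sup>+y. ennreal (\<bar>f x\<bar> powr p) * indicator K x * indicator Z y \<partial>lborel \<partial>lborel)"
    by (intro nn_integral_cong) (simp add: nn_integral_cmult_indicator eZ)
  also have "\<dots> \<le> (\<integral>\<^sup>+x. \<integral>\<^sup>+y. ennreal (2 powr p) * (ennreal (\<bar>f y - f x\<bar> powr p) * indicator K x * indicator K y * indicator {y. dist x y < 2 * r} y
       + ennreal (\<bar>f y\<bar> powr p) * indicator Z y * indicator K x) \<partial>lborel \<partial>lborel)"
  proof (intro nn_integral_mono)
    fix x y
    show "ennreal (\<bar>f x\<bar> powr p) * indicator K x * indicator Z y \<le> ennreal (2 powr p) * (ennreal (\<bar>f y - f x\<bar> powr p) * indicator K x * indicator K y * indicator {y. dist x y < 2 * r} y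
       + ennreal (\<bar>f y\<bar> powr p) * indicator Z y * indicator K x)"
    proof (cases "x \<in> K \<and> y \<in> Z")
      case True
      then have "y \<in> K" using Z by (auto simp: K_def)
      have "dist x y < 2 * r" using True \<open>y \<in> K\<close> dist_triangle_less_add[of x c r y r] by (simp add: K_def dist_commute)
      then show ?thesis using True \<open>y \<in> K\<close> ennreal_norm_add_powr_le[OF p0, of "f x - f y" "f y"] by (simp add: abs_minus_commute)
    qed (auto simp: indicator_def)
  qed
  also have "\<dots> = ennreal (2 powr p) * ((\<integral>\<^sup>+x. \<integral>\<^sup>+y. ennreal (\<bar>f y - f x\<bar> powr p) * indicator K x * indicator K y * indicator {y. dist x y < 2 * r} y \<partial>lborel \<partial>lborel)
       + (\<integral>\<^sup>+x. \<integral>\<^sup>+y. ennreal (\<bar>f y\<bar> powr p) * indicator Z y * indicator K x \<partial>lborel \<partial>lborel))"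
    by (subst nn_integral_cmult, measurable)+ (subst nn_integral_add, measurable)+
  also have "(\<integral>\<^sup>+x. \<integral>\<^sup>+y. ennreal (\<bar>f y\<bar> powr p) * indicator Z y * indicator K x \<partial>lborel \<partial>lborel) = ennreal L * ennreal mK"
  proof -
    have "(\<integral>\<^sup>+y. ennreal (\<bar>f y\<bar> powr p) * indicator Z y * indicator K x \<partial>lborel) = ennreal L * indicator K x" for x
      by (subst nn_integral_multc) (auto simp: eL)
    then show ?thesis using nn_integral_cmult_indicator[of K lborel "ennreal L"] by (simp add: eK)
  qed
  also have "(\<integral>\<^sup>+x. \<integral>\<^sup>+y. ennreal (\<bar>f y - f x\<bar> powr p) * indicator K x * indicator K y * indicator {y. dist x y < 2 * r} y \<partial>lborel \<partial>lborel)
      \<le> ennreal ((2 * r) powr p) * ennreal mB * ennreal J"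
    using double_integral_le[OF p1 sm, of K "2 * r"] by (simp add: eB eJ[unfolded K_def] K_def)
  finally have "ennreal mZ * ennreal I \<le> ennreal (2 powr p) * (ennreal ((2 * r) powr p) * ennreal mB * ennreal J + ennreal L * ennreal mK)"
    by (simp add: mult_left_mono add_mono)
  also have "\<dots> = ennreal (2 powr p * ((2 * r) powr p * mB * J + L * mK))"
    using nn by (simp add: ennreal_mult''[symmetric] ennreal_plus[symmetric] del: ennreal_plus)
  finally have "mZ * I \<le> 2 powr p * ((2 * r) powr p * mB * J + L * mK)"
    using nn by (subst (asm) ennreal_mult[symmetric]) (auto simp: ennreal_le_iff)
  then show ?thesis by (simp add: mZ_def mK_def mB_def I_def J_def L_def K_def mult.commute)
qed

lemma local_poincare:
  assumes W: "is_W0 u G" and r: "r > 0" "ball c r \<subseteq> \<Omega>" and Z: "Z \<in> sets borel" "Z \<subseteq> ball c r"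
  shows "measure lborel Z * pint p M (\<lambda>x. indicat_real (ball c r) x *\<^sub>R u x) \<le>
    2 powr p * ((2 * r) powr p * measure lborel (ball (0::'a) (2 * r)) * pint p M (\<lambda>x. indicat_real (ball c r) x *\<^sub>R G x)
     + measure lborel (ball c r) * pint p M (\<lambda>x. indicat_real Z x *\<^sub>R u x))"
proof -
  obtain \<psi> where \<psi>: "\<And>n. \<psi> n \<in> test_functions \<Omega>" "Lp_conv p M \<psi> u" "Lp_conv p M (\<lambda>n. classical_grad (\<psi> n)) G" using is_W0E[OF W] by blast
  have mi: "indicat_real S \<in> borel_measurable M" if "S \<in> sets borel" for S
    by (rule borel_lebesgue_on) (use that in auto)
  have bi: "\<bar>indicat_real S x\<bar> \<le> 1" for S x by (simp add: indicator_def)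
  have b: "ball c r \<in> sets borel" by simp
  note t1 = Lp_conv_pint'[OF p1 Lp_conv_bdd_mult[OF p1 \<psi>(2) mi[OF b] bi]]
  note t2 = Lp_conv_pint'[OF p1 Lp_conv_bdd_mult[OF p1 \<psi>(3) mi[OF b] bi]]
  note t3 = Lp_conv_pint'[OF p1 Lp_conv_bdd_mult[OF p1 \<psi>(2) mi[OF Z(1)] bi]]
  show ?thesis
    by (rule LIMSEQ_le[OF tendsto_mult[OF tendsto_const t1]
          tendsto_mult[OF tendsto_const tendsto_add[OF tendsto_mult[OF tendsto_const t2] tendsto_mult[OF tendsto_const t3]]]])
       (use local_poincare_test[OF \<psi>(1) r Z] in auto)
qed

text \<open>A nonnegative weak supersolution of the p-Laplace equation. Nonnegative eigenfunctions
  and nonnegative minimizers of the Rayleigh quotient are both of this kind, so one maximum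
  principle covers them.\<close>

definition supersol :: "('a \<Rightarrow> real) \<Rightarrow> ('a \<Rightarrow> 'a) \<Rightarrow> bool" where
  "supersol V H \<longleftrightarrow> is_W0 V H \<and> (AE x in M. V x \<ge> 0) \<and>
     (\<forall>\<psi> K. is_W0 \<psi> K \<longrightarrow> (AE x in M. \<psi> x \<ge> 0) \<longrightarrow> (LINT x|M. flux p (H x) \<bullet> K x) \<ge> 0)"

lemma supersol_scale:
  assumes "supersol V H" "e > 0"
  shows "supersol (\<lambda>x. e * V x) (\<lambda>x. e *\<^sub>R H x)"
  unfolding supersol_def
proof (intro conjI allI impI)
  have S: "is_W0 V H" "AE x in M. V x \<ge> 0" using assms(1) by (auto simp: supersol_def)
  show "is_W0 (\<lambda>x. e * V x) (\<lambda>x. e *\<^sub>R H x)" by (rule is_W0_cmult[OF S(1)])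
  show "AE x in M. e * V x \<ge> 0" using S(2) by eventually_elim (use assms(2) in auto)
  fix \<psi> K assume "is_W0 \<psi> K" "AE x in M. \<psi> x \<ge> 0"
  then have "(LINT x|M. flux p (H x) \<bullet> K x) \<ge> 0" using assms(1) by (auto simp: supersol_def)
  moreover have "(LINT x|M. flux p (e *\<^sub>R H x) \<bullet> K x) = e powr (p - 1) * (LINT x|M. flux p (H x) \<bullet> K x)"
    using assms(2) by (simp add: flux_scaleR_pos)
  ultimately show "(LINT x|M. flux p (e *\<^sub>R H x) \<bullet> K x) \<ge> 0" by simp
qed

text \<open>Serves functions such as ln (1 + t) and powers of 1 + t, which are smooth only near
  \<open>{0..}\<close>: the approximations of \<open>V\<close> are taken nonnegative, and
  \<open>max 0\<close> extends \<open>F\<close> to the line.\<close>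

lemma chain_nonneg:
  fixes F F' :: "real \<Rightarrow> real"
  assumes W: "is_W0 V H" and nn: "AE x in M. V x \<ge> 0"
    and CF: "\<And>(\<psi> :: 'a \<Rightarrow> real) k. (\<And>j. C_k j \<psi>) \<Longrightarrow> (\<And>x. \<psi> x \<ge> 0) \<Longrightarrow> C_k k (\<lambda>x. F (\<psi> x))"
    and der: "\<And>t. t \<ge> 0 \<Longrightarrow> (F has_real_derivative F' t) (at t)" and bd: "\<And>t. t \<ge> 0 \<Longrightarrow> \<bar>F' t\<bar> \<le> L"
    and cont: "continuous_on {0..} F'" and F0: "F 0 = 0"
  shows "is_W0 (\<lambda>x. F (V x)) (\<lambda>x. F' (V x) *\<^sub>R H x)"
proof -
  obtain \<psi> where \<psi>: "\<And>n. \<psi> n \<in> test_functions \<Omega>" "\<And>n x. \<psi> n x \<in> {0..}" "Lp_conv p M \<psi> V" "Lp_conv p M (\<lambda>n. classical_grad (\<psi> n)) H"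
    using is_W0SE[OF is_W0_nonneg[OF W nn]] by blast
  have nn': "\<psi> n x \<ge> 0" for n x using \<psi>(2)[of n x] by simp
  have eq: "(\<lambda>x. F (max 0 (\<psi> n x))) = (\<lambda>x. F (\<psi> n x))" for n using nn' by (auto simp: max_def)
  have "is_W0 (\<lambda>x. F (max 0 (V x))) (\<lambda>x. F' (max 0 (V x)) *\<^sub>R H x)"
  proof (rule is_W0S_chain_rule[OF \<psi>(1,3,4)])
    show "C_k k (\<lambda>x. F (max 0 (\<psi> n x)))" for n k unfolding eq
      by (rule CF[OF _ nn'], rule test_smooth[OF \<psi>(1)])
    show "classical_grad (\<lambda>x. F (max 0 (\<psi> n x))) x = F' (max 0 (\<psi> n x)) *\<^sub>R classical_grad (\<psi> n) x" for n x
      unfolding eq using grad_comp[OF test_smooth[OF \<psi>(1)] der[OF nn'[of n x]]] nn'[of n x] by (simp add: max_def)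
    show "\<bar>F (max 0 a) - F (max 0 b)\<bar> \<le> L * \<bar>a - b\<bar>" for a b by (rule has_derivative_mono_lipschitz[OF der bd])
    show "continuous_on UNIV (\<lambda>t. F' (max 0 t))"
      by (rule continuous_on_compose2[OF cont]) (auto intro!: continuous_intros)
  qed (use bd F0 in auto)
  then show ?thesis
    by (rule is_W0_cong) (use nn in \<open>eventually_elim, simp add: max_def\<close>)+
qed

text \<open>
  Test the inequality for \<open>V\<close> with \<open>\<eta>^N (1 + V)^(1-p)\<close> and absorb by Young's inequality; the bound does not depend
  on \<open>V\<close>, so it can be applied to \<open>V / \<epsilon>\<close>.
\<close>

lemma log_caccioppoli:
  assumes S: "supersol V H" and r: "r > 0" and c: "cball c (2 * r) \<subseteq> \<Omega>"
    and N: "real N \<ge> p" and B: "\<And>x. norm (classical_grad (bump c (2 * r)) x) \<le> B"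
  shows "(LINT x|M. bump c (2 * r) x ^ N * (norm (H x) / (1 + V x)) powr p) \<le>
    (real N * B) powr p * measure M \<Omega> / p / ((p - 1) * (1 - 1 / p))"
proof -
  define \<eta> where "\<eta> = bump c (2 * r)"
  have \<eta>: "\<eta> \<in> test_functions \<Omega>" unfolding \<eta>_def using r c by (intro test_bump) auto
  have \<eta>b: "0 \<le> \<eta> x" "\<eta> x \<le> 1" for x unfolding \<eta>_def by (rule bump_bounds)+
  have B': "norm (classical_grad \<eta> x) \<le> B" for x using B by (simp add: \<eta>_def)
  have B0: "B \<ge> 0" using B' norm_ge_zero order_trans by blast
  have N1: "N \<ge> 1" using N p1 by (cases N) auto
  define \<zeta> where "\<zeta> x = \<eta> x ^ N" for x
  have \<zeta>s: "C_k k \<zeta>" for k unfolding \<zeta>_def by (intro C_k_power test_smooth[OF \<eta>])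
  have \<zeta>: "\<zeta> \<in> test_functions \<Omega>" by (rule test_sub[OF \<eta> \<zeta>s]) (use N1 in \<open>simp add: \<zeta>_def\<close>)
  have g\<zeta>: "classical_grad \<zeta> x = (real N * \<eta> x ^ (N - 1)) *\<^sub>R classical_grad \<eta> x" for x
  proof -
    have "((\<lambda>t. t ^ N) has_real_derivative real N * \<eta> x ^ (N - 1)) (at (\<eta> x))"
      using DERIV_pow[of N "\<eta> x"] by simp
    from grad_comp[OF test_smooth[OF \<eta>] this] show ?thesis by (simp add: \<zeta>_def[abs_def])
  qed
  have W: "is_W0 V H" and nn: "AE x in M. V x \<ge> 0" using S by (auto simp: supersol_def)
  note mV[measurable] = Lp_fun_measurable[OF is_W0_Lp(1)[OF W]] and mH[measurable] = Lp_fun_measurable[OF is_W0_Lp(2)[OF W]]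
  \<comment> \<open>The constant -1 gives \<open>F 0 = 0\<close>, as composition within the space
    requires; multiplied by the cutoff, it is added back in \<open>Wt\<close>.\<close>
  define F where "F t = (1 + t) powr (1 - p) - 1" for t :: real
  define F' where "F' t = (1 - p) * (1 + t) powr (- p)" for t :: real
  have WF: "is_W0 (\<lambda>x. F (V x)) (\<lambda>x. F' (V x) *\<^sub>R H x)"
  proof (rule chain_nonneg[OF W nn])
    show "C_k k (\<lambda>x. F (\<psi> x))" if "\<And>j. C_k j \<psi>" "\<And>x. \<psi> x \<ge> 0" for \<psi> :: "'a \<Rightarrow> real" and k
    proof -
      have "C_k k (\<lambda>x. (1 + \<psi> x) powr (1 - p) + (-1))"
        using that by (intro C_k_add C_k_powr C_k_const) (auto simp: add_pos_nonneg)
      then show ?thesis by (simp add: F_def)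
    qed
    show "(F has_real_derivative F' t) (at t)" if "t \<ge> 0" for t
    proof -
      have "((\<lambda>t. (1 + t) powr (1 - p)) has_real_derivative ((1 - p) * (1 + t) powr (1 - p - 1)) * 1) (at t)"
        by (rule DERIV_chain2[OF has_real_derivative_powr]) (use that in \<open>auto intro!: derivative_eq_intros\<close>)
      from DERIV_diff[OF this DERIV_const[of 1]] show ?thesis
        unfolding F_def[abs_def] F'_def by (rule DERIV_cong) simp
    qed
    show "\<bar>F' t\<bar> \<le> p - 1" if "t \<ge> 0" for t
    proof -
      have "(1 + t) powr (-p) \<le> 1 powr (-p)" using that p1 by (intro powr_mono2') auto
      then show ?thesis using p1 by (simp add: F'_def abs_mult)
    qed
    show "continuous_on {0..} F'" unfolding F'_def by (intro continuous_intros) auto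
  qed (simp add: F_def)
  have Wt: "is_W0 (\<lambda>x. \<zeta> x * F (V x) + \<zeta> x) (\<lambda>x. (\<zeta> x *\<^sub>R (F' (V x) *\<^sub>R H x) + F (V x) *\<^sub>R classical_grad \<zeta> x) + classical_grad \<zeta> x)"
    by (rule is_W0_add[OF is_W0_test_mult[OF WF \<zeta>] is_W0_test[OF \<zeta>]])
  define K where "K x = (\<zeta> x *\<^sub>R (F' (V x) *\<^sub>R H x) + F (V x) *\<^sub>R classical_grad \<zeta> x) + classical_grad \<zeta> x" for x
  have "AE x in M. \<zeta> x * F (V x) + \<zeta> x \<ge> 0"
  proof (rule AE_I2)
    fix x
    have "\<zeta> x * F (V x) + \<zeta> x = \<zeta> x * (1 + V x) powr (1 - p)" by (simp add: F_def algebra_simps)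
    then show "\<zeta> x * F (V x) + \<zeta> x \<ge> 0" using \<eta>b by (simp add: \<zeta>_def)
  qed
  then have T: "(LINT x|M. flux p (H x) \<bullet> K x) \<ge> 0" using S Wt unfolding supersol_def K_def by blast
  have iT: "integrable M (\<lambda>x. flux p (H x) \<bullet> K x)"
    using Holder_inner(1)[OF p1 is_W0_Lp(2)[OF Wt] flux_Lp(1)[OF p1 is_W0_Lp(2)[OF W]]] by (simp add: K_def)
  define a where "a x = norm (H x) / (1 + V x)" for x
  have m1: "\<zeta> \<in> borel_measurable M" using Lp_fun_measurable[OF test_Lp'(1)[OF \<zeta> p0]] .
  have [measurable]: "\<zeta> \<in> borel_measurable M" by (rule m1)
  have iX: "integrable M (\<lambda>x. \<zeta> x * a x powr p)"
  proof (rule Bochner_Integration.integrable_bound[OF Lp_fun_integrable[OF is_W0_Lp(2)[OF W]]])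
    show "AE x in M. norm (\<zeta> x * a x powr p) \<le> norm (norm (H x) powr p)" using nn
    proof eventually_elim
      case (elim x)
      have "a x \<le> norm (H x)" using elim by (simp add: a_def divide_le_eq mult_le_cancel_left1 algebra_simps)
      then have "a x powr p \<le> norm (H x) powr p" using elim p0 by (intro powr_mono2) (auto simp: a_def)
      moreover have "0 \<le> \<zeta> x" "\<zeta> x \<le> 1" using \<eta>b by (auto simp: \<zeta>_def power_le_one)
      ultimately show ?case using mult_mono[of "\<zeta> x" 1 "a x powr p" "norm (H x) powr p"] by (simp add: abs_mult)
    qed
  qed (simp add: a_def)
  define X where "X = (LINT x|M. \<zeta> x * a x powr p)"
  define Q where "Q = (real N * B) powr p"
  have pw: "AE x in M. flux p (H x) \<bullet> K x \<le> - (p - 1) * (\<zeta> x * a x powr p) + ((1 - 1/p) * (\<zeta> x * a x powr p) + 1/p * Q)"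
    using nn
  proof eventually_elim
    case (elim x)
    have V1: "1 + V x > 0" using elim by simp
    have e1: "flux p (H x) \<bullet> (\<zeta> x *\<^sub>R (F' (V x) *\<^sub>R H x)) = - (p - 1) * (\<zeta> x * a x powr p)"
    proof -
      have "a x powr p = norm (H x) powr p * (1 + V x) powr (- p)"
        using V1 by (simp add: a_def powr_divide powr_minus_divide)
      then show ?thesis by (simp add: flux_inner F'_def algebra_simps)
    qed
    have e2: "flux p (H x) \<bullet> (F (V x) *\<^sub>R classical_grad \<zeta> x) + flux p (H x) \<bullet> classical_grad \<zeta> x
       = (1 + V x) powr (1 - p) * (flux p (H x) \<bullet> classical_grad \<zeta> x)" by (simp add: F_def algebra_simps)
    \<comment> \<open>The power N / p of the cutoff is put into \<open>s\<close> so that s^p is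
      exactly the integrand into which the gradient term is to be absorbed.\<close>
    define s where "s = a x * \<eta> x powr (N / p)"
    have s0: "s \<ge> 0" using V1 by (simp add: s_def a_def)
    have sp: "s powr p = \<zeta> x * a x powr p"
    proof (cases "\<eta> x = 0")
      case True
      then show ?thesis using N1 p0 by (simp add: s_def \<zeta>_def)
    next
      case False
      then have "\<eta> x > 0" using \<eta>b[of x] by simp
      then show ?thesis using p0 by (simp add: s_def \<zeta>_def powr_mult powr_powr powr_realpow)
    qed
    \<comment> \<open>Because N \<ge> p, the exponent N - 1 is at least (N / p) (p - 1), and the
      cutoff is at most 1.\<close>
    have "\<eta> x ^ (N - 1) \<le> (\<eta> x powr (N / p)) powr (p - 1)"
    proof (cases "\<eta> x = 0")
      case True
      then show ?thesis using N1 N p1 by (cases "N = 1") (auto simp: power_0_left)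
    next
      case False
      then have h: "\<eta> x > 0" using \<eta>b[of x] by simp
      have "real (N - 1) \<ge> real N / p * (p - 1)"
      proof -
        have "real N / p \<ge> 1" using N p0 by (simp add: field_simps)
        moreover have "real N / p * (p - 1) = real N - real N / p" using p0 by (simp add: field_simps)
        ultimately show ?thesis using N1 by (simp add: of_nat_diff)
      qed
      then have "\<eta> x powr real (N - 1) \<le> \<eta> x powr (real N / p * (p - 1))"
        using h \<eta>b[of x] by (intro powr_mono') auto
      then show ?thesis using h by (simp add: powr_powr powr_realpow)
    qed
    then have gz: "norm (classical_grad \<zeta> x) \<le> (\<eta> x powr (N / p)) powr (p - 1) * (real N * B)"
    proof -
      assume h: "\<eta> x ^ (N - 1) \<le> (\<eta> x powr (N / p)) powr (p - 1)"
      have "norm (classical_grad \<zeta> x) = (real N * \<eta> x ^ (N - 1)) * norm (classical_grad \<eta> x)"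
        using \<eta>b[of x] by (simp add: g\<zeta>)
      also have "\<dots> \<le> (real N * (\<eta> x powr (N / p)) powr (p - 1)) * B"
        using h B' \<eta>b[of x] by (intro mult_mono) auto
      finally show ?thesis by (simp add: ac_simps)
    qed
    have "(1 + V x) powr (1 - p) * (flux p (H x) \<bullet> classical_grad \<zeta> x) \<le> (1 + V x) powr (1 - p) * (norm (H x) powr (p - 1) * norm (classical_grad \<zeta> x))"
      using norm_cauchy_schwarz[of "flux p (H x)" "classical_grad \<zeta> x"] by (intro mult_left_mono) (auto simp: norm_flux)
    also have "\<dots> = a x powr (p - 1) * norm (classical_grad \<zeta> x)"
    proof -
      have "(1 + V x) powr (1 - p) = 1 / (1 + V x) powr (p - 1)" using powr_minus_divide[of "1 + V x" "p - 1"] by simp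
      then show ?thesis using V1 by (simp add: a_def powr_divide)
    qed
    also have "\<dots> \<le> a x powr (p - 1) * ((\<eta> x powr (N / p)) powr (p - 1) * (real N * B))"
      by (intro mult_left_mono gz) auto
    also have "\<dots> = s powr (p - 1) * (real N * B)" by (simp add: s_def powr_mult)
    also have "\<dots> \<le> (1 - 1/p) * s powr p + 1/p * (real N * B) powr p"
      using Young_inequality(1)[OF p1 s0, of "real N * B"] B0 by simp
    finally have "(1 + V x) powr (1 - p) * (flux p (H x) \<bullet> classical_grad \<zeta> x) \<le> (1 - 1/p) * (\<zeta> x * a x powr p) + 1/p * Q"
      unfolding sp Q_def .
    moreover have "flux p (H x) \<bullet> K x = flux p (H x) \<bullet> (\<zeta> x *\<^sub>R (F' (V x) *\<^sub>R H x)) + (flux p (H x) \<bullet> (F (V x) *\<^sub>R classical_grad \<zeta> x) + flux p (H x) \<bullet> classical_grad \<zeta> x)"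
      unfolding K_def inner_add_right by (rule add.assoc)
    ultimately show ?case using e1 e2 by linarith
  qed
  have "0 \<le> (LINT x|M. flux p (H x) \<bullet> K x)" by (rule T)
  also have "\<dots> \<le> (LINT x|M. - (p - 1) * (\<zeta> x * a x powr p) + ((1 - 1/p) * (\<zeta> x * a x powr p) + 1/p * Q))"
    by (intro integral_mono_AE iT pw Bochner_Integration.integrable_add integrable_mult_right iX const_int)
  also have "\<dots> = (LINT x|M. - (p - 1) * (\<zeta> x * a x powr p)) + ((LINT x|M. (1 - 1/p) * (\<zeta> x * a x powr p)) + (LINT x|M. 1/p * Q))"
    by (subst Bochner_Integration.integral_add | intro Bochner_Integration.integrable_add integrable_mult_right iX const_int)+ (rule refl)
  also have "\<dots> = - (p - 1) * X + ((1 - 1/p) * X + 1/p * Q * measure M \<Omega>)"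
    by (simp add: X_def)
  finally have "(p - 1) * X - (1 - 1/p) * X \<le> Q * measure M \<Omega> / p" by (simp add: algebra_simps)
  \<comment> \<open>The coefficient that survives the absorption is (p - 1)^2 / p.\<close>
  moreover have "(p - 1) * X - (1 - 1/p) * X = ((p - 1) * (1 - 1/p)) * X" using p0 by (simp add: field_simps)
  ultimately have "((p - 1) * (1 - 1/p)) * X \<le> Q * measure M \<Omega> / p" by simp
  moreover have "(p - 1) * (1 - 1/p) > 0" using p1 by simp
  ultimately have "X \<le> Q * measure M \<Omega> / p / ((p - 1) * (1 - 1/p))" by (metis mult.commute pos_le_divide_eq)
  then show ?thesis by (simp add: X_def Q_def \<zeta>_def a_def \<eta>_def)
qed

end

text \<open>Lindelof's theorem turns a property that holds almost everywhere near each point into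
  one that holds almost everywhere.\<close>

lemma AE_lebesgue_cover:
  fixes \<Omega> :: "'a::euclidean_space set"
  assumes "\<And>c. c \<in> \<Omega> \<Longrightarrow> \<exists>r>0. AE x in lebesgue. x \<in> ball c r \<longrightarrow> P x" "\<Omega> \<in> sets lebesgue"
  shows "AE x in lebesgue_on \<Omega>. P x"
proof -
  define F where "F = {B. open B \<and> (AE x in lebesgue. x \<in> B \<longrightarrow> P x)}"
  have opF: "open S" if "S \<in> F" for S using that by (auto simp: F_def)
  obtain F' where F': "F' \<subseteq> F" "countable F'" "\<Union>F' = \<Union>F"
    using Lindelof[OF opF] by blast
  have cov: "\<Omega> \<subseteq> \<Union>F"
  proof
    fix c assume "c \<in> \<Omega>"
    then obtain r where "r > 0" "AE x in lebesgue. x \<in> ball c r \<longrightarrow> P x" using assms(1) by blast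
    then show "c \<in> \<Union>F" by (auto simp: F_def intro!: exI[of _ "ball c r"])
  qed
  have "AE x in lebesgue. \<forall>B\<in>F'. x \<in> B \<longrightarrow> P x"
    using F'(2) by (subst AE_ball_countable) (use F'(1) in \<open>auto simp: F_def\<close>)
  then have "AE x in lebesgue. x \<in> \<Omega> \<longrightarrow> P x"
  proof eventually_elim
    case (elim x)
    show ?case
    proof
      assume "x \<in> \<Omega>"
      then obtain B where "B \<in> F'" "x \<in> B" using cov F'(3) by blast
      with elim show "P x" by blast
    qed
  qed
  then show ?thesis using assms(2) by (simp add: AE_restrict_space_iff)
qed

context sobolev begin

lemma is_W0_log:
  assumes W: "is_W0 V H" and nn: "AE x in M. V x \<ge> 0"
  shows "is_W0 (\<lambda>x. ln (1 + V x)) (\<lambda>x. (1 / (1 + V x)) *\<^sub>R H x)"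
proof (rule chain_nonneg[OF W nn])
  show "C_k k (\<lambda>x. ln (1 + \<psi> x))" if "\<And>j. C_k j \<psi>" "\<And>x. \<psi> x \<ge> 0" for \<psi> :: "'a \<Rightarrow> real" and k
    using that by (intro C_k_ln C_k_add C_k_const) (auto simp: add_pos_nonneg)
  show "((\<lambda>t. ln (1 + t)) has_real_derivative 1 / (1 + t)) (at t)" if "t \<ge> 0" for t :: real
    using that by (auto intro!: derivative_eq_intros)
  show "\<bar>1 / (1 + t)\<bar> \<le> 1" if "t \<ge> 0" for t :: real using that by simp
  show "continuous_on {0..} (\<lambda>t::real. 1 / (1 + t))" by (intro continuous_intros) auto
qed simp

lemma bump_lower: 
  assumes "r > 0" "x \<in> ball c r"
  shows "exp (- inverse (3 * r\<^sup>2)) \<le> bump c (2 * r) x"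
proof -
  have "norm (x - c) \<le> r" using assms by (simp add: dist_norm norm_minus_commute)
  then have "(x - c) \<bullet> (x - c) \<le> r\<^sup>2"
    unfolding power2_norm_eq_inner[symmetric] by (intro power_mono) auto
  then have t: "3 * r\<^sup>2 \<le> (2 * r)\<^sup>2 - (x - c) \<bullet> (x - c)" by (simp add: power2_eq_square)
  moreover have "3 * r\<^sup>2 > 0" using assms by simp
  ultimately have "inverse ((2 * r)\<^sup>2 - (x - c) \<bullet> (x - c)) \<le> inverse (3 * r\<^sup>2)" by (intro le_imp_inverse_le) auto
  moreover have "bump c (2 * r) x = exp (- inverse ((2 * r)\<^sup>2 - (x - c) \<bullet> (x - c)))"
  proof -
    have "\<not> (2 * r)\<^sup>2 - (x - c) \<bullet> (x - c) \<le> 0" using t \<open>3 * r\<^sup>2 > 0\<close> by linarith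
    then show ?thesis unfolding bump_def expinv_def by (simp only: if_False power_0 mult_1_right)
  qed
  ultimately show ?thesis by simp
qed

lemma log_gradient_bound:
  assumes r: "r > 0" and c: "cball c (2 * r) \<subseteq> \<Omega>"
  obtains C where "\<And>V H. supersol V H \<Longrightarrow> pint p M (\<lambda>x. indicat_real (ball c r) x *\<^sub>R ((1 / (1 + V x)) *\<^sub>R H x)) \<le> C"
proof -
  have \<eta>: "bump c (2 * r) \<in> test_functions \<Omega>" using r c by (intro test_bump) auto
  obtain B where B: "B > 0" "\<And>x. \<bar>bump c (2 * r) x\<bar> \<le> B" "\<And>x. norm (classical_grad (bump c (2 * r)) x) \<le> B" using test_bounded[OF \<eta>] by blast
  obtain N :: nat where N: "real N \<ge> p" using real_arch_simple by blast
  define C where "C = (real N * B) powr p * measure M \<Omega> / p / ((p - 1) * (1 - 1 / p))"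
  \<comment> \<open>Lower bound of the cutoff of radius 2 r on the ball of radius r; division by its
    N-th power removes the cutoff.\<close>
  define \<kappa> where "\<kappa> = exp (- inverse (3 * r\<^sup>2))"
  have \<kappa>: "\<kappa> > 0" by (simp add: \<kappa>_def)
  show ?thesis
  proof (rule that[of "C / \<kappa> ^ N"])
    fix V H assume S: "supersol V H"
    have W: "is_W0 V H" and nn: "AE x in M. V x \<ge> 0" using S by (auto simp: supersol_def)
    note WL = is_W0_log[OF W nn]
    define a where "a x = norm (H x) / (1 + V x)" for x
    have e: "AE x in M. norm ((1 / (1 + V x)) *\<^sub>R H x) = a x"
      using nn by eventually_elim (simp add: a_def)
    have bm: "bump c (2 * r) \<in> borel_measurable M" using Lp_fun_measurable[OF test_Lp'(1)[OF \<eta> p0]] .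
    note [measurable] = bm Lp_fun_measurable[OF is_W0_Lp(1)[OF W]] Lp_fun_measurable[OF is_W0_Lp(2)[OF W]]
    have bK: "indicat_real (ball c r) \<in> borel_measurable M" by (intro borel_lebesgue_on borel_measurable_indicator) simp
    have ia: "integrable M (\<lambda>x. norm ((1 / (1 + V x)) *\<^sub>R H x) powr p)" by (rule Lp_fun_integrable[OF is_W0_Lp(2)[OF WL]])
    have iX: "integrable M (\<lambda>x. bump c (2 * r) x ^ N * a x powr p)"
    proof (rule Bochner_Integration.integrable_bound[OF ia])
      show "AE x in M. norm (bump c (2 * r) x ^ N * a x powr p) \<le> norm (norm ((1 / (1 + V x)) *\<^sub>R H x) powr p)"
        using e
      proof eventually_elim
        case (elim x)
        show ?case unfolding elim using bump_bounds[of c "2 * r" x] by (simp add: abs_mult power_abs mult_left_le_one_le power_le_one)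
      qed
    qed (simp add: a_def)
    have "pint p M (\<lambda>x. indicat_real (ball c r) x *\<^sub>R ((1 / (1 + V x)) *\<^sub>R H x)) \<le> (LINT x|M. (bump c (2 * r) x ^ N * a x powr p) / \<kappa> ^ N)"
      unfolding pint_def
    proof (rule integral_mono_AE)
      show "integrable M (\<lambda>x. norm (indicat_real (ball c r) x *\<^sub>R ((1 / (1 + V x)) *\<^sub>R H x)) powr p)"
        by (rule Lp_fun_integrable[OF Lp_fun_bdd_mult(1)[OF is_W0_Lp(2)[OF WL] p0 bK, of 1]]) (simp add: indicator_def)
      show "integrable M (\<lambda>x. (bump c (2 * r) x ^ N * a x powr p) / \<kappa> ^ N)" using iX by simp
      show "AE x in M. norm (indicat_real (ball c r) x *\<^sub>R ((1 / (1 + V x)) *\<^sub>R H x)) powr p \<le> (bump c (2 * r) x ^ N * a x powr p) / \<kappa> ^ N"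
        using e
      proof eventually_elim
        case (elim x)
        show ?case
        proof (cases "x \<in> ball c r")
          case True
          have "\<kappa> ^ N \<le> bump c (2 * r) x ^ N" using bump_lower[OF r True] \<kappa> by (intro power_mono) (auto simp: \<kappa>_def)
          then have "\<kappa> ^ N * a x powr p \<le> bump c (2 * r) x ^ N * a x powr p" by (intro mult_right_mono) auto
          then have "a x powr p \<le> (bump c (2 * r) x ^ N * a x powr p) / \<kappa> ^ N" using \<kappa> by (simp add: pos_le_divide_eq mult.commute)
          then show ?thesis using True elim by (metis indicator_simps(1) scaleR_one)
        next
          case False
          then show ?thesis using \<kappa> bump_bounds(1)[of c "2 * r" x] by (simp add: indicator_def)
        qed
      qed
    qed
    also have "\<dots> = (LINT x|M. bump c (2 * r) x ^ N * a x powr p) / \<kappa> ^ N" by simp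
    also have "\<dots> \<le> C / \<kappa> ^ N"
      using log_caccioppoli[OF S r c N B(3)] \<kappa> by (intro divide_right_mono) (auto simp: C_def a_def)
    finally show "pint p M (\<lambda>x. indicat_real (ball c r) x *\<^sub>R ((1 / (1 + V x)) *\<^sub>R H x)) \<le> C / \<kappa> ^ N" .
  qed
qed

text \<open>
  If \<open>V\<close> vanishes on a part of the ball of positive measure, the Poincare inequality bounds \<open>ln (1 + V / \<epsilon>)\<close> in \<open>L\<^sup>p\<close>
  uniformly in \<open>\<epsilon>\<close>, which is impossible for \<open>\<epsilon> \<rightarrow> 0\<close> unless \<open>V = 0\<close> on the whole ball.
\<close>

lemma supersol_local_dichotomy:
  assumes S: "supersol V H" and r: "r > 0" and c: "cball c (2 * r) \<subseteq> \<Omega>"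
    and nz: "\<not> (AE x in lebesgue. x \<in> ball c r \<longrightarrow> V x \<noteq> 0)"
  shows "AE x in lebesgue. x \<in> ball c r \<longrightarrow> V x = 0"
proof -
  define K where "K = ball c r"
  have KO: "K \<subseteq> \<Omega>" using c r by (force simp: K_def)
  have W: "is_W0 V H" and nn: "AE x in M. V x \<ge> 0" using S by (auto simp: supersol_def)
  note mV[measurable] = Lp_fun_measurable[OF is_W0_Lp(1)[OF W]]
  have sub: "A \<in> sets lebesgue" if "A \<in> sets M" for A using that Omega_sets by (auto simp: sets_restrict_space)
  have Km[measurable]: "K \<in> sets M"
    using KO Omega_sets by (auto simp: K_def sets_restrict_space intro!: image_eqI[of _ _ "ball c r"])
  have zm: "{x \<in> space M. x \<in> K \<and> V x = 0} \<in> sets M" by measurable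
  have zeq: "{x \<in> space M. x \<in> K \<and> V x = 0} = {x \<in> K. V x = 0}" using KO by auto
  have Z0: "{x \<in> K. V x = 0} \<in> sets lebesgue" using sub[OF zm] unfolding zeq .
  \<comment> \<open>\<open>V\<close> is only Lebesgue measurable, while
    \<open>local_poincare\<close> asks for a Borel set; the Borel part of the zero set carries its
    measure.\<close>
  then obtain Z N N' where Z: "{x \<in> K. V x = 0} = Z \<union> N" "N \<subseteq> N'" "N' \<in> null_sets lborel" "Z \<in> sets lborel"
    by (rule sets_completionE)
  have ZK: "Z \<subseteq> ball c r" using Z(1) by (auto simp: K_def)
  have Zb: "Z \<in> sets borel" using Z(4) by simp
  have mZ: "measure lborel Z > 0"
  proof (rule ccontr)
    assume "\<not> measure lborel Z > 0"
    then have "measure lborel Z = 0" by (simp add: zero_less_measure_iff)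
    moreover have "emeasure lborel Z < \<infinity>"
      using emeasure_mono[OF ZK, of lborel] emeasure_lborel_ball_finite[of c r] by (auto intro: le_less_trans)
    ultimately have "emeasure lborel Z = 0" using emeasure_eq_ennreal_measure[of lborel Z] by auto
    then have "Z \<in> null_sets lborel" using Z(4) by (rule null_setsI)
    then have "AE x in lborel. x \<notin> Z" by (rule AE_not_in)
    moreover have "AE x in lborel. x \<notin> N'" by (rule AE_not_in[OF Z(3)])
    ultimately have "AE x in lborel. x \<in> ball c r \<longrightarrow> V x \<noteq> 0"
      by eventually_elim (use Z(1,2) in \<open>auto simp: K_def\<close>)
    then show False using nz AE_completion by blast
  qed
  obtain C where C: "\<And>V H. supersol V H \<Longrightarrow> pint p M (\<lambda>x. indicat_real (ball c r) x *\<^sub>R ((1 / (1 + V x)) *\<^sub>R H x)) \<le> C"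
    using log_gradient_bound[OF r c] by blast
  define C' where "C' = 2 powr p * ((2 * r) powr p * measure lborel (ball (0::'a) (2 * r)) * C) / measure lborel Z"
  have bd: "pint p M (\<lambda>x. indicat_real K x *\<^sub>R ln (1 + e * V x)) \<le> C'" if e: "e > 0" for e
  proof -
    note Se = supersol_scale[OF S e]
    have We: "is_W0 (\<lambda>x. e * V x) (\<lambda>x. e *\<^sub>R H x)" "AE x in M. e * V x \<ge> 0" using Se by (auto simp: supersol_def)
    note P = local_poincare[OF is_W0_log[OF We] r _ Zb ZK]
    have z: "pint p M (\<lambda>x. indicat_real Z x *\<^sub>R ln (1 + e * V x)) = 0"
    proof -
      have "V x = 0" if "x \<in> Z" for x using Z(1) that by blast
      then have "(\<lambda>x. indicat_real Z x *\<^sub>R ln (1 + e * V x)) = (\<lambda>x. 0)" by (auto simp: indicator_def fun_eq_iff)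
      then show ?thesis using p0 by (simp only:) (simp add: pint_def)
    qed
    have "measure lborel Z * pint p M (\<lambda>x. indicat_real K x *\<^sub>R ln (1 + e * V x)) \<le>
      2 powr p * ((2 * r) powr p * measure lborel (ball (0::'a) (2 * r)) * pint p M (\<lambda>x. indicat_real (ball c r) x *\<^sub>R ((1 / (1 + e * V x)) *\<^sub>R (e *\<^sub>R H x))))"
      using P KO z by (simp add: K_def)
    also have "\<dots> \<le> 2 powr p * ((2 * r) powr p * measure lborel (ball (0::'a) (2 * r)) * C)"
      by (intro mult_left_mono C[OF Se]) auto
    finally show ?thesis using mZ by (simp add: C'_def pos_le_divide_eq mult.commute)
  qed
  have T: "AE x in M. \<not> (x \<in> K \<and> V x \<ge> d)" if d: "d > 0" for d
  proof -
    define T where "T = {x \<in> space M. x \<in> K \<and> V x \<ge> d}"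
    have [measurable]: "T \<in> sets M" unfolding T_def by measurable
    interpret finite_measure M by (rule finM)
    have b: "measure M T * y powr p \<le> C'" if y: "y > 0" for y
    proof -
      \<comment> \<open>Scaled so that the logarithm equals y at the level d. It is then at least y
        on \<open>T\<close>, while its p-th power has an integral over the ball that is bounded
        independently of y.\<close>
      define e where "e = (exp y - 1) / d"
      have e: "e > 0" using y d by (simp add: e_def)
      have "ln (1 + e * d) = y" using d by (simp add: e_def)
      have "T \<inter> \<Omega> = T" by (auto simp: T_def)
      then have "measure M T * y powr p = (LINT x|M. indicat_real T x * y powr p)" by simp
      also have "\<dots> \<le> pint p M (\<lambda>x. indicat_real K x *\<^sub>R ln (1 + e * V x))"
        unfolding pint_def
      proof (rule integral_mono_AE)
        have We: "is_W0 (\<lambda>x. e * V x) (\<lambda>x. e *\<^sub>R H x)" "AE x in M. e * V x \<ge> 0" using supersol_scale[OF S e] by (auto simp: supersol_def)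
        have bK: "indicat_real K \<in> borel_measurable M" by measurable
        show "integrable M (\<lambda>x. norm (indicat_real K x *\<^sub>R ln (1 + e * V x)) powr p)"
          by (rule Lp_fun_integrable[OF Lp_fun_bdd_mult(1)[OF is_W0_Lp(1)[OF is_W0_log[OF We]] p0 bK, of 1]]) (simp add: indicator_def)
        show "integrable M (\<lambda>x. indicat_real T x * y powr p)" by (intro integrable_mult_left integrable_real_indicator) (auto simp: emeasure_eq_measure)
        show "AE x in M. indicat_real T x * y powr p \<le> norm (indicat_real K x *\<^sub>R ln (1 + e * V x)) powr p"
        proof (rule AE_I2)
          fix x
          show "indicat_real T x * y powr p \<le> norm (indicat_real K x *\<^sub>R ln (1 + e * V x)) powr p"
          proof (cases "x \<in> T")
            case True
            then have "x \<in> K" "V x \<ge> d" by (auto simp: T_def)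
            have "1 + e * d \<le> 1 + e * V x" using \<open>V x \<ge> d\<close> e by simp
            then have "y \<le> ln (1 + e * V x)" using \<open>ln (1 + e * d) = y\<close> d e by (metis add_pos_pos ln_mono mult_pos_pos zero_less_one)
            then have "y powr p \<le> \<bar>ln (1 + e * V x)\<bar> powr p" using y p0 by (intro powr_mono2) auto
            then show ?thesis using True \<open>x \<in> K\<close> by simp
          qed simp
        qed
      qed
      also have "\<dots> \<le> C'" by (rule bd[OF e])
      finally show ?thesis .
    qed
    have "measure M T = 0"
    proof (rule ccontr)
      assume "measure M T \<noteq> 0"
      then have m: "measure M T > 0" by (simp add: zero_less_measure_iff)
      \<comment> \<open>Any y with y^p above C' divided by the measure of \<open>T\<close>
        contradicts the bound; the absolute value and the summand 1 keep it positive.\<close>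
      define y where "y = (\<bar>C'\<bar> / measure M T + 1) powr (1/p)"
      have pos: "\<bar>C'\<bar> / measure M T + 1 > 0" using m by (intro add_nonneg_pos) auto
      then have "y > 0" by (simp only: y_def powr_gt_zero)
      have "y powr p = \<bar>C'\<bar> / measure M T + 1" using pos p0 by (simp add: y_def powr_powr)
      then have "measure M T * y powr p = \<bar>C'\<bar> + measure M T" using m by (simp add: field_simps)
      then show False using b[OF \<open>y > 0\<close>] m by linarith
    qed
    then have "T \<in> null_sets M" by (simp add: null_sets_def emeasure_eq_measure)
    then have "AE x in M. x \<notin> T" by (rule AE_not_in)
    then show ?thesis by (rule AE_mp) (auto simp: T_def intro!: AE_I2)
  qed
  have "AE x in M. \<forall>n. \<not> (x \<in> K \<and> V x \<ge> inverse (real (Suc n)))"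
    unfolding AE_all_countable using T by simp
  then have "AE x in M. x \<in> K \<longrightarrow> V x = 0" using nn
  proof eventually_elim
    case (elim x)
    show ?case
    proof
      assume x: "x \<in> K"
      show "V x = 0"
      proof (rule ccontr)
        assume "V x \<noteq> 0"
        then have "V x > 0" using elim(2) by simp
        then obtain n where "inverse (real (Suc n)) < V x" using reals_Archimedean by blast
        then show False using elim(1) x by (metis less_imp_le)
      qed
    qed
  qed
  then have "AE x in lebesgue. x \<in> \<Omega> \<longrightarrow> x \<in> K \<longrightarrow> V x = 0" using Omega_sets by (simp add: AE_restrict_space_iff)
  then show ?thesis by eventually_elim (use KO in \<open>auto simp: K_def\<close>)
qed

lemma ball_not_null:
  assumes "open U" "x \<in> U" "AE x in lebesgue. x \<in> U \<longrightarrow> False"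
  shows False
proof -
  have "U \<in> null_sets lebesgue"
    using assms by (subst AE_iff_null_sets) auto
  then show False using open_not_negligible[OF assms(1)] assms(2) by (auto simp: negligible_iff_null_sets)
qed

text \<open>By the local dichotomy every point of \<Omega> has a neighbourhood in which
  \<open>V\<close> vanishes almost everywhere or is nonzero almost everywhere. The two kinds of
  points form open sets, disjoint because balls are not null sets, so connectedness leaves one
  kind.\<close>

theorem strong_maximum_principle:
  assumes conn: "connected \<Omega>" and S: "supersol V H"
  shows "(AE x in M. V x = 0) \<or> (AE x in M. V x > 0)"
proof -
  have nn: "AE x in M. V x \<ge> 0" using S by (auto simp: supersol_def)
  define A where "A = {c \<in> \<Omega>. \<exists>r>0. AE x in lebesgue. x \<in> ball c r \<longrightarrow> V x = 0}"
  define B where "B = {c \<in> \<Omega>. \<exists>r>0. AE x in lebesgue. x \<in> ball c r \<longrightarrow> V x \<noteq> 0}"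
  have opn: "open {c \<in> \<Omega>. \<exists>r>0. AE x in lebesgue. x \<in> ball c r \<longrightarrow> P x}" for P
    unfolding open_contains_ball
  proof
    fix c assume "c \<in> {c \<in> \<Omega>. \<exists>r>0. AE x in lebesgue. x \<in> ball c r \<longrightarrow> P x}"
    then obtain r where r: "c \<in> \<Omega>" "r > 0" "AE x in lebesgue. x \<in> ball c r \<longrightarrow> P x" by auto
    obtain s where s: "s > 0" "ball c s \<subseteq> \<Omega>" using op r(1) open_contains_ball by blast
    show "\<exists>e>0. ball c e \<subseteq> {c \<in> \<Omega>. \<exists>r>0. AE x in lebesgue. x \<in> ball c r \<longrightarrow> P x}"
    proof (rule exI[of _ "min s (r/2)"], rule conjI, goal_cases)
      case 2
      show ?case
      proof (rule subsetI, rule CollectI, rule conjI)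
      fix d assume d: "d \<in> ball c (min s (r/2))"
      then show "d \<in> \<Omega>" using s by auto
      have "ball d (r/2) \<subseteq> ball c r"
      proof
        fix x assume "x \<in> ball d (r/2)"
        then show "x \<in> ball c r" using d dist_triangle[of c x d] by simp
      qed
      note sub = this
      have "AE x in lebesgue. x \<in> ball d (r/2) \<longrightarrow> P x" using r(3) by eventually_elim (use sub in blast)
      then show "\<exists>r>0. AE x in lebesgue. x \<in> ball d r \<longrightarrow> P x" using r(2) by (intro exI[of _ "r/2"]) auto
      qed
    qed (use s r in auto)
  qed
  have cov: "\<Omega> \<subseteq> A \<union> B"
  proof
    fix c assume c: "c \<in> \<Omega>"
    obtain s where s: "s > 0" "cball c s \<subseteq> \<Omega>" using op c open_contains_cball by blast
    have "cball c (2 * (s / 2)) \<subseteq> \<Omega>" "s / 2 > 0" using s by auto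
    from supersol_local_dichotomy[OF S this(2,1)] show "c \<in> A \<union> B" using c \<open>s / 2 > 0\<close> unfolding A_def B_def by blast
  qed
  have disj: "A \<inter> B \<inter> \<Omega> = {}"
  proof (rule ccontr)
    assume "A \<inter> B \<inter> \<Omega> \<noteq> {}"
    then obtain c r s where "r > 0" "AE x in lebesgue. x \<in> ball c r \<longrightarrow> V x = 0" "s > 0" "AE x in lebesgue. x \<in> ball c s \<longrightarrow> V x \<noteq> 0"
      by (auto simp: A_def B_def)
    note rs = this
    have "AE x in lebesgue. x \<in> ball c (min r s) \<longrightarrow> False" using rs(2,4) by eventually_elim auto
    then show False using ball_not_null[of "ball c (min r s)" c] rs(1,3) by auto
  qed
  have "open A" "open B" unfolding A_def B_def by (rule opn)+
  then have "A \<inter> \<Omega> = {} \<or> B \<inter> \<Omega> = {}" using connectedD[OF conn _ _ disj cov] by blast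
  then show ?thesis
  proof
    assume "A \<inter> \<Omega> = {}"
    then have "\<exists>r>0. AE x in lebesgue. x \<in> ball c r \<longrightarrow> V x \<noteq> 0" if "c \<in> \<Omega>" for c using cov that by (auto simp: B_def)
    then have "AE x in M. V x \<noteq> 0" by (rule AE_lebesgue_cover[OF _ Omega_sets])
    then have "AE x in M. V x > 0" using nn by eventually_elim simp
    then show ?thesis ..
  next
    assume "B \<inter> \<Omega> = {}"
    then have "\<exists>r>0. AE x in lebesgue. x \<in> ball c r \<longrightarrow> V x = 0" if "c \<in> \<Omega>" for c using cov that by (auto simp: A_def)
    then have "AE x in M. V x = 0" by (rule AE_lebesgue_cover[OF _ Omega_sets])
    then show ?thesis ..
  qed
qed

end

subsection \<open>Weak solutions and eigenfunctions\<close>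

definition comb :: "real \<Rightarrow> real \<Rightarrow> ('a \<Rightarrow> real) \<Rightarrow> 'a \<Rightarrow> real" where
  "comb s t u x = s * pos_part u x - t * neg_part u x"

text \<open>The gradient of \<open>comb s t u\<close> if \<open>G\<close> is that of
  \<open>u\<close>; the value 0 on the zero set of \<open>u\<close> fits because gradients vanish
  there almost everywhere.\<close>

definition comb_grad :: "real \<Rightarrow> real \<Rightarrow> ('a \<Rightarrow> real) \<Rightarrow> ('a \<Rightarrow> 'v::real_vector) \<Rightarrow> 'a \<Rightarrow> 'v" where
  "comb_grad s t u G x = (if u x > 0 then s else if u x < 0 then t else 0) *\<^sub>R G x"

lemma comb_cases: "comb s t u x = (if u x > 0 then s * u x else if u x < 0 then t * u x else 0)"
  by (auto simp: comb_def pos_part_def neg_part_def)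

lemma comb_cmult: "c \<ge> 0 \<Longrightarrow> comb s t (\<lambda>x. c * u x) = (\<lambda>x. comb (c * s) (c * t) u x)"
  by (rule ext) (auto simp: comb_cases zero_less_mult_iff mult_less_0_iff)

lemma comb_mult: "c * comb s t u x = comb (c * s) (c * t) u x"
  by (simp add: comb_cases)

text \<open>The parts have disjoint supports, so the nonlinear flux is additive on them, and it is
  homogeneous of degree p - 1 for nonnegative factors.\<close>

lemma flux_comb: 
  assumes "s \<ge> 0" "t \<ge> 0"
  shows "flux p (comb s t u x) = s powr (p - 1) * flux p (comb 1 0 u x) + t powr (p - 1) * flux p (comb 0 1 u x)"
  using flux_scaleR_pos[OF assms(1), of p "u x"] flux_scaleR_pos[OF assms(2), of p "u x"] by (simp add: comb_cases)

lemma flux_comb_grad: 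
  assumes "s \<ge> 0" "t \<ge> 0"
  shows "flux p (comb_grad s t u G x) = s powr (p - 1) *\<^sub>R flux p (comb_grad 1 0 u G x) + t powr (p - 1) *\<^sub>R flux p (comb_grad 0 1 u G x)"
  using flux_scaleR_pos[OF assms(1), of p "G x"] flux_scaleR_pos[OF assms(2), of p "G x"] by (simp add: comb_grad_def)

lemma comb_measurable[measurable]:
  assumes [measurable]: "u \<in> borel_measurable M"
  shows "comb s t u \<in> borel_measurable M"
  unfolding comb_def[abs_def] pos_part_def neg_part_def by measurable

lemma comb_grad_measurable[measurable]:
  fixes G :: "'m \<Rightarrow> 'v::euclidean_space"
  assumes [measurable]: "u \<in> borel_measurable M" "G \<in> borel_measurable M"
  shows "comb_grad s t u G \<in> borel_measurable M"
  unfolding comb_grad_def[abs_def] by measurable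

lemma comb_grad_Lp:
  fixes G :: "'m \<Rightarrow> 'v::euclidean_space"
  assumes "u \<in> borel_measurable M" "G \<in> Lp_fun p M" "p > 0"
  shows "comb_grad s t u G \<in> Lp_fun p M"
  by (rule Lp_fun_dom[OF comb_grad_measurable[OF assms(1) Lp_fun_measurable[OF assms(2)]] Lp_fun_scaleR[OF assms(2), of "\<bar>s\<bar> + \<bar>t\<bar>"] assms(3)])
     (auto simp: comb_grad_def mult_right_mono)

lemma pint_comb_grad:
  fixes G :: "'m \<Rightarrow> 'v::euclidean_space"
  assumes "u \<in> borel_measurable M" "G \<in> Lp_fun p M" "p > 0" "s \<ge> 0" "t \<ge> 0"
  shows "pint p M (comb_grad s t u G) = s powr p * pint p M (comb_grad 1 0 u G) + t powr p * pint p M (comb_grad 0 1 u G)"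
proof -
  have "norm (comb_grad s t u G x) powr p = s powr p * norm (comb_grad 1 0 u G x) powr p + t powr p * norm (comb_grad 0 1 u G x) powr p" for x
    using assms by (simp add: comb_grad_def powr_mult)
  then show ?thesis
    unfolding pint_def using Lp_fun_integrable[OF comb_grad_Lp[OF assms(1-3)]] by simp
qed

text \<open>The function is combined like its gradient, so norms inherit the facts proved for
  energies.\<close>

lemma comb_eq_grad: "comb s t u = comb_grad s t u u"
  by (rule ext) (simp add: comb_cases comb_grad_def)

lemma pint_comb:
  fixes u :: "'m \<Rightarrow> real"
  assumes "u \<in> Lp_fun p M" "p > 0" "s \<ge> 0" "t \<ge> 0"
  shows "pint p M (comb s t u) = s powr p * pint p M (comb 1 0 u) + t powr p * pint p M (comb 0 1 u)"
  unfolding comb_eq_grad by (rule pint_comb_grad[OF Lp_fun_measurable[OF assms(1)] assms])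

lemma comb_Lp:
  fixes u :: "'m \<Rightarrow> real"
  assumes "u \<in> Lp_fun p M" "p > 0"
  shows "comb s t u \<in> Lp_fun p M"
  unfolding comb_eq_grad by (rule comb_grad_Lp[OF Lp_fun_measurable[OF assms(1)] assms])

lemma comb_1_1: "comb 1 1 u = u"
  by (rule ext) (simp add: comb_cases)

lemma comb_1_0: "comb 1 0 u = pos_part u" and comb_0_1: "comb 0 1 u = (\<lambda>x. - neg_part u x)"
  by (auto simp: comb_def)

context sobolev begin

lemma is_W0_comb:
  assumes W: "is_W0 u G"
  shows "is_W0 (comb s t u) (comb_grad s t u G)"
proof (rule is_W0_cong[OF is_W0_diff[OF is_W0_cmult[OF is_W0_pos_part[OF W], of s] is_W0_cmult[OF is_W0_neg_part[OF W], of t]]])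
  show "AE x in M. s * pos_part u x - t * neg_part u x = comb s t u x" by (simp add: comb_def)
  show "AE x in M. s *\<^sub>R (indicat_real {x. 0 < u x} x *\<^sub>R G x) - t *\<^sub>R - (indicat_real {x. u x < 0} x *\<^sub>R G x) = comb_grad s t u G x"
    by (intro AE_I2) (auto simp: comb_grad_def indicator_def)
qed

text \<open>In contrast to \<open>plaplace_solution\<close> it carries a gradient \<open>H\<close>
  of its own, which can be scaled and passed to limits without choosing representatives.\<close>

definition sol :: "('a \<Rightarrow> real) \<Rightarrow> ('a \<Rightarrow> 'a) \<Rightarrow> ('a \<Rightarrow> real) \<Rightarrow> bool" where
  "sol U H f \<longleftrightarrow> is_W0 U H \<and> f \<in> Lp_fun q M \<and> (\<forall>\<psi> K. is_W0 \<psi> K \<longrightarrow> (LINT x|M. flux p (H x) \<bullet> K x) = (LINT x|M. f x * \<psi> x))"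

lemma solD:
  assumes "sol U H f"
  shows "is_W0 U H" "f \<in> Lp_fun q M" "is_W0 \<psi> K \<Longrightarrow> (LINT x|M. flux p (H x) \<bullet> K x) = (LINT x|M. f x * \<psi> x)"
  using assms by (auto simp: sol_def)

lemma plaplace_sol:
  assumes "plaplace_solution p \<Omega> g u"
  shows "sol u (weak_grad \<Omega> u) g"
  unfolding sol_def
proof (intro conjI allI impI)
  have u: "u \<in> W01p p \<Omega>" using assms by (simp add: plaplace_solution_def)
  show W: "is_W0 u (weak_grad \<Omega> u)" by (rule W01p_is_W0[OF u])
  show "g \<in> Lp_fun q M" using assms by (simp add: plaplace_solution_def Lp_space_eq)
  fix \<psi> K assume k: "is_W0 \<psi> K"
  note k' = is_W0_W01p[OF k]
  have "(LINT x|M. flux p (weak_grad \<Omega> u x) \<bullet> K x) = (LINT x|M. flux p (weak_grad \<Omega> u x) \<bullet> weak_grad \<Omega> \<psi> x)"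
  proof (rule integral_cong_AE)
    have m: "weak_grad \<Omega> u \<in> borel_measurable M" "K \<in> borel_measurable M" "weak_grad \<Omega> \<psi> \<in> borel_measurable M"
      using W k W01p_is_W0[OF k'(1)] is_W0_Lp(2) Lp_fun_measurable by blast+
    show "(\<lambda>x. flux p (weak_grad \<Omega> u x) \<bullet> K x) \<in> borel_measurable M" "(\<lambda>x. flux p (weak_grad \<Omega> u x) \<bullet> weak_grad \<Omega> \<psi> x) \<in> borel_measurable M"
      by (intro borel_measurable_inner flux_measurable[OF p1] m)+
    show "AE x in M. flux p (weak_grad \<Omega> u x) \<bullet> K x = flux p (weak_grad \<Omega> u x) \<bullet> weak_grad \<Omega> \<psi> x"
      using k'(2) by eventually_elim simp
  qed
  also have "\<dots> = (LINT x|M. g x * \<psi> x)" using assms k'(1) by (simp add: plaplace_solution_def flux_def)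
  finally show "(LINT x|M. flux p (weak_grad \<Omega> u x) \<bullet> K x) = (LINT x|M. g x * \<psi> x)" .
qed

lemma sol_cong:
  assumes S: "sol U H f" and "AE x in M. U x = U' x" "AE x in M. H x = H' x" "AE x in M. f x = f' x"
  shows "sol U' H' f'"
  unfolding sol_def
proof (intro conjI allI impI)
  show W': "is_W0 U' H'" by (rule is_W0_cong[OF solD(1)[OF S] assms(2,3)])
  have mf: "f' \<in> borel_measurable M" by (rule borel_measurable_AE_lebesgue_on[OF Lp_fun_measurable[OF solD(2)[OF S]] assms(4) Omega_sets])
  show f': "f' \<in> Lp_fun q M" by (rule Lp_fun_cong_AE[OF solD(2)[OF S] assms(4) mf q0])
  fix \<psi> K assume k: "is_W0 \<psi> K"
  note [measurable] = Lp_fun_measurable[OF is_W0_Lp(1)[OF k]] Lp_fun_measurable[OF is_W0_Lp(2)[OF k]] mf Lp_fun_measurable[OF solD(2)[OF S]]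
    flux_measurable[OF p1 Lp_fun_measurable[OF is_W0_Lp(2)[OF W']]] flux_measurable[OF p1 Lp_fun_measurable[OF is_W0_Lp(2)[OF solD(1)[OF S]]]]
  have "(LINT x|M. flux p (H' x) \<bullet> K x) = (LINT x|M. flux p (H x) \<bullet> K x)"
  proof (rule integral_cong_AE)
    show "AE x in M. flux p (H' x) \<bullet> K x = flux p (H x) \<bullet> K x" using assms(3) by eventually_elim simp
  qed measurable
  also have "\<dots> = (LINT x|M. f x * \<psi> x)" by (rule solD(3)[OF S k])
  also have "\<dots> = (LINT x|M. f' x * \<psi> x)"
  proof (rule integral_cong_AE)
    show "AE x in M. f x * \<psi> x = f' x * \<psi> x" using assms(4) by eventually_elim simp
  qed measurable
  finally show "(LINT x|M. flux p (H' x) \<bullet> K x) = (LINT x|M. f' x * \<psi> x)" .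
qed

lemma sol_plaplace:
  assumes S: "sol u H g"
  shows "plaplace_solution p \<Omega> g u"
proof -
  note u = is_W0_W01p[OF solD(1)[OF S]]
  have "AE x in M. H x = weak_grad \<Omega> u x" using u(2) by eventually_elim simp
  then have S': "sol u (weak_grad \<Omega> u) g" by (intro sol_cong[OF S]) auto
  show ?thesis
    unfolding plaplace_solution_def Lp_space_eq
    using solD(3)[OF S' W01p_is_W0] u(1) solD(2)[OF S] by (simp add: flux_def)
qed

lemma sol_scale:
  assumes S: "sol U H f" and c: "c > 0"
  shows "sol (\<lambda>x. c * U x) (\<lambda>x. c *\<^sub>R H x) (\<lambda>x. c powr (p - 1) * f x)"
  unfolding sol_def
proof (intro conjI allI impI)
  show "is_W0 (\<lambda>x. c * U x) (\<lambda>x. c *\<^sub>R H x)" by (rule is_W0_cmult[OF solD(1)[OF S]])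
  show "(\<lambda>x. c powr (p - 1) * f x) \<in> Lp_fun q M" by (rule Lp_fun_cmult[OF solD(2)[OF S]])
  fix \<psi> K assume k: "is_W0 \<psi> K"
  show "(LINT x|M. flux p (c *\<^sub>R H x) \<bullet> K x) = (LINT x|M. c powr (p - 1) * f x * \<psi> x)"
    using solD(3)[OF S k] c by (simp add: flux_scaleR_pos mult.assoc)
qed

lemma sol_energy:
  assumes S: "sol U H f"
  shows "pint p M H = (LINT x|M. f x * U x)" "pint p M H \<le> Lp_nrm p M U * Lp_nrm q M f"
proof -
  show e: "pint p M H = (LINT x|M. f x * U x)"
    using solD(3)[OF S solD(1)[OF S]] by (simp add: flux_inner pint_def)
  show "pint p M H \<le> Lp_nrm p M U * Lp_nrm q M f"
    unfolding e using Holder_inner(2)[OF p1 is_W0_Lp(1)[OF solD(1)[OF S]] solD(2)[OF S]] by simp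
qed

text \<open>Testing with the solution itself, together with Poincare's inequality, bounds the
  energies. Testing the difference of two equations with the difference of their solutions bounds
  the monotonicity defect by the distance of the right-hand sides, so \<open>flux_mono_small\<close>
  makes the gradients Cauchy in L^p.\<close>

lemma sol_conv:
  assumes S: "\<And>n. sol (U n) (H n) (f n)" and f: "Lp_conv q M f f0"
  obtains U0 H0 where "Lp_conv p M U U0" "Lp_conv p M H H0" "sol U0 H0 f0"
proof -
  obtain C where C: "C > 0" "\<And>u G. is_W0 u G \<Longrightarrow> pint p M u \<le> C * pint p M G" using poincare by blast
  have nP: "Lp_nrm p M u \<le> C powr (1/p) * Lp_nrm p M G" if "is_W0 u G" for u G
  proof -
    have "Lp_nrm p M u \<le> (C * pint p M G) powr (1/p)"
      unfolding Lp_nrm_def using C(2)[OF that] p0 by (intro powr_mono2) auto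
    then show ?thesis by (simp add: Lp_nrm_def powr_mult)
  qed
  note W = solD(1)[OF S]
  obtain F where F: "F > 0" "\<And>n. Lp_nrm q M (f n) \<le> F"
  proof -
    have "Bseq (\<lambda>n. Lp_nrm q M (f n))" using Lp_conv_nrm[OF q1 f] convergent_imp_Bseq convergentI by blast
    then obtain K where "K > 0" "\<And>n. norm (Lp_nrm q M (f n)) \<le> K" by (auto simp: Bseq_def)
    then show ?thesis using that[of K] by auto
  qed
  define A where "A = C powr (1/p) * F"
  have A: "A > 0" using C F by (simp add: A_def)
  have Hb: "Lp_nrm p M (H n) \<le> A powr (1/(p-1))" for n
  proof (cases "Lp_nrm p M (H n) = 0")
    case False
    define h where "h = Lp_nrm p M (H n)"
    have h: "h > 0" using False Lp_nrm_nonneg[of p M "H n"] by (simp add: h_def del: Lp_nrm_nonneg)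
    have "h powr p \<le> (C powr (1/p) * h) * F"
    proof -
      have "h powr p = pint p M (H n)" using p0 by (simp add: h_def Lp_nrm_powr)
      also have "\<dots> \<le> Lp_nrm p M (U n) * Lp_nrm q M (f n)" by (rule sol_energy(2)[OF S])
      also have "\<dots> \<le> (C powr (1/p) * h) * F" unfolding h_def using nP[OF W] F C by (intro mult_mono) auto
      finally show ?thesis .
    qed
    also have "h powr p = h powr (p - 1) * h" using h by (simp add: powr_diff)
    finally have "h powr (p - 1) \<le> A" using h by (simp add: A_def field_simps)
    then have "(h powr (p - 1)) powr (1/(p-1)) \<le> A powr (1/(p-1))" using p1 by (intro powr_mono2) auto
    then show ?thesis using p1 h by (simp add: powr_powr h_def)
  qed simp
  define B where "B = (A powr (1/(p-1))) powr p"
  have B: "B > 0" using A by (simp add: B_def)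
  have Hp: "pint p M (H n) \<le> B" for n
    using powr_mono2[OF _ _ Hb[of n], of p] p0 by (simp add: B_def Lp_nrm_powr)
  define D where "D = 2 * (C powr (1/p) * A powr (1/(p-1)))"
  have D: "D > 0" using A C by (simp add: D_def)
  have cau: "\<exists>N. \<forall>m\<ge>N. \<forall>n\<ge>N. pint p M (\<lambda>x. H m x - H n x) < e" if e: "e > 0" for e
  proof -
    obtain d where d: "d > 0" "\<And>(M::'a measure) (f :: 'a \<Rightarrow> 'a) g. f \<in> Lp_fun p M \<Longrightarrow> g \<in> Lp_fun p M \<Longrightarrow> pint p M f \<le> B \<Longrightarrow> pint p M g \<le> B \<Longrightarrow>
       (LINT x|M. (flux p (f x) - flux p (g x)) \<bullet> (f x - g x)) < d \<Longrightarrow> pint p M (\<lambda>x. f x - g x) < e"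
      using flux_mono_small[OF p1 e B] by blast
    have "\<forall>\<^sub>F n in sequentially. Lp_nrm q M (\<lambda>x. f n x - f0 x) < d / (2 * D)"
      using Lp_convD(3)[OF f] by (rule order_tendstoD) (use d D in simp)
    then obtain N where N: "\<And>n. n \<ge> N \<Longrightarrow> Lp_nrm q M (\<lambda>x. f n x - f0 x) < d / (2 * D)" by (auto simp: eventually_sequentially)
    have "pint p M (\<lambda>x. H m x - H n x) < e" if mn: "m \<ge> N" "n \<ge> N" for m n
    proof (rule d(2)[OF is_W0_Lp(2)[OF W] is_W0_Lp(2)[OF W] Hp Hp])
      note Wd = is_W0_diff[OF W[of m] W[of n]]
      have ii: "integrable M (\<lambda>x. flux p (H k x) \<bullet> (H m x - H n x))" for k
        by (rule Holder_inner(1)[OF p1 is_W0_Lp(2)[OF Wd] flux_Lp(1)[OF p1 is_W0_Lp(2)[OF W]]])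
      have fi: "integrable M (\<lambda>x. f k x * (U m x - U n x))" for k
        using Holder_inner(1)[OF p1 is_W0_Lp(1)[OF Wd] solD(2)[OF S, of k]] by simp
      have "(LINT x|M. (flux p (H m x) - flux p (H n x)) \<bullet> (H m x - H n x)) = (LINT x|M. flux p (H m x) \<bullet> (H m x - H n x)) - (LINT x|M. flux p (H n x) \<bullet> (H m x - H n x))"
        unfolding inner_diff_left by (rule Bochner_Integration.integral_diff[OF ii ii])
      also have "\<dots> = (LINT x|M. f m x * (U m x - U n x)) - (LINT x|M. f n x * (U m x - U n x))"
        using solD(3)[OF S Wd] by simp
      also have "\<dots> = (LINT x|M. (f m x - f n x) * (U m x - U n x))"
        unfolding left_diff_distrib by (rule Bochner_Integration.integral_diff[OF fi fi, symmetric])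
      also have "\<dots> \<le> Lp_nrm p M (\<lambda>x. U m x - U n x) * Lp_nrm q M (\<lambda>x. f m x - f n x)"
        using Holder_inner(2)[OF p1 is_W0_Lp(1)[OF Wd] Lp_fun_diff[OF solD(2)[OF S, of m] solD(2)[OF S, of n] q0]] by simp
      also have "\<dots> \<le> D * Lp_nrm q M (\<lambda>x. f m x - f n x)"
      proof (rule mult_right_mono)
        have "Lp_nrm p M (\<lambda>x. U m x - U n x) \<le> Lp_nrm p M (U m) + Lp_nrm p M (U n)"
          by (rule Minkowski_diff(1)[OF p1 is_W0_Lp(1)[OF W] is_W0_Lp(1)[OF W]])
        also have "\<dots> \<le> C powr (1/p) * A powr (1/(p-1)) + C powr (1/p) * A powr (1/(p-1))"
          using order_trans[OF nP[OF W] mult_left_mono[OF Hb]] by (intro add_mono) auto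
        finally show "Lp_nrm p M (\<lambda>x. U m x - U n x) \<le> D" by (simp add: D_def)
      qed simp
      also have "\<dots> < d"
      proof -
        have "Lp_nrm q M (\<lambda>x. f m x - f n x) \<le> Lp_nrm q M (\<lambda>x. f m x - f0 x) + Lp_nrm q M (\<lambda>x. f n x - f0 x)"
          using Minkowski_triangle[OF q1 solD(2)[OF S, of m] Lp_convD(2)[OF f] solD(2)[OF S, of n]]
          by (simp add: Lp_nrm_minus_commute[of q M f0])
        also have "\<dots> < d / D" using N[OF mn(1)] N[OF mn(2)] by simp
        finally show ?thesis using D by (simp add: field_simps)
      qed
      finally show "(LINT x|M. (flux p (H m x) - flux p (H n x)) \<bullet> (H m x - H n x)) < d" .
    qed
    then show ?thesis by blast
  qed
  obtain H0 where H0: "Lp_conv p M H H0" using Lp_complete[OF p1 is_W0_Lp(2)[OF W] cau] by blast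
  have cauU: "\<exists>N. \<forall>m\<ge>N. \<forall>n\<ge>N. pint p M (\<lambda>x. U m x - U n x) < e" if e: "e > 0" for e
  proof -
    obtain N where N: "\<forall>m\<ge>N. \<forall>n\<ge>N. pint p M (\<lambda>x. H m x - H n x) < e / C" using cau[of "e / C"] e C by auto
    have "pint p M (\<lambda>x. U m x - U n x) < e" if "m \<ge> N" "n \<ge> N" for m n
    proof -
      have "pint p M (\<lambda>x. U m x - U n x) \<le> C * pint p M (\<lambda>x. H m x - H n x)" by (rule C(2)[OF is_W0_diff[OF W W]])
      also have "\<dots> < e" using N that C(1) by (simp add: field_simps)
      finally show ?thesis .
    qed
    then show ?thesis by blast
  qed
  obtain U0 where U0: "Lp_conv p M U U0" using Lp_complete[of p U M, OF p1 is_W0_Lp(1)[OF W] cauU] by blast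
  have "sol U0 H0 f0"
    unfolding sol_def
  proof (intro conjI allI impI)
    show "is_W0 U0 H0" by (rule is_W0_closed[OF W U0 H0])
    show "f0 \<in> Lp_fun q M" by (rule Lp_convD(2)[OF f])
    fix \<psi> K assume k: "is_W0 \<psi> K"
    have 1: "(\<lambda>n. LINT x|M. flux p (H n x) \<bullet> K x) \<longlonglongrightarrow> (LINT x|M. flux p (H0 x) \<bullet> K x)"
      by (rule Lp_pairing_tendsto[OF p1 Lp_conv_const[OF is_W0_Lp(2)[OF k]] Lp_conv_flux[OF p1 H0]])
    have 2: "(\<lambda>n. LINT x|M. f n x \<bullet> \<psi> x) \<longlonglongrightarrow> (LINT x|M. f0 x \<bullet> \<psi> x)"
      by (rule Lp_pairing_tendsto[OF p1 Lp_conv_const[OF is_W0_Lp(1)[OF k]] f])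
    show "(LINT x|M. flux p (H0 x) \<bullet> K x) = (LINT x|M. f0 x * \<psi> x)"
      using LIMSEQ_unique[OF 1] 2 solD(3)[OF S k] by simp
  qed
  with U0 H0 that show ?thesis by blast
qed

definition eig :: "real \<Rightarrow> ('a \<Rightarrow> real) \<Rightarrow> ('a \<Rightarrow> 'a) \<Rightarrow> bool" where
  "eig \<mu> u G \<longleftrightarrow> sol u G (\<lambda>x. \<mu> * flux p (u x)) \<and> \<not> (AE x in M. u x = 0)"

lemma eig_nonneg_supersol:
  assumes "eig \<mu> u G" "\<mu> \<ge> 0" "AE x in M. u x \<ge> 0"
  shows "supersol u G"
  unfolding supersol_def
proof (intro conjI allI impI)
  have S: "sol u G (\<lambda>x. \<mu> * flux p (u x))" using assms(1) by (simp add: eig_def)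
  show "is_W0 u G" by (rule solD(1)[OF S])
  show "AE x in M. 0 \<le> u x" by (rule assms(3))
  fix \<psi> K assume k: "is_W0 \<psi> K" "AE x in M. 0 \<le> \<psi> x"
  have "0 \<le> (LINT x|M. \<mu> * flux p (u x) * \<psi> x)"
  proof (rule integral_nonneg_AE)
    show "AE x in M. 0 \<le> \<mu> * flux p (u x) * \<psi> x" using assms(3) k(2)
      by eventually_elim (use assms(2) in \<open>simp add: flux_def\<close>)
  qed
  then show "0 \<le> (LINT x|M. flux p (G x) \<bullet> K x)" using solD(3)[OF S k(1)] by simp
qed

text \<open>\<open>bd\<close> bounds the Rayleigh quotients of the negative parts. So they stay
  relatively compact after normalization even if the parts themselves shrink to 0, and the
  normalized ones have a limit of norm 1.\<close>

lemma not_nonneg_limit: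
  assumes conn: "connected \<Omega>" and W: "\<And>n. is_W0 (v n) (K n)"
    and pos: "\<And>n. pint p M (comb 0 1 (v n)) > 0"
    and bd: "\<And>n. pint p M (comb_grad 0 1 (v n) (K n)) \<le> B * pint p M (comb 0 1 (v n))"
    and conv: "Lp_conv p M v U" and E: "eig \<mu> U H" and \<mu>: "\<mu> \<ge> 0"
  shows "\<not> (AE x in M. U x \<ge> 0)"
proof
  assume nn: "AE x in M. U x \<ge> 0"
  have "(AE x in M. U x = 0) \<or> (AE x in M. U x > 0)"
    by (rule strong_maximum_principle[OF conn eig_nonneg_supersol[OF E \<mu> nn]])
  then have Up: "AE x in M. U x > 0" using E by (auto simp: eig_def)
  define c where "c n = 1 / Lp_nrm p M (comb 0 1 (v n))" for n
  have np: "Lp_nrm p M (comb 0 1 (v n)) > 0" for n using pos[of n] by (simp add: Lp_nrm_def)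
  have cp: "c n > 0" for n using np[of n] by (simp add: c_def)
  have cn: "c n powr p * pint p M (comb 0 1 (v n)) = 1" for n
    using np[of n] pos[of n] p0 by (simp add: c_def powr_divide Lp_nrm_powr)
  define m where "m n x = c n * comb 0 1 (v n) x" for n x
  define L where "L n x = c n *\<^sub>R comb_grad 0 1 (v n) (K n) x" for n x
  have Wm: "is_W0 (m n) (L n)" for n unfolding m_def L_def by (rule is_W0_cmult[OF is_W0_comb[OF W]])
  have m1: "pint p M (m n) = 1" for n
    using cn[of n] cp[of n] pint_scaleR[of p M "c n" "comb 0 1 (v n)"] by (simp add: m_def[abs_def])
  have L1: "pint p M (L n) \<le> B" for n
  proof -
    have "pint p M (L n) = c n powr p * pint p M (comb_grad 0 1 (v n) (K n))"
      using cp[of n] by (simp add: L_def[abs_def] pint_scaleR)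
    also have "\<dots> \<le> c n powr p * (B * pint p M (comb 0 1 (v n)))" by (intro mult_left_mono bd) auto
    also have "\<dots> = B * (c n powr p * pint p M (comb 0 1 (v n)))" by simp
    finally show ?thesis by (simp add: cn)
  qed
  obtain r f where r: "strict_mono r" "Lp_conv p M (\<lambda>n. m (r n)) f" using rellich[of m L B, OF Wm L1] by blast
  have f1: "pint p M f = 1" using LIMSEQ_unique[OF Lp_conv_pint'[OF p1 r(2)], of 1] by (simp add: m1)
  obtain s where s: "strict_mono s" "AE x in M. (\<lambda>n. m (r (s n)) x) \<longlonglongrightarrow> f x" using Lp_conv_AE_subseq[OF p1 r(2)] by blast
  obtain t where t: "strict_mono t" "AE x in M. (\<lambda>n. v (r (s (t n))) x) \<longlonglongrightarrow> U x"
    using Lp_conv_AE_subseq[OF p1 Lp_conv_subseq[OF Lp_conv_subseq[OF conv r(1)] s(1)]] by blast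
  have "AE x in M. f x = 0" using s(2) t(2) Up
  proof eventually_elim
    case (elim x)
    have "\<forall>\<^sub>F n in sequentially. v (r (s (t n))) x > 0" using elim(2,3) by (rule order_tendstoD)
    then have "\<forall>\<^sub>F n in sequentially. m (r (s (t n))) x = 0" by eventually_elim (simp add: m_def comb_cases)
    then have "(\<lambda>n. m (r (s (t n))) x) \<longlonglongrightarrow> 0" by (rule tendsto_eventually)
    moreover have "(\<lambda>n. m (r (s (t n))) x) \<longlonglongrightarrow> f x" using LIMSEQ_subseq_LIMSEQ[OF elim(1) t(1)] by (simp add: o_def)
    ultimately show ?case using LIMSEQ_unique by blast
  qed
  then have "pint p M f = 0" using pint_zero_iff[OF Lp_convD(2)[OF r(2)] p0] by blast
  then show False using f1 by simp
qed

end

section \<open>Rescaling and recombining eigenfunctions\<close>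

lemma flux_uminus: "flux p (- a) = - flux p a"
  by (simp add: flux_def)

lemma subseq_principle:
  fixes X :: "nat \<Rightarrow> real"
  assumes "\<And>r :: nat \<Rightarrow> nat. strict_mono r \<Longrightarrow> \<exists>s. strict_mono s \<and> (\<lambda>n. X (r (s n))) \<longlonglongrightarrow> L"
  shows "X \<longlonglongrightarrow> L"
proof (rule ccontr)
  assume "\<not> X \<longlonglongrightarrow> L"
  then obtain e where e: "e > 0" "\<forall>N. \<exists>n\<ge>N. \<not> dist (X n) L < e" by (auto simp: lim_sequentially)
  then have "infinite {n. \<not> dist (X n) L < e}" by (simp add: infinite_nat_iff_unbounded_le)
  then obtain r :: "nat \<Rightarrow> nat" where r: "strict_mono r" "\<And>n. r n \<in> {n. \<not> dist (X n) L < e}" using infinite_enumerate by blast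
  obtain s where s: "strict_mono s" "(\<lambda>n. X (r (s n))) \<longlonglongrightarrow> L" using assms[OF r(1)] by blast
  then obtain n where "dist (X (r (s n))) L < e" using e(1) by (metis lim_sequentially order_refl)
  then show False using r(2) by blast
qed

lemma Lp_conv_pos_part:
  fixes F :: "nat \<Rightarrow> 'm \<Rightarrow> real"
  assumes p: "p > 1" and F: "Lp_conv p M F f"
  shows "Lp_conv p M (\<lambda>n. comb 1 0 (F n)) (comb 1 0 f)"
proof (rule Lp_conv_sandwich)
  have p0: "p > 0" using p by simp
  show "comb 1 0 (F n) \<in> Lp_fun p M" for n by (rule comb_Lp[OF Lp_convD(1)[OF F] p0])
  show "comb 1 0 f \<in> Lp_fun p M" by (rule comb_Lp[OF Lp_convD(2)[OF F] p0])
  show "(\<lambda>n. Lp_nrm p M (\<lambda>x. F n x - f x)) \<longlonglongrightarrow> 0" by (rule Lp_convD(3)[OF F])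
  have "Lp_nrm p M (\<lambda>x. comb 1 0 (F n) x - comb 1 0 f x) \<le> Lp_nrm p M (\<lambda>x. F n x - f x)" for n
  proof (rule Lp_nrm_mono[OF _ Lp_fun_diff[OF Lp_convD(1,2)[OF F] p0] p0])
    show "(\<lambda>x. comb 1 0 (F n) x - comb 1 0 f x) \<in> borel_measurable M"
      using Lp_fun_measurable[OF Lp_convD(1)[OF F]] Lp_fun_measurable[OF Lp_convD(2)[OF F]] by (intro borel_measurable_diff comb_measurable)
    show "AE x in M. norm (comb 1 0 (F n) x - comb 1 0 f x) \<le> norm (F n x - f x)"
      by (intro AE_I2) (auto simp: comb_def pos_part_def max_def)
  qed
  then show "\<forall>\<^sub>F n in sequentially. Lp_nrm p M (\<lambda>x. comb 1 0 (F n) x - comb 1 0 f x) \<le> Lp_nrm p M (\<lambda>x. F n x - f x)" by simp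
qed

lemma Lp_conv_comb:
  fixes F :: "nat \<Rightarrow> 'm \<Rightarrow> real"
  assumes p: "p > 1" and F: "Lp_conv p M F f" and s: "s \<longlonglongrightarrow> s0" and t: "t \<longlonglongrightarrow> t0"
  shows "Lp_conv p M (\<lambda>n. comb (s n) (t n) (F n)) (comb s0 t0 f)"
proof -
  have 1: "comb a b g = (\<lambda>x. a * comb 1 0 g x + b * (g x - comb 1 0 g x))" for a b and g :: "'m \<Rightarrow> real"
    by (rule ext) (simp add: comb_cases)
  show ?thesis
    unfolding 1[of "s _"] 1[of s0]
    by (rule Lp_conv_add[OF p Lp_conv_cmult[OF p Lp_conv_pos_part[OF p F] s] Lp_conv_cmult[OF p Lp_conv_diff[OF p F Lp_conv_pos_part[OF p F]] t]])
qed

context sobolev begin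

lemma eig_uminus:
  assumes "eig \<mu> u G"
  shows "eig \<mu> (\<lambda>x. - u x) (\<lambda>x. - G x)"
proof -
  have S: "sol u G (\<lambda>x. \<mu> * flux p (u x))" and nz: "\<not> (AE x in M. u x = 0)" using assms by (auto simp: eig_def)
  have "sol (\<lambda>x. - u x) (\<lambda>x. - G x) (\<lambda>x. \<mu> * flux p (- u x))"
    unfolding sol_def
  proof (intro conjI allI impI)
    show "is_W0 (\<lambda>x. - u x) (\<lambda>x. - G x)" using is_W0_cmult[OF solD(1)[OF S], of "-1"] by simp
    show "(\<lambda>x. \<mu> * flux p (- u x)) \<in> Lp_fun q M" using Lp_fun_uminus[OF solD(2)[OF S]] by (simp add: flux_uminus)
    show "(LINT x|M. flux p (- G x) \<bullet> K x) = (LINT x|M. \<mu> * flux p (- u x) * \<psi> x)" if "is_W0 \<psi> K" for \<psi> K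
      using solD(3)[OF S that] by (simp add: flux_uminus)
  qed
  with nz show ?thesis by (simp add: eig_def)
qed

lemma eig_scale:
  assumes "eig \<mu> u G" "c > 0"
  shows "eig \<mu> (\<lambda>x. c * u x) (\<lambda>x. c *\<^sub>R G x)"
proof -
  have S: "sol u G (\<lambda>x. \<mu> * flux p (u x))" and nz: "\<not> (AE x in M. u x = 0)" using assms by (auto simp: eig_def)
  have "flux p (c * u x) = c powr (p - 1) * flux p (u x)" for x
    using flux_scaleR_pos[of c p "u x"] assms(2) by simp
  then have "sol (\<lambda>x. c * u x) (\<lambda>x. c *\<^sub>R G x) (\<lambda>x. \<mu> * flux p (c * u x))"
    using sol_scale[OF S assms(2)] by (simp add: mult.left_commute)
  with nz show ?thesis using assms(2) by (simp add: eig_def)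
qed

lemma eig_cong:
  assumes "eig \<mu> u G" "AE x in M. u x = u' x" "AE x in M. G x = G' x"
  shows "eig \<mu> u' G'"
proof -
  have S: "sol u G (\<lambda>x. \<mu> * flux p (u x))" and nz: "\<not> (AE x in M. u x = 0)" using assms by (auto simp: eig_def)
  have "AE x in M. \<mu> * flux p (u x) = \<mu> * flux p (u' x)" using assms(2) by eventually_elim simp
  then have "sol u' G' (\<lambda>x. \<mu> * flux p (u' x))" by (rule sol_cong[OF S assms(2,3)])
  moreover have "\<not> (AE x in M. u' x = 0)"
  proof
    assume "AE x in M. u' x = 0"
    then have "AE x in M. u x = 0" using assms(2) by eventually_elim simp
    with nz show False ..
  qed
  ultimately show ?thesis by (simp add: eig_def)
qed

lemma eig_comb_weights_equal:
  assumes conn: "connected \<Omega>" and e: "eig \<mu> e E" and \<mu>: "\<mu> \<ge> 0" and F: "eig \<mu> (comb \<sigma> \<tau> e) F"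
    and st: "\<sigma> > 0" "\<tau> > 0" and sg: "\<not> (AE x in M. e x \<ge> 0)" "\<not> (AE x in M. e x \<le> 0)"
  shows "\<sigma> = \<tau>"
proof (rule ccontr)
  assume ne: "\<sigma> \<noteq> \<tau>"
  have S1: "sol e E (\<lambda>x. \<mu> * flux p (e x))" and S2: "sol (comb \<sigma> \<tau> e) F (\<lambda>x. \<mu> * flux p (comb \<sigma> \<tau> e x))"
    using e F by (auto simp: eig_def)
  note We = solD(1)[OF S1]
  note me = Lp_fun_measurable[OF is_W0_Lp(1)[OF We]]
  have g1: "AE x in M. E x = comb_grad 1 1 e E x"
    by (rule is_W0_unique[OF We is_W0_comb[OF We, of 1 1]]) (simp add: comb_1_1)
  have S1': "sol (comb 1 1 e) (comb_grad 1 1 e E) (\<lambda>x. \<mu> * flux p (comb 1 1 e x))"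
    unfolding comb_1_1 by (rule sol_cong[OF S1 _ g1]) auto
  have g2: "AE x in M. F x = comb_grad \<sigma> \<tau> e E x"
    by (rule is_W0_unique[OF solD(1)[OF S2] is_W0_comb[OF We]]) simp
  have S2': "sol (comb \<sigma> \<tau> e) (comb_grad \<sigma> \<tau> e E) (\<lambda>x. \<mu> * flux p (comb \<sigma> \<tau> e x))"
    by (rule sol_cong[OF S2 _ g2]) auto
  \<comment> \<open>The defect of the eigenvalue equation for \<open>comb s t e\<close>. By
    \<open>lin\<close> it depends linearly on the powers p - 1 of s and t, and it vanishes for the
    weights 1, 1 and for \<sigma>, \<tau>. As these powers differ for \<sigma> and \<tau>, the
    positive part alone has defect 0.\<close>
  define X where "X s t \<psi> K = (LINT x|M. flux p (comb_grad s t e E x) \<bullet> K x) - (LINT x|M. \<mu> * flux p (comb s t e x) * \<psi> x)" for s t and \<psi> :: "'a \<Rightarrow> real" and K :: "'a \<Rightarrow> 'a"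
  have lin: "X s t \<psi> K = s powr (p - 1) * X 1 0 \<psi> K + t powr (p - 1) * X 0 1 \<psi> K" if "s \<ge> 0" "t \<ge> 0" "is_W0 \<psi> K" for s t \<psi> K
  proof -
    have i1: "integrable M (\<lambda>x. flux p (comb_grad s t e E x) \<bullet> K x)" for s t
      by (rule Holder_inner(1)[OF p1 is_W0_Lp(2)[OF that(3)] flux_Lp(1)[OF p1 comb_grad_Lp[OF me is_W0_Lp(2)[OF We] p0]]])
    have i2: "integrable M (\<lambda>x. flux p (comb s t e x) * \<psi> x)" for s t
      using Holder_inner(1)[OF p1 is_W0_Lp(1)[OF that(3)] flux_Lp(1)[OF p1 comb_Lp[OF is_W0_Lp(1)[OF We] p0]]] by simp
    have "(LINT x|M. flux p (comb_grad s t e E x) \<bullet> K x) = (LINT x|M. s powr (p - 1) * (flux p (comb_grad 1 0 e E x) \<bullet> K x) + t powr (p - 1) * (flux p (comb_grad 0 1 e E x) \<bullet> K x))"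
      unfolding flux_comb_grad[OF that(1,2), of p e E] by (simp add: inner_add_left)
    also have "\<dots> = s powr (p - 1) * (LINT x|M. flux p (comb_grad 1 0 e E x) \<bullet> K x) + t powr (p - 1) * (LINT x|M. flux p (comb_grad 0 1 e E x) \<bullet> K x)"
      using i1[of 1 0] i1[of 0 1] by simp
    finally have e1: "(LINT x|M. flux p (comb_grad s t e E x) \<bullet> K x) = s powr (p - 1) * (LINT x|M. flux p (comb_grad 1 0 e E x) \<bullet> K x) + t powr (p - 1) * (LINT x|M. flux p (comb_grad 0 1 e E x) \<bullet> K x)" .
    have "(LINT x|M. \<mu> * flux p (comb s t e x) * \<psi> x) = (LINT x|M. (\<mu> * s powr (p - 1)) * (flux p (comb 1 0 e x) * \<psi> x) + (\<mu> * t powr (p - 1)) * (flux p (comb 0 1 e x) * \<psi> x))"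
      unfolding flux_comb[OF that(1,2), of p e] by (simp add: algebra_simps)
    also have "\<dots> = (\<mu> * s powr (p - 1)) * (LINT x|M. flux p (comb 1 0 e x) * \<psi> x) + (\<mu> * t powr (p - 1)) * (LINT x|M. flux p (comb 0 1 e x) * \<psi> x)"
      using i2[of 1 0] i2[of 0 1] by simp
    finally have e2: "(LINT x|M. \<mu> * flux p (comb s t e x) * \<psi> x) = (\<mu> * s powr (p - 1)) * (LINT x|M. flux p (comb 1 0 e x) * \<psi> x) + (\<mu> * t powr (p - 1)) * (LINT x|M. flux p (comb 0 1 e x) * \<psi> x)" .
    have e3: "(LINT x|M. \<mu> * flux p (comb a b e x) * \<psi> x) = \<mu> * (LINT x|M. flux p (comb a b e x) * \<psi> x)" for a b
      by (simp add: mult.assoc)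
    show ?thesis unfolding X_def e1 e2 e3 by (simp add: algebra_simps)
  qed
  have X0: "X 1 0 \<psi> K = 0" if k: "is_W0 \<psi> K" for \<psi> K
  proof -
    have a: "X 1 0 \<psi> K + X 0 1 \<psi> K = 0" using lin[OF _ _ k, of 1 1] solD(3)[OF S1' k] by (simp add: X_def)
    have b: "\<sigma> powr (p - 1) * X 1 0 \<psi> K + \<tau> powr (p - 1) * X 0 1 \<psi> K = 0"
      using lin[OF _ _ k, of \<sigma> \<tau>] solD(3)[OF S2' k] st by (simp add: X_def)
    have "(\<sigma> powr (p - 1) - \<tau> powr (p - 1)) * X 1 0 \<psi> K = (\<sigma> powr (p - 1) * X 1 0 \<psi> K + \<tau> powr (p - 1) * X 0 1 \<psi> K) - \<tau> powr (p - 1) * (X 1 0 \<psi> K + X 0 1 \<psi> K)"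
      by (simp add: algebra_simps)
    then have "(\<sigma> powr (p - 1) - \<tau> powr (p - 1)) * X 1 0 \<psi> K = 0" using a b by simp
    moreover have "\<sigma> powr (p - 1) \<noteq> \<tau> powr (p - 1)"
      using ne st p1 powr_less_mono2[of "p - 1" \<sigma> \<tau>] powr_less_mono2[of "p - 1" \<tau> \<sigma>] by (metis diff_gt_0_iff_gt less_eq_real_def less_irrefl linorder_neqE_linordered_idom)
    ultimately show ?thesis by simp
  qed
  \<comment> \<open>The positive part alone solves the equation but vanishes where e is negative,
    against the strong maximum principle.\<close>
  have "sol (comb 1 0 e) (comb_grad 1 0 e E) (\<lambda>x. \<mu> * flux p (comb 1 0 e x))"
    unfolding sol_def
  proof (intro conjI allI impI)
    show "is_W0 (comb 1 0 e) (comb_grad 1 0 e E)" by (rule is_W0_comb[OF We])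
    show "(\<lambda>x. \<mu> * flux p (comb 1 0 e x)) \<in> Lp_fun q M"
      by (rule Lp_fun_cmult[OF flux_Lp(1)[OF p1 comb_Lp[OF is_W0_Lp(1)[OF We] p0]]])
    show "(LINT x|M. flux p (comb_grad 1 0 e E x) \<bullet> K x) = (LINT x|M. \<mu> * flux p (comb 1 0 e x) * \<psi> x)" if "is_W0 \<psi> K" for \<psi> K
      using X0[OF that] by (simp add: X_def)
  qed
  moreover have nz: "\<not> (AE x in M. comb 1 0 e x = 0)"
  proof
    assume "AE x in M. comb 1 0 e x = 0"
    then have "AE x in M. e x \<le> 0" by eventually_elim (auto simp: comb_cases split: if_splits)
    with sg(2) show False ..
  qed
  ultimately have "eig \<mu> (comb 1 0 e) (comb_grad 1 0 e E)" by (simp add: eig_def)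
  moreover have "AE x in M. comb 1 0 e x \<ge> 0" by (simp add: comb_cases)
  ultimately have "(AE x in M. comb 1 0 e x = 0) \<or> (AE x in M. comb 1 0 e x > 0)"
    using strong_maximum_principle[OF conn eig_nonneg_supersol] \<mu> by blast
  with nz have "AE x in M. comb 1 0 e x > 0" by blast
  then have "AE x in M. e x \<ge> 0" by eventually_elim (auto simp: comb_cases split: if_splits)
  with sg(1) show False ..
qed

subsection \<open>The iteration\<close>

text \<open>With y the norm of \<open>V\<close>, the two Hoelder inequalities read \<rho>' y^(p-1)
  \<le> 1 and 1 \<le> \<rho>' y^(p-1) (\<rho> / \<rho>')^(1/p); their combination gives the
  monotonicity. The first conclusion is listed separately because it passes to the limit.\<close>

lemma inverse_step:
  assumes w: "is_W0 w K" "pint p M w = 1" and S: "sol V H (\<lambda>x. flux p (w x))"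
    and H: "pint p M H = \<rho>' * pint p M V" and \<rho>: "\<rho>' > 0" "pint p M K = \<rho>"
  shows "1 \<le> Lp_nrm p M H powr (p - 1) * \<rho> powr (1/p)" "pint p M H \<le> Lp_nrm p M V" "\<rho>' \<le> \<rho>" "pint p M V > 0"
proof -
  have Wn: "Lp_nrm p M w = 1" using w(2) by (simp add: Lp_nrm_def)
  show 2: "pint p M H \<le> Lp_nrm p M V"
    using sol_energy(2)[OF S] by (simp add: flux_Lp(3)[OF p1 is_W0_Lp(1)[OF w(1)]] Wn)
  have "1 = (LINT x|M. flux p (w x) * w x)"
    using w(2) flux_inner[of p "w _"] by (simp add: pint_def)
  also have "\<dots> = (LINT x|M. flux p (H x) \<bullet> K x)" using solD(3)[OF S w(1)] by simp
  also have "\<dots> \<le> Lp_nrm p M K * Lp_nrm q M (\<lambda>x. flux p (H x))"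
    using Holder_inner(2)[OF p1 is_W0_Lp(2)[OF w(1)] flux_Lp(1)[OF p1 is_W0_Lp(2)[OF solD(1)[OF S]]]] by linarith
  also have "\<dots> = Lp_nrm p M H powr (p - 1) * \<rho> powr (1/p)"
    using flux_Lp(3)[OF p1 is_W0_Lp(2)[OF solD(1)[OF S]]] \<rho>(2) by (simp add: Lp_nrm_def mult.commute)
  finally show 1: "1 \<le> Lp_nrm p M H powr (p - 1) * \<rho> powr (1/p)" .
  define y where "y = Lp_nrm p M V"
  have yp: "pint p M V = y powr p" using p0 by (simp add: y_def Lp_nrm_powr)
  have "y \<noteq> 0"
  proof
    assume "y = 0"
    then have "pint p M H = 0" using H yp by simp
    then have "Lp_nrm p M H = 0" by (simp add: Lp_nrm_def)
    then show False using 1 by simp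
  qed
  then have y: "y > 0" using Lp_nrm_nonneg[of p M V] by (simp add: y_def del: Lp_nrm_nonneg)
  then show "pint p M V > 0" by (simp add: yp)
  have "\<rho>' * y powr p \<le> y" using 2 H yp by (simp add: y_def)
  moreover have "y powr p = y powr (p - 1) * y" using y by (simp add: powr_diff)
  ultimately have i2: "\<rho>' * y powr (p - 1) \<le> 1" using y by (simp add: mult.assoc[symmetric])
  have nH: "Lp_nrm p M H = \<rho>' powr (1/p) * y" using H yp y p0 \<rho>(1) by (simp add: Lp_nrm_def powr_mult powr_powr)
  have "1 \<le> (\<rho>' powr (1/p) * y) powr (p - 1) * \<rho> powr (1/p)" using 1 by (simp add: nH)
  also have "(\<rho>' powr (1/p) * y) powr (p - 1) = \<rho>' powr ((p - 1)/p) * y powr (p - 1)"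
    by (simp add: powr_mult powr_powr)
  also have "\<rho>' powr ((p - 1)/p) = \<rho>' * \<rho>' powr (- (1/p))"
  proof -
    have "(p - 1)/p = 1 + - (1/p)" using p0 by (simp add: field_simps)
    then show ?thesis using \<rho>(1) by (simp only: powr_add) simp
  qed
  also have "\<rho>' * \<rho>' powr (- (1/p)) * y powr (p - 1) * \<rho> powr (1/p) = (\<rho>' * y powr (p - 1)) * (\<rho>' powr (- (1/p)) * \<rho> powr (1/p))"
    by simp
  also have "\<dots> \<le> 1 * (\<rho>' powr (- (1/p)) * \<rho> powr (1/p))" by (intro mult_right_mono i2) auto
  finally have "1 \<le> \<rho>' powr (- (1/p)) * \<rho> powr (1/p)" by simp
  then have "\<rho>' powr (1/p) * 1 \<le> \<rho>' powr (1/p) * (\<rho>' powr (- (1/p)) * \<rho> powr (1/p))" by (intro mult_left_mono) auto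
  also have "\<dots> = \<rho> powr (1/p)" using \<rho>(1) by (simp add: mult.assoc[symmetric] powr_add[symmetric])
  finally have "\<rho>' powr (1/p) \<le> \<rho> powr (1/p)" by simp
  then have "(\<rho>' powr (1/p)) powr p \<le> (\<rho> powr (1/p)) powr p" by (rule powr_mono2[OF less_imp_le[OF p0] powr_ge_zero])
  moreover have "\<rho> \<ge> 0" using \<rho>(2) pint_nonneg[of p M K] by simp
  ultimately show "\<rho>' \<le> \<rho>" using p0 \<rho>(1) by (simp add: powr_powr)
qed

text \<open>For equal quotients both inequalities together give \<rho> y^(p-1) = 1 with y the norm
  of \<open>V\<close>. That is equality in Hoelder's inequality for w and V / y, so V = y w, and the
  right-hand side rewritten in \<open>V\<close> is the eigenvalue equation. The limit
  \<open>w\<close> enters only as an element of L^p: Rellich's theorem provides no gradient.\<close>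

lemma inverse_limit:
  assumes w: "w \<in> Lp_fun p M" "pint p M w = 1" and S: "sol V H (\<lambda>x. flux p (w x))"
    and H: "pint p M H = \<rho> * pint p M V" "\<rho> > 0" "1 \<le> Lp_nrm p M H powr (p - 1) * \<rho> powr (1/p)"
  shows "AE x in M. V x = \<rho> powr (- 1 / (p - 1)) * w x" "eig \<rho> V H"
proof -
  have Wn: "Lp_nrm p M w = 1" using w(2) by (simp add: Lp_nrm_def)
  have 2: "pint p M H \<le> Lp_nrm p M V"
    using sol_energy(2)[OF S] by (simp add: flux_Lp(3)[OF p1 w(1)] Wn)
  define y where "y = Lp_nrm p M V"
  have yp: "pint p M V = y powr p" using p0 by (simp add: y_def Lp_nrm_powr)
  have "y \<noteq> 0"
  proof
    assume "y = 0"
    then have "pint p M H = 0" using H yp by simp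
    then have "Lp_nrm p M H = 0" by (simp add: Lp_nrm_def)
    then show False using H(3) by simp
  qed
  then have y: "y > 0" using Lp_nrm_nonneg[of p M V] by (simp add: y_def del: Lp_nrm_nonneg)
  have ypp: "y powr p = y powr (p - 1) * y" using y by (simp add: powr_diff)
  have "\<rho> * y powr p \<le> y" using 2 H yp by (simp add: y_def)
  then have i2: "\<rho> * y powr (p - 1) \<le> 1" using y ypp by (simp add: mult.assoc[symmetric])
  have nH: "Lp_nrm p M H = \<rho> powr (1/p) * y" using H yp y p0 by (simp add: Lp_nrm_def powr_mult powr_powr)
  have "1 \<le> (\<rho> powr (1/p) * y) powr (p - 1) * \<rho> powr (1/p)" using H(3) by (simp add: nH)
  also have "\<dots> = (\<rho> powr ((p - 1)/p) * \<rho> powr (1/p)) * y powr (p - 1)"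
    by (simp add: powr_mult powr_powr)
  also have "\<rho> powr ((p - 1)/p) * \<rho> powr (1/p) = \<rho>"
  proof -
    have "(p - 1)/p + 1/p = 1" using p0 by (simp add: field_simps)
    then show ?thesis using H(2) by (simp add: powr_add[symmetric])
  qed
  finally have i1: "1 \<le> \<rho> * y powr (p - 1)" .
  have eq: "\<rho> * y powr (p - 1) = 1" using i1 i2 by simp
  have yv: "y = \<rho> powr (- 1 / (p - 1))"
  proof -
    have "y powr (p - 1) = \<rho> powr (-1)" using eq H(2) by (simp add: powr_minus_divide field_simps)
    then have "(y powr (p - 1)) powr (1 / (p - 1)) = (\<rho> powr (-1)) powr (1 / (p - 1))" by (rule arg_cong)
    also have "(\<rho> powr (-1)) powr (1 / (p - 1)) = \<rho> powr (-1 * (1 / (p - 1)))" by (rule powr_powr)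
    also have "(y powr (p - 1)) powr (1 / (p - 1)) = y powr ((p - 1) * (1 / (p - 1)))" by (rule powr_powr)
    finally show ?thesis using y p1 by simp
  qed
  have V: "V \<in> Lp_fun p M" by (rule is_W0_Lp(1)[OF solD(1)[OF S]])
  have wV: "AE x in M. w x = (1/y) * V x"
  proof (rule Holder_equality[OF p1 w(1) Lp_fun_cmult[OF V] w(2)])
    show "pint p M (\<lambda>x. (1/y) * V x) = 1" using pint_scaleR[of p M "1/y" V] y p0 by (simp add: yp powr_divide)
    have "(LINT x|M. flux p (w x) * ((1/y) * V x)) = (1/y) * (LINT x|M. flux p (w x) * V x)"
    proof -
      have "(\<lambda>x. flux p (w x) * ((1/y) * V x)) = (\<lambda>x. (1/y) * (flux p (w x) * V x))" by (auto simp: fun_eq_iff)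
      then show ?thesis by (simp only: integral_mult_right_zero)
    qed
    also have "(LINT x|M. flux p (w x) * V x) = \<rho> * y powr p" using sol_energy(1)[OF S] H(1) yp by simp
    also have "(1/y) * (\<rho> * y powr p) = 1" using y ypp eq by simp
    finally show "(LINT x|M. flux p (w x) * ((1/y) * V x)) \<ge> 1" by simp
  qed
  then show Vw: "AE x in M. V x = \<rho> powr (- 1 / (p - 1)) * w x"
    unfolding yv[symmetric] by eventually_elim (use y in simp)
  have "AE x in M. flux p (w x) = \<rho> * flux p (V x)" using wV
  proof eventually_elim
    case (elim x)
    have "flux p (w x) = (1/y) powr (p - 1) * flux p (V x)"
      using flux_scaleR_pos[of "1/y" p "V x"] y elim by simp
    moreover have "(1/y) powr (p - 1) = \<rho>" using eq y H(2) by (simp add: powr_divide field_simps)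
    ultimately show ?case by simp
  qed
  then have "sol V H (\<lambda>x. \<rho> * flux p (V x))" by (intro sol_cong[OF S]) auto
  moreover have "\<not> (AE x in M. V x = 0)" using Lp_nrm_zero_iff[OF V p0] y by (simp add: y_def)
  ultimately show "eig \<rho> V H" by (simp add: eig_def)
qed

end

locale inverse_iteration = sobolev p \<Omega> for p :: real and \<Omega> :: "'a::euclidean_space set" +
  fixes \<beta> :: "real \<Rightarrow> real" and \<phi> :: "nat \<Rightarrow> real \<Rightarrow> 'a \<Rightarrow> real" and \<alpha> :: "nat \<Rightarrow> real" and u :: "nat \<Rightarrow> 'a \<Rightarrow> real"
  assumes conn: "connected \<Omega>" and alg: "algorithm_A p \<Omega> \<beta> \<phi> \<alpha> u"
begin

lemma beta: "continuous_on {0..1} \<beta>" "strict_antimono_on {0..1} \<beta>" "\<beta> 0 = 1" "\<beta> 1 = 0" "\<And>x. x \<in> {0..1} \<Longrightarrow> \<beta> x \<in> {0..1}"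
proof -
  have b: "\<beta> ` {0..1} \<subseteq> {0..1}" using alg unfolding algorithm_A_def by blast
  show "continuous_on {0..1} \<beta>" "strict_antimono_on {0..1} \<beta>" "\<beta> 0 = 1" "\<beta> 1 = 0"
    using alg unfolding algorithm_A_def by blast+
  show "\<And>x. x \<in> {0..1} \<Longrightarrow> \<beta> x \<in> {0..1}" using b by blast
qed

lemma beta_less: "x \<in> {0..1} \<Longrightarrow> y \<in> {0..1} \<Longrightarrow> x < y \<Longrightarrow> \<beta> y < \<beta> x"
  using beta(2) by (auto simp: monotone_on_def)

lemma alpha: "\<alpha> k \<in> {0<..<1}" "\<beta> (\<alpha> k) \<in> {0<..<1}"
proof -
  show a: "\<alpha> k \<in> {0<..<1}" using alg by (auto simp: algorithm_A_def)
  show "\<beta> (\<alpha> k) \<in> {0<..<1}" using beta_less[of 0 "\<alpha> k"] beta_less[of "\<alpha> k" 1] a beta(3,4) by auto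
qed

definition G where "G k = weak_grad \<Omega> (u k)"
definition R where "R k = rayleigh p \<Omega> (u k)"
definition nu where "nu k = Lp_nrm p M (u k)"

lemma step_sol:
  "sol (u (Suc k)) (G (Suc k)) (\<lambda>x. \<alpha> k * pos_part (normalized p \<Omega> (u k)) x powr (p - 1) - \<beta> (\<alpha> k) * neg_part (normalized p \<Omega> (u k)) x powr (p - 1))"
proof -
  have "\<alpha> k \<in> {0..1}" using alpha(1)[of k] by auto
  then have "plaplace_solution p \<Omega> (\<lambda>x. \<alpha> k * pos_part (normalized p \<Omega> (u k)) x powr (p - 1)
              - \<beta> (\<alpha> k) * neg_part (normalized p \<Omega> (u k)) x powr (p - 1)) (\<phi> k (\<alpha> k))" and "u (Suc k) = \<phi> k (\<alpha> k)"
    using alg by (auto simp: algorithm_A_def)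
  then show ?thesis unfolding G_def using plaplace_sol by simp
qed

lemma W: "k \<ge> 1 \<Longrightarrow> is_W0 (u k) (G k)"
  using solD(1)[OF step_sol[of "k - 1"]] by simp

text \<open>The norms and energies of the two parts add up to those of \<open>u k\<close>, so the
  common quotient of the parts is also the quotient of the sum. Expressing it by \<open>comb\<close>
  makes all combinations accessible.\<close>

lemma balanced:
  assumes k: "k \<ge> 1"
  shows "pint p M (comb 1 0 (u k)) > 0" "pint p M (comb 0 1 (u k)) > 0"
    "pint p M (comb_grad 1 0 (u k) (G k)) = R k * pint p M (comb 1 0 (u k))"
    "pint p M (comb_grad 0 1 (u k) (G k)) = R k * pint p M (comb 0 1 (u k))"
proof -
  obtain j where j: "k = Suc j" using k by (cases k) auto
  have sc: "sign_changing \<Omega> (u k)" and ray: "rayleigh p \<Omega> (pos_part (u k)) = rayleigh p \<Omega> (neg_part (u k))"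
    using alg unfolding j by (auto simp: algorithm_A_def)
  note L = is_W0_Lp[OF W[OF k]] and mu = Lp_fun_measurable[OF is_W0_Lp(1)[OF W[OF k]]]
  show P: "pint p M (comb 1 0 (u k)) > 0"
  proof -
    have "\<not> (AE x in M. comb 1 0 (u k) x = 0)" using sc by (simp add: sign_changing_def is_zero_def ae_eq_def comb_1_0)
    then show ?thesis using pint_zero_iff[OF comb_Lp[OF L(1) p0] p0] pint_nonneg[of p M "comb 1 0 (u k)"] by (metis order.order_iff_strict)
  qed
  show N: "pint p M (comb 0 1 (u k)) > 0"
  proof -
    have "\<not> (AE x in M. comb 0 1 (u k) x = 0)" using sc by (simp add: sign_changing_def is_zero_def ae_eq_def comb_0_1)
    then show ?thesis using pint_zero_iff[OF comb_Lp[OF L(1) p0] p0] pint_nonneg[of p M "comb 0 1 (u k)"] by (metis order.order_iff_strict)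
  qed
  have r1: "rayleigh p \<Omega> v = pint p M H / pint p M v" if "is_W0 v H" for v H
  proof -
    have "pint p M (weak_grad \<Omega> v) = pint p M H"
      using is_W0_W01p[OF that] Lp_fun_measurable[OF is_W0_Lp(2)[OF W01p_is_W0[OF is_W0_W01p(1)[OF that]]]] Lp_fun_measurable[OF is_W0_Lp(2)[OF that]]
      by (intro pint_cong_AE) auto
    then show ?thesis by (simp add: rayleigh_def pint_def)
  qed
  define \<rho> where "\<rho> = rayleigh p \<Omega> (pos_part (u k))"
  have 1: "pint p M (comb_grad 1 0 (u k) (G k)) = \<rho> * pint p M (comb 1 0 (u k))"
    using r1[OF is_W0_comb[OF W[OF k], of 1 0]] P unfolding \<rho>_def comb_1_0 by (simp add: field_simps)
  have "is_W0 (\<lambda>x. -1 * comb 0 1 (u k) x) (\<lambda>x. -1 *\<^sub>R comb_grad 0 1 (u k) (G k) x)"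
    by (rule is_W0_cmult[OF is_W0_comb[OF W[OF k]]])
  from r1[OF this] have "rayleigh p \<Omega> (neg_part (u k)) = pint p M (comb_grad 0 1 (u k) (G k)) / pint p M (comb 0 1 (u k))"
    by (simp add: comb_0_1 pint_def)
  then have 2: "pint p M (comb_grad 0 1 (u k) (G k)) = \<rho> * pint p M (comb 0 1 (u k))"
    using N ray unfolding \<rho>_def by (simp add: field_simps)
  have "pint p M (u k) = pint p M (comb 1 0 (u k)) + pint p M (comb 0 1 (u k))"
    using pint_comb[OF L(1) p0, of 1 1] by (simp add: comb_1_1)
  moreover have "pint p M (G k) = pint p M (comb_grad 1 0 (u k) (G k)) + pint p M (comb_grad 0 1 (u k) (G k))"
  proof -
    have "AE x in M. G k x = comb_grad 1 1 (u k) (G k) x"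
      by (rule is_W0_unique[OF W[OF k] is_W0_comb[OF W[OF k], of 1 1]]) (simp add: comb_1_1)
    then have "pint p M (G k) = pint p M (comb_grad 1 1 (u k) (G k))"
      by (intro pint_cong_AE) (use mu Lp_fun_measurable[OF L(2)] in \<open>auto intro!: comb_grad_measurable\<close>)
    then show ?thesis using pint_comb_grad[OF mu L(2) p0, of 1 1] by simp
  qed
  ultimately have "pint p M (G k) = \<rho> * pint p M (u k)" using 1 2 by (simp add: algebra_simps)
  moreover have "pint p M (u k) > 0" using \<open>pint p M (u k) = _\<close> P N by simp
  ultimately have "R k = \<rho>" using r1[OF W[OF k]] by (simp add: R_def)
  then show "pint p M (comb_grad 1 0 (u k) (G k)) = R k * pint p M (comb 1 0 (u k))"
    "pint p M (comb_grad 0 1 (u k) (G k)) = R k * pint p M (comb 0 1 (u k))" using 1 2 by auto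
qed

lemma pint_comb_u_pos:
  assumes "k \<ge> 1" "s \<ge> 0" "t \<ge> 0" "s > 0 \<or> t > 0"
  shows "pint p M (comb s t (u k)) > 0"
proof -
  have "s powr p * pint p M (comb 1 0 (u k)) + t powr p * pint p M (comb 0 1 (u k)) > 0"
  proof (cases "s > 0")
    case True
    then show ?thesis using balanced(1)[OF assms(1)] by (intro add_pos_nonneg) auto
  next
    case False
    then show ?thesis using balanced(2)[OF assms(1)] assms(4) by (intro add_nonneg_pos) auto
  qed
  then show ?thesis using pint_comb[OF is_W0_Lp(1)[OF W[OF assms(1)]] p0 assms(2,3)] by simp
qed

lemma pint_comb_grad_u:
  assumes "k \<ge> 1" "s \<ge> 0" "t \<ge> 0"
  shows "pint p M (comb_grad s t (u k) (G k)) = R k * pint p M (comb s t (u k))"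
  using pint_comb[OF is_W0_Lp(1)[OF W[OF assms(1)]] p0 assms(2,3)]
    pint_comb_grad[OF Lp_fun_measurable[OF is_W0_Lp(1)[OF W[OF assms(1)]]] is_W0_Lp(2)[OF W[OF assms(1)]] p0 assms(2,3)]
    balanced(3,4)[OF assms(1)] by (simp add: algebra_simps)

lemma nu_pos: "k \<ge> 1 \<Longrightarrow> nu k > 0"
  using pint_comb_u_pos[of k 1 1] by (simp add: comb_1_1 nu_def Lp_nrm_def)

text \<open>
  \<open>w k\<close> and \<open>V k\<close> are the functions of the inverse power method in step \<open>k\<close>, with gradients \<open>Kw k\<close> and \<open>H k\<close>;
  \<open>cc k\<close> is the factor that normalizes \<open>w k\<close>.
\<close>

definition sa where "sa k = \<alpha> k powr (1 / (p - 1))"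
definition ta where "ta k = \<beta> (\<alpha> k) powr (1 / (p - 1))"
definition un where "un k x = (1 / nu k) * u k x"
definition w0 where "w0 k = comb (sa k) (ta k) (un k)"
definition cc where "cc k = pint p M (w0 k) powr (- 1 / p)"
definition w where "w k x = cc k * w0 k x"
definition Kw where "Kw k x = cc k *\<^sub>R comb_grad (sa k / nu k) (ta k / nu k) (u k) (G k) x"
definition V where "V k x = cc k * u (Suc k) x"
definition H where "H k x = cc k *\<^sub>R G (Suc k) x"

lemma sa_ta_pos: "sa k > 0" "ta k > 0" "sa k powr (p - 1) = \<alpha> k" "ta k powr (p - 1) = \<beta> (\<alpha> k)"
  using alpha[of k] p1 by (auto simp: sa_def ta_def powr_powr)

lemma w0_eq: "k \<ge> 1 \<Longrightarrow> w0 k = comb (sa k / nu k) (ta k / nu k) (u k)"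
  unfolding w0_def un_def using comb_cmult[of "1 / nu k" "sa k" "ta k" "u k"] nu_pos[of k] by (simp add: fun_eq_iff)

lemma w0_pos: "k \<ge> 1 \<Longrightarrow> pint p M (w0 k) > 0"
  unfolding w0_eq using sa_ta_pos[of k] nu_pos[of k] by (intro pint_comb_u_pos) auto

lemma cc_pos: "k \<ge> 1 \<Longrightarrow> cc k > 0"
  using w0_pos[of k] by (simp add: cc_def)

lemma cc_powr:
  assumes k: "k \<ge> 1"
  shows "cc k powr p * pint p M (w0 k) = 1"
proof -
  have "cc k powr p = pint p M (w0 k) powr (- 1 / p * p)" unfolding cc_def by (rule powr_powr)
  also have "\<dots> = 1 / pint p M (w0 k)" using w0_pos[OF k] p0 by (simp add: powr_minus_divide)
  finally show ?thesis using w0_pos[OF k] by simp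
qed

lemma W_w: "k \<ge> 1 \<Longrightarrow> is_W0 (w k) (Kw k)"
  unfolding w_def[abs_def] Kw_def[abs_def] using is_W0_cmult[OF is_W0_comb[OF W]] w0_eq by simp

lemma pint_w: "k \<ge> 1 \<Longrightarrow> pint p M (w k) = 1" "k \<ge> 1 \<Longrightarrow> pint p M (Kw k) = R k"
proof -
  assume k: "k \<ge> 1"
  show "pint p M (w k) = 1"
    using cc_powr[OF k] cc_pos[OF k] pint_scaleR[of p M "cc k" "w0 k"] by (simp add: w_def[abs_def])
  have "pint p M (Kw k) = cc k powr p * pint p M (comb_grad (sa k / nu k) (ta k / nu k) (u k) (G k))"
    using cc_pos[OF k] by (simp add: Kw_def[abs_def] pint_scaleR)
  also have "\<dots> = cc k powr p * (R k * pint p M (w0 k))"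
    using pint_comb_grad_u[OF k, of "sa k / nu k" "ta k / nu k"] sa_ta_pos[of k] nu_pos[OF k] w0_eq[OF k] by simp
  also have "\<dots> = R k * (cc k powr p * pint p M (w0 k))" by simp
  finally show "pint p M (Kw k) = R k" using cc_powr[OF k] by simp
qed

text \<open>The exponent 1 / (p - 1) in \<open>sa\<close> and \<open>ta\<close> moves the
  coefficients of the two parts inside the flux, so that a step of the algorithm has the right-hand
  side of an inverse power step.\<close>

lemma flux_w0: "\<alpha> k * pos_part (normalized p \<Omega> (u k)) x powr (p - 1) - \<beta> (\<alpha> k) * neg_part (normalized p \<Omega> (u k)) x powr (p - 1) = flux p (w0 k x)"
proof -
  have n: "normalized p \<Omega> (u k) = un k" by (auto simp: normalized_def un_def nu_def Lp_norm_eq)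
  have f: "flux p y = y powr (p - 1)" if "y > 0" for y :: real
    using that by (simp add: flux_def powr_diff power2_eq_square powr_numeral)
  have "flux p (w0 k x) = sa k powr (p - 1) * flux p (comb 1 0 (un k) x) + ta k powr (p - 1) * flux p (comb 0 1 (un k) x)"
    unfolding w0_def using sa_ta_pos[of k] by (intro flux_comb) auto
  moreover have "flux p (comb 1 0 (un k) x) = pos_part (un k) x powr (p - 1)"
    using f by (auto simp: comb_cases pos_part_def max_def)
  moreover have "flux p (comb 0 1 (un k) x) = - (neg_part (un k) x powr (p - 1))"
    using f[of "- un k x"] flux_uminus[of p "un k x"] by (auto simp: comb_cases neg_part_def max_def)
  ultimately show ?thesis unfolding n sa_ta_pos(3,4) by simp
qed

lemma sol_V: "k \<ge> 1 \<Longrightarrow> sol (V k) (H k) (\<lambda>x. flux p (w k x))"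
proof -
  assume k: "k \<ge> 1"
  have "(\<lambda>x. cc k powr (p - 1) * flux p (w0 k x)) = (\<lambda>x. flux p (w k x))"
    using flux_scaleR_pos[of "cc k" p "w0 k _"] cc_pos[OF k] by (simp add: w_def)
  then show ?thesis using sol_scale[OF step_sol[of k, unfolded flux_w0] cc_pos[OF k]] by (simp add: V_def[abs_def] H_def[abs_def])
qed

lemma pint_u: "k \<ge> 1 \<Longrightarrow> pint p M (G k) = R k * pint p M (u k)"
proof -
  assume k: "k \<ge> 1"
  have "AE x in M. G k x = comb_grad 1 1 (u k) (G k) x"
    by (rule is_W0_unique[OF W[OF k] is_W0_comb[OF W[OF k], of 1 1]]) (simp add: comb_1_1)
  then have "pint p M (G k) = pint p M (comb_grad 1 1 (u k) (G k))"
    by (intro pint_cong_AE) (use Lp_fun_measurable[OF is_W0_Lp(1)[OF W[OF k]]] Lp_fun_measurable[OF is_W0_Lp(2)[OF W[OF k]]] in \<open>auto intro!: comb_grad_measurable\<close>)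
  then show ?thesis using pint_comb_grad_u[OF k, of 1 1] by (simp add: comb_1_1)
qed

lemma pint_VH: "k \<ge> 1 \<Longrightarrow> pint p M (H k) = R (Suc k) * pint p M (V k)"
  using pint_u[of "Suc k"] pint_scaleR[of p M "cc k" "u (Suc k)"] pint_scaleR[of p M "cc k" "G (Suc k)"]
  by (simp add: V_def[abs_def] H_def[abs_def])

lemma R_lower: obtains r where "r > 0" "\<And>k. k \<ge> 1 \<Longrightarrow> R k \<ge> r"
proof -
  obtain C where C: "C > 0" "\<And>u G. is_W0 u G \<Longrightarrow> pint p M u \<le> C * pint p M G" using poincare by blast
  show ?thesis
  proof (rule that[of "1 / C"])
    show "1 / C \<le> R k" if k: "k \<ge> 1" for k
    proof -
      have p: "pint p M (u k) > 0" using pint_comb_u_pos[OF k, of 1 1] by (simp add: comb_1_1)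
      have "pint p M (u k) \<le> (C * R k) * pint p M (u k)" using C(2)[OF W[OF k]] pint_u[OF k] by simp
      then have "1 \<le> C * R k" using p by simp
      then show ?thesis using C by (simp add: field_simps)
    qed
  qed (use C in simp)
qed

lemma R_pos: "k \<ge> 1 \<Longrightarrow> R k > 0"
  using R_lower by (metis less_le_trans)

lemma R_mono:
  assumes k: "k \<ge> 1"
  shows "R (Suc k) \<le> R k"
  by (rule inverse_step(3)[OF W_w[OF k] pint_w(1)[OF k] sol_V[OF k] pint_VH[OF k] R_pos pint_w(2)[OF k]]) simp

definition Rs where "Rs = R_star p \<Omega> u"

lemma R_tendsto: "R \<longlonglongrightarrow> Rs"
proof -
  \<comment> \<open>The monotonicity starts at index 1, since \<open>u 0\<close> need not be a
    Sobolev function.\<close>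
  have d: "decseq (\<lambda>k. R (Suc k))" using R_mono by (intro decseq_SucI) simp
  obtain r where r: "r > 0" "\<And>k. k \<ge> 1 \<Longrightarrow> R k \<ge> r" using R_lower by blast
  have "bdd_below (range (\<lambda>k. R (Suc k)))" using r(2) by (intro bdd_belowI2[of _ r]) auto
  from LIMSEQ_decseq_INF[OF this d] have 1: "(\<lambda>k. R (Suc k)) \<longlonglongrightarrow> (INF k. R (Suc k))" .
  have "range (\<lambda>k. R (Suc k)) = R ` {1..}"
  proof -
    have "{1..} = range Suc" by (auto simp: image_def) (metis Suc_le_D)
    then show ?thesis by (simp add: image_image)
  qed
  then have "(INF k. R (Suc k)) = Rs" unfolding Rs_def R_star_def R_def by simp
  with 1 show ?thesis using LIMSEQ_imp_Suc[of R Rs] by simp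
qed

lemma Rs_pos: "Rs > 0"
proof -
  obtain r where r: "r > 0" "\<And>k. k \<ge> 1 \<Longrightarrow> R k \<ge> r" using R_lower by blast
  have "r \<le> Rs" by (rule LIMSEQ_le_const[OF R_tendsto]) (use r in auto)
  with r show ?thesis by simp
qed

lemma R_bound: "k \<ge> 1 \<Longrightarrow> R k \<le> R 1"
  by (induction k rule: dec_induct) (use R_mono order_trans in fastforce)+

text \<open>The quotients of \<open>w\<close> and \<open>V\<close> have the same limit
  \<open>Rs\<close>, so the first inequality of \<open>inverse_step\<close> becomes a hypothesis of
  \<open>inverse_limit\<close>. Both sign statements come from \<open>not_nonneg_limit\<close>, the
  second one applied to the negatives; the balance of the parts provides the uniform bound
  \<open>R 1\<close> for the quotients.\<close>

lemma inverse_limit_subsequence: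
  fixes r :: "nat \<Rightarrow> nat"
  assumes r: "strict_mono r" "\<And>n. r n \<ge> (1::nat)"
  obtains s :: "nat \<Rightarrow> nat" and w' V' H' where "strict_mono s" "Lp_conv p M (\<lambda>n. w (r (s n))) w'"
    "Lp_conv p M (\<lambda>n. V (r (s n))) V'" "Lp_conv p M (\<lambda>n. H (r (s n))) H'"
    "eig Rs V' H'" "AE x in M. V' x = Rs powr (- 1 / (p - 1)) * w' x"
    "\<not> (AE x in M. V' x \<ge> 0)" "\<not> (AE x in M. V' x \<le> 0)"
proof -
  have Kb: "pint p M (Kw (r n)) \<le> R 1" for n using pint_w(2)[OF r(2)] R_bound[OF r(2)] by simp
  obtain s w' where s: "strict_mono s" "Lp_conv p M (\<lambda>n. w (r (s n))) w'"
    using rellich[of "\<lambda>n. w (r n)" "\<lambda>n. Kw (r n)" "R 1", OF W_w[OF r(2)] Kb] by blast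
  obtain V' H' where VH: "Lp_conv p M (\<lambda>n. V (r (s n))) V'" "Lp_conv p M (\<lambda>n. H (r (s n))) H'" "sol V' H' (\<lambda>x. flux p (w' x))"
    using sol_conv[of "\<lambda>n. V (r (s n))" "\<lambda>n. H (r (s n))", OF sol_V[OF r(2)] Lp_conv_flux[OF p1 s(2)]] by blast
  have rs: "strict_mono (\<lambda>n. r (s n))" using strict_mono_o[OF r(1) s(1)] by (simp add: o_def)
  have w'1: "pint p M w' = 1" using LIMSEQ_unique[OF Lp_conv_pint'[OF p1 s(2)], of 1] pint_w(1)[OF r(2)] by simp
  have Rl: "(\<lambda>n. R (r (s n))) \<longlonglongrightarrow> Rs" "(\<lambda>n. R (Suc (r (s n)))) \<longlonglongrightarrow> Rs"
    using LIMSEQ_subseq_LIMSEQ[OF R_tendsto rs] LIMSEQ_subseq_LIMSEQ[OF LIMSEQ_Suc[OF R_tendsto] rs] by (simp_all add: o_def)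
  have H'V': "pint p M H' = Rs * pint p M V'"
  proof -
    have "(\<lambda>n. R (Suc (r (s n))) * pint p M (V (r (s n)))) \<longlonglongrightarrow> Rs * pint p M V'"
      by (intro tendsto_intros Rl Lp_conv_pint'[OF p1 VH(1)])
    then show ?thesis using LIMSEQ_unique[OF Lp_conv_pint'[OF p1 VH(2)]] pint_VH[OF r(2)] by simp
  qed
  have one: "1 \<le> Lp_nrm p M H' powr (p - 1) * Rs powr (1/p)"
  proof -
    have "(\<lambda>n. Lp_nrm p M (H (r (s n))) powr (p - 1) * R (r (s n)) powr (1/p)) \<longlonglongrightarrow> Lp_nrm p M H' powr (p - 1) * Rs powr (1/p)"
      using p1 Rs_pos by (intro tendsto_mult tendsto_powr' Rl(1) Lp_conv_nrm[OF p1 VH(2)] tendsto_const) auto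
    then show ?thesis
      by (rule LIMSEQ_le_const) (use inverse_step(1)[OF W_w[OF r(2)] pint_w(1)[OF r(2)] sol_V[OF r(2)] pint_VH[OF r(2)] R_pos pint_w(2)[OF r(2)]] r(2) in auto)
  qed
  note lim = inverse_limit[OF Lp_convD(2)[OF s(2)] w'1 VH(3) H'V' Rs_pos one]
  have pV: "pint p M (comb a b (V k)) > 0" "pint p M (comb_grad a b (V k) (H k)) \<le> R 1 * pint p M (comb a b (V k))"
    if "k \<ge> 1" "a \<ge> 0" "b \<ge> 0" "a > 0 \<or> b > 0" for a b k
  proof -
    have c: "cc k > 0" by (rule cc_pos[OF that(1)])
    have e1: "comb a b (V k) = comb (cc k * a) (cc k * b) (u (Suc k))"
      unfolding V_def[abs_def] using comb_cmult[of "cc k" a b "u (Suc k)"] c by (simp add: fun_eq_iff)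
    have e2: "comb_grad a b (V k) (H k) = comb_grad (cc k * a) (cc k * b) (u (Suc k)) (G (Suc k))"
      using c by (auto simp: fun_eq_iff comb_grad_def V_def H_def zero_less_mult_iff mult_less_0_iff)
    show "pint p M (comb a b (V k)) > 0" unfolding e1 using that c by (intro pint_comb_u_pos) auto
    have "pint p M (comb_grad a b (V k) (H k)) = R (Suc k) * pint p M (comb a b (V k))"
      unfolding e1 e2 using that c by (intro pint_comb_grad_u) auto
    also have "\<dots> \<le> R 1 * pint p M (comb a b (V k))" by (intro mult_right_mono R_bound) auto
    finally show "pint p M (comb_grad a b (V k) (H k)) \<le> R 1 * pint p M (comb a b (V k))" .
  qed
  have n1: "\<not> (AE x in M. V' x \<ge> 0)"
    by (rule not_nonneg_limit[OF conn solD(1)[OF sol_V[OF r(2)]] pV(1)[OF r(2)] pV(2)[OF r(2)] VH(1) lim(2)])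
       (use Rs_pos in auto)
  have e0: "comb 0 1 (\<lambda>x. - v x) = (\<lambda>x. - comb 1 0 v x)" "comb_grad 0 1 (\<lambda>x. - v x) (\<lambda>x. - K x) = (\<lambda>x. - comb_grad 1 0 v K x)"
    for v :: "'a \<Rightarrow> real" and K :: "'a \<Rightarrow> 'a"
    by (auto simp: fun_eq_iff comb_cases comb_grad_def)
  have pm: "pint p M (\<lambda>x. - f x) = pint p M f" for f :: "'a \<Rightarrow> 'v::euclidean_space" by (simp add: pint_def)
  have n2: "\<not> (AE x in M. - V' x \<ge> 0)"
  proof (rule not_nonneg_limit[OF conn _ _ _ _ eig_uminus[OF lim(2)]])
    show "is_W0 (\<lambda>x. - V (r (s n)) x) (\<lambda>x. - H (r (s n)) x)" for n
      using is_W0_cmult[OF solD(1)[OF sol_V[OF r(2)]], of "-1"] by simp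
    show "pint p M (comb 0 1 (\<lambda>x. - V (r (s n)) x)) > 0" for n unfolding e0 pm by (rule pV(1)[OF r(2)]) auto
    show "pint p M (comb_grad 0 1 (\<lambda>x. - V (r (s n)) x) (\<lambda>x. - H (r (s n)) x)) \<le> R 1 * pint p M (comb 0 1 (\<lambda>x. - V (r (s n)) x))" for n
      unfolding e0 pm by (rule pV(2)[OF r(2)]) auto
    show "Lp_conv p M (\<lambda>n x. - V (r (s n)) x) (\<lambda>x. - V' x)"
      using Lp_conv_cmult[OF p1 VH(1), of "\<lambda>_. -1" "-1"] by simp
  qed (use Rs_pos in auto)
  show ?thesis
    by (rule that[OF s VH(1,2) lim(2,1) n1]) (use n2 in simp)
qed

subsection \<open>Limits of the iterates\<close>

lemma fixpoint_unique: "a \<in> {0..1} \<Longrightarrow> b \<in> {0..1} \<Longrightarrow> \<beta> a = a \<Longrightarrow> \<beta> b = b \<Longrightarrow> a = b"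
  using beta_less[of a b] beta_less[of b a] by (cases a b rule: linorder_cases) auto

lemma fixpoint_exists: "\<exists>a\<in>{0..1}. \<beta> a = a"
proof -
  have "continuous_on {0..1} (\<lambda>x. x - \<beta> x)" by (intro continuous_intros beta(1))
  have "0 - \<beta> 0 \<le> 0" "0 \<le> 1 - \<beta> 1" using beta(3,4) by simp_all
  from IVT'[of "\<lambda>x. x - \<beta> x" 0 0 1, OF this zero_le_one \<open>continuous_on {0..1} (\<lambda>x. x - \<beta> x)\<close>]
  obtain x where "0 \<le> x" "x \<le> 1" "x - \<beta> x = 0" by blast
  then have "x \<in> {0..1}" "\<beta> x = x" by auto
  then show ?thesis by blast
qed

definition astar where "astar = (THE a. a \<in> {0..1} \<and> \<beta> a = a)"

lemma astar: "astar \<in> {0..1}" "\<beta> astar = astar" "a \<in> {0..1} \<Longrightarrow> \<beta> a = a \<Longrightarrow> a = astar"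
proof -
  have "\<exists>!a. a \<in> {0..1} \<and> \<beta> a = a" using fixpoint_exists fixpoint_unique by blast
  from theI'[OF this] show 1: "astar \<in> {0..1}" "\<beta> astar = astar" unfolding astar_def by auto
  show "a \<in> {0..1} \<Longrightarrow> \<beta> a = a \<Longrightarrow> a = astar" using fixpoint_unique 1 by blast
qed

text \<open>If an iterate is close to a normalized eigenfunction e and the next one to a multiple c
  e, the step forces \<open>Rs\<close> times c^(p-1) to be the fixed point \<open>astar\<close>;
  this is the equation solved for c.\<close>

definition kappa where "kappa = Rs powr (- 1 / (p - 1)) * astar powr (1 / (p - 1))"

lemma kappa_pos: "kappa > 0"
proof -
  have "astar \<noteq> 0" using astar(2) beta(3) by auto
  then show ?thesis using astar(1) Rs_pos by (simp add: kappa_def)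
qed

text \<open>Phrased by inequalities, which is what \<open>not_nonneg_limit\<close> delivers and what
  the maximum principle contradicts.\<close>

definition sign_ch :: "('a \<Rightarrow> real) \<Rightarrow> bool" where
  "sign_ch v \<longleftrightarrow> \<not> (AE x in M. v x \<ge> 0) \<and> \<not> (AE x in M. v x \<le> 0)"

lemma sign_ch_scale:
  assumes "sign_ch v" "c > 0" "AE x in M. v' x = c * v x"
  shows "sign_ch v'"
  unfolding sign_ch_def
proof (intro conjI notI)
  assume "AE x in M. v' x \<ge> 0"
  then have "AE x in M. v x \<ge> 0" using assms(3) by eventually_elim (use assms(2) in \<open>simp add: zero_le_mult_iff\<close>)
  with assms(1) show False by (simp add: sign_ch_def)
next
  assume "AE x in M. v' x \<le> 0"
  then have "AE x in M. v x \<le> 0" using assms(3) by eventually_elim (use assms(2) in \<open>simp add: mult_le_0_iff\<close>)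
  with assms(1) show False by (simp add: sign_ch_def)
qed

text \<open>
  The index shift in \<open>2 \<le> r n\<close> is needed because \<open>u (Suc k)\<close> is a multiple of \<open>V k\<close>, whose properties require \<open>1 \<le> k\<close>.
\<close>

lemma normalized_limit:
  fixes r :: "nat \<Rightarrow> nat"
  assumes r: "strict_mono r" "\<And>n. r n \<ge> (2::nat)"
  obtains s :: "nat \<Rightarrow> nat" and e E where "strict_mono s" "eig Rs e E" "pint p M e = 1" "sign_ch e"
    "Lp_conv p M (\<lambda>n. un (r (s n))) e" "Lp_conv p M (\<lambda>n x. (1 / nu (r (s n))) *\<^sub>R G (r (s n)) x) E"
proof -
  define r1 where "r1 n = r n - 1" for n
  have r1: "strict_mono r1"
    unfolding strict_mono_Suc_iff
  proof
    fix n show "r1 n < r1 (Suc n)" using r(1) r(2)[of n] by (auto simp: r1_def strict_mono_Suc_iff intro: diff_less_mono)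
  qed
  have r1': "r1 n \<ge> 1" "Suc (r1 n) = r n" for n using r(2)[of n] by (auto simp: r1_def)
  obtain s w' V' H' where s: "strict_mono s" "Lp_conv p M (\<lambda>n. w (r1 (s n))) w'"
    "Lp_conv p M (\<lambda>n. V (r1 (s n))) V'" "Lp_conv p M (\<lambda>n. H (r1 (s n))) H'"
    "eig Rs V' H'" "AE x in M. V' x = Rs powr (- 1 / (p - 1)) * w' x"
    "\<not> (AE x in M. V' x \<ge> 0)" "\<not> (AE x in M. V' x \<le> 0)"
    using inverse_limit_subsequence[OF r1 r1'(1)] by blast
  define y where "y = Lp_nrm p M V'"
  have V'L: "V' \<in> Lp_fun p M" by (rule Lp_convD(2)[OF s(3)])
  have "y \<noteq> 0" using Lp_nrm_zero_iff[OF V'L p0] s(5) by (simp add: y_def eig_def)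
  then have y: "y > 0" using Lp_nrm_nonneg[of p M V'] by (simp add: y_def del: Lp_nrm_nonneg)
  have yl: "(\<lambda>n. 1 / Lp_nrm p M (V (r1 (s n)))) \<longlonglongrightarrow> 1 / y"
    using y by (intro tendsto_intros) (auto simp: y_def intro!: Lp_conv_nrm[OF p1 s(3)])
  have nV: "Lp_nrm p M (V (r1 n)) = cc (r1 n) * nu (r n)" for n
    using Lp_nrm_cmult[OF p0, of M "cc (r1 n)" "u (r n)"] cc_pos[OF r1'(1), of n] r1'(2)[of n] by (simp add: V_def[abs_def] nu_def)
  have e1: "(\<lambda>x. (1 / Lp_nrm p M (V (r1 n))) * V (r1 n) x) = un (r n)" for n
    unfolding nV using cc_pos[OF r1'(1), of n] r1'(2)[of n] by (auto simp: V_def un_def fun_eq_iff)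
  have e2: "(\<lambda>x. (1 / Lp_nrm p M (V (r1 n))) *\<^sub>R H (r1 n) x) = (\<lambda>x. (1 / nu (r n)) *\<^sub>R G (r n) x)" for n
    unfolding nV using cc_pos[OF r1'(1), of n] r1'(2)[of n] by (auto simp: H_def fun_eq_iff)
  define e where "e x = (1/y) * V' x" for x
  define E where "E x = (1/y) *\<^sub>R H' x" for x
  show ?thesis
  proof (rule that[OF s(1)])
    show "eig Rs e E" unfolding e_def E_def using y by (intro eig_scale[OF s(5)]) simp
    have "y powr p = pint p M V'" using p0 by (simp add: y_def Lp_nrm_powr)
    moreover have "y powr p > 0" using y by simp
    ultimately show "pint p M e = 1" using y pint_scaleR[of p M "1/y" V'] by (simp add: e_def[abs_def] powr_divide)
    show "sign_ch e" by (rule sign_ch_scale[of V' "1/y"]) (use s(7,8) y in \<open>auto simp: sign_ch_def e_def\<close>)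
    show "Lp_conv p M (\<lambda>n. un (r (s n))) e" unfolding e1[symmetric] e_def by (rule Lp_conv_cmult[OF p1 s(3) yl])
    show "Lp_conv p M (\<lambda>n x. (1 / nu (r (s n))) *\<^sub>R G (r (s n)) x) E" unfolding e2[symmetric] E_def by (rule Lp_conv_scaleR[OF p1 s(4) yl])
  qed
qed

text \<open>The limit of \<open>w\<close> is found in two ways: from \<open>w0\<close> it is a
  combination of the parts of e with weights proportional to s and t, and from the inverse step it
  is a multiple of the eigenfunction \<open>V'\<close>. Since \<open>V'\<close> changes sign, s and
  t are positive, and \<open>eig_comb_weights_equal\<close> forces s = t; so the limit of \<alpha>
  is fixed by \<beta>.\<close>

lemma successor_limit:
  fixes r :: "nat \<Rightarrow> nat"
  assumes r: "strict_mono r" "\<And>n. r n \<ge> (2::nat)"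
  obtains s :: "nat \<Rightarrow> nat" and e E where "strict_mono s" "eig Rs e E" "pint p M e = 1" "sign_ch e"
    "Lp_conv p M (\<lambda>n. un (r (s n))) e" "Lp_conv p M (\<lambda>n x. (1 / nu (r (s n))) *\<^sub>R G (r (s n)) x) E"
    "(\<lambda>n. \<alpha> (r (s n))) \<longlonglongrightarrow> astar"
    "Lp_conv p M (\<lambda>n. u (Suc (r (s n)))) (\<lambda>x. kappa * e x)" "Lp_conv p M (\<lambda>n. G (Suc (r (s n)))) (\<lambda>x. kappa *\<^sub>R E x)"
proof -
  obtain s1 e E where s1: "strict_mono s1" and e: "eig Rs e E" "pint p M e = 1" "sign_ch e"
    and c1: "Lp_conv p M (\<lambda>n. un (r (s1 n))) e" "Lp_conv p M (\<lambda>n x. (1 / nu (r (s1 n))) *\<^sub>R G (r (s1 n)) x) E"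
    using normalized_limit[OF r] by blast
  have "\<alpha> (r (s1 n)) \<in> {0..1}" for n using alpha(1)[of "r (s1 n)"] by auto
  then have "\<forall>n. \<alpha> (r (s1 n)) \<in> {0..1}" by blast
  with compact_imp_seq_compact[OF compact_Icc[of "0::real" 1]] obtain l s2
    where l: "l \<in> {0..1}" and s2: "strict_mono s2" "((\<lambda>n. \<alpha> (r (s1 n))) \<circ> s2) \<longlonglongrightarrow> l"
    by (rule seq_compactE)
  have m12: "strict_mono (\<lambda>n. r (s1 (s2 n)))" using strict_mono_o[OF r(1) strict_mono_o[OF s1 s2(1)]] by (simp add: o_def)
  have ge1: "r n \<ge> 1" for n using r(2)[of n] by simp
  obtain s3 w' V' H' where s3: "strict_mono s3" "Lp_conv p M (\<lambda>n. w (r (s1 (s2 (s3 n))))) w'"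
    "Lp_conv p M (\<lambda>n. V (r (s1 (s2 (s3 n))))) V'" "Lp_conv p M (\<lambda>n. H (r (s1 (s2 (s3 n))))) H'"
    "eig Rs V' H'" "AE x in M. V' x = Rs powr (- 1 / (p - 1)) * w' x"
    "\<not> (AE x in M. V' x \<ge> 0)" "\<not> (AE x in M. V' x \<le> 0)"
    using inverse_limit_subsequence[OF m12 ge1] by blast
  define j where "j n = s1 (s2 (s3 n))" for n
  have j: "strict_mono j" using strict_mono_o[OF s1 strict_mono_o[OF s2(1) s3(1)]] by (simp add: o_def j_def[abs_def])
  have j23: "strict_mono (\<lambda>n. s2 (s3 n))" using strict_mono_o[OF s2(1) s3(1)] by (simp add: o_def)
  define k where "k n = r (j n)" for n
  have k: "k n \<ge> 1" for n unfolding k_def by (rule ge1)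
  have al: "(\<lambda>n. \<alpha> (k n)) \<longlonglongrightarrow> l" using LIMSEQ_subseq_LIMSEQ[OF s2(2) s3(1)] by (simp add: o_def k_def j_def)
  have bl: "(\<lambda>n. \<beta> (\<alpha> (k n))) \<longlonglongrightarrow> \<beta> l"
  proof -
    have "\<forall>n. \<alpha> (k n) \<in> {0..1}" using alpha(1) by (auto simp: less_imp_le)
    then show ?thesis using beta(1) al l unfolding continuous_on_sequentially by (auto simp: o_def)
  qed
  define s where "s = l powr (1 / (p - 1))" define t where "t = \<beta> l powr (1 / (p - 1))"
  have bl0: "\<beta> l \<ge> 0" using beta(5)[OF l] by simp
  have sl: "(\<lambda>n. sa (k n)) \<longlonglongrightarrow> s" unfolding sa_def s_def
    using l p1 alpha(1) by (intro tendsto_powr' al tendsto_const) (auto simp: less_imp_le)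
  have tl: "(\<lambda>n. ta (k n)) \<longlonglongrightarrow> t" unfolding ta_def t_def
    using bl0 p1 alpha(2) by (intro tendsto_powr' bl tendsto_const) (auto simp: less_imp_le)
  have st0: "s \<ge> 0" "t \<ge> 0" by (auto simp: s_def t_def)
  have c1': "Lp_conv p M (\<lambda>n. un (k n)) e" "Lp_conv p M (\<lambda>n x. (1 / nu (k n)) *\<^sub>R G (k n) x) E"
    using Lp_conv_subseq[OF c1(1) j23] Lp_conv_subseq[OF c1(2) j23] by (simp_all add: k_def j_def)
  have wl: "Lp_conv p M (\<lambda>n. w0 (k n)) (comb s t e)" unfolding w0_def by (rule Lp_conv_comb[OF p1 c1'(1) sl tl])
  have eL: "e \<in> Lp_fun p M" by (rule Lp_convD(2)[OF c1'(1)])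
  have S: "pint p M (comb s t e) > 0"
  proof -
    have "\<not> (AE x in M. comb 1 0 e x = 0)"
    proof
      assume "AE x in M. comb 1 0 e x = 0"
      then have "AE x in M. e x \<le> 0" by eventually_elim (auto simp: comb_cases split: if_splits)
      then show False using e(3) by (simp add: sign_ch_def)
    qed
    then have 1: "pint p M (comb 1 0 e) > 0" using pint_zero_iff[OF comb_Lp[OF eL p0] p0] pint_nonneg[of p M "comb 1 0 e"] by (metis order.order_iff_strict)
    have "\<not> (AE x in M. comb 0 1 e x = 0)"
    proof
      assume "AE x in M. comb 0 1 e x = 0"
      then have "AE x in M. e x \<ge> 0" by eventually_elim (auto simp: comb_cases split: if_splits)
      then show False using e(3) by (simp add: sign_ch_def)
    qed
    then have 2: "pint p M (comb 0 1 e) > 0" using pint_zero_iff[OF comb_Lp[OF eL p0] p0] pint_nonneg[of p M "comb 0 1 e"] by (metis order.order_iff_strict)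
    \<comment> \<open>The value \<beta> 0 = 1 keeps the weights from vanishing together, so that the
      limit of \<open>w0\<close> can be normalized.\<close>
    have "s > 0 \<or> t > 0"
    proof (cases "l = 0")
      case True
      then have "t = 1" by (simp add: t_def beta(3))
      then show ?thesis by simp
    next
      case False
      then show ?thesis using l by (simp add: s_def)
    qed
    then have "s powr p * pint p M (comb 1 0 e) + t powr p * pint p M (comb 0 1 e) > 0"
    proof
      assume "s > 0"
      then show ?thesis using 1 by (intro add_pos_nonneg) auto
    next
      assume "t > 0"
      then show ?thesis using 2 by (intro add_nonneg_pos) auto
    qed
    then show ?thesis using pint_comb[OF eL p0 st0] by simp
  qed
  define c where "c = pint p M (comb s t e) powr (- 1 / p)"
  have c0: "c > 0" using S by (simp add: c_def)
  have cl: "(\<lambda>n. cc (k n)) \<longlonglongrightarrow> c" unfolding cc_def c_def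
    by (rule tendsto_powr[OF Lp_conv_pint'[OF p1 wl] tendsto_const]) (use S in simp)
  have wl2: "Lp_conv p M (\<lambda>n. w (k n)) (\<lambda>x. c * comb s t e x)"
    unfolding w_def by (rule Lp_conv_cmult[OF p1 wl cl])
  have sk: "Lp_conv p M (\<lambda>n. w (k n)) w'" "Lp_conv p M (\<lambda>n. V (k n)) V'" "Lp_conv p M (\<lambda>n. H (k n)) H'"
    using s3(2-4) by (simp_all add: k_def j_def)
  define y where "y = Rs powr (- 1 / (p - 1))"
  have y0: "y > 0" using Rs_pos by (simp add: y_def)
  have V'e: "AE x in M. V' x = comb (y * c * s) (y * c * t) e x"
    using s3(6) Lp_conv_unique[OF p1 wl2 sk(1)]
  proof eventually_elim
    case (elim x)
    then have "V' x = y * (c * comb s t e x)" by (simp add: y_def)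
    also have "\<dots> = comb (y * c * s) (y * c * t) e x" unfolding comb_mult by (simp add: mult.assoc)
    finally show ?case .
  qed
  have s_pos: "s > 0"
  proof (rule ccontr)
    assume "\<not> s > 0"
    then have "s = 0" using st0 by simp
    have "AE x in M. V' x \<le> 0" using V'e
      by eventually_elim (use \<open>s = 0\<close> st0 y0 c0 in \<open>auto simp: comb_cases mult_nonneg_nonpos\<close>)
    with s3(8) show False ..
  qed
  have t_pos: "t > 0"
  proof (rule ccontr)
    assume "\<not> t > 0"
    then have "t = 0" using st0 by simp
    have "AE x in M. V' x \<ge> 0" using V'e
      by eventually_elim (use \<open>t = 0\<close> st0 y0 c0 in \<open>auto simp: comb_cases\<close>)
    with s3(7) show False ..
  qed
  have "eig Rs (comb (y * c * s) (y * c * t) e) H'" by (rule eig_cong[OF s3(5) V'e]) simp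
  from eig_comb_weights_equal[OF conn e(1) less_imp_le[OF Rs_pos] this] s_pos t_pos y0 c0 e(3)
  have "y * c * s = y * c * t" by (simp add: sign_ch_def)
  then have st: "s = t" using y0 c0 by simp
  have "l = s powr (p - 1)" "\<beta> l = t powr (p - 1)" using l bl0 p1 by (simp_all add: s_def t_def powr_powr)
  then have "\<beta> l = l" using st by simp
  then have la: "l = astar" using astar(3)[OF l] by simp
  \<comment> \<open>The normalizing constant cancels: \<open>u (Suc k)\<close> is \<open>V k\<close>
    divided by \<open>cc k\<close>, so its limit is \<open>y * s\<close> times e.\<close>
  have cs: "y * s = kappa" by (simp add: y_def s_def kappa_def la)
  have icl: "(\<lambda>n. 1 / cc (k n)) \<longlonglongrightarrow> 1 / c" using cl c0 by (intro tendsto_intros) auto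
  have eu: "(\<lambda>x. (1 / cc (k n)) * V (k n) x) = u (Suc (k n))" "(\<lambda>x. (1 / cc (k n)) *\<^sub>R H (k n) x) = G (Suc (k n))" for n
    using cc_pos[OF k, of n] by (auto simp: V_def H_def fun_eq_iff)
  have u1: "Lp_conv p M (\<lambda>n. u (Suc (k n))) (\<lambda>x. (1/c) * V' x)"
    unfolding eu(1)[symmetric] by (rule Lp_conv_cmult[OF p1 sk(2) icl])
  have g1: "Lp_conv p M (\<lambda>n. G (Suc (k n))) (\<lambda>x. (1/c) *\<^sub>R H' x)"
    unfolding eu(2)[symmetric] by (rule Lp_conv_scaleR[OF p1 sk(3) icl])
  have ae1: "AE x in M. (1/c) * V' x = kappa * e x" using V'e
  proof eventually_elim
    case (elim x)
    have "comb (y * c * s) (y * c * t) e x = y * c * s * e x" using st by (simp add: comb_cases)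
    then show ?case using elim c0 cs by (simp add: mult.commute mult.left_commute)
  qed
  have WV': "is_W0 V' H'" and We: "is_W0 e E" using s3(5) e(1) by (auto simp: eig_def dest: solD(1))
  have ae2: "AE x in M. (1/c) *\<^sub>R H' x = kappa *\<^sub>R E x"
    by (rule is_W0_unique[OF is_W0_cmult[OF WV'] is_W0_cmult[OF We] ae1])
  note We' = is_W0_Lp[OF is_W0_cmult[OF We, of kappa]]
  show ?thesis
  proof (rule that[OF j e])
    show "Lp_conv p M (\<lambda>n. un (r (j n))) e" "Lp_conv p M (\<lambda>n x. (1 / nu (r (j n))) *\<^sub>R G (r (j n)) x) E"
      using c1' by (simp_all add: k_def)
    show "(\<lambda>n. \<alpha> (r (j n))) \<longlonglongrightarrow> astar" using al la by (simp add: k_def)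
    show "Lp_conv p M (\<lambda>n. u (Suc (r (j n)))) (\<lambda>x. kappa * e x)"
      using Lp_conv_cong_AE[OF u1 ae1 Lp_fun_measurable[OF We'(1)] p0] by (simp add: k_def)
    show "Lp_conv p M (\<lambda>n. G (Suc (r (j n)))) (\<lambda>x. kappa *\<^sub>R E x)"
      using Lp_conv_cong_AE[OF g1 ae2 Lp_fun_measurable[OF We'(2)] p0] by (simp add: k_def)
  qed
qed

lemma strict_mono_shift: "strict_mono r \<Longrightarrow> strict_mono (\<lambda>n. r (n + m) :: nat)" for r :: "nat \<Rightarrow> nat"
  by (simp add: strict_mono_def)

lemma strict_mono_ge: "strict_mono r \<Longrightarrow> m \<le> r (n + m)" for r :: "nat \<Rightarrow> nat"
  using seq_suble[of r "n + m"] by simp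

lemma alpha_tendsto: "\<alpha> \<longlonglongrightarrow> astar"
proof (rule subseq_principle)
  fix r :: "nat \<Rightarrow> nat" assume r: "strict_mono r"
  obtain s where s: "strict_mono s" "(\<lambda>n. \<alpha> (r (s n + 2))) \<longlonglongrightarrow> astar"
    by (rule successor_limit[OF strict_mono_shift[OF r, of 2] strict_mono_ge[OF r, of 2]]) (rule that; assumption)
  show "\<exists>s. strict_mono s \<and> (\<lambda>n. \<alpha> (r (s n))) \<longlonglongrightarrow> astar"
    using s by (intro exI[of _ "\<lambda>n. s n + 2"]) (auto simp: strict_mono_def)
qed

lemma nu_tendsto: "nu \<longlonglongrightarrow> kappa"
proof (rule subseq_principle)
  fix r :: "nat \<Rightarrow> nat" assume r: "strict_mono r"
  \<comment> \<open>\<open>successor_limit\<close> controls the iterate after a given index, so the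
    index is lowered by one; the shift by 3 keeps it at least 2.\<close>
  define r' where "r' n = r (n + 3) - 1" for n
  have r3: "r (n + 3) \<ge> 3" for n by (rule strict_mono_ge[OF r])
  have r': "strict_mono r'"
    unfolding strict_mono_Suc_iff
  proof
    fix n show "r' n < r' (Suc n)" using strict_mono_shift[OF r, of 3] r3[of n] by (auto simp: r'_def strict_mono_Suc_iff intro!: diff_less_mono)
  qed
  have r'2: "r' n \<ge> 2" "Suc (r' n) = r (n + 3)" for n using r3[of n] by (auto simp: r'_def)
  obtain s e where s: "strict_mono s" "pint p M e = 1" "Lp_conv p M (\<lambda>n. u (Suc (r' (s n)))) (\<lambda>x. kappa * e x)"
    by (rule successor_limit[OF r' r'2(1)]) (rule that; assumption)
  have "(\<lambda>n. nu (r (s n + 3))) \<longlonglongrightarrow> Lp_nrm p M (\<lambda>x. kappa * e x)"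
    using Lp_conv_nrm[OF p1 s(3)] by (simp add: nu_def r'2(2))
  also have "Lp_nrm p M (\<lambda>x. kappa * e x) = kappa" using s(2) kappa_pos by (simp add: Lp_nrm_cmult[OF p0]) (simp add: Lp_nrm_def)
  finally show "\<exists>s. strict_mono s \<and> (\<lambda>n. nu (r (s n))) \<longlonglongrightarrow> kappa"
    using s(1) by (intro exI[of _ "\<lambda>n. s n + 3"]) (auto simp: strict_mono_def)
qed

text \<open>Since the norms converge, the iterates themselves converge along the subsequence, to the
  same multiple of e as their successors. This is the source of the vanishing increments.\<close>

lemma subsequence_limit:
  assumes r: "strict_mono (r :: nat \<Rightarrow> nat)"
  obtains s :: "nat \<Rightarrow> nat" and v Gv where "strict_mono s" "eig Rs v Gv" "sign_ch v" "pint p M v = kappa powr p"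
    "Lp_conv p M (\<lambda>n. u (r (s n))) v" "Lp_conv p M (\<lambda>n. G (r (s n))) Gv"
    "Lp_conv p M (\<lambda>n. u (Suc (r (s n)))) v" "Lp_conv p M (\<lambda>n. G (Suc (r (s n)))) Gv"
proof -
  obtain s e E where s: "strict_mono s" and e: "eig Rs e E" "pint p M e = 1" "sign_ch e"
    and c: "Lp_conv p M (\<lambda>n. un (r (s n + 2))) e" "Lp_conv p M (\<lambda>n x. (1 / nu (r (s n + 2))) *\<^sub>R G (r (s n + 2)) x) E"
    and d: "Lp_conv p M (\<lambda>n. u (Suc (r (s n + 2)))) (\<lambda>x. kappa * e x)" "Lp_conv p M (\<lambda>n. G (Suc (r (s n + 2)))) (\<lambda>x. kappa *\<^sub>R E x)"
    by (rule successor_limit[OF strict_mono_shift[OF r, of 2] strict_mono_ge[OF r, of 2]]) (rule that; assumption)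
  have sm: "strict_mono (\<lambda>n. s n + 2)" using s by (auto simp: strict_mono_def)
  have rs: "strict_mono (\<lambda>n. r (s n + 2))" using strict_mono_o[OF r sm] by (simp add: o_def)
  have nl: "(\<lambda>n. nu (r (s n + 2))) \<longlonglongrightarrow> kappa" using LIMSEQ_subseq_LIMSEQ[OF nu_tendsto rs] by (simp add: o_def)
  have np: "nu (r (s n + 2)) > 0" for n using nu_pos strict_mono_ge[OF r, of 2 "s n"] by simp
  have e1: "(\<lambda>x. nu (r (s n + 2)) * un (r (s n + 2)) x) = u (r (s n + 2))" "(\<lambda>x. nu (r (s n + 2)) *\<^sub>R (1 / nu (r (s n + 2))) *\<^sub>R G (r (s n + 2)) x) = G (r (s n + 2))" for n
    using np[of n] by (auto simp: un_def fun_eq_iff)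
  show ?thesis
  proof (rule that[OF sm eig_scale[OF e(1) kappa_pos] sign_ch_scale[OF e(3) kappa_pos]])
    show "pint p M (\<lambda>x. kappa * e x) = kappa powr p" using pint_scaleR[of p M kappa e] e(2) kappa_pos by simp
    show "Lp_conv p M (\<lambda>n. u (r (s n + 2))) (\<lambda>x. kappa * e x)"
      using Lp_conv_cmult[OF p1 c(1) nl] unfolding e1 .
    show "Lp_conv p M (\<lambda>n. G (r (s n + 2))) (\<lambda>x. kappa *\<^sub>R E x)"
      using Lp_conv_scaleR[OF p1 c(2) nl] unfolding e1 .
  qed (use d in auto)
qed

end

text \<open>The tangent inequality of the convex function \<open>norm a powr p\<close> at y, read
  off from Young's inequality.\<close>

lemma powr_convex_ineq:
  fixes a y :: "'v::real_inner"
  assumes p: "p > 1"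
  shows "norm a powr p \<ge> norm y powr p + p * (flux p y \<bullet> (a - y))"
proof -
  have "flux p y \<bullet> a \<le> norm y powr (p - 1) * norm a"
    using norm_cauchy_schwarz[of "flux p y" a] by (simp add: norm_flux)
  also have "\<dots> \<le> (1 - 1/p) * norm y powr p + 1/p * norm a powr p" by (rule Young_inequality(1)[OF p]) auto
  finally have "p * (flux p y \<bullet> a) \<le> p * ((1 - 1/p) * norm y powr p + 1/p * norm a powr p)" using p by simp
  also have "\<dots> = (p - 1) * norm y powr p + norm a powr p" using p by (simp add: algebra_simps)
  finally show ?thesis by (simp add: inner_diff_right flux_inner algebra_simps)
qed

section \<open>The metric of the Sobolev space, and the first eigenvalue\<close>

context sobolev begin

lemma W0_dist_eq:
  assumes "a \<in> W01p p \<Omega>" "b \<in> W01p p \<Omega>"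
  shows "W0_dist p \<Omega> a b = Lp_nrm p M (\<lambda>x. weak_grad \<Omega> a x - weak_grad \<Omega> b x)"
proof -
  note a = W01p_is_W0[OF assms(1)] and b = W01p_is_W0[OF assms(2)]
  note d = is_W0_diff[OF a b]
  note dW = is_W0_W01p[OF d]
  have "AE x in M. norm (weak_grad \<Omega> (\<lambda>x. a x - b x) x) = norm (weak_grad \<Omega> a x - weak_grad \<Omega> b x)"
    using dW(2) by eventually_elim simp
  then have "Lp_nrm p M (weak_grad \<Omega> (\<lambda>x. a x - b x)) = Lp_nrm p M (\<lambda>x. weak_grad \<Omega> a x - weak_grad \<Omega> b x)"
    by (rule Lp_nrm_cong_AE) (rule Lp_fun_measurable[OF is_W0_Lp(2)[OF W01p_is_W0[OF dW(1)]]], rule Lp_fun_measurable[OF is_W0_Lp(2)[OF d]])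
  then show ?thesis by (simp add: W0_dist_def W0_norm_def Lp_norm_eq)
qed

lemma W0_dist_nonneg: "W0_dist p \<Omega> a b \<ge> 0"
  by (simp add: W0_dist_def W0_norm_def Lp_norm_eq)

lemma weak_grad_Lp: "a \<in> W01p p \<Omega> \<Longrightarrow> weak_grad \<Omega> a \<in> Lp_fun p M"
  by (rule is_W0_Lp(2)[OF W01p_is_W0])

lemma W0_dist_commute: "a \<in> W01p p \<Omega> \<Longrightarrow> b \<in> W01p p \<Omega> \<Longrightarrow> W0_dist p \<Omega> a b = W0_dist p \<Omega> b a"
  using W0_dist_eq[of a b] W0_dist_eq[of b a] Lp_nrm_minus_commute[of p M "weak_grad \<Omega> a" "weak_grad \<Omega> b"] by simp

lemma W0_dist_triangle:
  "a \<in> W01p p \<Omega> \<Longrightarrow> b \<in> W01p p \<Omega> \<Longrightarrow> c \<in> W01p p \<Omega> \<Longrightarrow> W0_dist p \<Omega> a c \<le> W0_dist p \<Omega> a b + W0_dist p \<Omega> b c"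
  unfolding W0_dist_eq by (rule Minkowski_triangle[OF p1 weak_grad_Lp weak_grad_Lp weak_grad_Lp])

text \<open>Poincare's inequality in one direction, uniqueness of the weak gradient in the
  other.\<close>

lemma W0_dist_zero_iff:
  assumes a: "a \<in> W01p p \<Omega>" and b: "b \<in> W01p p \<Omega>"
  shows "W0_dist p \<Omega> a b = 0 \<longleftrightarrow> ae_eq \<Omega> a b"
proof -
  obtain C where C: "C > 0" "\<And>u G. is_W0 u G \<Longrightarrow> pint p M u \<le> C * pint p M G" using poincare by blast
  note Wd = is_W0_diff[OF W01p_is_W0[OF a] W01p_is_W0[OF b]]
  show ?thesis
  proof
    assume "W0_dist p \<Omega> a b = 0"
    then have "pint p M (\<lambda>x. weak_grad \<Omega> a x - weak_grad \<Omega> b x) = 0"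
      using Lp_nrm_powr[OF p0, of M "\<lambda>x. weak_grad \<Omega> a x - weak_grad \<Omega> b x"] W0_dist_eq[OF a b] p0 by simp
    then have "pint p M (\<lambda>x. a x - b x) \<le> 0" using C(2)[OF Wd] by simp
    then have "pint p M (\<lambda>x. a x - b x) = 0" using pint_nonneg[of p M "\<lambda>x. a x - b x"] by simp
    then have "AE x in M. a x - b x = 0" using pint_zero_iff[OF is_W0_Lp(1)[OF Wd] p0] by blast
    then show "ae_eq \<Omega> a b" unfolding ae_eq_def by eventually_elim simp
  next
    assume "ae_eq \<Omega> a b"
    then have "AE x in M. weak_grad \<Omega> a x = weak_grad \<Omega> b x"
      unfolding ae_eq_def by (rule is_W0_unique[OF W01p_is_W0[OF a] W01p_is_W0[OF b]])
    then have "AE x in M. weak_grad \<Omega> a x - weak_grad \<Omega> b x = 0" by eventually_elim simp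
    then show "W0_dist p \<Omega> a b = 0" using Lp_nrm_zero_iff[OF is_W0_Lp(2)[OF Wd] p0] W0_dist_eq[OF a b] by simp
  qed
qed

text \<open>The quotient is multiplied out so that functions vanishing almost everywhere are
  covered.\<close>

lemma first_eigenvalue_le:
  assumes W: "is_W0 \<phi> K"
  shows "first_eigenvalue p \<Omega> * pint p M \<phi> \<le> pint p M K"
proof (cases "pint p M \<phi> = 0")
  case False
  then have pos: "pint p M \<phi> > 0" using pint_nonneg[of p M \<phi>] by (simp del: pint_nonneg)
  note W' = is_W0_W01p[OF W]
  have nz: "\<not> is_zero \<Omega> \<phi>" using False pint_zero_iff[OF is_W0_Lp(1)[OF W] p0] by (simp add: is_zero_def ae_eq_def)
  have "pint p M (weak_grad \<Omega> \<phi>) = pint p M K"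
    using W'(2) Lp_fun_measurable[OF weak_grad_Lp[OF W'(1)]] Lp_fun_measurable[OF is_W0_Lp(2)[OF W]]
    by (intro pint_cong_AE) auto
  then have r: "rayleigh p \<Omega> \<phi> = pint p M K / pint p M \<phi>" by (simp add: rayleigh_def pint_def)
  have "first_eigenvalue p \<Omega> \<le> rayleigh p \<Omega> \<phi>" unfolding first_eigenvalue_def
  proof (rule cINF_lower)
    show "bdd_below (rayleigh p \<Omega> ` {u \<in> W01p p \<Omega>. \<not> is_zero \<Omega> u})"
      by (intro bdd_belowI2[of _ 0]) (simp add: rayleigh_def)
  qed (use W'(1) nz in simp)
  then show ?thesis unfolding r using pos by (simp add: pos_le_divide_eq)
qed simp

text \<open>Compares v with v + h \<psi> for small h > 0. The tangent inequality is used at the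
  perturbed gradient for the energy and at v for the norm, so that both estimates have the direction
  which minimality needs; division by p h and h \<rightarrow> 0 give the weak inequality.\<close>

lemma minimizer_supersol:
  assumes v: "is_W0 v P" "AE x in M. v x \<ge> 0" and eq: "pint p M P = \<mu> * pint p M v" and \<mu>: "\<mu> \<ge> 0"
    and min: "\<And>\<phi> K. is_W0 \<phi> K \<Longrightarrow> \<mu> * pint p M \<phi> \<le> pint p M K"
  shows "supersol v P"
  unfolding supersol_def
proof (intro conjI v allI impI)
  fix \<psi> K assume k: "is_W0 \<psi> K" "AE x in M. \<psi> x \<ge> 0"
  define h where "h n = inverse (real (Suc n))" for n
  have h: "h n > 0" for n by (simp add: h_def)
  have h0: "h \<longlonglongrightarrow> 0" unfolding h_def by (rule LIMSEQ_inverse_real_of_nat)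
  note PL = is_W0_Lp(2)[OF v(1)] and vL = is_W0_Lp(1)[OF v(1)] and KL = is_W0_Lp(2)[OF k(1)] and \<psi>L = is_W0_Lp(1)[OF k(1)]
  define Q where "Q n x = P x + h n *\<^sub>R K x" for n x
  have Qc: "Lp_conv p M Q P"
    using Lp_conv_add[OF p1 Lp_conv_const[OF PL] Lp_conv_scaleR[OF p1 Lp_conv_const[OF KL] h0]] by (simp add: Q_def[abs_def])
  have QL: "Q n \<in> Lp_fun p M" for n by (rule Lp_convD(1)[OF Qc])
  have iv: "integrable M (\<lambda>x. flux p (v x) * \<psi> x)"
    using Holder_inner(1)[OF p1 \<psi>L flux_Lp(1)[OF p1 vL]] by simp
  have main: "\<mu> * (LINT x|M. flux p (v x) * \<psi> x) \<le> (LINT x|M. flux p (Q n x) \<bullet> K x)" for n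
  proof -
    note W = is_W0_add[OF v(1) is_W0_cmult[OF k(1), of "h n"]]
    have iQ: "integrable M (\<lambda>x. flux p (Q n x) \<bullet> K x)" by (rule Holder_inner(1)[OF p1 KL flux_Lp(1)[OF p1 QL]])
    have "pint p M (Q n) - p * h n * (LINT x|M. flux p (Q n x) \<bullet> K x) = (LINT x|M. norm (Q n x) powr p - p * h n * (flux p (Q n x) \<bullet> K x))"
      using iQ Lp_fun_integrable[OF QL[of n]] by (simp add: pint_def)
    also have "\<dots> \<le> pint p M P" unfolding pint_def
    proof (rule integral_mono)
      show "norm (Q n x) powr p - p * h n * (flux p (Q n x) \<bullet> K x) \<le> norm (P x) powr p" for x
        using powr_convex_ineq[OF p1, of "Q n x" "P x"] by (simp add: Q_def)
    qed (use iQ Lp_fun_integrable[OF QL[of n]] Lp_fun_integrable[OF PL] in auto)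
    finally have 1: "pint p M (Q n) \<le> pint p M P + p * h n * (LINT x|M. flux p (Q n x) \<bullet> K x)" by simp
    have "pint p M v + p * h n * (LINT x|M. flux p (v x) * \<psi> x) = (LINT x|M. norm (v x) powr p + p * h n * (flux p (v x) * \<psi> x))"
      using iv Lp_fun_integrable[OF vL] by (simp add: pint_def)
    also have "\<dots> \<le> pint p M (\<lambda>x. v x + h n * \<psi> x)" unfolding pint_def
    proof (rule integral_mono)
      show "norm (v x) powr p + p * h n * (flux p (v x) * \<psi> x) \<le> norm (v x + h n * \<psi> x) powr p" for x
        using powr_convex_ineq[OF p1, of "v x" "v x + h n * \<psi> x"] by (simp add: mult.assoc mult.left_commute)
    qed (use iv Lp_fun_integrable[OF vL] Lp_fun_integrable[OF is_W0_Lp(1)[OF W]] in auto)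
    finally have 2: "pint p M v + p * h n * (LINT x|M. flux p (v x) * \<psi> x) \<le> pint p M (\<lambda>x. v x + h n * \<psi> x)" .
    have "\<mu> * (pint p M v + p * h n * (LINT x|M. flux p (v x) * \<psi> x)) \<le> \<mu> * pint p M (\<lambda>x. v x + h n * \<psi> x)"
      by (rule mult_left_mono[OF 2 \<mu>])
    also have "\<dots> \<le> pint p M (Q n)" using min[OF W] by (simp add: Q_def[abs_def])
    also note 1
    finally have "p * h n * (\<mu> * (LINT x|M. flux p (v x) * \<psi> x)) \<le> p * h n * (LINT x|M. flux p (Q n x) \<bullet> K x)"
      using eq by (simp add: algebra_simps)
    then show ?thesis using p0 h[of n] by simp
  qed
  have "(\<lambda>n. LINT x|M. flux p (Q n x) \<bullet> K x) \<longlonglongrightarrow> (LINT x|M. flux p (P x) \<bullet> K x)"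
    by (rule Lp_pairing_tendsto[OF p1 Lp_conv_const[OF KL] Lp_conv_flux[OF p1 Qc]])
  then have "\<mu> * (LINT x|M. flux p (v x) * \<psi> x) \<le> (LINT x|M. flux p (P x) \<bullet> K x)"
    by (rule LIMSEQ_le_const) (use main in auto)
  moreover have "0 \<le> (LINT x|M. flux p (v x) * \<psi> x)"
  proof (rule integral_nonneg_AE)
    show "AE x in M. 0 \<le> flux p (v x) * \<psi> x" using v(2) k(2) by eventually_elim (simp add: flux_def)
  qed
  ultimately show "0 \<le> (LINT x|M. flux p (P x) \<bullet> K x)" using \<mu> by (meson mult_nonneg_nonneg order_trans)
qed

text \<open>Testing the equation with the positive part shows that this part has the Rayleigh
  quotient \<mu>. If \<mu> is the infimum, it is a minimizer and hence a supersolution, which must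
  be zero or positive almost everywhere; both contradict the sign change.\<close>

lemma sign_changing_not_first:
  assumes conn: "connected \<Omega>" and e: "eig \<mu> v Gv" and \<mu>: "\<mu> \<ge> 0" and sg: "\<not> (AE x in M. v x \<ge> 0)" "\<not> (AE x in M. v x \<le> 0)"
  shows "\<mu> \<noteq> first_eigenvalue p \<Omega>"
proof
  assume eq: "\<mu> = first_eigenvalue p \<Omega>"
  have S: "sol v Gv (\<lambda>x. \<mu> * flux p (v x))" using e by (simp add: eig_def)
  note Wp = is_W0_comb[OF solD(1)[OF S], of 1 0]
  have "flux p (Gv x) \<bullet> comb_grad 1 0 v Gv x = norm (comb_grad 1 0 v Gv x) powr p" for x
    by (simp add: comb_grad_def flux_inner)
  then have "pint p M (comb_grad 1 0 v Gv) = (LINT x|M. flux p (Gv x) \<bullet> comb_grad 1 0 v Gv x)" by (simp add: pint_def)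
  also have "\<dots> = (LINT x|M. \<mu> * flux p (v x) * comb 1 0 v x)" by (rule solD(3)[OF S Wp])
  also have "\<dots> = (LINT x|M. \<mu> * norm (comb 1 0 v x) powr p)"
  proof (rule Bochner_Integration.integral_cong)
    show "\<mu> * flux p (v x) * comb 1 0 v x = \<mu> * norm (comb 1 0 v x) powr p" for x
      using flux_inner[of p "v x"] by (simp add: comb_cases)
  qed simp
  also have "\<dots> = \<mu> * pint p M (comb 1 0 v)" by (simp add: pint_def)
  finally have "pint p M (comb_grad 1 0 v Gv) = \<mu> * pint p M (comb 1 0 v)" .
  then have "supersol (comb 1 0 v) (comb_grad 1 0 v Gv)"
    by (intro minimizer_supersol[OF Wp _ _ \<mu>]) (use first_eigenvalue_le eq in \<open>auto simp: comb_cases\<close>)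
  from strong_maximum_principle[OF conn this] show False
  proof
    assume "AE x in M. comb 1 0 v x = 0"
    then have "AE x in M. v x \<le> 0" by eventually_elim (auto simp: comb_cases split: if_splits)
    with sg(2) show False ..
  next
    assume "AE x in M. comb 1 0 v x > 0"
    then have "AE x in M. v x \<ge> 0" by eventually_elim (auto simp: comb_cases split: if_splits)
    with sg(1) show False ..
  qed
qed

lemma eig_eigenpair:
  assumes e: "eig \<mu> v Gv"
  shows "eigenpair p \<Omega> \<mu> v"
proof -
  have S: "sol v Gv (\<lambda>x. \<mu> * flux p (v x))" and nz: "\<not> (AE x in M. v x = 0)" using e by (auto simp: eig_def)
  have "(\<lambda>x. \<mu> * flux p (v x)) = (\<lambda>x. \<mu> * \<bar>v x\<bar> powr (p - 2) * v x)" by (simp add: flux_def mult.assoc)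
  with sol_plaplace[OF S] show ?thesis
    using nz is_W0_W01p(1)[OF solD(1)[OF S]] by (simp add: eigenpair_def is_zero_def ae_eq_def)
qed

end

section \<open>The set of strong limit points\<close>

context inverse_iteration begin

lemma sign_ch_sign_changing: "sign_ch v \<Longrightarrow> sign_changing \<Omega> v"
  unfolding sign_changing_def is_zero_def ae_eq_def
proof (intro conjI notI)
  assume s: "sign_ch v"
  { assume "AE x in M. pos_part v x = 0"
    then have "AE x in M. v x \<le> 0" by eventually_elim (auto simp: pos_part_def max_def split: if_splits)
    with s show False by (simp add: sign_ch_def) }
  { assume "AE x in M. neg_part v x = 0"
    then have "AE x in M. v x \<ge> 0" by eventually_elim (auto simp: neg_part_def max_def split: if_splits)
    with s show False by (simp add: sign_ch_def) }
qed

lemma u_W01p: "k \<ge> 1 \<Longrightarrow> u k \<in> W01p p \<Omega>"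
  by (rule is_W0_W01p(1)[OF W])

abbreviation D where "D a b \<equiv> W0_dist p \<Omega> a b"

lemma W0_dist_u: "k \<ge> 1 \<Longrightarrow> is_W0 v Gv \<Longrightarrow> D (u k) v = Lp_nrm p M (\<lambda>x. G k x - Gv x)"
proof -
  assume k: "k \<ge> 1" and v: "is_W0 v Gv"
  note v' = is_W0_W01p[OF v]
  have "D (u k) v = Lp_nrm p M (\<lambda>x. G k x - weak_grad \<Omega> v x)" by (simp add: W0_dist_eq[OF u_W01p[OF k] v'(1)] G_def)
  also have "\<dots> = Lp_nrm p M (\<lambda>x. G k x - Gv x)"
  proof (rule Lp_nrm_cong_AE)
    show "AE x in M. norm (G k x - weak_grad \<Omega> v x) = norm (G k x - Gv x)" using v'(2) by eventually_elim simp
  qed (use Lp_fun_measurable[OF is_W0_Lp(2)[OF W[OF k]]] Lp_fun_measurable[OF weak_grad_Lp[OF v'(1)]] Lp_fun_measurable[OF is_W0_Lp(2)[OF v]] in auto)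
  finally show ?thesis .
qed

lemma strict_mono_eventually_ge_1: "strict_mono (r :: nat \<Rightarrow> nat) \<Longrightarrow> \<forall>\<^sub>F n in sequentially. r n \<ge> 1"
  using seq_suble[of r] eventually_ge_at_top[of 1] by (metis (mono_tags, lifting) eventually_mono order_trans)

lemma W0_convergesI:
  assumes r: "strict_mono r" and v: "is_W0 v Gv" and c: "Lp_conv p M (\<lambda>n. G (r n)) Gv"
  shows "W0_converges p \<Omega> (\<lambda>n. u (r n)) v"
  unfolding W0_converges_def
proof (intro conjI)
  show "v \<in> W01p p \<Omega>" by (rule is_W0_W01p(1)[OF v])
  show "\<forall>\<^sub>F n in sequentially. u (r n) \<in> W01p p \<Omega>" using strict_mono_eventually_ge_1[OF r] by eventually_elim (rule u_W01p)
  have "\<forall>\<^sub>F n in sequentially. Lp_nrm p M (\<lambda>x. G (r n) x - Gv x) = D (u (r n)) v"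
    using strict_mono_eventually_ge_1[OF r] by eventually_elim (simp add: W0_dist_u[OF _ v])
  then show "(\<lambda>n. D (u (r n)) v) \<longlonglongrightarrow> 0" by (rule Lim_transform_eventually[OF Lp_convD(3)[OF c]])
qed

text \<open>A further subsequence converges to an eigenfunction with the listed properties. The
  triangle inequality puts it at distance 0 from \<open>v\<close>, and the properties are invariant
  under almost everywhere equality.\<close>

lemma limit_point:
  assumes r: "strict_mono r" and c: "W0_converges p \<Omega> (\<lambda>n. u (r n)) v"
  shows "\<exists>Gv. eig Rs v Gv" "sign_ch v" "pint p M v = kappa powr p" "v \<in> W01p p \<Omega>"
proof -
  show v: "v \<in> W01p p \<Omega>" using c by (simp add: W0_converges_def)
  obtain s v' G' where s: "strict_mono s" "eig Rs v' G'" "sign_ch v'" "pint p M v' = kappa powr p"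
    "Lp_conv p M (\<lambda>n. G (r (s n))) G'" using subsequence_limit[OF r] by metis
  have W': "is_W0 v' G'" using s(2) by (auto simp: eig_def dest: solD(1))
  note v' = is_W0_W01p(1)[OF W']
  have rs: "strict_mono (\<lambda>n. r (s n))" using strict_mono_o[OF r s(1)] by (simp add: o_def)
  have c1: "(\<lambda>n. D (u (r (s n))) v') \<longlonglongrightarrow> 0" using W0_convergesI[OF rs W' s(5)] by (simp add: W0_converges_def)
  have c2: "(\<lambda>n. D (u (r (s n))) v) \<longlonglongrightarrow> 0"
    using LIMSEQ_subseq_LIMSEQ[of "\<lambda>n. D (u (r n)) v" 0 s] c s(1) by (simp add: W0_converges_def o_def)
  have "D v v' \<le> 0 + 0"
  proof (rule tendsto_le[OF _ tendsto_add[OF c2 c1] tendsto_const])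
    show "\<forall>\<^sub>F n in sequentially. D v v' \<le> D (u (r (s n))) v + D (u (r (s n))) v'"
      using strict_mono_eventually_ge_1[OF rs]
    proof eventually_elim
      case (elim n)
      show ?case using W0_dist_triangle[OF v u_W01p[OF elim] v'] W0_dist_commute[OF v u_W01p[OF elim]] by simp
    qed
  qed simp
  then have "D v v' = 0" using W0_dist_nonneg[of v v'] by simp
  then have "ae_eq \<Omega> v v'" using W0_dist_zero_iff[OF v v'] by simp
  then have ae: "AE x in M. v x = v' x" by (simp add: ae_eq_def)
  then have ae': "AE x in M. v' x = v x" by eventually_elim simp
  show "\<exists>Gv. eig Rs v Gv" using eig_cong[OF s(2) ae', of G'] by auto
  show "sign_ch v" using ae by (intro sign_ch_scale[OF s(3), of 1]) auto
  have vL: "v \<in> borel_measurable M" "v' \<in> borel_measurable M"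
    using Lp_fun_measurable[OF is_W0_Lp(1)[OF W01p_is_W0[OF v]]] Lp_fun_measurable[OF is_W0_Lp(1)[OF W']] by auto
  have "AE x in M. norm (v x) = norm (v' x)" using ae by eventually_elim simp
  then have "pint p M v = pint p M v'" using vL by (rule pint_cong_AE)
  then show "pint p M v = kappa powr p" using s(4) by simp
qed

abbreviation S where "S \<equiv> strong_limit_points p \<Omega> u"

lemma S_iff: "v \<in> S \<longleftrightarrow> (\<exists>r :: nat \<Rightarrow> nat. strict_mono r \<and> W0_converges p \<Omega> (\<lambda>n. u (r n)) v)"
  by (simp add: strong_limit_points_def o_def)

lemma S_W01p: "v \<in> S \<Longrightarrow> v \<in> W01p p \<Omega>"
  using limit_point(4) by (auto simp: S_iff)

lemma subsequence_limit_point: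
  assumes r: "strict_mono (r :: nat \<Rightarrow> nat)"
  obtains s v where "strict_mono (s :: nat \<Rightarrow> nat)" "v \<in> S" "W0_converges p \<Omega> (\<lambda>n. u (r (s n))) v"
proof -
  obtain s v Gv where s: "strict_mono s" "eig Rs v Gv" "Lp_conv p M (\<lambda>n. G (r (s n))) Gv" using subsequence_limit[OF r] by metis
  have W': "is_W0 v Gv" using s(2) by (auto simp: eig_def dest: solD(1))
  have rs: "strict_mono (\<lambda>n. r (s n))" using strict_mono_o[OF r s(1)] by (simp add: o_def)
  note c = W0_convergesI[OF rs W' s(3)]
  have "v \<in> S" unfolding S_iff by (intro exI[of _ "\<lambda>n. r (s n)"] conjI rs c)
  with s(1) c that show ?thesis by blast
qed

text \<open>Every subsequence has a further one along which the iterates and their successors share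
  a limit.\<close>

lemma successor_dist: "(\<lambda>k. D (u (Suc k)) (u k)) \<longlonglongrightarrow> 0"
proof (rule subseq_principle)
  fix r :: "nat \<Rightarrow> nat" assume r: "strict_mono r"
  obtain s v Gv where s: "strict_mono s" "Lp_conv p M (\<lambda>n. G (r (s n))) Gv" "Lp_conv p M (\<lambda>n. G (Suc (r (s n)))) Gv"
    using subsequence_limit[OF r] by metis
  have rs: "strict_mono (\<lambda>n. r (s n))" using strict_mono_o[OF r s(1)] by (simp add: o_def)
  have c: "(\<lambda>n. Lp_nrm p M (\<lambda>x. G (Suc (r (s n))) x - G (r (s n)) x)) \<longlonglongrightarrow> 0"
    using Lp_convD(3)[OF Lp_conv_diff[OF p1 s(3,2)]] by simp
  have "\<forall>\<^sub>F n in sequentially. Lp_nrm p M (\<lambda>x. G (Suc (r (s n))) x - G (r (s n)) x) = D (u (Suc (r (s n)))) (u (r (s n)))"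
    using strict_mono_eventually_ge_1[OF rs] by eventually_elim (rule W0_dist_u[symmetric, OF _ W], auto)
  then have "(\<lambda>n. D (u (Suc (r (s n)))) (u (r (s n)))) \<longlonglongrightarrow> 0" by (rule Lim_transform_eventually[OF c])
  with s(1) show "\<exists>s. strict_mono s \<and> (\<lambda>n. D (u (Suc (r (s n)))) (u (r (s n)))) \<longlonglongrightarrow> 0" by blast
qed

lemma shifted_convergence:
  assumes r: "strict_mono (r :: nat \<Rightarrow> nat)" and c: "W0_converges p \<Omega> (\<lambda>n. u (r n)) v"
  shows "W0_converges p \<Omega> (\<lambda>n. u (r n + i)) v"
proof (induction i)
  case 0
  then show ?case using c by simp
next
  case (Suc i)
  have v: "v \<in> W01p p \<Omega>" using c by (simp add: W0_converges_def)
  have ri: "strict_mono (\<lambda>n. r n + i)" using r by (simp add: strict_mono_def)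
  have "(\<lambda>n. D (u (Suc (r n + i))) (u (r n + i))) \<longlonglongrightarrow> 0"
    using LIMSEQ_subseq_LIMSEQ[OF successor_dist ri] by (simp add: o_def)
  moreover have "(\<lambda>n. D (u (r n + i)) v) \<longlonglongrightarrow> 0" using Suc by (simp add: W0_converges_def)
  ultimately have l: "(\<lambda>n. D (u (Suc (r n + i))) (u (r n + i)) + D (u (r n + i)) v) \<longlonglongrightarrow> 0"
    using tendsto_add by fastforce
  have ev: "\<forall>\<^sub>F n in sequentially. r n + i \<ge> 1" by (rule strict_mono_eventually_ge_1[OF ri])
  have "(\<lambda>n. D (u (r n + Suc i)) v) \<longlonglongrightarrow> 0"
  proof (rule tendsto_sandwich[OF _ _ tendsto_const l])
    show "\<forall>\<^sub>F n in sequentially. D (u (r n + Suc i)) v \<le> D (u (Suc (r n + i))) (u (r n + i)) + D (u (r n + i)) v"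
      using ev by eventually_elim (use W0_dist_triangle[OF u_W01p u_W01p v] in simp)
  qed (simp add: W0_dist_nonneg)
  moreover have "\<forall>\<^sub>F n in sequentially. u (r n + Suc i) \<in> W01p p \<Omega>" using ev by eventually_elim (rule u_W01p, simp)
  ultimately show ?case using v by (simp add: W0_converges_def)
qed

lemma infdist_tendsto: "(\<lambda>k. W0_infdist p \<Omega> (u k) S) \<longlonglongrightarrow> 0"
proof (rule subseq_principle)
  fix r :: "nat \<Rightarrow> nat" assume r: "strict_mono r"
  obtain s v where s: "strict_mono s" "v \<in> S" "W0_converges p \<Omega> (\<lambda>n. u (r (s n))) v" using subsequence_limit_point[OF r] by blast
  have b: "bdd_below (D a ` S)" for a by (intro bdd_belowI2[of _ 0]) (rule W0_dist_nonneg)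
  have "(\<lambda>n. W0_infdist p \<Omega> (u (r (s n))) S) \<longlonglongrightarrow> 0"
  proof (rule tendsto_sandwich[OF _ _ tendsto_const])
    show "(\<lambda>n. D (u (r (s n))) v) \<longlonglongrightarrow> 0" using s(3) by (simp add: W0_converges_def)
    show "\<forall>\<^sub>F n in sequentially. W0_infdist p \<Omega> (u (r (s n))) S \<le> D (u (r (s n))) v"
      unfolding W0_infdist_def by (intro always_eventually allI cINF_lower b s(2))
    show "\<forall>\<^sub>F n in sequentially. 0 \<le> W0_infdist p \<Omega> (u (r (s n))) S"
      unfolding W0_infdist_def using s(2) by (intro always_eventually allI cINF_greatest W0_dist_nonneg) auto
  qed
  with s(1) show "\<exists>s. strict_mono s \<and> (\<lambda>n. W0_infdist p \<Omega> (u (r (s n))) S) \<longlonglongrightarrow> 0" by blast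
qed

text \<open>
  If the iterates returned infinitely often to two limit points, one of them isolated, then, as their increments
  vanish, infinitely many of them would lie in a thin annulus around the isolated one, and so would a further limit point.
\<close>

lemma isolated_unique:
  fixes v w :: "'a \<Rightarrow> real"
  assumes v: "isolated_element p \<Omega> v S" and w: "w \<in> S"
  shows "ae_eq \<Omega> w v"
proof (rule ccontr)
  assume ne: "\<not> ae_eq \<Omega> w v"
  obtain e where e: "e > 0" "\<And>w. w \<in> S \<Longrightarrow> D w v < e \<Longrightarrow> ae_eq \<Omega> w v" and vS: "v \<in> S"
    using v by (auto simp: isolated_element_def)
  note vW = S_W01p[OF vS] and wW = S_W01p[OF w]
  have far: "D w v \<ge> e" using e(2)[OF w] ne by force
  define d where "d k = D (u k) v" for k
  have "\<forall>\<^sub>F k in sequentially. D (u (Suc k)) (u k) < e / 4" using successor_dist by (rule order_tendstoD) (use e in simp)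
  then obtain N0 where N0: "\<And>k. k \<ge> N0 \<Longrightarrow> D (u (Suc k)) (u k) < e / 4" by (auto simp: eventually_sequentially)
  have small: "\<exists>i\<ge>N. d i < e / 4" for N
  proof -
    obtain r where r: "strict_mono (r :: nat \<Rightarrow> nat)" "W0_converges p \<Omega> (\<lambda>n. u (r n)) v" using vS by (auto simp: S_iff)
    have "(\<lambda>n. D (u (r n)) v) \<longlonglongrightarrow> 0" using r(2) by (simp add: W0_converges_def)
    then have "\<forall>\<^sub>F n in sequentially. D (u (r n)) v < e / 4" by (rule order_tendstoD) (use e in simp)
    then obtain n0 where "\<And>n. n \<ge> n0 \<Longrightarrow> D (u (r n)) v < e / 4" by (auto simp: eventually_sequentially)
    then have "d (r (max n0 N)) < e / 4" by (simp add: d_def)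
    moreover have "r (max n0 N) \<ge> N" using seq_suble[OF r(1), of "max n0 N"] by simp
    ultimately show ?thesis by blast
  qed
  have large: "\<exists>j\<ge>N. d j \<ge> e / 2" for N
  proof -
    obtain r where r: "strict_mono (r :: nat \<Rightarrow> nat)" "W0_converges p \<Omega> (\<lambda>n. u (r n)) w" using w by (auto simp: S_iff)
    have "(\<lambda>n. D (u (r n)) w) \<longlonglongrightarrow> 0" using r(2) by (simp add: W0_converges_def)
    then have "\<forall>\<^sub>F n in sequentially. D (u (r n)) w < e / 2" by (rule order_tendstoD) (use e in simp)
    then obtain n0 where n0: "\<And>n. n \<ge> n0 \<Longrightarrow> D (u (r n)) w < e / 2" by (auto simp: eventually_sequentially)
    define n where "n = max (max n0 N) 1"
    have rn: "r n \<ge> N" "r n \<ge> 1" using seq_suble[OF r(1), of n] by (auto simp: n_def)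
    have "D w v \<le> D (u (r n)) w + D (u (r n)) v"
      using W0_dist_triangle[OF wW u_W01p[OF rn(2)] vW] W0_dist_commute[OF wW u_W01p[OF rn(2)]] by simp
    then have "d (r n) \<ge> e / 2" using far n0[of n] unfolding d_def n_def by (auto simp: max.coboundedI1)
    with rn(1) show ?thesis by blast
  qed
  have mid: "\<exists>k\<ge>N. e / 4 \<le> d k \<and> d k \<le> e / 2" for N
  proof -
    obtain i where i: "i \<ge> max (max N N0) 1" "d i < e / 4" using small by blast
    obtain j where j: "j \<ge> i" "d j \<ge> e / 2" using large by blast
    \<comment> \<open>The first index from i on at which the distance reaches e / 4. The previous
      distance is smaller and the increment is below e / 4, so the distance has not passed e /
      2.\<close>
    define k where "k = (LEAST k. k \<ge> i \<and> d k \<ge> e / 4)"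
    have ex: "j \<ge> i \<and> d j \<ge> e / 4" using j e(1) by simp
    have k: "k \<ge> i" "d k \<ge> e / 4" using LeastI[of "\<lambda>k. k \<ge> i \<and> d k \<ge> e / 4", OF ex] by (auto simp: k_def)
    then have "k \<noteq> i" using i(2) by auto
    then obtain m where m: "k = Suc m" "m \<ge> i" using k(1) by (cases k) auto
    have "\<not> (m \<ge> i \<and> d m \<ge> e / 4)" using not_less_Least[of m "\<lambda>k. k \<ge> i \<and> d k \<ge> e / 4"] m(1) by (simp add: k_def)
    then have dm: "d m < e / 4" using m(2) by simp
    have m1: "m \<ge> 1" "m \<ge> N0" using m(2) i(1) by auto
    have "d k \<le> D (u (Suc m)) (u m) + d m" unfolding d_def m(1) by (rule W0_dist_triangle[OF u_W01p u_W01p vW]) (use m1 in auto)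
    then have "d k \<le> e / 2" using N0[OF m1(2)] dm by simp
    then show ?thesis using k i(1) by (intro exI[of _ k]) auto
  qed
  then have "infinite {k. e / 4 \<le> d k \<and> d k \<le> e / 2}" by (simp add: infinite_nat_iff_unbounded_le)
  then obtain r :: "nat \<Rightarrow> nat" where r: "strict_mono r" "\<And>n. r n \<in> {k. e / 4 \<le> d k \<and> d k \<le> e / 2}" using infinite_enumerate by blast
  obtain s z where s: "strict_mono s" "z \<in> S" "W0_converges p \<Omega> (\<lambda>n. u (r (s n))) z" using subsequence_limit_point[OF r(1)] by blast
  note zW = S_W01p[OF s(2)]
  have rs: "strict_mono (\<lambda>n. r (s n))" using strict_mono_o[OF r(1) s(1)] by (simp add: o_def)
  have "(\<lambda>n. D (u (r (s n))) z) \<longlonglongrightarrow> 0" using s(3) by (simp add: W0_converges_def)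
  then have "\<forall>\<^sub>F n in sequentially. D (u (r (s n))) z < e / 4" by (rule order_tendstoD) (use e in simp)
  then have "\<forall>\<^sub>F n in sequentially. D (u (r (s n))) z < e / 4 \<and> r (s n) \<ge> 1" using strict_mono_eventually_ge_1[OF rs] by eventually_elim simp
  then obtain n where n: "D (u (r (s n))) z < e / 4" "r (s n) \<ge> 1" by (auto simp: eventually_sequentially)
  have rn: "e / 4 \<le> d (r (s n))" "d (r (s n)) \<le> e / 2" using r(2)[of "s n"] by auto
  note un = u_W01p[OF n(2)]
  \<comment> \<open>As e / 4 + e / 2 < e, the isolation makes z equal to v, whereas the iterates
    approaching z keep the distance e / 4 from v.\<close>
  have "D z v \<le> D (u (r (s n))) z + d (r (s n))" unfolding d_def
    using W0_dist_triangle[OF zW un vW] W0_dist_commute[OF zW un] by simp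
  then have "D z v < e" using n(1) rn(2) e(1) by linarith
  then have "ae_eq \<Omega> z v" by (rule e(2)[OF s(2)])
  then have "D z v = 0" using W0_dist_zero_iff[OF zW vW] by simp
  moreover have "d (r (s n)) \<le> D (u (r (s n))) z + D z v" unfolding d_def by (rule W0_dist_triangle[OF un zW vW])
  ultimately show False using n(1) rn(1) by simp
qed

lemma S_nonempty: "S \<noteq> {}"
  using subsequence_limit_point[OF strict_mono_id] by (metis empty_iff id_apply)

lemma converges_if_unique:
  assumes v: "v \<in> S" and un: "\<And>w. w \<in> S \<Longrightarrow> ae_eq \<Omega> w v"
  shows "W0_converges p \<Omega> u v"
  unfolding W0_converges_def
proof (intro conjI)
  show vW: "v \<in> W01p p \<Omega>" by (rule S_W01p[OF v])
  show "\<forall>\<^sub>F n in sequentially. u n \<in> W01p p \<Omega>" using eventually_ge_at_top[of 1] by eventually_elim (rule u_W01p)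
  show "(\<lambda>n. D (u n) v) \<longlonglongrightarrow> 0"
  proof (rule subseq_principle)
    fix r :: "nat \<Rightarrow> nat" assume r: "strict_mono r"
    obtain s z where s: "strict_mono s" "z \<in> S" "W0_converges p \<Omega> (\<lambda>n. u (r (s n))) z" using subsequence_limit_point[OF r] by blast
    note zW = S_W01p[OF s(2)]
    have rs: "strict_mono (\<lambda>n. r (s n))" using strict_mono_o[OF r s(1)] by (simp add: o_def)
    have z0: "D z v = 0" using un[OF s(2)] W0_dist_zero_iff[OF zW vW] by simp
    have "(\<lambda>n. D (u (r (s n))) v) \<longlonglongrightarrow> 0"
    proof (rule tendsto_sandwich[OF _ _ tendsto_const])
      show "(\<lambda>n. D (u (r (s n))) z) \<longlonglongrightarrow> 0" using s(3) by (simp add: W0_converges_def)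
      show "\<forall>\<^sub>F n in sequentially. D (u (r (s n))) v \<le> D (u (r (s n))) z"
        using strict_mono_eventually_ge_1[OF rs] by eventually_elim (use W0_dist_triangle[OF u_W01p zW vW] z0 in fastforce)
    qed (simp add: W0_dist_nonneg)
    with s(1) show "\<exists>s. strict_mono s \<and> (\<lambda>n. D (u (r (s n))) v) \<longlonglongrightarrow> 0" by blast
  qed
qed

text \<open>All limit points have the same norm \<open>kappa\<close> in L^p. If the eigenfunctions
  form a line, only v and its negative remain, and the negative lies at distance 2 \<epsilon>, where
  \<epsilon> is the gradient norm of v.\<close>

lemma simple_isolated:
  assumes e: "\<And>v. eigenpair p \<Omega> Rs v \<Longrightarrow> \<exists>c. ae_eq \<Omega> v (\<lambda>x. c * e x)" and v: "v \<in> S"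
  shows "isolated_element p \<Omega> v S"
proof -
  have facts: "eigenpair p \<Omega> Rs z \<and> pint p M z = kappa powr p \<and> z \<in> W01p p \<Omega>" if "z \<in> S" for z
    using that limit_point[of _ z] eig_eigenpair unfolding S_iff by blast
  note pv = facts[OF v]
  obtain C where C: "C > 0" "\<And>u G. is_W0 u G \<Longrightarrow> pint p M u \<le> C * pint p M G" using poincare by blast
  define \<epsilon> where "\<epsilon> = Lp_nrm p M (weak_grad \<Omega> v)"
  have kp: "kappa powr p > 0" using kappa_pos by simp
  have vW: "v \<in> W01p p \<Omega>" using pv by blast
  have "pint p M (weak_grad \<Omega> v) > 0"
  proof (rule ccontr)
    assume "\<not> pint p M (weak_grad \<Omega> v) > 0"
    then have "pint p M (weak_grad \<Omega> v) = 0" using pint_nonneg[of p M "weak_grad \<Omega> v"] by (simp del: pint_nonneg)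
    then show False using C(2)[OF W01p_is_W0[OF vW]] pv kp by simp
  qed
  then have \<epsilon>: "\<epsilon> > 0" by (simp add: \<epsilon>_def Lp_nrm_def)
  have "ae_eq \<Omega> w v" if w: "w \<in> S" "D w v < \<epsilon>" for w
  proof -
    note pw = facts[OF w(1)]
    obtain a where a: "ae_eq \<Omega> v (\<lambda>x. a * e x)" using e pv by blast
    obtain b where b: "ae_eq \<Omega> w (\<lambda>x. b * e x)" using e pw by blast
    have a0: "a \<noteq> 0"
    proof
      assume "a = 0"
      then have "AE x in M. v x = 0" using a by (simp add: ae_eq_def)
      then have "pint p M v = 0" using pint_zero_iff[OF is_W0_Lp(1)[OF W01p_is_W0[OF vW]] p0] by blast
      then show False using pv kp by simp
    qed
    define t where "t = b / a"
    have wt: "AE x in M. w x = t * v x" using a b unfolding ae_eq_def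
      by eventually_elim (use a0 in \<open>simp add: t_def\<close>)
    have vL: "v \<in> Lp_fun p M" "w \<in> Lp_fun p M" using is_W0_Lp(1)[OF W01p_is_W0] pv pw by blast+
    have "pint p M w = pint p M (\<lambda>x. t * v x)"
      using wt Lp_fun_measurable[OF vL(2)] Lp_fun_measurable[OF vL(1)] by (intro pint_cong_AE) auto
    also have "\<dots> = \<bar>t\<bar> powr p * pint p M v" using pint_scaleR[of p M t v] by simp
    finally have "\<bar>t\<bar> powr p = 1" using pv pw kp by simp
    then have "(\<bar>t\<bar> powr p) powr (1/p) = 1" by simp
    then have "\<bar>t\<bar> = 1" using p0 by (simp add: powr_powr)
    then consider "t = 1" | "t = -1" by linarith
    then show ?thesis
    proof cases
      case 1
      then show ?thesis using wt by (simp add: ae_eq_def)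
    next
      case 2
      have "AE x in M. weak_grad \<Omega> w x = t *\<^sub>R weak_grad \<Omega> v x"
        using is_W0_unique[OF W01p_is_W0 is_W0_cmult[OF W01p_is_W0[OF vW]] wt] pw by blast
      then have "AE x in M. norm (weak_grad \<Omega> w x - weak_grad \<Omega> v x) = norm (2 *\<^sub>R weak_grad \<Omega> v x)"
      proof eventually_elim
        case (elim x)
        have "weak_grad \<Omega> w x - weak_grad \<Omega> v x = - (2 *\<^sub>R weak_grad \<Omega> v x)" unfolding elim 2 by (simp add: scaleR_2)
        then show ?case by (simp only: norm_minus_cancel)
      qed
      then have "Lp_nrm p M (\<lambda>x. weak_grad \<Omega> w x - weak_grad \<Omega> v x) = Lp_nrm p M (\<lambda>x. 2 *\<^sub>R weak_grad \<Omega> v x)"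
        using Lp_fun_measurable[OF weak_grad_Lp[OF vW]] Lp_fun_measurable[OF weak_grad_Lp, of w] pw
        by (intro Lp_nrm_cong_AE) auto
      also have "\<dots> = 2 * \<epsilon>" by (simp add: Lp_nrm_scaleR[OF p0] \<epsilon>_def)
      finally have "D w v = 2 * \<epsilon>" using W0_dist_eq[of w v] pw vW by simp
      then show ?thesis using w(2) \<epsilon> by simp
    qed
  qed
  with \<epsilon> v show ?thesis unfolding isolated_element_def by blast
qed

end

theorem theorem3p2:
  fixes p :: real and \<Omega> :: "'a::euclidean_space set"
    and \<beta> :: "real \<Rightarrow> real" and \<phi> :: "nat \<Rightarrow> real \<Rightarrow> 'a \<Rightarrow> real"
    and \<alpha> :: "nat \<Rightarrow> real" and u :: "nat \<Rightarrow> 'a \<Rightarrow> real"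
  assumes "1 < p"
    and "open \<Omega>" and "connected \<Omega>" and "\<Omega> \<noteq> {}" and "emeasure lebesgue \<Omega> < \<infinity>"
    and "algorithm_A p \<Omega> \<beta> \<phi> \<alpha> u"
  shows
    \<comment> \<open>(I)\<close>
    "((\<forall>k\<ge>1. rayleigh p \<Omega> (u (Suc k)) \<le> rayleigh p \<Omega> (u k)) \<and>
      (\<lambda>k. rayleigh p \<Omega> (u k)) \<longlonglongrightarrow> R_star p \<Omega> u \<and>
      higher_eigenvalue p \<Omega> (R_star p \<Omega> u)) \<and>
     \<comment> \<open>(II)\<close>
     (strong_limit_points p \<Omega> u \<noteq> {} \<and>
      (\<forall>v\<in>strong_limit_points p \<Omega> u. eigenpair p \<Omega> (R_star p \<Omega> u) v \<and> sign_changing \<Omega> v)) \<and>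
     \<comment> \<open>(III)\<close>
     ((\<forall>r :: nat \<Rightarrow> nat. strict_mono r \<longrightarrow> (\<exists>(s :: nat \<Rightarrow> nat) v. strict_mono s \<and> W0_converges p \<Omega> (u \<circ> r \<circ> s) v)) \<and>
      (\<forall>r. \<forall>v\<in>strong_limit_points p \<Omega> u. strict_mono r \<and> W0_converges p \<Omega> (u \<circ> r) v \<longrightarrow>
         (\<forall>i. W0_converges p \<Omega> (\<lambda>n. u (r n + i)) v))) \<and>
     \<comment> \<open>(IV)\<close>
     (\<lambda>k. W0_infdist p \<Omega> (u k) (strong_limit_points p \<Omega> u)) \<longlonglongrightarrow> 0 \<and>
     \<comment> \<open>(V)\<close>
     (\<exists>a\<in>{0..1}. \<beta> a = a \<and> (\<forall>b\<in>{0..1}. \<beta> b = b \<longrightarrow> b = a) \<and>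
        \<alpha> \<longlonglongrightarrow> a \<and> (\<lambda>k. \<beta> (\<alpha> k)) \<longlonglongrightarrow> a) \<and>
     \<comment> \<open>(VI)\<close>
     (((\<exists>v\<in>strong_limit_points p \<Omega> u. \<forall>w\<in>strong_limit_points p \<Omega> u. ae_eq \<Omega> w v) \<or>
       \<not> (\<exists>v. isolated_element p \<Omega> v (strong_limit_points p \<Omega> u))) \<and>
      (simple_eigenvalue p \<Omega> (R_star p \<Omega> u) \<longrightarrow>
         (\<exists>v. eigenpair p \<Omega> (R_star p \<Omega> u) v \<and> W0_converges p \<Omega> u v)))"
proof -
  interpret inverse_iteration p \<Omega> \<beta> \<phi> \<alpha> u
    by unfold_locales (use assms in auto)
  have Rs: "R_star p \<Omega> u = Rs" by (simp add: Rs_def)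
  have lim: "eigenpair p \<Omega> Rs v" "sign_changing \<Omega> v" "Rs \<noteq> first_eigenvalue p \<Omega>" if v: "v \<in> S" for v
  proof -
    obtain r where r: "strict_mono r" "W0_converges p \<Omega> (\<lambda>n. u (r n)) v" using v unfolding S_iff by blast
    note l = limit_point[OF r]
    obtain Gv where e: "eig Rs v Gv" using l(1) by blast
    show "eigenpair p \<Omega> Rs v" by (rule eig_eigenpair[OF e])
    show "sign_changing \<Omega> v" by (rule sign_ch_sign_changing[OF l(2)])
    show "Rs \<noteq> first_eigenvalue p \<Omega>"
      using sign_changing_not_first[OF conn e less_imp_le[OF Rs_pos]] l(2) by (simp add: sign_ch_def)
  qed
  obtain v0 where v0: "v0 \<in> S" using S_nonempty by blast
  have I: "(\<forall>k\<ge>1. rayleigh p \<Omega> (u (Suc k)) \<le> rayleigh p \<Omega> (u k)) \<and> (\<lambda>k. rayleigh p \<Omega> (u k)) \<longlonglongrightarrow> Rs \<and> higher_eigenvalue p \<Omega> Rs"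
    using R_mono R_tendsto lim[OF v0] by (auto simp: R_def[abs_def] higher_eigenvalue_def eigenvalue_def)
  have II: "S \<noteq> {} \<and> (\<forall>v\<in>S. eigenpair p \<Omega> Rs v \<and> sign_changing \<Omega> v)" using S_nonempty lim(1,2) by blast
  have III: "(\<forall>r :: nat \<Rightarrow> nat. strict_mono r \<longrightarrow> (\<exists>(s :: nat \<Rightarrow> nat) v. strict_mono s \<and> W0_converges p \<Omega> (u \<circ> r \<circ> s) v)) \<and>
      (\<forall>r. \<forall>v\<in>S. strict_mono r \<and> W0_converges p \<Omega> (u \<circ> r) v \<longrightarrow> (\<forall>i. W0_converges p \<Omega> (\<lambda>n. u (r n + i)) v))"
  proof (intro conjI allI impI ballI)
    fix r :: "nat \<Rightarrow> nat" assume "strict_mono r"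
    then obtain s v where "strict_mono (s :: nat \<Rightarrow> nat)" "W0_converges p \<Omega> (\<lambda>n. u (r (s n))) v" using subsequence_limit_point by blast
    then show "\<exists>(s :: nat \<Rightarrow> nat) v. strict_mono s \<and> W0_converges p \<Omega> (u \<circ> r \<circ> s) v" by (auto simp: o_def)
  next
    fix r v i assume "strict_mono r \<and> W0_converges p \<Omega> (u \<circ> r) v"
    then show "W0_converges p \<Omega> (\<lambda>n. u (r n + i)) v" using shifted_convergence[of r v i] by (simp add: o_def)
  qed
  have V: "\<exists>a\<in>{0..1}. \<beta> a = a \<and> (\<forall>b\<in>{0..1}. \<beta> b = b \<longrightarrow> b = a) \<and> \<alpha> \<longlonglongrightarrow> a \<and> (\<lambda>k. \<beta> (\<alpha> k)) \<longlonglongrightarrow> a"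
  proof (intro bexI[of _ astar] conjI)
    have "\<forall>n. \<alpha> n \<in> {0..1}" using alpha(1) by (auto simp: less_imp_le)
    then have "(\<lambda>k. \<beta> (\<alpha> k)) \<longlonglongrightarrow> \<beta> astar"
      using beta(1) alpha_tendsto astar(1) unfolding continuous_on_sequentially by (auto simp: o_def)
    then show "(\<lambda>k. \<beta> (\<alpha> k)) \<longlonglongrightarrow> astar" by (simp add: astar(2))
    show "\<forall>b\<in>{0..1}. \<beta> b = b \<longrightarrow> b = astar" using astar(3) by blast
  qed (rule astar(2) alpha_tendsto astar(1))+
  have VI1: "(\<exists>v\<in>S. \<forall>w\<in>S. ae_eq \<Omega> w v) \<or> \<not> (\<exists>v. isolated_element p \<Omega> v S)"
    using isolated_unique unfolding isolated_element_def by meson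
  have VI2: "\<exists>v. eigenpair p \<Omega> Rs v \<and> W0_converges p \<Omega> u v" if simple: "simple_eigenvalue p \<Omega> Rs"
  proof -
    obtain e where e: "\<And>v. eigenpair p \<Omega> Rs v \<Longrightarrow> \<exists>c. ae_eq \<Omega> v (\<lambda>x. c * e x)"
      using simple by (auto simp: simple_eigenvalue_def)
    have "isolated_element p \<Omega> v0 S" by (rule simple_isolated[OF e v0])
    then have "W0_converges p \<Omega> u v0" using converges_if_unique[OF v0] isolated_unique by blast
    then show ?thesis using lim(1)[OF v0] by blast
  qed
  show ?thesis unfolding Rs using I II III infdist_tendsto V VI1 VI2 by blast
qed

end
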